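(* Let $C\subset\mathbb{M}^n$ be a Coxeter polyhedron and let $\Xi=\partial C$ be its boundary. Cut $\Xi$ along all hyperedges with even labels (i.e. hyperedges at which the dihedral angle of $C$ is $\pi/(2k)$, $k$ a positive integer), and let $\Omega_1,\Omega_2,\dots$ be the connected pieces of the cut surface. Then the universal covering $\Omega_j^{\sim}$ of each $\Omega_j$ is a Coxeter domain in $\mathbb{M}^{n-1}$.
   Context: $\mathbb{M}^n$ is a space of constant curvature: Euclidean space $\mathbb{R}^n$, the sphere $\mathbb{S}^n$, or Lobachevsky (hyperbolic) space $\mathbb{L}^n$; $\mathbb{M}^{n-1}$ is the space of the same type of dimension $n-1$ (a hyperplane, i.e. totally geodesic hypersurface, of $\mathbb{M}^n$). A domain $C\subset\mathbb{M}^n$ that is an intersection of a finite or locally finite collection of half-spaces is a Coxeter domain if, by reflecting $C$ in all its $(n-1)$-dimensional faces, then reflecting the new polyhedra in their faces, and so on, one obtains a tiling of the whole space. The degenerate case in which the collection of half-spaces is empty, so that the domain is the whole space, is allowed. A Coxeter polyhedron is a compact Coxeter domain. The dihedral angle of a Coxeter domain at a hyperedge (an $(n-2)$-dimensional stratum, the common boundary of two neighbouring $(n-1)$-dimensional faces) has the form $\pi/m$ with an integer $m\ge 2$; $m$ is called the label of the hyperedge. The boundary $\Xi$ is regarded with its intrinsic structure of an $(n-1)$-dimensional manifold of constant curvature with singularities (obtained by gluing the $(n-1)$-dimensional faces of $C$ along hyperedges). Cutting along the even hyperedges means that the pieces $\Omega_j$ are, up to boundary points, the connected components of $\Xi$ with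 all closed hyperedges of even label deleted. The universal covering $\Omega_j^\sim$ carries the pulled-back intrinsic structure, and the assertion that it is a Coxeter domain means that, with this structure, it is isometric (up to adding boundary points) to a Coxeter domain in $\mathbb{M}^{n-1}$.
   Formalization: Excluded: a polygon C in S^2 with no even labels (hemisphere, or digon with odd label), where Ω is all of Ξ, a closed circle of length 2π; its universal covering is an infinite line, which is not a domain in S^1, so the claim fails there. The dimension n is at least 2. *)

theory Defs
  imports "HOL-Analysis.Analysis"
begin

text \<open>
  All three geometries of dimension \<open>n = DIM('a)\<close> are realised inside \<open>'a \<times> real\<close> as a component
  of the quadric \<open>t\<^sup>2 + \<kappa> (norm x)\<^sup>2 = 1\<close>: the affine hyperplane \<open>t = 1\<close> for
  \<open>\<kappa> = 0\<close>, the unit sphere for \<open>\<kappa> = 1\<close>, the upper sheet of the hyperboloid for \<open>\<kappa> = -1\<close>.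
  Hyperplanes (totally geodesic hypersurfaces) are then the sections by linear hyperplanes.
\<close>

datatype geometry = Euclidean | Spherical | Hyperbolic

primrec curvature :: "geometry \<Rightarrow> real" where
  "curvature Euclidean = 0"
| "curvature Spherical = 1"
| "curvature Hyperbolic = - 1"

definition space_form :: "geometry \<Rightarrow> ('a::euclidean_space \<times> real) set" where
  "space_form g =
     {(x, t). t\<^sup>2 + curvature g * (norm x)\<^sup>2 = 1 \<and> (g = Spherical \<or> t > 0)}"

primrec space_dist ::
    "geometry \<Rightarrow> 'a::euclidean_space \<times> real \<Rightarrow> 'a \<times> real \<Rightarrow> real" where
  "space_dist Euclidean p q = dist p q"
| "space_dist Spherical p q = arccos (p \<bullet> q)"
| "space_dist Hyperbolic p q = arcosh (snd p * snd q - fst p \<bullet> fst q)"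

text \<open>
  A hyperplane is given by a covector \<open>\<nu> = (a, b)\<close>, that is, by the linear form
  \<open>(x, t) \<mapsto> \<nu> \<bullet> (x, t) = a \<bullet> x + b t\<close>. On covectors the geometry induces the form \<open>conormal_form\<close>;
  its positivity on \<open>\<nu>\<close> means exactly that the linear form takes both signs on the space.
  The vector dual to \<open>(a, b)\<close> is \<open>(a, \<kappa> b)\<close>.
\<close>

definition conormal_form ::
    "geometry \<Rightarrow> 'a::euclidean_space \<times> real \<Rightarrow> 'a \<times> real \<Rightarrow> real" where
  "conormal_form g \<nu> \<mu> = fst \<nu> \<bullet> fst \<mu> + curvature g * (snd \<nu> * snd \<mu>)"

definition conormal :: "geometry \<Rightarrow> 'a::euclidean_space \<times> real \<Rightarrow> bool" where
  "conormal g \<nu> \<longleftrightarrow> conormal_form g \<nu> \<nu> > 0"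

definition hyperplane_of ::
    "geometry \<Rightarrow> 'a::euclidean_space \<times> real \<Rightarrow> ('a \<times> real) set" where
  "hyperplane_of g \<nu> = {p \<in> space_form g. \<nu> \<bullet> p = 0}"

definition half_space ::
    "geometry \<Rightarrow> 'a::euclidean_space \<times> real \<Rightarrow> ('a \<times> real) set" where
  "half_space g \<nu> = {p \<in> space_form g. \<nu> \<bullet> p \<ge> 0}"

definition reflection ::
    "geometry \<Rightarrow> 'a::euclidean_space \<times> real \<Rightarrow> 'a \<times> real \<Rightarrow> 'a \<times> real" where
  "reflection g \<nu> p =
     p - (2 * (\<nu> \<bullet> p) / conormal_form g \<nu> \<nu>) *\<^sub>R (fst \<nu>, curvature g * snd \<nu>)"

abbreviation space_topology :: "geometry \<Rightarrow> ('a::euclidean_space \<times> real) topology" where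
  "space_topology g \<equiv> top_of_set (space_form g)"

text \<open>
  Local finiteness of a collection of half-spaces refers to their bounding hyperplanes. The empty
  collection gives the whole space.
\<close>

definition polyhedral_domain :: "geometry \<Rightarrow> ('a::euclidean_space \<times> real) set \<Rightarrow> bool" where
  "polyhedral_domain g C \<longleftrightarrow>
     (\<exists>N. (\<forall>\<nu>\<in>N. conormal g \<nu>) \<and>
          locally_finite_in (space_topology g) (hyperplane_of g ` N) \<and>
          C = space_form g \<inter> (\<Inter>\<nu>\<in>N. half_space g \<nu>)) \<and>
     space_topology g interior_of C \<noteq> {}"

text \<open>
  \<open>\<nu>\<close> is an inner normal of an \<open>(n-1)\<close>-dimensional face \<open>C \<inter> hyperplane_of g \<nu>\<close> of \<open>C\<close>.
\<close>

definition facet_normal ::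
    "geometry \<Rightarrow> ('a::euclidean_space \<times> real) set \<Rightarrow> 'a \<times> real \<Rightarrow> bool" where
  "facet_normal g C \<nu> \<longleftrightarrow>
     conormal g \<nu> \<and> C \<subseteq> half_space g \<nu> \<and>
     top_of_set (hyperplane_of g \<nu>) interior_of C \<noteq> {}"

text \<open>
  The copies of \<open>C\<close> produced by the iterated reflections are recorded as isometries \<open>w\<close>, the copy
  being \<open>w ` C\<close>. In the tiling condition overlapping copies have to agree as isometries, not only
  as sets: a regular Euclidean hexagon produces the honeycomb when copies are compared as sets, but
  its angles \<open>2\<pi>/3\<close> are not of the form \<open>\<pi>/m\<close> and it is not a Coxeter domain.
\<close>

inductive_set reflected_copies ::
    "geometry \<Rightarrow> ('a::euclidean_space \<times> real) set \<Rightarrow> ('a \<times> real \<Rightarrow> 'a \<times> real) set"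
  for g C where
  start: "id \<in> reflected_copies g C"
| reflect: "w \<in> reflected_copies g C \<Longrightarrow> facet_normal g (w ` C) \<nu> \<Longrightarrow>
    reflection g \<nu> \<circ> w \<in> reflected_copies g C"

definition coxeter_domain :: "geometry \<Rightarrow> ('a::euclidean_space \<times> real) set \<Rightarrow> bool" where
  "coxeter_domain g C \<longleftrightarrow>
     polyhedral_domain g C \<and>
     (\<Union>w\<in>reflected_copies g C. w ` C) = space_form g \<and>
     (\<forall>w\<in>reflected_copies g C. \<forall>w'\<in>reflected_copies g C.
        (space_topology g interior_of (w ` C)) \<inter> (space_topology g interior_of (w' ` C)) \<noteq> {} \<longrightarrow>
        (\<forall>p\<in>space_form g. w p = w' p))"

definition coxeter_polyhedron :: "geometry \<Rightarrow> ('a::euclidean_space \<times> real) set \<Rightarrow> bool" where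
  "coxeter_polyhedron g C \<longleftrightarrow> coxeter_domain g C \<and> compact C"

definition boundary_surface ::
    "geometry \<Rightarrow> ('a::euclidean_space \<times> real) set \<Rightarrow> ('a \<times> real) set" where
  "boundary_surface g C = space_topology g frontier_of C"

text \<open>
  The faces with inner normals \<open>\<nu>\<close> and \<open>\<mu>\<close> are neighbours along the (closed) hyperedge
  \<open>C \<inter> hyperplane_of g \<nu> \<inter> hyperplane_of g \<mu>\<close>.
\<close>

definition neighbouring_facets ::
    "geometry \<Rightarrow> ('a::euclidean_space \<times> real) set \<Rightarrow> 'a \<times> real \<Rightarrow> 'a \<times> real \<Rightarrow> bool" where
  "neighbouring_facets g C \<nu> \<mu> \<longleftrightarrow>
     facet_normal g C \<nu> \<and> facet_normal g C \<mu> \<and> hyperplane_of g \<nu> \<noteq> hyperplane_of g \<mu> \<and>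
     top_of_set (hyperplane_of g \<nu> \<inter> hyperplane_of g \<mu>) interior_of C \<noteq> {}"

text \<open>The dihedral angle is \<open>\<pi>\<close> minus the angle between the inner normals.\<close>

definition dihedral_angle ::
    "geometry \<Rightarrow> 'a::euclidean_space \<times> real \<Rightarrow> 'a \<times> real \<Rightarrow> real" where
  "dihedral_angle g \<nu> \<mu> =
     arccos (- conormal_form g \<nu> \<mu> / sqrt (conormal_form g \<nu> \<nu> * conormal_form g \<mu> \<mu>))"

definition even_hyperedges ::
    "geometry \<Rightarrow> ('a::euclidean_space \<times> real) set \<Rightarrow> ('a \<times> real) set set" where
  "even_hyperedges g C =
     {C \<inter> hyperplane_of g \<nu> \<inter> hyperplane_of g \<mu> | \<nu> \<mu>.
        neighbouring_facets g C \<nu> \<mu> \<and>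
        (\<exists>k::nat. k > 0 \<and> dihedral_angle g \<nu> \<mu> = pi / (2 * real k))}"

definition pieces ::
    "geometry \<Rightarrow> ('a::euclidean_space \<times> real) set \<Rightarrow> ('a \<times> real) set set" where
  "pieces g C = components (boundary_surface g C - \<Union>(even_hyperedges g C))"

definition universal_covering ::
    "'c::topological_space set \<Rightarrow> ('c \<Rightarrow> 'a::topological_space) \<Rightarrow> 'a set \<Rightarrow> bool" where
  "universal_covering T p S \<longleftrightarrow> covering_space T p S \<and> simply_connected T"

definition path_length ::
    "geometry \<Rightarrow> (real \<Rightarrow> 'a::euclidean_space \<times> real) \<Rightarrow> ennreal" where
  "path_length g c =
     (SUP ts \<in> {ts. sorted ts \<and> set ts \<subseteq> {0..1}}.
        \<Sum>i<length ts - 1. ennreal (space_dist g (c (ts ! i)) (c (ts ! Suc i))))"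

text \<open>
  The intrinsic metric pulled back along \<open>p\<close>: curves in \<open>T\<close> are measured by the length of their
  images. Lengths of curves in the boundary of a polyhedron are the same in the ambient space
  and in the surface glued from its faces.
\<close>

definition pullback_dist ::
    "geometry \<Rightarrow> 'c::topological_space set \<Rightarrow> ('c \<Rightarrow> 'a::euclidean_space \<times> real) \<Rightarrow>
     'c \<Rightarrow> 'c \<Rightarrow> ennreal" where
  "pullback_dist g T p x y =
     (INF c \<in> {c. path c \<and> path_image c \<subseteq> T \<and> pathstart c = x \<and> pathfinish c = y}.
        path_length g (p \<circ> c))"

text \<open>
  \<open>T\<close> becomes the domain \<open>D\<close> after adding boundary points: \<open>f\<close> identifies it with the interior
  of \<open>D\<close>. Intersections of half-spaces being convex, the metric of \<open>D\<close> is the ambient one.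
\<close>

definition isometric_to_interior ::
    "geometry \<Rightarrow> 'c::topological_space set \<Rightarrow> ('c \<Rightarrow> 'a::euclidean_space \<times> real) \<Rightarrow>
     ('b::euclidean_space \<times> real) set \<Rightarrow> bool" where
  "isometric_to_interior g T p D \<longleftrightarrow>
     (\<exists>f. bij_betw f T (space_topology g interior_of D) \<and>
          (\<forall>x\<in>T. \<forall>y\<in>T. pullback_dist g T p x y = ennreal (space_dist g (f x) (f y))))"

end

theory Submission
  imports Defs
begin

text \<open>
  The reflections in the facets of the Coxeter polyhedron \<open>C\<close> generate a discrete group \<open>W\<close>, and \<open>C\<close> is
  a chamber of the arrangement of all its mirrors (\<open>coxeter_polyhedron_chamber\<close>). Every orbit of \<open>W\<close> meets
  \<open>C\<close> in one point, so the space folds onto \<open>C\<close>; folding is an isometry on each copy of \<open>C\<close>, and it takes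
  every mirror into the boundary of \<open>C\<close>. The covering of a piece \<open>\<Omega>\<close> is obtained by unfolding: let \<open>M\<close> be the
  hyperplane of a facet that meets \<open>\<Omega>\<close>, and fold \<open>M\<close>.

  The parity of the labels decides how far this works. The mirrors through a hyperedge with
  label \<open>m\<close> make angles that are multiples of \<open>\<pi> / m\<close>. If \<open>m\<close> is odd, the bisector of the two facets is
  a mirror which interchanges their hyperplanes, so the copy of \<open>C\<close> that continues \<open>M\<close> beyond
  the hyperedge shows there the neighbouring facet, and \<open>M\<close> unfolds both. If \<open>m\<close> is even, one of the
  mirrors is perpendicular to \<open>M\<close>. At a point where no even hyperedge passes at most two facets meet, and no mirror
  through it is perpendicular to \<open>M\<close> (\<open>perpendicular_iff_not_odd\<close>). So the mirrors perpendicular to \<open>M\<close>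
  meet \<open>M\<close> exactly in the points that fold into the even hyperedges. Reflections in such mirrors preserve \<open>M\<close>; the
  mirrors therefore cut out on \<open>M\<close> the arrangement of a reflection group, and the component \<open>U\<close> of their complement
  that contains the given point is the interior of a Coxeter domain
  \<open>D\<close> in \<open>M\<close> (\<open>chamber_mirror\<close>, \<open>coxeter_domain_Ch\<close>).

  Folding maps \<open>U\<close> onto \<open>\<Omega>\<close> (\<open>\<phi>_image_component\<close>): its image is open and closed in the boundary without
  the even hyperedges. Two points of \<open>U\<close> with the same image differ by an element of \<open>W\<close> that preserves \<open>M\<close>;
  these elements act freely on \<open>U\<close> (\<open>odd_at_stabiliser_trivial\<close>) and discontinuously, so folding is a
  covering of \<open>\<Omega>\<close> (\<open>\<phi>_covering\<close>). Moreover \<open>U\<close> is simply connected: it is convex, or it is a whole sphere. The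
  only exception is a circle; it arises when \<open>C\<close> lies in the two-dimensional sphere and \<open>\<Omega>\<close> is its whole boundary,
  and there the universal covering is a line, which no domain of the circle can represent. Coverings by simply connected
  spaces are unique (\<open>simply_connected_covering_unique\<close>), so \<open>U\<close> is the universal covering.

  Finally, folding preserves the lengths of curves (\<open>folded_curve_length_ge\<close>), and two points of
  \<open>U\<close> are joined by a geodesic inside \<open>U\<close>. Hence the intrinsic metric pulled back to \<open>U\<close> is the
  distance of the space form \<open>M\<close>.

  The three geometries are treated together by working with covectors: a mirror is a unit covector,
  a motion is a linear map, and a sign of a linear form says on which side of a mirror a point lies.
\<close>

section \<open>Coverings by simply connected spaces\<close>

definition evenly_covered ::
    "'c::topological_space set \<Rightarrow> ('c \<Rightarrow> 's::topological_space) \<Rightarrow> 's set \<Rightarrow> 's set \<Rightarrow> bool" where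
  "evenly_covered X p S V \<longleftrightarrow> openin (top_of_set S) V \<and>
     (\<exists>\<V>. \<Union>\<V> = X \<inter> p -` V \<and> (\<forall>u\<in>\<V>. openin (top_of_set X) u) \<and> pairwise disjnt \<V> \<and>
       (\<forall>u\<in>\<V>. \<exists>q. homeomorphism u V p q))"

lemma covering_space_evenly_covered:
  assumes "covering_space X p S" "y \<in> S"
  obtains V where "y \<in> V" "evenly_covered X p S V"
  using assms unfolding covering_space_def evenly_covered_def by (metis (no_types))

text \<open>
  A connected set that lies over an evenly covered set and meets a sheet stays in this sheet, since the
  sheets are disjoint and open.
\<close>

lemma evenly_covered_sheet:
  assumes ev: "evenly_covered X p S V" and x: "x \<in> X" "p x \<in> V"
  obtains u q where "openin (top_of_set X) u" "x \<in> u" "u \<subseteq> X" "homeomorphism u V p q"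
    "\<And>A k. connected A \<Longrightarrow> continuous_on A k \<Longrightarrow> k ` A \<subseteq> X \<Longrightarrow> p ` (k ` A) \<subseteq> V \<Longrightarrow>
       (\<exists>a\<in>A. k a \<in> u) \<Longrightarrow> k ` A \<subseteq> u"
proof -
  obtain \<V> where \<V>: "\<Union>\<V> = X \<inter> p -` V" "\<forall>u\<in>\<V>. openin (top_of_set X) u" "pairwise disjnt \<V>"
     "\<forall>u\<in>\<V>. \<exists>q. homeomorphism u V p q"
    using ev unfolding evenly_covered_def by (elim conjE exE) (rule that)
  obtain u where u: "u \<in> \<V>" "x \<in> u" using x \<V>(1) by blast
  obtain q where q: "homeomorphism u V p q" using \<V>(4) u by blast
  have ou: "openin (top_of_set X) u" using \<V>(2) u by blast
  have "k ` A \<subseteq> u" if A: "connected A" and k: "continuous_on A k" and kX: "k ` A \<subseteq> X"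
      and kV: "p ` (k ` A) \<subseteq> V" and a: "\<exists>a\<in>A. k a \<in> u" for A :: "'e::topological_space set" and k
  proof -
    have o2: "openin (top_of_set X) (\<Union>(\<V> - {u}))" using \<V>(2) by (intro openin_Union) auto
    have "openin (top_of_set A) (A \<inter> k -` u)" "openin (top_of_set A) (A \<inter> k -` (\<Union>(\<V> - {u})))"
      using continuous_openin_preimage[OF k _ ou] continuous_openin_preimage[OF k _ o2] kX by auto
    moreover have "A \<inter> k -` (\<Union>(\<V> - {u})) = A - (A \<inter> k -` u)"
    proof -
      have "(y \<in> \<Union>(\<V> - {u})) \<longleftrightarrow> y \<notin> u" if "y \<in> X" "p y \<in> V" for y
      proof -
        have "y \<in> \<Union>\<V>" unfolding \<V>(1) using that by simp
        moreover have "y \<notin> u''" if "y \<in> u" "u'' \<in> \<V> - {u}" for u''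
          using \<V>(3) u(1) that unfolding pairwise_def disjnt_iff by (metis DiffE singletonI)
        ultimately show ?thesis by auto
      qed
      then show ?thesis using kX kV by (auto simp: image_subset_iff)
    qed
    ultimately have "A \<inter> k -` u = {} \<or> A \<inter> k -` u = A"
      using A unfolding connected_clopen by (auto simp: closedin_def)
    then show ?thesis using a by auto
  qed
  then show thesis using that ou u(2) q openin_imp_subset[OF ou] by blast
qed

text \<open>
  The lift on \<open>A\<close> selects one sheet over \<open>V\<close>, because \<open>A \<inter> B\<close> is connected; on \<open>B\<close> the inverse of the
  projection of that sheet is used.
\<close>

lemma lift_extends_over_evenly_covered_piece:
  fixes A B :: "'x::topological_space set" and h :: "'x \<Rightarrow> 's::topological_space"
  assumes ev: "evenly_covered X p S V"
    and A: "closed A" "closed B" "connected (A \<inter> B)" "A \<inter> B \<noteq> {}"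
    and k: "continuous_on A k" "k ` A \<subseteq> X" "\<And>x. x \<in> A \<Longrightarrow> p (k x) = h x"
    and h: "continuous_on B h" "h ` B \<subseteq> V"
  obtains k' where "continuous_on (A \<union> B) k'" "k' ` (A \<union> B) \<subseteq> X"
    "\<And>x. x \<in> A \<union> B \<Longrightarrow> p (k' x) = h x" "\<And>x. x \<in> A \<Longrightarrow> k' x = k x"
proof -
  obtain a where a: "a \<in> A" "a \<in> B" using A(4) by blast
  obtain u q where u: "openin (top_of_set X) u" "k a \<in> u" "u \<subseteq> X" and q: "homeomorphism u V p q"
    and conn: "\<And>(A'::'x set) k'. connected A' \<Longrightarrow> continuous_on A' k' \<Longrightarrow> k' ` A' \<subseteq> X \<Longrightarrow> p ` (k' ` A') \<subseteq> V \<Longrightarrow>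
       (\<exists>a\<in>A'. k' a \<in> u) \<Longrightarrow> k' ` A' \<subseteq> u"
  proof (rule evenly_covered_sheet[OF ev, of "k a"])
    show "k a \<in> X" "p (k a) \<in> V" using k(2) k(3)[OF a(1)] a h(2) by auto
  qed (use that in blast)
  have "k ` (A \<inter> B) \<subseteq> u"
    using k h a u(2) by (intro conn A(3)) (auto intro: continuous_on_subset)
  then have eq: "k x = q (h x)" if "x \<in> A" "x \<in> B" for x
    using q k(3) that unfolding homeomorphism_def by (metis IntI image_subset_iff)
  define k' where "k' = (\<lambda>x. if x \<in> A then k x else q (h x))"
  have qh: "continuous_on B (\<lambda>x. q (h x))"
    using q h unfolding homeomorphism_def
    by (auto intro: continuous_on_compose2)
  have "continuous_on (A \<union> B) k'" unfolding k'_def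
    by (intro continuous_on_If A k qh) (use eq in auto)
  moreover have "k' ` (A \<union> B) \<subseteq> X"
  proof -
    have "q ` V = u" using q by (simp add: homeomorphism_def)
    then have "q (h x) \<in> X" if "x \<in> B" for x using h(2) u(3) that by blast
    then show ?thesis using k(2) unfolding k'_def by auto
  qed
  moreover have "p (k' x) = h x" if "x \<in> A \<union> B" for x
    using q k(3) h(2) that unfolding k'_def homeomorphism_def by auto
  ultimately show thesis using that[of k'] by (auto simp: k'_def)
qed

text \<open>
  A map of a square lifts to any covering: on a fine grid every cell has an evenly covered image,
  and the cells are added one by one. Each new cell meets the part already treated in a connected
  set, namely its left and lower edge.
\<close>

lemma covering_space_lift_square:
  fixes h :: "real \<times> real \<Rightarrow> 's::topological_space"
  assumes cov: "covering_space X p S"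
    and h: "continuous_on ({0..1} \<times> {0..1}) h" "h ` ({0..1} \<times> {0..1}) \<subseteq> S"
    and a: "a \<in> X" "p a = h (0, 0)"
  obtains k where "continuous_on ({0..1} \<times> {0..1}) k" "k ` ({0..1} \<times> {0..1}) \<subseteq> X"
    "\<And>z. z \<in> {0..1} \<times> {0..1} \<Longrightarrow> p (k z) = h z" "k (0, 0) = a"
proof -
  let ?Q = "{0..1::real} \<times> {0..1::real}"
  define \<C> where "\<C> = {W. open W \<and> (\<exists>V. evenly_covered X p S V \<and> h ` (W \<inter> ?Q) \<subseteq> V)}"
  have cover: "z \<in> \<Union>\<C>" if z: "z \<in> ?Q" for z
  proof -
    have "h z \<in> S" using h(2) z by auto
    then obtain V where V: "h z \<in> V" "evenly_covered X p S V"
      by (rule covering_space_evenly_covered[OF cov])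
    have "openin (top_of_set ?Q) (?Q \<inter> h -` V)"
      using continuous_openin_preimage[OF h(1), of S V] h(2) V(2) unfolding evenly_covered_def by auto
    then obtain W where W: "open W" "?Q \<inter> h -` V = ?Q \<inter> W" unfolding openin_open by metis
    then have "h ` (W \<inter> ?Q) \<subseteq> V" "z \<in> W" using V z by auto
    then show ?thesis using V(2) W(1) unfolding \<C>_def by auto
  qed
  have "\<C> \<noteq> {}" using cover[of "(0,0)"] by auto
  moreover have "?Q \<subseteq> \<Union>\<C>" using cover by blast
  moreover have "compact ?Q" "\<And>B. B \<in> \<C> \<Longrightarrow> open B" by (auto simp: \<C>_def intro: compact_Times)
  ultimately obtain \<delta> where \<delta>: "0 < \<delta>"
      and leb: "\<And>T. T \<subseteq> ?Q \<Longrightarrow> diameter T < \<delta> \<Longrightarrow> \<exists>B\<in>\<C>. T \<subseteq> B"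
    using Lebesgue_number_lemma[of ?Q \<C>] by metis
  obtain N :: nat where N: "N > 0" "2 / N < \<delta>"
  proof -
    obtain N :: nat where N: "N > 2 / \<delta>" using reals_Archimedean2 by blast
    have "0 < 2 / \<delta>" using \<delta> by simp
    then have "real N > 0" using N by linarith
    then show thesis using that[of N] \<delta> N by (simp add: field_simps)
  qed
  \<comment> \<open>the side of the grid is \<open>1 / N\<close>, so a cell has diameter at most \<open>2 / N\<close>\<close>
  define r where "r i = real i / real N" for i
  have r: "r 0 = 0" "r N = 1" "r i < r (Suc i)" "r i \<ge> 0" for i using N by (auto simp: r_def field_simps)
  have r1: "r i \<le> 1" if "i \<le> N" for i using N that by (auto simp: r_def)
  have cell: "\<exists>V. evenly_covered X p S V \<and> h ` T \<subseteq> V"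
    if ij: "i < N" "j < N" and T: "T \<subseteq> {r i..r (Suc i)} \<times> {r j..r (Suc j)}" for i j T
  proof -
    have sub: "{r i..r (Suc i)} \<times> {r j..r (Suc j)} \<subseteq> ?Q"
      using r1[of "Suc i"] r1[of "Suc j"] r(4)[of i] r(4)[of j] ij by auto
    have "diameter ({r i..r (Suc i)} \<times> {r j..r (Suc j)}) \<le> 2 / N"
    proof (rule diameter_le)
      fix x y assume "x \<in> {r i..r (Suc i)} \<times> {r j..r (Suc j)}" "y \<in> {r i..r (Suc i)} \<times> {r j..r (Suc j)}"
      then have "\<bar>fst x - fst y\<bar> \<le> 1 / N" "\<bar>snd x - snd y\<bar> \<le> 1 / N"
        by (auto simp: r_def add_divide_distrib abs_le_iff)
      then have "\<bar>fst x - fst y\<bar> + \<bar>snd x - snd y\<bar> \<le> 2 / N" by simp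
      moreover have "norm (x - y) \<le> \<bar>fst x - fst y\<bar> + \<bar>snd x - snd y\<bar>"
        using norm_Pair_le[of "fst (x - y)" "snd (x - y)"] by (simp add: norm_prod_def)
      ultimately show "norm (x - y) \<le> 2 / N" by linarith
    qed auto
    then obtain B where "B \<in> \<C>" "{r i..r (Suc i)} \<times> {r j..r (Suc j)} \<subseteq> B"
      using leb[OF sub] N(2) by (meson le_less_trans)
    moreover then obtain V where "evenly_covered X p S V" "h ` (B \<inter> ?Q) \<subseteq> V" unfolding \<C>_def by blast
    moreover have "T \<subseteq> B \<inter> ?Q" using T sub calculation(2) by blast
    ultimately show ?thesis by blast
  qed
  define lifted where "lifted A \<longleftrightarrow> (\<exists>k. continuous_on A k \<and> k ` A \<subseteq> X \<and> (\<forall>z\<in>A. p (k z) = h z) \<and> k (0, 0) = a)"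
    for A
  have step: "lifted (A \<union> B)" if asm: "lifted A" "closed A" "(0, 0) \<in> A" "closed B" "connected (A \<inter> B)"
      "A \<inter> B \<noteq> {}" "i < N" "j < N" "B \<subseteq> {r i..r (Suc i)} \<times> {r j..r (Suc j)}" for A B i j
  proof -
    obtain V where V: "evenly_covered X p S V" "h ` B \<subseteq> V" using cell[OF asm(7,8,9)] by blast
    obtain k where k: "continuous_on A k" "k ` A \<subseteq> X" "\<And>z. z \<in> A \<Longrightarrow> p (k z) = h z" "k (0, 0) = a"
      using asm(1) unfolding lifted_def by blast
    have "B \<subseteq> ?Q" using asm(7-9) r1[of "Suc i"] r1[of "Suc j"] r(4)[of i] r(4)[of j] by force
    then have hB: "continuous_on B h" using h(1) continuous_on_subset by blast
    obtain k' where "continuous_on (A \<union> B) k'" "k' ` (A \<union> B) \<subseteq> X"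
        "\<And>x. x \<in> A \<union> B \<Longrightarrow> p (k' x) = h x" "\<And>x. x \<in> A \<Longrightarrow> k' x = k x"
      using lift_extends_over_evenly_covered_piece[OF V(1) asm(2,4,5,6) k(1-3) hB V(2)] by blast
    then show ?thesis unfolding lifted_def using k(4) asm(3) by (intro exI[of _ k']) auto
  qed
  have left: "j \<le> N \<Longrightarrow> lifted ({0} \<times> {0..r j})" for j
  proof (induction j)
    case 0
    show ?case unfolding lifted_def using a r(1) by (intro exI[of _ "\<lambda>_. a"]) auto
  next
    case (Suc j)
    have un: "{0} \<times> {0..r (Suc j)} = {0} \<times> {0..r j} \<union> {0} \<times> {r j..r (Suc j)}"
      using r(3,4)[of j] by force
    have int: "({0} \<times> {0..r j}) \<inter> ({0} \<times> {r j..r (Suc j)}) = {(0, r j)}"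
      using r(3,4)[of j] by force
    have sub: "{0} \<times> {r j..r (Suc j)} \<subseteq> {r 0..r (Suc 0)} \<times> {r j..r (Suc j)}"
      using r(1) r(3)[of 0] by auto
    show ?case unfolding un
    proof (rule step[OF _ _ _ _ _ _ N(1) _ sub])
      show "lifted ({0} \<times> {0..r j})" "j < N" using Suc by auto
      show "(0, 0) \<in> {0} \<times> {0..r j}" using r(4) by simp
    qed (simp_all add: int closed_Times)
  qed
  \<comment> \<open>the part treated when \<open>i\<close> columns are complete and \<open>j\<close> cells of the next one are\<close>
  define A where "A i j = {0..r i} \<times> {0..1} \<union> {r i..r (Suc i)} \<times> {0..r j}" for i j
  have clA: "closed (A i j)" for i j by (simp add: A_def closed_Times closed_Un)
  have A0: "(0, 0) \<in> A i j" for i j using r(4) by (auto simp: A_def)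
  have main: "i \<le> N \<Longrightarrow> lifted ({0..r i} \<times> {0..1})" for i
  proof (induction i)
    case 0
    then show ?case using left[of N] r by simp
  next
    case (Suc i)
    then have iN: "i < N" and IH: "lifted ({0..r i} \<times> {0..1})" by auto
    have cells: "j \<le> N \<Longrightarrow> lifted (A i j)" for j
    proof (induction j)
      case 0
      have "({0..r i} \<times> {0..1}) \<inter> ({r i..r (Suc i)} \<times> {0::real}) = {(r i, 0)}"
        using r(3,4)[of i] by (intro set_eqI) auto
      moreover have "{r i..r (Suc i)} \<times> {0} \<subseteq> {r i..r (Suc i)} \<times> {r 0..r (Suc 0)}"
        using r(1) r(3)[of 0] by auto
      ultimately have "lifted ({0..r i} \<times> {0..1} \<union> {r i..r (Suc i)} \<times> {0})"
        using r(4) by (intro step[OF IH _ _ _ _ _ iN N(1)]) (auto simp: closed_Times)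
      then show ?case by (simp add: A_def r(1))
    next
      case (Suc j)
      then have jN: "j < N" and IH': "lifted (A i j)" by auto
      have eq: "A i (Suc j) = A i j \<union> {r i..r (Suc i)} \<times> {r j..r (Suc j)}"
        using r(3,4)[of j] by (auto simp: A_def)
      have int: "A i j \<inter> ({r i..r (Suc i)} \<times> {r j..r (Suc j)})
          = {r i} \<times> {r j..r (Suc j)} \<union> {r i..r (Suc i)} \<times> {r j}"
        using r(3,4)[of j] r(3,4)[of i] r1[of "Suc j"] jN by (auto simp: A_def)
      have "connected ({r i} \<times> {r j..r (Suc j)} \<union> {r i..r (Suc i)} \<times> {r j})"
      proof (rule connected_Un)
        have "(r i, r j) \<in> ({r i} \<times> {r j..r (Suc j)}) \<inter> ({r i..r (Suc i)} \<times> {r j})"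
          using r(3)[of i] r(3)[of j] by auto
        then show "({r i} \<times> {r j..r (Suc j)}) \<inter> ({r i..r (Suc i)} \<times> {r j}) \<noteq> {}" by blast
      qed (auto intro: connected_Times)
      then show ?case unfolding eq
        using r(3)[of i] r(3)[of j] int
        by (intro step[OF IH' clA A0 _ _ _ iN jN]) (auto simp: closed_Times)
    qed
    have "A i N = {0..r (Suc i)} \<times> {0..1}" using r(2) r(3,4)[of i] by (auto simp: A_def)
    then show ?case using cells[of N] by simp
  qed
  show thesis using main[of N] that r(2) unfolding lifted_def by auto
qed

lemma covering_space_unique_lift:
  assumes cov: "covering_space X p S" and A: "connected A"
    and k: "continuous_on A k" "k ` A \<subseteq> X" and k': "continuous_on A k'" "k' ` A \<subseteq> X"
    and eq: "\<And>x. x \<in> A \<Longrightarrow> p (k x) = p (k' x)" and a: "a \<in> A" "k a = k' a" and x: "x \<in> A"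
  shows "k x = k' x"
proof -
  have *: "\<exists>U. openin (top_of_set A) U \<and> x \<in> U \<and> ((\<forall>y\<in>U. k y = k' y) \<or> (\<forall>y\<in>U. k y \<noteq> k' y))"
    if x: "x \<in> A" for x
  proof -
    have "p (k x) \<in> S" using k(2) x covering_space_imp_surjective[OF cov] by auto
    then obtain V where V: "p (k x) \<in> V" "evenly_covered X p S V"
      by (rule covering_space_evenly_covered[OF cov])
    obtain \<V> where \<V>: "\<Union>\<V> = X \<inter> p -` V" "\<forall>u\<in>\<V>. openin (top_of_set X) u" "pairwise disjnt \<V>"
      "\<forall>u\<in>\<V>. \<exists>q. homeomorphism u V p q"
      using V(2) unfolding evenly_covered_def by (elim conjE exE) (rule that)
    obtain u u' where u: "u \<in> \<V>" "k x \<in> u" "u' \<in> \<V>" "k' x \<in> u'"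
      using \<V>(1) k(2) k'(2) x V(1) eq[OF x] by (smt (verit) IntI UnionE image_subset_iff vimage_eq)
    define U where "U = (A \<inter> k -` u) \<inter> (A \<inter> k' -` u')"
    have "openin (top_of_set A) (A \<inter> k -` u)" "openin (top_of_set A) (A \<inter> k' -` u')"
      using continuous_openin_preimage[OF k(1), of X u] continuous_openin_preimage[OF k'(1), of X u']
        k(2) k'(2) \<V>(2) u by (simp_all add: image_subset_iff Pi_iff)
    then have "openin (top_of_set A) U" unfolding U_def by (rule openin_Int)
    moreover have "x \<in> U" using u x by (auto simp: U_def)
    moreover have "k y = k' y" if "u = u'" "y \<in> U" for y
    proof -
      obtain q where "homeomorphism u V p q" using \<V>(4) u(1) by blast
      moreover have "y \<in> A" "k y \<in> u" "k' y \<in> u" using that by (auto simp: U_def)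
      ultimately show ?thesis using eq[of y] by (metis homeomorphism_apply1)
    qed
    moreover have "k y \<noteq> k' y" if "u \<noteq> u'" "y \<in> U" for y
    proof -
      have "k y \<in> u" "k' y \<in> u'" using that by (auto simp: U_def)
      moreover have "disjnt u u'" using \<V>(3) u(1,3) that(1) by (simp add: pairwise_def)
      ultimately show ?thesis by (auto simp: disjnt_iff)
    qed
    ultimately show ?thesis by metis
  qed
  have "openin (top_of_set A) {x\<in>A. k x = k' x}" "openin (top_of_set A) {x\<in>A. k x \<noteq> k' x}"
  proof (subst openin_subopen, intro ballI)
    fix x assume "x \<in> {x\<in>A. k x = k' x}"
    then obtain U where "openin (top_of_set A) U" "x \<in> U" "\<forall>y\<in>U. k y = k' y" using *[of x] by blast
    then show "\<exists>U. openin (top_of_set A) U \<and> x \<in> U \<and> U \<subseteq> {x\<in>A. k x = k' x}"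
      using openin_imp_subset by (intro exI[of _ U]) blast
  next
    show "openin (top_of_set A) {x\<in>A. k x \<noteq> k' x}"
    proof (subst openin_subopen, intro ballI)
      fix x assume "x \<in> {x\<in>A. k x \<noteq> k' x}"
      then obtain U where "openin (top_of_set A) U" "x \<in> U" "\<forall>y\<in>U. k y \<noteq> k' y" using *[of x] by blast
      then show "\<exists>U. openin (top_of_set A) U \<and> x \<in> U \<and> U \<subseteq> {x\<in>A. k x \<noteq> k' x}"
        using openin_imp_subset by (intro exI[of _ U]) blast
    qed
  qed
  moreover have "{x\<in>A. k x \<noteq> k' x} = A - {x\<in>A. k x = k' x}" by auto
  ultimately have "{x\<in>A. k x = k' x} = {} \<or> {x\<in>A. k x = k' x} = A"
    using A unfolding connected_clopen by (auto simp: closedin_def)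
  then show ?thesis using a x by blast
qed

lemma covering_space_path_lifting:
  assumes cov: "covering_space X p S" and g: "path g" "path_image g \<subseteq> S" and a: "a \<in> X" "p a = g 0"
  obtains k where "path k" "path_image k \<subseteq> X" "k 0 = a" "\<And>t. t \<in> {0..1} \<Longrightarrow> p (k t) = g t"
proof -
  let ?h = "\<lambda>z::real\<times>real. g (fst z)"
  have "continuous_on ({0..1} \<times> {0..1}) ?h"
    using g(1) unfolding path_def by (rule continuous_on_compose2) (auto intro: continuous_intros)
  moreover have "?h ` ({0..1} \<times> {0..1}) \<subseteq> S" using g(2) by (auto simp: path_image_def)
  ultimately obtain k where k: "continuous_on ({0..1} \<times> {0..1}) k" "k ` ({0..1} \<times> {0..1}) \<subseteq> X"
    "\<And>z. z \<in> {0..1} \<times> {0..1} \<Longrightarrow> p (k z) = ?h z" "k (0, 0) = a"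
    using covering_space_lift_square[OF cov, of ?h a] a by auto
  have "continuous_on {0..1} (\<lambda>t. k (t, 0))"
    by (rule continuous_on_compose2[OF k(1)]) (auto intro!: continuous_intros)
  moreover have "(\<lambda>t. k (t, 0)) ` {0..1} \<subseteq> X" using k(2) by (auto simp: image_subset_iff)
  ultimately show thesis using that[of "\<lambda>t. k (t, 0)"] k(3,4) by (auto simp: path_def path_image_def)
qed

text \<open>
  A free null-homotopy of the loop \<open>c\<close> is lifted as a map of the square. The two vertical sides are
  lifts of one and the same path, and they agree at the end where the loop has become constant.
\<close>

lemma lift_of_null_homotopic_loop_is_closed:
  assumes sc: "simply_connected X1" and p1: "continuous_on X1 p1" "p1 ` X1 \<subseteq> S"
    and cov: "covering_space X2 p2 S"
    and c: "path c" "path_image c \<subseteq> X1" "c 0 = c 1"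
    and d: "path d" "path_image d \<subseteq> X2" "\<And>t. t \<in> {0..1} \<Longrightarrow> p2 (d t) = p1 (c t)"
  shows "d 0 = d 1"
proof -
  let ?Q = "{0..1::real} \<times> {0..1::real}"
  have "c 1 \<in> X1" using c by (auto simp: path_image_def)
  then have "homotopic_loops X1 c (\<lambda>_. c 0)"
    using sc[unfolded simply_connected_def, rule_format, of c "\<lambda>_. c 0"] c
    by (auto simp: pathstart_def pathfinish_def path_def path_image_def)
  then obtain H where H: "continuous_on ?Q H" "H ` ?Q \<subseteq> X1" "\<And>x. x \<in> {0..1} \<Longrightarrow> H (0, x) = c x"
      "\<And>x. x \<in> {0..1} \<Longrightarrow> H (1, x) = c 0" "\<And>t. t \<in> {0..1} \<Longrightarrow> H (t, 0) = H (t, 1)"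
    unfolding homotopic_loops by (auto simp: pathstart_def pathfinish_def image_subset_iff_funcset)
  have pH: "continuous_on ?Q (\<lambda>z. p1 (H z))" "(\<lambda>z. p1 (H z)) ` ?Q \<subseteq> S"
    using H(1,2) p1 by (auto intro: continuous_on_compose2)
  have d0: "d 0 \<in> X2" "p2 (d 0) = p1 (H (0, 0))" using d H(3)[of 0] by (auto simp: path_image_def)
  obtain k where k: "continuous_on ?Q k" "k ` ?Q \<subseteq> X2" "\<And>z. z \<in> ?Q \<Longrightarrow> p2 (k z) = p1 (H z)" "k (0, 0) = d 0"
    using covering_space_lift_square[OF cov pH d0] by blast
  have side: "continuous_on {0..1} (\<lambda>t. k (t, s))" "(\<lambda>t. k (t, s)) ` {0..1} \<subseteq> X2"
             "continuous_on {0..1} (\<lambda>t. k (s, t))" "(\<lambda>t. k (s, t)) ` {0..1} \<subseteq> X2" if "s \<in> {0..1}" for s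
    using that k(2) by (auto intro!: continuous_on_compose2[OF k(1)] continuous_intros)
  have "k (1, 0) = k (1, 1)"
    using k(3) H(4) side[of 1] k(2)
    by (intro covering_space_unique_lift[OF cov connected_Icc, of 0 1 "\<lambda>t. k (1, t)" "\<lambda>_. k (1, 0)" 0 1, symmetric]) auto
  then have "k (0, 0) = k (0, 1)"
    using k(3) H(5) side[of 0] side[of 1]
    by (intro covering_space_unique_lift[OF cov connected_Icc, of 0 1 "\<lambda>t. k (t, 0)" "\<lambda>t. k (t, 1)" 1 0]) auto
  moreover have "k (0, 1) = d 1"
    using k(3,4) H(3) side[of 0] d
    by (intro covering_space_unique_lift[OF cov connected_Icc, of 0 1 "\<lambda>t. k (0, t)" d 0 1])
       (auto simp: path_def path_image_def)
  ultimately show ?thesis using k(4) by simp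
qed

text \<open>
  The point over \<open>S\<close> that corresponds to \<open>x\<close> is found by transporting the base point \<open>b\<close> along a lift of the
  image of a path from \<open>a\<close> to \<open>x\<close>.
\<close>

definition linked_by_lifts ::
    "'a::topological_space set \<Rightarrow> ('a \<Rightarrow> 's) \<Rightarrow> 'b::topological_space set \<Rightarrow> ('b \<Rightarrow> 's) \<Rightarrow> 'a \<Rightarrow> 'b \<Rightarrow> 'a \<Rightarrow> 'b \<Rightarrow> bool" where
  "linked_by_lifts X1 p1 X2 p2 a b x y \<longleftrightarrow>
     (\<exists>c d. path c \<and> path_image c \<subseteq> X1 \<and> c 0 = a \<and> c 1 = x \<and>
            path d \<and> path_image d \<subseteq> X2 \<and> d 0 = b \<and> d 1 = y \<and> (\<forall>t\<in>{0..1}. p2 (d t) = p1 (c t)))"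

lemma linked_by_lifts_swap:
  assumes "linked_by_lifts X1 p1 X2 p2 a b x y"
  shows "linked_by_lifts X2 p2 X1 p1 b a y x"
proof -
  obtain c d where "path c" "path_image c \<subseteq> X1" "c 0 = a" "c 1 = x"
      "path d" "path_image d \<subseteq> X2" "d 0 = b" "d 1 = y" "\<forall>t\<in>{0..1}. p2 (d t) = p1 (c t)"
    using assms unfolding linked_by_lifts_def by blast
  then show ?thesis unfolding linked_by_lifts_def by (intro exI[of _ d] exI[of _ c]) auto
qed

lemma linked_by_lifts_sym:
  "linked_by_lifts X1 p1 X2 p2 a b x y \<longleftrightarrow> linked_by_lifts X2 p2 X1 p1 b a y x"
  using linked_by_lifts_swap by metis

lemma linked_by_lifts_exists:
  assumes sc: "simply_connected X1" and p1: "continuous_on X1 p1" "p1 ` X1 \<subseteq> S"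
    and cov: "covering_space X2 p2 S" and ab: "a \<in> X1" "b \<in> X2" "p2 b = p1 a" and x: "x \<in> X1"
  shows "\<exists>y. linked_by_lifts X1 p1 X2 p2 a b x y"
proof -
  have "homotopic_loops X1 (\<lambda>_. a) (\<lambda>_. x)"
    using sc[unfolded simply_connected_def, rule_format, of "\<lambda>_. a" "\<lambda>_. x"] ab x
    by (auto simp: pathstart_def pathfinish_def path_def path_image_def)
  then obtain H :: "real \<times> real \<Rightarrow> 'a" where
    H: "continuous_on ({0..1} \<times> {0..1}) H" "H \<in> {0..1} \<times> {0..1} \<rightarrow> X1" "H (0, 0) = a" "H (1, 0) = x"
    unfolding homotopic_loops by auto
  define c where "c t = H (t, 0)" for t
  have "continuous_on {0..1} c" unfolding c_def
    by (rule continuous_on_compose2[OF H(1)]) (auto intro!: continuous_intros)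
  then have c: "path c" "path_image c \<subseteq> X1" "c 0 = a" "c 1 = x"
    using H by (auto simp: c_def path_def path_image_def)
  have "continuous_on {0..1} (\<lambda>t. p1 (c t))"
    using p1(1) c(1,2) by (auto simp: path_def path_image_def intro: continuous_on_compose2)
  then have pc: "path (\<lambda>t. p1 (c t))" "path_image (\<lambda>t. p1 (c t)) \<subseteq> S"
    using c p1 by (auto simp: path_def path_image_def)
  obtain d where "path d" "path_image d \<subseteq> X2" "d 0 = b" "\<And>t. t \<in> {0..1} \<Longrightarrow> p2 (d t) = p1 (c t)"
    using covering_space_path_lifting[OF cov pc ab(2)] ab(3) c(3) by auto
  then show ?thesis using c unfolding linked_by_lifts_def by blast
qed

text \<open>
  Two paths to \<open>x\<close> form a loop, which is null-homotopic; hence the corresponding lifts form a loop as well.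
\<close>

lemma linked_by_lifts_unique:
  assumes sc: "simply_connected X1" and p1: "continuous_on X1 p1" "p1 ` X1 \<subseteq> S"
    and cov: "covering_space X2 p2 S"
    and y: "linked_by_lifts X1 p1 X2 p2 a b x y" and y': "linked_by_lifts X1 p1 X2 p2 a b x y'"
  shows "y = y'"
proof -
  obtain c d where cd: "path c" "path_image c \<subseteq> X1" "c 0 = a" "c 1 = x"
      "path d" "path_image d \<subseteq> X2" "d 0 = b" "d 1 = y" "\<forall>t\<in>{0..1}. p2 (d t) = p1 (c t)"
    using y unfolding linked_by_lifts_def by blast
  obtain c' d' where cd': "path c'" "path_image c' \<subseteq> X1" "c' 0 = a" "c' 1 = x"
      "path d'" "path_image d' \<subseteq> X2" "d' 0 = b" "d' 1 = y'" "\<forall>t\<in>{0..1}. p2 (d' t) = p1 (c' t)"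
    using y' unfolding linked_by_lifts_def by blast
  \<comment> \<open>the loop out along \<open>c\<close> and back along \<open>c'\<close>, run from the point \<open>x\<close>\<close>
  let ?l = "reversepath c' +++ c"
  have l: "path ?l" "path_image ?l \<subseteq> X1" "?l 0 = ?l 1"
  proof -
    show "path ?l" using cd cd' by (intro path_join_imp) (simp_all add: pathstart_def pathfinish_def path_reversepath, simp add: reversepath_def)
    show "path_image ?l \<subseteq> X1" using cd cd' path_image_join_subset[of "reversepath c'" c] by auto
    show "?l 0 = ?l 1" using cd cd' by (simp add: joinpaths_def reversepath_def)
  qed
  let ?m = "reversepath d' +++ d"
  have m: "path ?m" "path_image ?m \<subseteq> X2"
  proof -
    show "path ?m" using cd cd' by (intro path_join_imp) (simp_all add: pathstart_def pathfinish_def path_reversepath, simp add: reversepath_def)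
    show "path_image ?m \<subseteq> X2" using cd cd' path_image_join_subset[of "reversepath d'" d] by auto
  qed
  have "p2 (?m t) = p1 (?l t)" if "t \<in> {0..1}" for t
    using cd(9) cd'(9) that by (auto simp: joinpaths_def reversepath_def)
  then have "?m 0 = ?m 1" using lift_of_null_homotopic_loop_is_closed[OF sc p1 cov l m] by blast
  then show ?thesis using cd(8) cd'(8) by (simp add: joinpaths_def reversepath_def)
qed

text \<open>
  Near \<open>x\<close> the map is the composition of local inverses of the two projections: over a path-connected
  neighbourhood \<open>W\<close> of \<open>p1 x\<close> both lifts are prolonged by the lifts of one path in \<open>W\<close>.
\<close>

lemma linked_by_lifts_continuous:
  assumes sc: "simply_connected X1" and cov1: "covering_space X1 p1 S"
    and cov: "covering_space X2 p2 S" and lpc: "locally path_connected S"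
    and h: "\<And>x. x \<in> X1 \<Longrightarrow> linked_by_lifts X1 p1 X2 p2 a b x (h x)"
  shows "continuous_on X1 h"
  unfolding continuous_on_topological
proof (intro ballI allI impI)
  fix x B assume x: "x \<in> X1" and B: "open B" "h x \<in> B"
  have p1: "continuous_on X1 p1" "p1 ` X1 \<subseteq> S"
    using covering_space_imp_continuous[OF cov1] covering_space_imp_surjective[OF cov1] by auto
  obtain c d where cd: "path c" "path_image c \<subseteq> X1" "c 0 = a" "c 1 = x"
      "path d" "path_image d \<subseteq> X2" "d 0 = b" "d 1 = h x" "\<forall>t\<in>{0..1}. p2 (d t) = p1 (c t)"
    using h[OF x] unfolding linked_by_lifts_def by blast
  have "d 1 \<in> path_image d" by (simp add: path_image_def)
  moreover have "p2 (d 1) = p1 (c 1)" using cd(9) by simp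
  ultimately have hx: "h x \<in> X2" "p2 (h x) = p1 x" using cd(4,6,8) by auto
  obtain u1 V1 q1 where 1: "x \<in> u1" "openin (top_of_set X1) u1" "p1 x \<in> V1" "openin (top_of_set S) V1"
      "homeomorphism u1 V1 p1 q1"
    using covering_space_local_homeomorphism[OF cov1 x] by blast
  obtain u2 V2 q2 where 2: "h x \<in> u2" "openin (top_of_set X2) u2" "p2 (h x) \<in> V2" "openin (top_of_set S) V2"
      "homeomorphism u2 V2 p2 q2"
    using covering_space_local_homeomorphism[OF cov hx(1)] by blast
  have "continuous_on V2 q2" "q2 ` V2 = u2" using 2(5) by (auto simp: homeomorphism_def)
  then have "openin (top_of_set V2) (V2 \<inter> q2 -` B)"
    using B(1) by (intro continuous_openin_preimage_gen)
  then have "openin (top_of_set S) (V1 \<inter> (V2 \<inter> q2 -` B))"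
    using 1(4) 2(4) openin_trans by blast
  moreover have qx: "q2 (p1 x) = h x" using 2(1,5) hx by (metis homeomorphism_apply1)
  ultimately obtain W where W: "openin (top_of_set S) W" "path_connected W" "p1 x \<in> W" "W \<subseteq> V1 \<inter> (V2 \<inter> q2 -` B)"
    using lpc 1(3) 2(3) hx(2) B(2) unfolding locally_def
    by (smt (verit, best) IntI openin_imp_subset subset_iff vimageI
        locally_path_connected lpc)
  have "openin (top_of_set X1) (u1 \<inter> p1 -` W)"
  proof -
    have "openin (top_of_set X1) (X1 \<inter> p1 -` W)"
      using continuous_openin_preimage[OF p1(1) _ W(1)] p1(2) by auto
    then have "openin (top_of_set X1) (u1 \<inter> (X1 \<inter> p1 -` W))" using 1(2) by blast
    then show ?thesis using openin_imp_subset[OF 1(2)] by (simp add: Int_absorb1 Int_assoc[symmetric] Int_absorb2)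
  qed
  then obtain A where A: "open A" "u1 \<inter> p1 -` W = X1 \<inter> A" unfolding openin_open by blast
  show "\<exists>A. open A \<and> x \<in> A \<and> (\<forall>y\<in>X1. y \<in> A \<longrightarrow> h y \<in> B)"
  proof (intro exI conjI ballI impI)
    show "open A" "x \<in> A" using A 1(1) W(3) x by blast+
    fix y assume y: "y \<in> X1" "y \<in> A"
    then have yu: "y \<in> u1" "p1 y \<in> W" using A(2) by blast+
    obtain g where g: "path g" "path_image g \<subseteq> W" "g 0 = p1 x" "g 1 = p1 y"
      using W(2,3) yu(2) unfolding path_connected_def pathstart_def pathfinish_def by blast
    have gV: "path_image g \<subseteq> V1" "path_image g \<subseteq> V2" using g(2) W(4) by auto
    have q: "path (q1 \<circ> g)" "path (q2 \<circ> g)" "path_image (q1 \<circ> g) \<subseteq> X1" "path_image (q2 \<circ> g) \<subseteq> X2"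
    proof -
      have "continuous_on V1 q1" "continuous_on V2 q2" "q1 ` V1 \<subseteq> X1" "q2 ` V2 \<subseteq> X2"
        using 1(2,5) 2(2,5) openin_imp_subset[OF 1(2)] openin_imp_subset[OF 2(2)]
        unfolding homeomorphism_def by auto
      then show "path (q1 \<circ> g)" "path (q2 \<circ> g)" "path_image (q1 \<circ> g) \<subseteq> X1" "path_image (q2 \<circ> g) \<subseteq> X2"
        using g(1) gV by (auto simp: path_image_compose intro!: path_continuous_image
            intro: continuous_on_subset) blast+
    qed
    have ends: "q1 (g 0) = x" "q1 (g 1) = y" "q2 (g 0) = h x"
      using g(3,4) 1(1,5) yu(1) qx by (auto simp: homeomorphism_def)
    have pq: "p1 (q1 (g t)) = g t" "p2 (q2 (g t)) = g t" if "t \<in> {0..1}" for t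
    proof -
      have "g t \<in> V1" "g t \<in> V2" using that gV unfolding path_image_def by blast+
      then show "p1 (q1 (g t)) = g t" "p2 (q2 (g t)) = g t" 
        using 1(5) 2(5) by (auto simp: homeomorphism_def)
    qed
    have "linked_by_lifts X1 p1 X2 p2 a b y (q2 (g 1))"
      unfolding linked_by_lifts_def
    proof (intro exI[of _ "c +++ (q1 \<circ> g)"] exI[of _ "d +++ (q2 \<circ> g)"] conjI)
      show "path (c +++ (q1 \<circ> g))" "path (d +++ (q2 \<circ> g))"
        using cd q ends by (auto intro!: path_join_imp simp: pathstart_def pathfinish_def)
      show "path_image (c +++ (q1 \<circ> g)) \<subseteq> X1" "path_image (d +++ (q2 \<circ> g)) \<subseteq> X2"
        using cd q path_image_join_subset by blast+
      show "\<forall>t\<in>{0..1}. p2 ((d +++ (q2 \<circ> g)) t) = p1 ((c +++ (q1 \<circ> g)) t)"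
        using cd(9) pq by (auto simp: joinpaths_def)
    qed (use cd ends in \<open>auto simp: joinpaths_def\<close>)
    then have "h y = q2 (g 1)" using linked_by_lifts_unique[OF sc p1 cov h[OF y(1)]] by blast
    then show "h y \<in> B" using g(4) yu(2) W(4) by auto
  qed
qed

text \<open>
  The correspondence given by transport along lifts is symmetric in the two coverings, so it is inverted by the correspondence
  in the other direction.
\<close>

theorem simply_connected_covering_unique:
  assumes sc: "simply_connected X1" "simply_connected X2" and cov: "covering_space X1 p1 S" "covering_space X2 p2 S"
    and lpc: "locally path_connected S" and ne: "S \<noteq> {}"
  obtains h h' where "homeomorphism X1 X2 h h'" "\<And>x. x \<in> X1 \<Longrightarrow> p2 (h x) = p1 x"
proof -
  obtain y where "y \<in> S" using ne by blast
  then obtain a b where ab: "a \<in> X1" "b \<in> X2" "p2 b = p1 a"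
    using cov covering_space_imp_surjective by (metis imageE)
  note p1 = covering_space_imp_continuous[OF cov(1)] equalityD1[OF covering_space_imp_surjective[OF cov(1)]]
  note p2 = covering_space_imp_continuous[OF cov(2)] equalityD1[OF covering_space_imp_surjective[OF cov(2)]]
  let ?R = "linked_by_lifts X1 p1 X2 p2 a b"
  obtain h where h: "\<And>x. x \<in> X1 \<Longrightarrow> ?R x (h x)"
    using linked_by_lifts_exists[OF sc(1) p1 cov(2) ab] by metis
  obtain h' where h': "\<And>y. y \<in> X2 \<Longrightarrow> linked_by_lifts X2 p2 X1 p1 b a y (h' y)"
    using linked_by_lifts_exists[OF sc(2) p2 cov(1) ab(2,1) ab(3)[symmetric]] by metis
  have val: "x \<in> X1 \<and> y \<in> X2 \<and> p2 y = p1 x" if "?R x y" for x y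
    using that unfolding linked_by_lifts_def by (auto simp: path_image_def)
  have u1: "y = y'" if "?R x y" "?R x y'" for x y y' using linked_by_lifts_unique[OF sc(1) p1 cov(2) that] .
  have u2: "x = x'" if "?R x y" "?R x' y" for x x' y
    using linked_by_lifts_unique[OF sc(2) p2 cov(1)] that linked_by_lifts_sym by metis
  have "homeomorphism X1 X2 h h'"
    unfolding homeomorphism_def
  proof (intro conjI ballI)
    show "continuous_on X1 h" using linked_by_lifts_continuous[OF sc(1) cov lpc h] by blast
    show "continuous_on X2 h'" using linked_by_lifts_continuous[OF sc(2) cov(2,1) lpc h'] by blast
    have hh: "h' (h x) = x" if "x \<in> X1" for x
      using h[OF that] h'[of "h x"] val u2 linked_by_lifts_sym by metis
    have hh': "h (h' y) = y" if "y \<in> X2" for y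
      using h'[OF that] h[of "h' y"] val u1 linked_by_lifts_sym by metis
    show "\<And>x. x \<in> X1 \<Longrightarrow> h' (h x) = x" "\<And>y. y \<in> X2 \<Longrightarrow> h (h' y) = y" using hh hh' by auto
    have m: "h x \<in> X2" if "x \<in> X1" for x using val h that by blast
    have m': "h' y \<in> X1" if "y \<in> X2" for y using val h' that linked_by_lifts_sym by metis
    show "h ` X1 = X2" "h' ` X2 = X1" using m m' hh hh' by (force simp: image_iff)+
  qed
  then show thesis using that h val by blast
qed

section \<open>The three space forms\<close>

definition dual_vector :: "geometry \<Rightarrow> 'a::euclidean_space \<times> real \<Rightarrow> 'a \<times> real" where
  "dual_vector g \<nu> = (fst \<nu>, curvature g * snd \<nu>)"

text \<open>
  The action of the reflection on covectors.
\<close>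

definition root_reflection ::
    "geometry \<Rightarrow> 'a::euclidean_space \<times> real \<Rightarrow> 'a \<times> real \<Rightarrow> 'a \<times> real" where
  "root_reflection g \<nu> \<mu> = \<mu> - (2 * conormal_form g \<nu> \<mu>) *\<^sub>R \<nu>"

text \<open>
  The quadratic form whose level \<open>1\<close> contains the space form.
\<close>

definition qform :: "geometry \<Rightarrow> 'a::euclidean_space \<times> real \<Rightarrow> real" where
  "qform g v = (snd v)\<^sup>2 + curvature g * (norm (fst v))\<^sup>2"

text \<open>
  The rays through the points of the space form. Positive combinations of points are taken in this cone and
  are brought back by the radial projection.
\<close>

definition cone_over :: "geometry \<Rightarrow> ('a::euclidean_space \<times> real) set" where
  "cone_over g = {v. 0 < qform g v \<and> (g = Spherical \<or> 0 < snd v)}"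

definition radial :: "geometry \<Rightarrow> 'a::euclidean_space \<times> real \<Rightarrow> 'a \<times> real" where
  "radial g v = v /\<^sub>R sqrt (qform g v)"

text \<open>
  The square of the chord between two points. It is a monotone function of the distance, given in all three
  geometries by one formula, and it makes sense without square roots and inverse functions.
\<close>

definition sep :: "geometry \<Rightarrow> 'a::euclidean_space \<times> real \<Rightarrow> 'a \<times> real \<Rightarrow> real" where
  "sep g p q = conormal_form g (p - q) (p - q)"

lemma conormal_form_eq_inner: "conormal_form g \<nu> \<mu> = \<nu> \<bullet> dual_vector g \<mu>"
  by (simp add: conormal_form_def dual_vector_def inner_prod_def)

lemma conormal_form_simps:
  "conormal_form g (\<nu> + \<nu>') \<mu> = conormal_form g \<nu> \<mu> + conormal_form g \<nu>' \<mu>"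
  "conormal_form g \<mu> (\<nu> + \<nu>') = conormal_form g \<mu> \<nu> + conormal_form g \<mu> \<nu>'"
  "conormal_form g (\<nu> - \<nu>') \<mu> = conormal_form g \<nu> \<mu> - conormal_form g \<nu>' \<mu>"
  "conormal_form g \<mu> (\<nu> - \<nu>') = conormal_form g \<mu> \<nu> - conormal_form g \<mu> \<nu>'"
  "conormal_form g (s *\<^sub>R \<nu>) \<mu> = s * conormal_form g \<nu> \<mu>"
  "conormal_form g \<mu> (s *\<^sub>R \<nu>) = s * conormal_form g \<mu> \<nu>"
  "conormal_form g (- \<nu>) \<mu> = - conormal_form g \<nu> \<mu>"
  "conormal_form g \<mu> (- \<nu>) = - conormal_form g \<mu> \<nu>"
  "conormal_form g 0 \<mu> = 0" "conormal_form g \<mu> 0 = 0"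
  by (simp_all add: conormal_form_def algebra_simps)

lemma conormal_form_commute: "conormal_form g \<nu> \<mu> = conormal_form g \<mu> \<nu>"
  by (simp add: conormal_form_def inner_commute mult.commute)

lemma conormal_form_sum: "finite A \<Longrightarrow> conormal_form g (sum f A) \<mu> = (\<Sum>a\<in>A. conormal_form g (f a) \<mu>)"
  by (induction A rule: finite_induct) (auto simp: conormal_form_simps)

lemma conormal_form_sum2: "finite A \<Longrightarrow> conormal_form g \<mu> (sum f A) = (\<Sum>a\<in>A. conormal_form g \<mu> (f a))"
  by (simp add: conormal_form_commute[of g \<mu>] conormal_form_sum)

lemma reflection_eq: "reflection g \<nu> p = p - (2 * (\<nu> \<bullet> p) / conormal_form g \<nu> \<nu>) *\<^sub>R dual_vector g \<nu>"
  by (simp add: reflection_def dual_vector_def)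

lemma dual_vector_simps:
  "dual_vector g (\<nu> + \<mu>) = dual_vector g \<nu> + dual_vector g \<mu>"
  "dual_vector g (\<nu> - \<mu>) = dual_vector g \<nu> - dual_vector g \<mu>"
  "dual_vector g (s *\<^sub>R \<nu>) = s *\<^sub>R dual_vector g \<nu>"
  by (simp_all add: dual_vector_def algebra_simps)

lemma linear_reflection: "linear (reflection g \<nu>)"
  unfolding reflection_eq
  by (rule linearI) (simp_all add: inner_add_right algebra_simps add_divide_distrib scaleR_add_left)

lemma reflection_scale: "s \<noteq> 0 \<Longrightarrow> reflection g (s *\<^sub>R \<nu>) = reflection g \<nu>"
  by (rule ext) (simp add: reflection_eq conormal_form_simps dual_vector_simps)

lemma inner_reflection:
  assumes "conormal_form g \<nu> \<nu> = 1"
  shows "\<mu> \<bullet> reflection g \<nu> p = root_reflection g \<nu> \<mu> \<bullet> p"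
proof -
  have "conormal_form g \<nu> \<mu> = \<mu> \<bullet> dual_vector g \<nu>" by (metis conormal_form_commute conormal_form_eq_inner)
  then show ?thesis using assms by (simp add: reflection_eq root_reflection_def inner_diff_right inner_diff_left)
qed

lemma adjoint_reflection:
  assumes "conormal_form g \<nu> \<nu> = 1"
  shows "adjoint (reflection g \<nu>) = root_reflection g \<nu>"
  by (rule adjoint_unique) (use inner_reflection[OF assms] in \<open>simp add: inner_commute\<close>)

lemma reflection_involution:
  assumes "conormal_form g \<nu> \<nu> \<noteq> 0" shows "reflection g \<nu> (reflection g \<nu> p) = p"
proof -
  have "\<nu> \<bullet> reflection g \<nu> p = - (\<nu> \<bullet> p)"
    using assms by (simp add: reflection_eq inner_diff_right conormal_form_eq_inner[symmetric])
  then show ?thesis by (simp add: reflection_eq)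
qed

lemma reflection_comp_self [simp]:
  "conormal_form g \<nu> \<nu> = 1 \<Longrightarrow> reflection g \<nu> \<circ> reflection g \<nu> = id"
  by (rule ext) (simp add: reflection_involution)

lemma root_reflection_form:
  assumes "conormal_form g \<nu> \<nu> = 1"
  shows "conormal_form g (root_reflection g \<nu> \<mu>) (root_reflection g \<nu> \<mu>') = conormal_form g \<mu> \<mu>'"
  using assms by (simp add: root_reflection_def conormal_form_simps conormal_form_commute[of g \<mu> \<nu>])

lemma root_reflection_involution:
  assumes "conormal_form g \<nu> \<nu> = 1"
  shows "root_reflection g \<nu> (root_reflection g \<nu> \<mu>) = \<mu>"
  using assms by (simp add: root_reflection_def conormal_form_simps)

lemma root_reflection_self: "conormal_form g \<nu> \<nu> = 1 \<Longrightarrow> root_reflection g \<nu> \<nu> = - \<nu>"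
  by (simp add: root_reflection_def scaleR_2)

lemma root_reflection_simps:
  "root_reflection g \<nu> (\<mu> + \<mu>') = root_reflection g \<nu> \<mu> + root_reflection g \<nu> \<mu>'"
  "root_reflection g \<nu> (s *\<^sub>R \<mu>) = s *\<^sub>R root_reflection g \<nu> \<mu>"
  "root_reflection g \<nu> (- \<mu>) = - root_reflection g \<nu> \<mu>"
  by (simp_all add: root_reflection_def conormal_form_simps algebra_simps)

lemma reflection_conjugate:
  assumes "conormal_form g \<nu> \<nu> = 1" "conormal_form g \<mu> \<mu> = 1"
  shows "reflection g \<nu> \<circ> reflection g \<mu> \<circ> reflection g \<nu> = reflection g (root_reflection g \<nu> \<mu>)"
proof
  fix p
  have d: "reflection g \<nu> (dual_vector g \<mu>) = dual_vector g (root_reflection g \<nu> \<mu>)"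
    using assms by (simp add: reflection_eq root_reflection_def dual_vector_simps
        conormal_form_eq_inner[symmetric])
  have 1: "reflection g \<mu> p = p - (2 * (\<mu> \<bullet> p)) *\<^sub>R dual_vector g \<mu>" for p
    using assms by (simp add: reflection_eq)
  have "reflection g \<nu> (reflection g \<mu> (reflection g \<nu> p)) =
      reflection g \<nu> (reflection g \<nu> p) - (2 * (\<mu> \<bullet> reflection g \<nu> p)) *\<^sub>R reflection g \<nu> (dual_vector g \<mu>)"
    unfolding 1 by (simp add: linear_diff[OF linear_reflection] linear_scale[OF linear_reflection])
  also have "\<dots> = p - (2 * (root_reflection g \<nu> \<mu> \<bullet> p)) *\<^sub>R dual_vector g (root_reflection g \<nu> \<mu>)"
    using assms by (simp add: reflection_involution d inner_reflection)
  also have "\<dots> = reflection g (root_reflection g \<nu> \<mu>) p"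
    using assms by (simp add: reflection_eq root_reflection_form)
  finally show "(reflection g \<nu> \<circ> reflection g \<mu> \<circ> reflection g \<nu>) p = reflection g (root_reflection g \<nu> \<mu>) p"
    by simp
qed

subsection \<open>Radial projection\<close>

lemma curvature_cube: "curvature g * (curvature g * curvature g) = curvature g"
  by (cases g) auto

lemma mem_cone_over_iff:
  "v \<in> cone_over g \<longleftrightarrow> (case g of Spherical \<Rightarrow> v \<noteq> 0 | Euclidean \<Rightarrow> 0 < snd v | Hyperbolic \<Rightarrow> norm (fst v) < snd v)"
proof (cases g)
  case Hyperbolic
  have "(0 < (snd v)\<^sup>2 - (norm (fst v))\<^sup>2 \<and> 0 < snd v) \<longleftrightarrow> norm (fst v) < snd v"
    by (smt (verit, best) norm_ge_zero power2_less_imp_less power_strict_mono zero_less_numeral)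
  then show ?thesis using Hyperbolic by (simp add: cone_over_def qform_def)
next
  case Spherical
  have "0 < (snd v)\<^sup>2 + (norm (fst v))\<^sup>2 \<longleftrightarrow> v \<noteq> 0"
    by (metis add.commute add_cancel_left_right sum_power2_gt_zero_iff norm_eq_zero fst_zero snd_zero prod_eqI)
  then show ?thesis using Spherical by (simp add: cone_over_def qform_def)
qed (auto simp: cone_over_def qform_def)

lemma space_form_iff: "p \<in> space_form g \<longleftrightarrow> p \<in> cone_over g \<and> qform g p = 1"
  by (auto simp: space_form_def cone_over_def qform_def)

lemma open_cone_over: "open (cone_over g :: ('a::euclidean_space \<times> real) set)"
proof -
  have "cone_over g = (if g = Spherical then - {0 :: 'a \<times> real} else if g = Euclidean then {v. 0 < snd v} else {v. norm (fst v) < snd v})"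
    by (rule set_eqI, cases g) (auto simp: mem_cone_over_iff)
  then show ?thesis by (auto intro!: open_Collect_less continuous_intros)
qed

lemma radial_in_space_form:
  assumes "v \<in> cone_over g" shows "radial g v \<in> space_form g"
proof -
  have q: "0 < qform g v" using assms by (simp add: cone_over_def)
  have "qform g (r *\<^sub>R v) = r\<^sup>2 * qform g v" for r
    by (simp add: qform_def power_mult_distrib algebra_simps)
  then have "qform g (radial g v) = (inverse (sqrt (qform g v)))\<^sup>2 * qform g v"
    unfolding radial_def .
  then have "qform g (radial g v) = 1" using q by (simp add: power_inverse)
  moreover have "g = Spherical \<or> 0 < snd (radial g v)"
    using assms q by (auto simp: cone_over_def radial_def)
  ultimately show ?thesis by (simp add: space_form_iff cone_over_def)
qed

lemma radial_id: "p \<in> space_form g \<Longrightarrow> radial g p = p"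
  by (simp add: space_form_iff radial_def)

lemma continuous_on_radial: "continuous_on (cone_over g) (radial g)"
proof -
  have "continuous_on (cone_over g) (qform g)"
    unfolding qform_def by (intro continuous_intros)
  then show ?thesis unfolding radial_def
    by (intro continuous_intros) (auto simp: cone_over_def)
qed

lemma inner_radial: "\<nu> \<bullet> radial g v = (\<nu> \<bullet> v) / sqrt (qform g v)"
  by (simp add: radial_def divide_inverse mult.commute)

lemma inner_radial_sign:
  assumes "v \<in> cone_over g"
  shows "0 < \<nu> \<bullet> radial g v \<longleftrightarrow> 0 < \<nu> \<bullet> v" "0 \<le> \<nu> \<bullet> radial g v \<longleftrightarrow> 0 \<le> \<nu> \<bullet> v" "\<nu> \<bullet> radial g v = 0 \<longleftrightarrow> \<nu> \<bullet> v = 0"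
proof -
  have q: "0 < qform g v" using assms by (simp add: cone_over_def)
  then show "0 < \<nu> \<bullet> radial g v \<longleftrightarrow> 0 < \<nu> \<bullet> v" "0 \<le> \<nu> \<bullet> radial g v \<longleftrightarrow> 0 \<le> \<nu> \<bullet> v"
      "\<nu> \<bullet> radial g v = 0 \<longleftrightarrow> \<nu> \<bullet> v = 0"
    by (simp_all add: inner_radial pos_less_divide_eq pos_le_divide_eq)
qed

lemma cone_over_segment:
  assumes "c \<in> cone_over g" "x \<in> cone_over g" "0 \<le> s" "s \<le> 1"
    and "g = Spherical \<Longrightarrow> (1 - s) *\<^sub>R c + s *\<^sub>R x \<noteq> 0"
  shows "(1 - s) *\<^sub>R c + s *\<^sub>R x \<in> cone_over g"
proof (cases g)
  case Euclidean
  then show ?thesis using assms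
    by (simp add: mem_cone_over_iff)
      (smt (verit, best) mult_nonneg_nonneg mult_pos_pos)
next
  case Hyperbolic
  have "norm ((1 - s) *\<^sub>R fst c + s *\<^sub>R fst x) \<le> (1 - s) * norm (fst c) + s * norm (fst x)"
    using assms(3,4) by (metis abs_of_nonneg diff_ge_0_iff_ge norm_scaleR norm_triangle_ineq)
  also have "\<dots> < (1 - s) * snd c + s * snd x"
  proof (cases "s = 0")
    case False
    have "(1 - s) * norm (fst c) \<le> (1 - s) * snd c" "s * norm (fst x) < s * snd x"
      using assms Hyperbolic False by (auto simp: mem_cone_over_iff intro!: mult_left_mono)
    then show ?thesis by simp
  qed (use assms Hyperbolic in \<open>simp add: mem_cone_over_iff\<close>)
  finally show ?thesis using Hyperbolic by (simp add: mem_cone_over_iff)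
qed (use assms in \<open>simp add: mem_cone_over_iff\<close>)

lemma base_point_in_space_form: "(0, 1) \<in> space_form g"
  by (simp add: space_form_def)

lemma closed_space_form: "closed (space_form g :: ('a::euclidean_space \<times> real) set)"
proof -
  have "g = Spherical \<or> 0 < snd v" if "qform g v = 1" "g = Spherical \<or> 0 \<le> snd v" for v :: "'a \<times> real"
  proof (rule ccontr)
    assume "\<not> ?thesis"
    then have "g \<noteq> Spherical" "snd v = 0" using that(2) by auto
    moreover have "(norm (fst v))\<^sup>2 \<noteq> - 1" using zero_le_power2[of "norm (fst v)"] by linarith
    ultimately show False using that(1) by (cases g) (simp_all add: qform_def)
  qed
  then have "space_form g = {v :: 'a \<times> real. qform g v = 1} \<inter> {v. g = Spherical \<or> 0 \<le> snd v}"
    by (auto simp: space_form_iff cone_over_def)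
  moreover have "closed {v :: 'a \<times> real. qform g v = 1}"
    unfolding qform_def by (intro closed_Collect_eq continuous_intros)
  moreover have "closed {v :: 'a \<times> real. g = Spherical \<or> 0 \<le> snd v}"
    by (cases "g = Spherical") (auto intro!: closed_Collect_le continuous_intros)
  ultimately show ?thesis by (metis closed_Int)
qed

lemma space_form_spherical: "space_form Spherical = sphere 0 1"
  by (auto simp: space_form_def norm_prod_def add.commute)

text \<open>
  Except on the sphere the radial image of the segment serves; antipodal points of the sphere have no such image,
  and the whole sphere is used.
\<close>

lemma connected_compact_through:
  fixes c x :: "'a::euclidean_space \<times> real"
  assumes "c \<in> space_form g" "x \<in> space_form g"
  obtains K where "K \<subseteq> space_form g" "compact K" "connected K" "c \<in> K" "x \<in> K"
proof (cases "g = Spherical")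
  case True
  have "2 \<le> DIM('a \<times> real)" using DIM_positive[where 'a='a] by simp
  then have "connected (sphere (0 :: 'a \<times> real) 1)" by (rule connected_sphere)
  then show ?thesis using that[of "sphere 0 1"] assms True by (simp add: space_form_spherical)
next
  case False
  have sub: "closed_segment c x \<subseteq> cone_over g"
    using cone_over_segment[of c g x] assms False by (auto simp: closed_segment_def space_form_iff)
  then have cont: "continuous_on (closed_segment c x) (radial g)"
    using continuous_on_radial continuous_on_subset by blast
  show ?thesis
  proof (rule that[of "radial g ` closed_segment c x"])
    show "radial g ` closed_segment c x \<subseteq> space_form g" using sub radial_in_space_form by blast
    show "compact (radial g ` closed_segment c x)" "connected (radial g ` closed_segment c x)"
      using cont by (auto intro: compact_continuous_image connected_continuous_image)
    show "c \<in> radial g ` closed_segment c x" "x \<in> radial g ` closed_segment c x"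
      using radial_id assms by (metis ends_in_segment(1,2) image_eqI)+
  qed
qed

lemma connected_compact_neighbourhood:
  fixes x :: "'a::euclidean_space \<times> real"
  assumes "x \<in> space_form g"
  obtains K e where "K \<subseteq> space_form g" "compact K" "connected K" "0 < e" "space_form g \<inter> ball x e \<subseteq> K"
proof -
  obtain e where e: "0 < e" "cball x e \<subseteq> cone_over g"
    using assms open_cone_over open_contains_cball by (metis space_form_iff)
  have cont: "continuous_on (cball x e) (radial g)" using continuous_on_radial continuous_on_subset e(2) by blast
  show thesis
  proof (rule that[of "radial g ` cball x e" e])
    show "radial g ` cball x e \<subseteq> space_form g" using e(2) radial_in_space_form by blast
    show "compact (radial g ` cball x e)" "connected (radial g ` cball x e)"
      using cont by (auto intro: compact_continuous_image connected_continuous_image convex_connected)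
    show "space_form g \<inter> ball x e \<subseteq> radial g ` cball x e"
      using radial_id by (smt (verit) IntE ball_subset_cball image_iff subsetD subsetI)
  qed (use e in auto)
qed

text \<open>
  Moving off \<open>y\<close> in an arbitrary direction of the linear space and projecting back: a substitute for the exponential map,
  which keeps the signs of linear forms computable.
\<close>

lemma radial_perturbation:
  assumes y: "y \<in> space_form g" and U: "open U" "y \<in> U"
  obtains e where "0 < e"
    "\<And>\<epsilon>. \<bar>\<epsilon>\<bar> < e \<Longrightarrow> y + \<epsilon> *\<^sub>R d \<in> cone_over g \<and> radial g (y + \<epsilon> *\<^sub>R d) \<in> U \<inter> space_form g"
proof -
  have "open (cone_over g \<inter> radial g -` U)"
    using continuous_open_preimage[OF continuous_on_radial open_cone_over U(1)] .
  then have "open ((\<lambda>\<epsilon>. y + \<epsilon> *\<^sub>R d) -` (cone_over g \<inter> radial g -` U))"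
    by (rule open_vimage) (intro continuous_intros)
  moreover have "0 \<in> (\<lambda>\<epsilon>. y + \<epsilon> *\<^sub>R d) -` (cone_over g \<inter> radial g -` U)"
    using y U by (simp add: radial_id) (simp add: space_form_iff)
  ultimately obtain e where "0 < e" "ball 0 e \<subseteq> (\<lambda>\<epsilon>. y + \<epsilon> *\<^sub>R d) -` (cone_over g \<inter> radial g -` U)"
    unfolding open_contains_ball by blast
  then have "y + \<epsilon> *\<^sub>R d \<in> cone_over g \<inter> radial g -` U" if "\<bar>\<epsilon>\<bar> < e" for \<epsilon>
    using that by (auto simp: subset_iff)
  then show thesis using that[OF \<open>0 < e\<close>] radial_in_space_form by blast
qed

lemma nonneg_near_imp_pos:
  assumes y: "y \<in> space_form g" "open U" "y \<in> U" and nn: "\<And>p. p \<in> U \<inter> space_form g \<Longrightarrow> 0 \<le> \<nu> \<bullet> p" and "\<nu> \<noteq> 0"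
  shows "0 < \<nu> \<bullet> y"
proof (rule ccontr)
  assume "\<not> 0 < \<nu> \<bullet> y"
  moreover have "0 \<le> \<nu> \<bullet> y" using nn y by auto
  ultimately have 0: "\<nu> \<bullet> y = 0" by simp
  obtain e where e: "0 < e" "\<And>\<epsilon>. \<bar>\<epsilon>\<bar> < e \<Longrightarrow> y + \<epsilon> *\<^sub>R (- \<nu>) \<in> cone_over g \<and> radial g (y + \<epsilon> *\<^sub>R (- \<nu>)) \<in> U \<inter> space_form g"
    using radial_perturbation[OF y] by blast
  let ?v = "y + (e / 2) *\<^sub>R (- \<nu>)"
  have v: "?v \<in> cone_over g" "radial g ?v \<in> U \<inter> space_form g" using e(2)[of "e/2"] e(1) by auto
  have "0 \<le> \<nu> \<bullet> ?v" using nn[OF v(2)] inner_radial_sign(2)[OF v(1)] by blast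
  then have "(e / 2) * (\<nu> \<bullet> \<nu>) \<le> 0" using 0 by (simp add: inner_diff_right)
  then have "\<nu> \<bullet> \<nu> \<le> 0" using e(1) by (simp add: mult_le_0_iff)
  then show False using \<open>\<nu> \<noteq> 0\<close> inner_ge_zero[of \<nu>] by (metis antisym inner_eq_zero_iff)
qed

text \<open>
  If \<open>\<mu>\<close> were not a multiple of \<open>\<nu>\<close>, it would take negative values in some direction tangent to the mirror of \<open>\<nu>\<close>.
\<close>

lemma nonneg_near_on_hyperplane_imp_multiple:
  assumes y: "y \<in> space_form g" "open U" "y \<in> U" and \<nu>: "\<nu> \<bullet> y = 0" and \<mu>: "\<mu> \<bullet> y = 0"
    and nn: "\<And>p. p \<in> U \<Longrightarrow> p \<in> space_form g \<Longrightarrow> \<nu> \<bullet> p = 0 \<Longrightarrow> 0 \<le> \<mu> \<bullet> p"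
  shows "\<exists>r. \<mu> = r *\<^sub>R \<nu>"
proof -
  define d where "d = \<mu> - (\<mu> \<bullet> \<nu> / (\<nu> \<bullet> \<nu>)) *\<^sub>R \<nu>"
  have d\<nu>: "\<nu> \<bullet> d = 0" by (cases "\<nu> = 0") (simp_all add: d_def inner_diff_right inner_commute)
  have d\<mu>: "\<mu> \<bullet> d = d \<bullet> d" using d\<nu> unfolding d_def
    by (simp add: inner_diff_right inner_diff_left inner_commute)
  obtain e where e: "0 < e" "\<And>\<epsilon>. \<bar>\<epsilon>\<bar> < e \<Longrightarrow> y + \<epsilon> *\<^sub>R (- d) \<in> cone_over g \<and> radial g (y + \<epsilon> *\<^sub>R (- d)) \<in> U \<inter> space_form g"
    using radial_perturbation[OF y] by blast
  let ?v = "y + (e / 2) *\<^sub>R (- d)"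
  have v: "?v \<in> cone_over g" "radial g ?v \<in> U \<inter> space_form g" using e(2)[of "e/2"] e(1) by auto
  have "\<nu> \<bullet> radial g ?v = 0" unfolding inner_radial_sign(3)[OF v(1)] using \<nu> d\<nu> by (simp add: inner_diff_right)
  then have "0 \<le> \<mu> \<bullet> ?v" using nn v inner_radial_sign(2) by blast
  then have "(e / 2) * (d \<bullet> d) \<le> 0" using \<mu> d\<mu> by (simp add: inner_diff_right)
  then have "d \<bullet> d \<le> 0" using e(1) by (simp add: mult_le_0_iff)
  then have "d = 0" using inner_ge_zero[of d] by (metis antisym inner_eq_zero_iff)
  then show ?thesis unfolding d_def by auto
qed

lemma linear_eq_if_eq_on_space_form:
  fixes w w' :: "'a::euclidean_space \<times> real \<Rightarrow> 'a \<times> real"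
  assumes lin: "linear w" "linear w'" and eq: "\<And>p. p \<in> space_form g \<Longrightarrow> w p = w' p"
  shows "w = w'"
proof
  fix v
  let ?c = "(0, 1) :: 'a \<times> real"
  obtain e where e: "0 < e" "\<And>\<epsilon>. \<bar>\<epsilon>\<bar> < e \<Longrightarrow> ?c + \<epsilon> *\<^sub>R v \<in> cone_over g \<and> radial g (?c + \<epsilon> *\<^sub>R v) \<in> UNIV \<inter> space_form g"
    using radial_perturbation[OF base_point_in_space_form open_UNIV] by blast
  let ?v = "?c + (e / 2) *\<^sub>R v"
  have v: "?v \<in> cone_over g" "radial g ?v \<in> space_form g" using e(2)[of "e/2"] e(1) by auto
  have "w (radial g ?v) = w' (radial g ?v)" using eq v by blast
  then have "w ?v /\<^sub>R sqrt (qform g ?v) = w' ?v /\<^sub>R sqrt (qform g ?v)"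
    unfolding radial_def linear_scale[OF lin(1)] linear_scale[OF lin(2)] .
  then have "w ?v = w' ?v" using v(1) by (simp add: cone_over_def)
  then show "w v = w' v"
    using e(1) eq[OF base_point_in_space_form]
    by (simp add: linear_add[OF lin(1)] linear_add[OF lin(2)] linear_scale[OF lin(1)] linear_scale[OF lin(2)])
qed

subsection \<open>Reflections preserve the space form and the separation of its points\<close>

lemma qform_diff_scale: "qform g (p - s *\<^sub>R dual_vector g \<nu>) =
    qform g p - 2 * s * curvature g * (\<nu> \<bullet> p) + s\<^sup>2 * (curvature g * conormal_form g \<nu> \<nu>)"
proof -
  have "(norm (fst p - s *\<^sub>R fst \<nu>))\<^sup>2 = (norm (fst p))\<^sup>2 - 2 * s * (fst \<nu> \<bullet> fst p) + s\<^sup>2 * (fst \<nu> \<bullet> fst \<nu>)"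
    unfolding power2_norm_eq_inner
    by (simp add: inner_diff_left inner_diff_right inner_commute power2_eq_square algebra_simps)
  moreover have "(snd p - s * (curvature g * snd \<nu>))\<^sup>2
      = (snd p)\<^sup>2 - 2 * s * curvature g * (snd \<nu> * snd p) + s\<^sup>2 * (curvature g * (curvature g * (snd \<nu> * snd \<nu>)))"
    by (simp add: power2_eq_square algebra_simps)
  ultimately have "qform g (p - s *\<^sub>R dual_vector g \<nu>) =
     ((snd p)\<^sup>2 - 2 * s * curvature g * (snd \<nu> * snd p) + s\<^sup>2 * (curvature g * (curvature g * (snd \<nu> * snd \<nu>))))
     + curvature g * ((norm (fst p))\<^sup>2 - 2 * s * (fst \<nu> \<bullet> fst p) + s\<^sup>2 * (fst \<nu> \<bullet> fst \<nu>))"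
    by (simp add: qform_def dual_vector_def)
  then show ?thesis
    by (simp add: qform_def conormal_form_def inner_prod_def algebra_simps)
qed

lemma qform_reflection:
  assumes "conormal g \<nu>" shows "qform g (reflection g \<nu> p) = qform g p"
  unfolding reflection_eq qform_diff_scale using assms
  by (simp add: conormal_def power2_eq_square field_simps)

lemma reflection_space_form:
  assumes \<nu>: "conormal g \<nu>" and p: "p \<in> space_form g"
  shows "reflection g \<nu> p \<in> space_form g"
proof -
  have q: "qform g (reflection g \<nu> p) = 1" using qform_reflection[OF \<nu>] p by (simp add: space_form_iff)
  moreover have "g = Spherical \<or> 0 < snd (reflection g \<nu> p)"
  proof (cases g)
    case Euclidean
    then show ?thesis using p by (simp add: reflection_def space_form_iff cone_over_def)
  next
    case Hyperbolic
    let ?r = "reflection g \<nu> p" let ?c = "2 * (\<nu> \<bullet> p) / conormal_form g \<nu> \<nu>"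
    have r: "fst ?r = fst p - ?c *\<^sub>R fst \<nu>" "snd ?r = snd p + ?c * snd \<nu>"
      using Hyperbolic by (simp_all add: reflection_def)
    have "snd p * (snd p + c * snd \<nu>) - fst p \<bullet> (fst p - c *\<^sub>R fst \<nu>) = qform g p + c * (\<nu> \<bullet> p)" for c
      using Hyperbolic unfolding qform_def power2_norm_eq_inner
      by (simp add: inner_prod_def inner_diff_right power2_eq_square algebra_simps inner_commute)
    then have "snd p * snd ?r - fst p \<bullet> fst ?r = qform g p + ?c * (\<nu> \<bullet> p)" unfolding r .
    also have "?c * (\<nu> \<bullet> p) = 2 * (\<nu> \<bullet> p)\<^sup>2 / conormal_form g \<nu> \<nu>" by (simp add: power2_eq_square)
    also have "qform g p + \<dots> > 0" using \<nu> p by (simp add: conormal_def space_form_iff add_pos_nonneg)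
    finally have 1: "fst p \<bullet> fst ?r < snd p * snd ?r" by simp
    have t: "norm (fst p) < snd p" using p Hyperbolic by (simp add: space_form_iff mem_cone_over_iff)
    have "(norm (fst ?r))\<^sup>2 < (snd ?r)\<^sup>2" using q Hyperbolic by (simp add: qform_def)
    then have "norm (fst ?r) < \<bar>snd ?r\<bar>" by (metis abs_le_square_iff abs_norm_cancel linorder_not_less)
    have "\<not> snd ?r \<le> 0"
    proof
      assume "snd ?r \<le> 0"
      then have "norm (fst p) * norm (fst ?r) \<le> snd p * - snd ?r"
        using t order_le_less_trans[OF norm_ge_zero t] \<open>norm (fst ?r) < \<bar>snd ?r\<bar>\<close> by (intro mult_mono) auto
      then have "- (fst p \<bullet> fst ?r) \<le> snd p * - snd ?r"
        using Cauchy_Schwarz_ineq2[of "fst p" "fst ?r"] by linarith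
      then show False using 1 by simp
    qed
    then show ?thesis by simp
  qed simp
  ultimately show ?thesis by (simp add: space_form_iff cone_over_def)
qed

lemma curvature_snd_diff:
  "p \<in> space_form g \<Longrightarrow> q \<in> space_form g \<Longrightarrow> curvature g * (curvature g * snd (p - q)) = snd (p - q)"
  by (cases g) (auto simp: space_form_def power2_eq_1_iff)

text \<open>
  When \<open>p\<close> and \<open>q\<close> lie on different sides of the mirror, the correction term is negative: reflecting \<open>p\<close> brings it closer to \<open>q\<close>.
\<close>

lemma sep_reflection_left:
  assumes \<nu>: "conormal g \<nu>" and p: "p \<in> space_form g" "q \<in> space_form g"
  shows "sep g (reflection g \<nu> p) q = sep g p q + 4 * (\<nu> \<bullet> p) * (\<nu> \<bullet> q) / conormal_form g \<nu> \<nu>"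
proof -
  let ?v = "p - q" let ?G = "conormal_form g \<nu> \<nu>" let ?c = "2 * (\<nu> \<bullet> p) / ?G"
  have G: "?G \<noteq> 0" using \<nu> by (simp add: conormal_def)
  have v\<nu>: "conormal_form g ?v (dual_vector g \<nu>) = \<nu> \<bullet> ?v"
  proof -
    have "curvature g * (snd ?v * (curvature g * snd \<nu>)) = (curvature g * (curvature g * snd ?v)) * snd \<nu>"
      by (simp only: mult_ac)
    then show ?thesis unfolding curvature_snd_diff[OF p]
      by (simp add: conormal_form_def dual_vector_def inner_prod_def inner_commute mult.commute)
  qed
  have GG: "conormal_form g (dual_vector g \<nu>) (dual_vector g \<nu>) = ?G"
    using curvature_cube[of g] by (simp add: conormal_form_def dual_vector_def) (metis mult.assoc mult.commute)
  have v\<nu>': "conormal_form g (dual_vector g \<nu>) ?v = \<nu> \<bullet> ?v" using v\<nu> conormal_form_commute by metis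
  have "conormal_form g (?v - c *\<^sub>R dual_vector g \<nu>) (?v - c *\<^sub>R dual_vector g \<nu>)
      = conormal_form g ?v ?v - 2 * c * (\<nu> \<bullet> ?v) + c\<^sup>2 * ?G" for c
    unfolding conormal_form_simps(3)[of g ?v] conormal_form_simps(4)[of g _ ?v] conormal_form_simps(5,6) v\<nu> v\<nu>' GG
    by (simp add: power2_eq_square algebra_simps)
  moreover have r: "reflection g \<nu> p - q = ?v - ?c *\<^sub>R dual_vector g \<nu>" by (simp add: reflection_eq)
  ultimately have "sep g (reflection g \<nu> p) q = sep g p q - 2 * ?c * (\<nu> \<bullet> ?v) + ?c\<^sup>2 * ?G"
    unfolding sep_def r by blast
  also have "\<dots> = sep g p q + 4 * (\<nu> \<bullet> p) * (\<nu> \<bullet> q) / ?G"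
    using G by (simp add: inner_diff_right power2_eq_square field_simps)
  finally show ?thesis .
qed

lemma sep_commute: "sep g p q = sep g q p"
  by (simp add: sep_def conormal_form_simps)

lemma inner_reflection_self: "conormal g \<nu> \<Longrightarrow> \<nu> \<bullet> reflection g \<nu> p = - (\<nu> \<bullet> p)"
  by (simp add: reflection_eq inner_diff_right conormal_form_eq_inner[symmetric] conormal_def)

lemma sep_reflection:
  assumes \<nu>: "conormal g \<nu>" and p: "p \<in> space_form g" "q \<in> space_form g"
  shows "sep g (reflection g \<nu> p) (reflection g \<nu> q) = sep g p q"
  using sep_reflection_left[OF \<nu> p(1) reflection_space_form[OF \<nu> p(2)]] sep_reflection_left[OF \<nu> p(2,1)]
  by (simp add: inner_reflection_self[OF \<nu>] sep_commute[of g _ p] sep_commute[of g "reflection g \<nu> q" p] sep_commute[of g q p])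

lemma sep_formulas:
  assumes "p \<in> space_form g" "q \<in> space_form g"
  shows "g = Euclidean \<Longrightarrow> sep g p q = (dist p q)\<^sup>2"
    and "g = Spherical \<Longrightarrow> sep g p q = 2 - 2 * (p \<bullet> q)"
    and "g = Hyperbolic \<Longrightarrow> sep g p q = 2 * (snd p * snd q - fst p \<bullet> fst q) - 2"
proof -
  show "g = Euclidean \<Longrightarrow> sep g p q = (dist p q)\<^sup>2"
    using assms by (auto simp: sep_def conormal_form_def space_form_def power2_eq_1_iff dist_norm power2_norm_eq_inner inner_prod_def)
  show "sep g p q = 2 - 2 * (p \<bullet> q)" if "g = Spherical"
  proof -
    have "sep g p q = (p - q) \<bullet> (p - q)" using that by (simp add: sep_def conormal_form_def inner_prod_def)
    moreover have "p \<bullet> p = 1" "q \<bullet> q = 1" using assms that by (simp_all add: space_form_spherical norm_eq_1)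
    ultimately show ?thesis by (simp add: inner_diff_left inner_diff_right inner_commute)
  qed
  show "sep g p q = 2 * (snd p * snd q - fst p \<bullet> fst q) - 2" if "g = Hyperbolic"
  proof -
    have "fst p \<bullet> fst p = snd p * snd p - 1" "fst q \<bullet> fst q = snd q * snd q - 1"
      using assms that by (auto simp: space_form_def power2_eq_square dot_square_norm)
    then show ?thesis using that
      by (simp add: sep_def conormal_form_def inner_diff_left inner_diff_right inner_commute algebra_simps)
  qed
qed

lemma hyperbolic_product_ge_1:
  assumes "p \<in> space_form Hyperbolic" "q \<in> space_form Hyperbolic"
  shows "(norm (fst p - fst q))\<^sup>2 \<le> (snd p * snd q)\<^sup>2 - (1 + fst p \<bullet> fst q)\<^sup>2"
    and "1 \<le> snd p * snd q - fst p \<bullet> fst q"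
proof -
  let ?x = "fst p" let ?y = "fst q"
  have t: "(snd p)\<^sup>2 = 1 + ?x \<bullet> ?x" "(snd q)\<^sup>2 = 1 + ?y \<bullet> ?y" "0 < snd p" "0 < snd q"
    using assms by (auto simp: space_form_def power2_norm_eq_inner)
  have cs: "(?x \<bullet> ?y)\<^sup>2 \<le> (?x \<bullet> ?x) * (?y \<bullet> ?y)" by (rule Cauchy_Schwarz_ineq)
  have "(snd p * snd q)\<^sup>2 - (1 + ?x \<bullet> ?y)\<^sup>2 = (norm (?x - ?y))\<^sup>2 + ((?x \<bullet> ?x) * (?y \<bullet> ?y) - (?x \<bullet> ?y)\<^sup>2)"
    unfolding power_mult_distrib t power2_norm_eq_inner
    by (simp add: inner_diff_left inner_diff_right inner_commute power2_eq_square algebra_simps)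
  then show 1: "(norm (?x - ?y))\<^sup>2 \<le> (snd p * snd q)\<^sup>2 - (1 + ?x \<bullet> ?y)\<^sup>2" using cs by simp
  then have "(1 + ?x \<bullet> ?y)\<^sup>2 \<le> (snd p * snd q)\<^sup>2" by (smt (verit) zero_le_power2)
  then show "1 \<le> snd p * snd q - ?x \<bullet> ?y"
    using t(3,4) by (smt (verit) mult_pos_pos power2_le_imp_le)
qed

lemma sep_nonneg:
  assumes "p \<in> space_form g" "q \<in> space_form g" shows "0 \<le> sep g p q"
proof (cases g)
  case Hyperbolic
  then show ?thesis using sep_formulas(3)[OF assms] hyperbolic_product_ge_1(2)[of p q] assms by simp
qed (simp_all add: sep_def conormal_form_def)

lemma sep_eq_0_iff:
  assumes "p \<in> space_form g" "q \<in> space_form g" shows "sep g p q = 0 \<longleftrightarrow> p = q"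
proof
  assume s: "sep g p q = 0"
  show "p = q"
  proof (cases g)
    case Hyperbolic
    then have "snd p * snd q = 1 + fst p \<bullet> fst q" using sep_formulas(3)[OF assms] s by simp
    then have "fst p = fst q" using hyperbolic_product_ge_1(1)[of p q] assms Hyperbolic by simp
    moreover have "(snd p)\<^sup>2 = 1 + (norm (fst p))\<^sup>2" "(snd q)\<^sup>2 = 1 + (norm (fst q))\<^sup>2" "0 < snd p" "0 < snd q"
      using assms Hyperbolic by (auto simp: space_form_def)
    ultimately show ?thesis by (metis less_eq_real_def power2_eq_iff_nonneg prod_eqI)
  next
    case Euclidean then show ?thesis using sep_formulas(1)[OF assms] s by simp
  next
    case Spherical
    then have "fst (p - q) \<bullet> fst (p - q) + snd (p - q) * snd (p - q) = 0" using s by (simp add: sep_def conormal_form_def)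
    then have "(p - q) \<bullet> (p - q) = 0" by (simp add: inner_prod_def)
    then show ?thesis by simp
  qed
qed (simp add: sep_def conormal_form_simps)

definition dist_of_sep :: "geometry \<Rightarrow> real \<Rightarrow> real" where
  "dist_of_sep g s = (case g of Euclidean \<Rightarrow> sqrt s | Spherical \<Rightarrow> arccos (1 - s / 2) | Hyperbolic \<Rightarrow> arcosh (1 + s / 2))"

lemma space_dist_sep:
  assumes "p \<in> space_form g" "q \<in> space_form g" shows "space_dist g p q = dist_of_sep g (sep g p q)"
proof (cases g)
  case Hyperbolic
  have "1 + sep g p q / 2 = snd p * snd q - fst p \<bullet> fst q" using sep_formulas(3)[OF assms] Hyperbolic by (simp add: field_simps)
  then show ?thesis using Hyperbolic by (simp add: dist_of_sep_def)
next
  case Spherical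
  have "1 - sep g p q / 2 = p \<bullet> q" using sep_formulas(2)[OF assms] Spherical by (simp add: field_simps)
  then show ?thesis using Spherical by (simp add: dist_of_sep_def)
qed (use sep_formulas(1)[OF assms] in \<open>simp add: dist_of_sep_def\<close>)

lemma sep_spherical_le: "p \<in> space_form Spherical \<Longrightarrow> q \<in> space_form Spherical \<Longrightarrow> sep Spherical p q \<le> 4"
  using sep_formulas(2)[of p Spherical q] Cauchy_Schwarz_ineq2[of p q] by (simp add: space_form_spherical)

lemma space_dist_mono:
  fixes p q :: "'a::euclidean_space \<times> real" and p' q' :: "'b::euclidean_space \<times> real"
  assumes p: "p \<in> space_form g" "q \<in> space_form g" "p' \<in> space_form g" "q' \<in> space_form g"
    and le: "sep g p q \<le> sep g p' q'"
  shows "space_dist g p q \<le> space_dist g p' q'"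
  unfolding space_dist_sep[OF p(1,2)] space_dist_sep[OF p(3,4)]
proof (cases g)
  case Spherical
  then show "dist_of_sep g (sep g p q) \<le> dist_of_sep g (sep g p' q')"
    using le sep_nonneg[OF p(1,2)] sep_spherical_le[of p' q'] p by (simp add: dist_of_sep_def arccos_le_arccos)
next
  case Hyperbolic
  then show "dist_of_sep g (sep g p q) \<le> dist_of_sep g (sep g p' q')"
    using le sep_nonneg[OF p(1,2)] arcosh_less_iff_real[of "1 + sep g p' q' / 2" "1 + sep g p q / 2"]
    by (simp add: dist_of_sep_def not_less[symmetric] del: arcosh_less_iff_real)
qed (use le in \<open>simp add: dist_of_sep_def\<close>)

lemma space_dist_nonneg:
  assumes p: "p \<in> space_form g" "q \<in> space_form g" shows "0 \<le> space_dist g p q"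
  unfolding space_dist_sep[OF p]
  using sep_nonneg[OF p] sep_spherical_le[of p q] p
  by (cases g) (auto simp: dist_of_sep_def arccos_lbound)

section \<open>Motions and the group generated by reflections in facets\<close>

text \<open>
  Members of reflection groups are used through these properties only. The last clause says how the mirror
  of a reflection moves under conjugation; it is recorded here because it is stable under composition.
\<close>

definition motion :: "geometry \<Rightarrow> ('a::euclidean_space \<times> real \<Rightarrow> 'a \<times> real) \<Rightarrow> bool" where
  "motion g w \<longleftrightarrow> linear w \<and> (\<forall>p\<in>space_form g. w p \<in> space_form g) \<and>
     (\<forall>p\<in>space_form g. \<forall>q\<in>space_form g. sep g (w p) (w q) = sep g p q) \<and>
     (\<forall>\<nu> \<mu>. conormal_form g (adjoint w \<nu>) (adjoint w \<mu>) = conormal_form g \<nu> \<mu>) \<and>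
     (\<forall>\<nu>. conormal_form g \<nu> \<nu> = 1 \<longrightarrow> w \<circ> reflection g (adjoint w \<nu>) = reflection g \<nu> \<circ> w)"

lemma motion_linear: "motion g w \<Longrightarrow> linear w" by (simp add: motion_def)

lemma motion_space_form: "motion g w \<Longrightarrow> p \<in> space_form g \<Longrightarrow> w p \<in> space_form g" by (simp add: motion_def)

lemma motion_sep: "motion g w \<Longrightarrow> p \<in> space_form g \<Longrightarrow> q \<in> space_form g \<Longrightarrow> sep g (w p) (w q) = sep g p q"
  by (simp add: motion_def)

lemma motion_form: "motion g w \<Longrightarrow> conormal_form g (adjoint w \<nu>) (adjoint w \<mu>) = conormal_form g \<nu> \<mu>"
  unfolding motion_def by blast

lemma inner_linear:
  fixes w :: "'e::euclidean_space \<Rightarrow> 'e" shows "linear w \<Longrightarrow> \<nu> \<bullet> w p = adjoint w \<nu> \<bullet> p"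
  using adjoint_works[of w p \<nu>] by (simp add: inner_commute)

lemma adjoint_comp:
  fixes w w' :: "'e::euclidean_space \<Rightarrow> 'e"
  assumes "linear w" "linear w'" shows "adjoint (w \<circ> w') \<nu> = adjoint w' (adjoint w \<nu>)"
  by (rule vector_eq_rdot[THEN iffD1]) (simp add: inner_linear[symmetric] assms linear_compose)

lemma adjoint_id: "adjoint id (\<nu> :: 'e::euclidean_space) = \<nu>"
  by (rule vector_eq_rdot[THEN iffD1]) (simp add: inner_linear[OF linear_id, symmetric])

lemma continuous_on_linear: fixes w :: "'e::euclidean_space \<Rightarrow> 'e" shows "linear w \<Longrightarrow> continuous_on A w"
  using linear_continuous_on linear_conv_bounded_linear by blast

lemma open_linear_vimage:
  fixes w :: "'e::euclidean_space \<Rightarrow> 'e" assumes "linear w" "open U" shows "open (w -` U)"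
  using assms continuous_on_linear[of w UNIV] by (intro open_vimage) auto

lemma motion_conjugate:
  assumes "motion g w" "conormal g \<nu>"
  shows "w \<circ> reflection g (adjoint w \<nu>) = reflection g \<nu> \<circ> w"
proof -
  have con: "0 < conormal_form g \<nu> \<nu>" using assms(2) by (simp add: conormal_def)
  define r where "r = 1 / sqrt (conormal_form g \<nu> \<nu>)"
  have r: "r \<noteq> 0" "conormal_form g (r *\<^sub>R \<nu>) (r *\<^sub>R \<nu>) = 1" using con by (auto simp: r_def conormal_form_simps)
  have lin: "adjoint w (r *\<^sub>R \<nu>) = r *\<^sub>R adjoint w \<nu>"
    using adjoint_linear[OF motion_linear[OF assms(1)]] linear_scale by blast
  have "w \<circ> reflection g (adjoint w (r *\<^sub>R \<nu>)) = reflection g (r *\<^sub>R \<nu>) \<circ> w"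
    using assms(1) r(2) unfolding motion_def by blast
  then show ?thesis unfolding lin reflection_scale[OF r(1)] .
qed

lemma motion_id: "motion g id"
  unfolding motion_def by (simp add: adjoint_id linear_id del: id_apply) (simp add: adjoint_id)

lemma motion_comp:
  assumes "motion g w" "motion g v" shows "motion g (w \<circ> v)"
proof -
  have lin: "linear w" "linear v" using assms motion_linear by auto
  have "(w \<circ> v) \<circ> reflection g (adjoint (w \<circ> v) \<nu>) = reflection g \<nu> \<circ> (w \<circ> v)" if \<nu>: "conormal_form g \<nu> \<nu> = 1" for \<nu>
  proof -
    have con: "conormal g \<nu>" "conormal g (adjoint w \<nu>)" using \<nu> motion_form[OF assms(1)] by (auto simp: conormal_def)
    have "(w \<circ> v) \<circ> reflection g (adjoint (w \<circ> v) \<nu>) = w \<circ> (v \<circ> reflection g (adjoint v (adjoint w \<nu>)))"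
      by (simp only: adjoint_comp[OF lin] comp_assoc)
    also have "\<dots> = w \<circ> reflection g (adjoint w \<nu>) \<circ> v"
      by (simp only: motion_conjugate[OF assms(2) con(2)] comp_assoc)
    also have "\<dots> = reflection g \<nu> \<circ> (w \<circ> v)"
      by (simp only: motion_conjugate[OF assms(1) con(1)] comp_assoc)
    finally show ?thesis .
  qed
  moreover have "conormal_form g (adjoint (w \<circ> v) \<nu>) (adjoint (w \<circ> v) \<mu>) = conormal_form g \<nu> \<mu>" for \<nu> \<mu>
    by (simp only: adjoint_comp[OF lin] motion_form[OF assms(1)] motion_form[OF assms(2)])
  moreover have "sep g ((w \<circ> v) p) ((w \<circ> v) q) = sep g p q" if "p \<in> space_form g" "q \<in> space_form g" for p q
    using assms that by (simp add: motion_sep motion_space_form)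
  ultimately show ?thesis
    using linear_compose[OF lin(2,1)] assms motion_space_form unfolding motion_def by (metis comp_apply)
qed

lemma motion_unit_reflection:
  assumes u: "conormal_form g a a = 1" shows "motion g (reflection g a)"
  unfolding motion_def
proof (intro conjI ballI allI impI)
  have con: "conormal g a" using u by (simp add: conormal_def)
  show "linear (reflection g a)" by (rule linear_reflection)
  show "p \<in> space_form g \<Longrightarrow> reflection g a p \<in> space_form g" for p using reflection_space_form[OF con] .
  show "p \<in> space_form g \<Longrightarrow> q \<in> space_form g \<Longrightarrow> sep g (reflection g a p) (reflection g a q) = sep g p q" for p q
    using sep_reflection[OF con] .
  show "conormal_form g (adjoint (reflection g a) \<nu>) (adjoint (reflection g a) \<mu>) = conormal_form g \<nu> \<mu>" for \<nu> \<mu>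
    by (simp add: adjoint_reflection[OF u] root_reflection_form[OF u])
  fix \<nu> :: "'a \<times> real" assume \<nu>: "conormal_form g \<nu> \<nu> = 1"
  have "reflection g a \<circ> reflection g (adjoint (reflection g a) \<nu>)
      = (reflection g a \<circ> reflection g a) \<circ> reflection g \<nu> \<circ> reflection g a"
    unfolding adjoint_reflection[OF u] reflection_conjugate[OF u \<nu>, symmetric] by (simp only: comp_assoc)
  then show "reflection g a \<circ> reflection g (adjoint (reflection g a) \<nu>) = reflection g \<nu> \<circ> reflection g a"
    by (simp only: reflection_comp_self[OF u] id_comp)
qed

lemma unit_multiple:
  assumes "conormal g \<nu>"
  shows "conormal_form g ((1 / sqrt (conormal_form g \<nu> \<nu>)) *\<^sub>R \<nu>) ((1 / sqrt (conormal_form g \<nu> \<nu>)) *\<^sub>R \<nu>) = 1"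
    and "reflection g ((1 / sqrt (conormal_form g \<nu> \<nu>)) *\<^sub>R \<nu>) = reflection g \<nu>"
  using assms by (auto simp: conormal_def conormal_form_simps intro!: reflection_scale)

lemma motion_reflection: "conormal g a \<Longrightarrow> motion g (reflection g a)"
  using motion_unit_reflection[OF unit_multiple(1)] unit_multiple(2) by metis

lemma motion_vimage_openin:
  assumes w: "motion g w" and U: "open U" "z \<in> U" "hyperplane_of g \<nu> \<inter> U \<subseteq> w ` X" "w p = z" "p \<in> space_form g" "\<nu> \<bullet> z = 0"
    and inj: "\<And>q. w' (w q) = q"
  shows "p \<in> top_of_set (hyperplane_of g (adjoint w \<nu>)) interior_of X"
proof -
  let ?H = "hyperplane_of g (adjoint w \<nu>)"
  have "openin (top_of_set ?H) (?H \<inter> w -` U)"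
    using open_linear_vimage[OF motion_linear[OF w] U(1)] by (simp add: openin_open_Int)
  moreover have "?H \<inter> w -` U \<subseteq> X"
  proof
    fix q assume q: "q \<in> ?H \<inter> w -` U"
    then have "w q \<in> hyperplane_of g \<nu> \<inter> U"
      using motion_space_form[OF w] inner_linear[OF motion_linear[OF w], of \<nu> q] by (auto simp: hyperplane_of_def)
    then have "w q \<in> w ` X" using U(3) by blast
    then show "q \<in> X" using inj by (metis imageE)
  qed
  moreover have "p \<in> ?H \<inter> w -` U"
    using U inner_linear[OF motion_linear[OF w], of \<nu> p] by (auto simp: hyperplane_of_def)
  ultimately show ?thesis using interior_of_maximal by blast
qed

lemma facet_normal_transport:
  assumes w: "motion g w" "motion g w'" "w' \<circ> w = id" "w \<circ> w' = id" and X: "X \<subseteq> space_form g"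
    and f: "facet_normal g (w ` X) \<nu>"
  shows "facet_normal g X (adjoint w \<nu>)"
proof -
  have inj: "w' (w p) = p" "w (w' p) = p" for p using w by (metis comp_apply id_apply)+
  have "conormal g (adjoint w \<nu>)" using f motion_form[OF w(1)] by (simp add: facet_normal_def conormal_def)
  moreover have "X \<subseteq> half_space g (adjoint w \<nu>)"
  proof
    fix p assume p: "p \<in> X"
    then have "w p \<in> half_space g \<nu>" using f by (auto simp: facet_normal_def)
    then show "p \<in> half_space g (adjoint w \<nu>)"
      using X p inner_linear[OF motion_linear[OF w(1)], of \<nu> p] by (auto simp: half_space_def)
  qed
  moreover obtain z where "z \<in> top_of_set (hyperplane_of g \<nu>) interior_of (w ` X)" using f by (auto simp: facet_normal_def)
  then obtain U where U: "open U" "z \<in> U" "hyperplane_of g \<nu> \<inter> U \<subseteq> w ` X" "z \<in> hyperplane_of g \<nu>"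
    by (auto simp: interior_of_def openin_open)
  have "w' z \<in> top_of_set (hyperplane_of g (adjoint w \<nu>)) interior_of X"
    using U motion_space_form[OF w(2)] inj
    by (intro motion_vimage_openin[OF w(1) U(1-3), of _ w']) (auto simp: hyperplane_of_def)
  ultimately show ?thesis unfolding facet_normal_def by blast
qed

lemma interior_of_motion:
  assumes w: "motion g w" "motion g w'" "w' \<circ> w = id" "w \<circ> w' = id"
    and p: "p \<in> top_of_set (space_form g) interior_of (w ` X)"
  shows "w' p \<in> top_of_set (space_form g) interior_of X"
proof -
  have inj: "w' (w p) = p" "w (w' p) = p" for p using w by (metis comp_apply id_apply)+
  obtain U where U: "open U" "p \<in> U" "space_form g \<inter> U \<subseteq> w ` X" "p \<in> space_form g"
    using p by (auto simp: interior_of_def openin_open)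
  have "openin (top_of_set (space_form g)) (space_form g \<inter> w -` U)"
    using open_linear_vimage[OF motion_linear[OF w(1)] U(1)] by (simp add: openin_open_Int)
  moreover have "space_form g \<inter> w -` U \<subseteq> X"
  proof
    fix q assume "q \<in> space_form g \<inter> w -` U"
    then have "w q \<in> w ` X" using U(3) motion_space_form[OF w(1)] by blast
    then show "q \<in> X" using inj by (metis imageE)
  qed
  moreover have "w' p \<in> space_form g \<inter> w -` U" using U inj motion_space_form[OF w(2)] by auto
  ultimately show ?thesis using interior_of_maximal by blast
qed

text \<open>
  The copies of \<open>X\<close> are described by words in the reflections in the facets of \<open>X\<close> itself, in
  place of the facets of the copies. In this form they visibly form a group.
\<close>

inductive_set facet_group :: "geometry \<Rightarrow> ('a::euclidean_space \<times> real) set \<Rightarrow> ('a \<times> real \<Rightarrow> 'a \<times> real) set"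
  for g X where
  one: "id \<in> facet_group g X"
| step: "facet_normal g X a \<Longrightarrow> w \<in> facet_group g X \<Longrightarrow> reflection g a \<circ> w \<in> facet_group g X"

lemma facet_group_motion: "w \<in> facet_group g X \<Longrightarrow> motion g w"
proof (induction rule: facet_group.induct)
  case (step a w)
  then show ?case by (intro motion_comp motion_reflection) (simp_all add: facet_normal_def)
qed (rule motion_id)

lemma facet_reflection_in_group: "facet_normal g X a \<Longrightarrow> reflection g a \<in> facet_group g X"
  using facet_group.step[OF _ facet_group.one] by (simp only: comp_id)

lemma facet_group_comp: "w \<in> facet_group g X \<Longrightarrow> v \<in> facet_group g X \<Longrightarrow> w \<circ> v \<in> facet_group g X"
  by (induction rule: facet_group.induct) (simp_all only: id_comp comp_assoc facet_group.step)

lemma facet_group_inverse: "w \<in> facet_group g X \<Longrightarrow> \<exists>w'\<in>facet_group g X. w' \<circ> w = id \<and> w \<circ> w' = id"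
proof (induction rule: facet_group.induct)
  case (step a w)
  then obtain w' where w': "w' \<in> facet_group g X" "w' \<circ> w = id" "w \<circ> w' = id" by blast
  have aa: "reflection g a \<circ> reflection g a = id"
    using step(1) by (intro ext) (simp add: reflection_involution facet_normal_def conormal_def)
  have "(w' \<circ> reflection g a) \<circ> (reflection g a \<circ> w) = w' \<circ> (reflection g a \<circ> reflection g a) \<circ> w"
       "(reflection g a \<circ> w) \<circ> (w' \<circ> reflection g a) = reflection g a \<circ> (w \<circ> w') \<circ> reflection g a"
    by (simp_all only: comp_assoc)
  then show ?case using w' aa facet_group_comp[OF w'(1) facet_reflection_in_group[OF step(1)]]
    by (intro bexI[of _ "w' \<circ> reflection g a"]) (simp_all only: comp_id id_comp)
qed (intro bexI[of _ id] conjI facet_group.one; simp only: comp_id)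

text \<open>
  Reflecting the copy \<open>w ` X\<close> in one of its facets amounts to composing \<open>w\<close>, on the right, with the
  reflection in the corresponding facet of \<open>X\<close>.
\<close>

theorem reflected_copies_eq_facet_group:
  assumes X: "X \<subseteq> space_form g"
  shows "reflected_copies g X = facet_group g X"
proof
  show "reflected_copies g X \<subseteq> facet_group g X"
  proof
    fix w assume "w \<in> reflected_copies g X"
    then show "w \<in> facet_group g X"
    proof (induction rule: reflected_copies.induct)
      case (reflect w \<nu>)
      obtain w' where w': "w' \<in> facet_group g X" "w' \<circ> w = id" "w \<circ> w' = id"
        using facet_group_inverse[OF reflect(3)] by blast
      have "facet_normal g X (adjoint w \<nu>)"
        using facet_normal_transport[OF _ _ w'(2,3) X reflect(2)] facet_group_motion reflect(3) w'(1) by blast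
      then have "w \<circ> reflection g (adjoint w \<nu>) \<in> facet_group g X"
        using facet_group_comp[OF reflect(3)] facet_reflection_in_group by blast
      moreover have "w \<circ> reflection g (adjoint w \<nu>) = reflection g \<nu> \<circ> w"
        using motion_conjugate facet_group_motion reflect(2,3) facet_normal_def by blast
      ultimately show ?case by (simp only:)
    qed (rule facet_group.one)
  qed
  have right_step: "w \<circ> reflection g a \<in> reflected_copies g X"
    if w: "w \<in> facet_group g X" "w \<in> reflected_copies g X" and a: "facet_normal g X a" for w a
  proof -
    obtain w' where w': "w' \<in> facet_group g X" "w' \<circ> w = id" "w \<circ> w' = id"
      using facet_group_inverse[OF w(1)] by blast
    have m: "motion g w" "motion g w'" using facet_group_motion w w' by auto
    have lin: "linear w" "linear w'" using m motion_linear by auto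
    let ?\<nu> = "adjoint w' a"
    have "w' ` w ` X = X" unfolding image_comp w'(2) by simp
    moreover have "w ` X \<subseteq> space_form g" using motion_space_form[OF m(1)] X by blast
    ultimately have f: "facet_normal g (w ` X) ?\<nu>"
      using facet_normal_transport[OF m(2,1) w'(3,2)] a by metis
    have "adjoint w ?\<nu> = a" using adjoint_comp[OF lin(2,1), of a] w'(2) by (simp add: adjoint_id)
    then have "w \<circ> reflection g a = reflection g ?\<nu> \<circ> w"
      using motion_conjugate[OF m(1), of ?\<nu>] f by (simp add: facet_normal_def)
    then show ?thesis using reflected_copies.reflect[OF w(2) f] by metis
  qed
  have "v \<in> facet_group g X \<Longrightarrow> w \<in> facet_group g X \<and> w \<in> reflected_copies g X \<Longrightarrow> w \<circ> v \<in> reflected_copies g X" for v w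
  proof (induction arbitrary: w rule: facet_group.induct)
    case (step a v)
    then have "w \<circ> reflection g a \<in> facet_group g X \<and> w \<circ> reflection g a \<in> reflected_copies g X"
      using right_step facet_group_comp facet_reflection_in_group by blast
    from step(3)[OF this] show ?case by (simp only: comp_assoc)
  qed (simp only: comp_id)
  from this[of _ id] show "facet_group g X \<subseteq> reflected_copies g X"
    using facet_group.one reflected_copies.start by (metis id_comp subsetI)
qed

section \<open>Chambers of a locally finite reflection arrangement\<close>

lemma finite_avoid_hyperplanes:
  fixes A :: "'e::euclidean_space set"
  assumes "finite A" "0 \<notin> A" shows "\<exists>d. \<forall>a\<in>A. a \<bullet> d \<noteq> 0"
  using assms
proof (induction A rule: finite_induct)
  case (insert a A)
  then obtain d where d: "\<forall>b\<in>A. b \<bullet> d \<noteq> 0" by auto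
  have "finite (insert 0 ((\<lambda>b. - (b \<bullet> d) / (b \<bullet> a)) ` insert a A))" using insert by simp
  then obtain r :: real where r: "r \<notin> insert 0 ((\<lambda>b. - (b \<bullet> d) / (b \<bullet> a)) ` insert a A)"
    using ex_new_if_finite infinite_UNIV_char_0 by blast
  have "b \<bullet> (d + r *\<^sub>R a) \<noteq> 0" if "b \<in> insert a A" for b
  proof
    assume 0: "b \<bullet> (d + r *\<^sub>R a) = 0"
    have "b \<bullet> a \<noteq> 0"
    proof
      assume "b \<bullet> a = 0"
      then have "b \<noteq> a" using insert.prems by auto
      then show False using 0 \<open>b \<bullet> a = 0\<close> d that by (auto simp: inner_add_right)
    qed
    then have "r = - (b \<bullet> d) / (b \<bullet> a)" using 0 by (simp add: inner_add_right field_simps)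
    then show False using r that by blast
  qed
  then show ?case by blast
qed simp

lemma small_generic_parameter:
  fixes A :: "'e::euclidean_space set"
  assumes "finite A" "\<forall>a\<in>A. a \<bullet> d \<noteq> 0" "0 < e"
  obtains \<epsilon> where "0 < \<epsilon>" "\<epsilon> < e" "\<forall>a\<in>A. a \<bullet> (c + \<epsilon> *\<^sub>R d) \<noteq> 0"
proof -
  have "infinite {0<..<e}" using assms(3) by simp
  moreover have "finite ((\<lambda>a. - (a \<bullet> c) / (a \<bullet> d)) ` A)" using assms(1) by simp
  ultimately obtain \<epsilon> where \<epsilon>: "\<epsilon> \<in> {0<..<e}" "\<epsilon> \<notin> (\<lambda>a. - (a \<bullet> c) / (a \<bullet> d)) ` A"
    by (meson finite_subset subsetI)
  have "a \<bullet> (c + \<epsilon> *\<^sub>R d) \<noteq> 0" if "a \<in> A" for a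
  proof
    assume "a \<bullet> (c + \<epsilon> *\<^sub>R d) = 0"
    then have "\<epsilon> = - (a \<bullet> c) / (a \<bullet> d)" using assms(2) that by (simp add: inner_add_right field_simps)
    then show False using \<epsilon> that by blast
  qed
  then show thesis using that[of \<epsilon>] \<epsilon> by simp
qed

lemma unit_covector_multiple:
  assumes "conormal_form g \<nu> \<nu> = 1" "conormal_form g \<mu> \<mu> = 1" "\<nu> = r *\<^sub>R \<mu>"
  shows "\<nu> = \<mu> \<or> \<nu> = - \<mu>"
proof -
  have "r * r = 1" using assms by (simp add: conormal_form_simps)
  then have "r = 1 \<or> r = -1" by (simp add: square_eq_1_iff)
  then show ?thesis using assms(3) by auto
qed

text \<open>
  A point outside a locally finite intersection of half-spaces is separated from it by a wall, and
  the wall carries a point that lies strictly inside all the other half-spaces: move from a generic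
  interior point \<open>c'\<close> towards \<open>x\<close>. Genericity makes the hyperplanes be crossed one at a time, so at
  the first crossing exactly one of the forms vanishes.
\<close>

lemma separating_wall:
  fixes N :: "('a::euclidean_space \<times> real) set"
  assumes unit: "\<And>\<nu>. \<nu> \<in> N \<Longrightarrow> conormal_form g \<nu> \<nu> = 1"
    and c: "c \<in> space_form g" "open U" "c \<in> U" and nn: "\<And>p \<nu>. p \<in> U \<inter> space_form g \<Longrightarrow> \<nu> \<in> N \<Longrightarrow> 0 \<le> \<nu> \<bullet> p"
    and x: "x \<in> space_form g" and ex: "\<nu>0 \<in> N" "\<nu>0 \<bullet> x < 0" and fin: "finite {\<nu>\<in>N. \<nu> \<bullet> x < 0}"
  obtains \<nu> z where "\<nu> \<in> N" "\<nu> \<bullet> x < 0" "z \<in> space_form g" "\<nu> \<bullet> z = 0" "\<And>\<mu>. \<mu> \<in> N \<Longrightarrow> \<mu> \<noteq> \<nu> \<Longrightarrow> 0 < \<mu> \<bullet> z"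
proof -
  let ?F = "{\<nu>\<in>N. \<nu> \<bullet> x < 0}"
  have "2 \<le> DIM('a \<times> real)" using DIM_positive[where 'a='a] by simp
  then obtain a where a: "a \<noteq> 0" "a \<bullet> x = 0"
    using orthogonal_to_vector_exists[of x] by (auto simp: orthogonal_def inner_commute)
  \<comment> \<open>a direction that avoids \<open>a\<close> keeps the segment off \<open>0\<close>; the other covectors prevent \<open>\<nu>\<close> and \<open>\<mu>\<close> from vanishing at the same time\<close>
  define A where "A = insert a ((\<lambda>(\<nu>, \<mu>). (\<mu> \<bullet> x) *\<^sub>R \<nu> - (\<nu> \<bullet> x) *\<^sub>R \<mu>) ` {(\<nu>, \<mu>) \<in> ?F \<times> ?F. \<nu> \<noteq> \<mu>})"
  have "finite {(\<nu>, \<mu>) \<in> ?F \<times> ?F. \<nu> \<noteq> \<mu>}"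
    by (rule finite_subset[OF _ finite_cartesian_product[OF fin fin]]) blast
  then have "finite A" by (simp add: A_def)
  moreover have "0 \<notin> A"
  proof
    assume "0 \<in> A"
    then have "0 \<in> (\<lambda>(\<nu>, \<mu>). (\<mu> \<bullet> x) *\<^sub>R \<nu> - (\<nu> \<bullet> x) *\<^sub>R \<mu>) ` {(\<nu>, \<mu>) \<in> ?F \<times> ?F. \<nu> \<noteq> \<mu>}"
      using a(1) unfolding A_def by blast
    then obtain w where w: "w \<in> {(\<nu>, \<mu>) \<in> ?F \<times> ?F. \<nu> \<noteq> \<mu>}"
        "0 = (\<lambda>(\<nu>, \<mu>). (\<mu> \<bullet> x) *\<^sub>R \<nu> - (\<nu> \<bullet> x) *\<^sub>R \<mu>) w" by (rule imageE)
    obtain \<nu> \<mu> where "w = (\<nu>, \<mu>)" by (rule prod.exhaust)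
    with w have *: "\<nu> \<in> ?F" "\<mu> \<in> ?F" "\<nu> \<noteq> \<mu>" "(\<mu> \<bullet> x) *\<^sub>R \<nu> = (\<nu> \<bullet> x) *\<^sub>R \<mu>"
      by simp_all
    then have "(1 / (\<mu> \<bullet> x)) *\<^sub>R (\<mu> \<bullet> x) *\<^sub>R \<nu> = (1 / (\<mu> \<bullet> x)) *\<^sub>R (\<nu> \<bullet> x) *\<^sub>R \<mu>" by simp
    then have eq: "\<nu> = ((\<nu> \<bullet> x) / (\<mu> \<bullet> x)) *\<^sub>R \<mu>" using *(2) by simp
    moreover have "\<nu> \<noteq> - \<mu>" using *(1,2) by auto
    ultimately show False using unit_covector_multiple[of g \<nu> \<mu>] unit *(1-3) by blast
  qed
  ultimately obtain d where d: "\<forall>b\<in>A. b \<bullet> d \<noteq> 0" using finite_avoid_hyperplanes by blast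
  obtain e where e: "0 < e" "\<And>\<epsilon>. \<bar>\<epsilon>\<bar> < e \<Longrightarrow> c + \<epsilon> *\<^sub>R d \<in> cone_over g \<and> radial g (c + \<epsilon> *\<^sub>R d) \<in> U \<inter> space_form g"
    using radial_perturbation[OF c] by blast
  obtain \<epsilon> where \<epsilon>: "0 < \<epsilon>" "\<epsilon> < e" "\<forall>b\<in>A. b \<bullet> (c + \<epsilon> *\<^sub>R d) \<noteq> 0"
    using small_generic_parameter[OF \<open>finite A\<close> d e(1)] by blast
  define c' where "c' = c + \<epsilon> *\<^sub>R d"
  have c': "c' \<in> cone_over g" "radial g c' \<in> U \<inter> space_form g" using e(2)[of \<epsilon>] \<epsilon> by (auto simp: c'_def)
  have pos: "0 < \<nu> \<bullet> c'" if "\<nu> \<in> N" for \<nu>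
  proof -
    have "\<nu> \<noteq> 0" using unit[OF that] by (auto simp: conormal_form_simps)
    then have "0 < \<nu> \<bullet> radial g c'"
      using c' nn that by (intro nonneg_near_imp_pos[OF _ c(2)]) blast+
    then show ?thesis using inner_radial_sign[OF c'(1)] by blast
  qed
  \<comment> \<open>the time at which the segment from \<open>c'\<close> to \<open>x\<close> crosses the mirror of \<open>\<nu>\<close>\<close>
  define s where "s \<nu> = (\<nu> \<bullet> c') / (\<nu> \<bullet> c' - \<nu> \<bullet> x)" for \<nu>
  have "?F \<noteq> {}" using ex by blast
  then obtain \<nu> where \<nu>: "\<nu> \<in> ?F" "\<And>\<mu>. \<mu> \<in> ?F \<Longrightarrow> s \<nu> \<le> s \<mu>"
    using ex_is_arg_min_if_finite[OF fin, of s] unfolding is_arg_min_linorder by blast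
  have s01: "0 < s \<mu>" "s \<mu> < 1" if "\<mu> \<in> ?F" for \<mu>
    using that pos[of \<mu>] by (auto simp: s_def divide_simps)
  define z' where "z' = (1 - s \<nu>) *\<^sub>R c' + s \<nu> *\<^sub>R x"
  have z'\<mu>: "\<mu> \<bullet> z' = \<mu> \<bullet> c' - s \<nu> * (\<mu> \<bullet> c' - \<mu> \<bullet> x)" for \<mu>
    by (simp add: z'_def inner_add_right algebra_simps)
  have "a \<bullet> z' = (1 - s \<nu>) * (a \<bullet> c')" using a by (simp add: z'_def inner_add_right)
  also have "\<dots> \<noteq> 0" using s01[OF \<nu>(1)] \<epsilon>(3) by (simp add: c'_def A_def)
  finally have "z' \<noteq> 0" by auto
  then have z'c: "z' \<in> cone_over g" unfolding z'_def
    using c'(1) x s01[OF \<nu>(1)] by (intro cone_over_segment) (auto simp: space_form_iff)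
  have zero: "\<nu> \<bullet> z' = 0" using pos[of \<nu>] \<nu>(1) by (simp add: z'\<mu> s_def)
  have other: "0 < \<mu> \<bullet> z'" if \<mu>: "\<mu> \<in> N" "\<mu> \<noteq> \<nu>" for \<mu>
  proof (cases "\<mu> \<bullet> x < 0")
    case True
    have "s \<nu> \<noteq> s \<mu>"
    proof
      assume "s \<nu> = s \<mu>"
      then have "(\<nu> \<bullet> c') * (\<mu> \<bullet> c' - \<mu> \<bullet> x) = (\<mu> \<bullet> c') * (\<nu> \<bullet> c' - \<nu> \<bullet> x)"
        using pos[of \<nu>] pos[of \<mu>] \<mu> \<nu>(1) True by (simp add: s_def frac_eq_eq)
      then have "((\<mu> \<bullet> x) *\<^sub>R \<nu> - (\<nu> \<bullet> x) *\<^sub>R \<mu>) \<bullet> c' = 0" by (simp add: inner_diff_left algebra_simps)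
      moreover have "(\<mu> \<bullet> x) *\<^sub>R \<nu> - (\<nu> \<bullet> x) *\<^sub>R \<mu> \<in> A" using \<mu> \<nu>(1) True by (auto simp: A_def)
      ultimately show False using \<epsilon>(3) by (simp add: c'_def)
    qed
    then have "s \<nu> < s \<mu>" using \<nu>(2)[of \<mu>] True \<mu> by simp
    then have "s \<nu> * (\<mu> \<bullet> c' - \<mu> \<bullet> x) < s \<mu> * (\<mu> \<bullet> c' - \<mu> \<bullet> x)"
      using pos[OF \<mu>(1)] True by (intro mult_strict_right_mono) auto
    also have "\<dots> = \<mu> \<bullet> c'" using pos[OF \<mu>(1)] True by (simp add: s_def)
    finally show ?thesis by (simp add: z'\<mu>)
  next
    case False
    have "s \<nu> * (\<mu> \<bullet> c' - \<mu> \<bullet> x) \<le> s \<nu> * (\<mu> \<bullet> c')" using False s01[OF \<nu>(1)] by (intro mult_left_mono) auto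
    also have "\<dots> < \<mu> \<bullet> c'" using pos[OF \<mu>(1)] s01[OF \<nu>(1)] by simp
    finally show ?thesis by (simp add: z'\<mu>)
  qed
  show thesis
  proof (rule that[of \<nu> "radial g z'"])
    show "radial g z' \<in> space_form g" using radial_in_space_form[OF z'c] .
  qed (use \<nu>(1) zero other inner_radial_sign[OF z'c] in auto)
qed

text \<open>
  Local finiteness is imposed on compact sets. The covectors of a wall system may carry one sign only, as the
  inner normals of a polyhedral domain do; for the roots of a reflection group both signs are present.
\<close>

locale wall_system =
  fixes g :: geometry and R :: "('a::euclidean_space \<times> real) set"
  assumes unit: "\<nu> \<in> R \<Longrightarrow> conormal_form g \<nu> \<nu> = 1"
    and locally_finite: "K \<subseteq> space_form g \<Longrightarrow> compact K \<Longrightarrow> finite {\<nu>\<in>R. \<exists>p\<in>K. \<nu> \<bullet> p = 0}"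
begin

lemma conormal_root: "\<nu> \<in> R \<Longrightarrow> conormal g \<nu>"
  by (simp add: conormal_def unit)

lemma root_nonzero: "\<nu> \<in> R \<Longrightarrow> \<nu> \<noteq> 0"
  using unit[of \<nu>] by (auto simp: conormal_form_simps)

lemma sign_change_on_connected:
  fixes \<nu> :: "'a \<times> real"
  assumes "connected K" "c \<in> K" "x \<in> K" "0 \<le> \<nu> \<bullet> c" "\<nu> \<bullet> x \<le> 0" shows "\<exists>p\<in>K. \<nu> \<bullet> p = 0"
  using connected_ivt_hyperplane[OF assms(1,3,2), of \<nu> 0] assms(4,5) by simp

lemma finite_separating_roots:
  assumes "c \<in> space_form g" "x \<in> space_form g" shows "finite {\<nu>\<in>R. 0 \<le> \<nu> \<bullet> c \<and> \<nu> \<bullet> x \<le> 0}"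
proof -
  obtain K where K: "K \<subseteq> space_form g" "compact K" "connected K" "c \<in> K" "x \<in> K"
    using connected_compact_through[OF assms] by blast
  have "{\<nu>\<in>R. 0 \<le> \<nu> \<bullet> c \<and> \<nu> \<bullet> x \<le> 0} \<subseteq> {\<nu>\<in>R. \<exists>p\<in>K. \<nu> \<bullet> p = 0}"
    using sign_change_on_connected[OF K(3-5)] by blast
  then show ?thesis using locally_finite[OF K(1,2)] finite_subset by blast
qed

text \<open>
  Infinitely many covectors may be positive at \<open>x\<close>, but only finitely many change sign on a connected compact neighbourhood.
\<close>

lemma sign_stable:
  assumes x: "x \<in> space_form g"
  obtains e where "0 < e" "\<And>\<nu> p. \<nu> \<in> R \<Longrightarrow> 0 < \<nu> \<bullet> x \<Longrightarrow> p \<in> space_form g \<Longrightarrow> p \<in> ball x e \<Longrightarrow> 0 < \<nu> \<bullet> p"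
proof -
  obtain K e where K: "K \<subseteq> space_form g" "compact K" "connected K" "0 < e" "space_form g \<inter> ball x e \<subseteq> K"
    using connected_compact_neighbourhood[OF x] by blast
  let ?F = "{\<nu>\<in>R. (\<exists>p\<in>K. \<nu> \<bullet> p = 0) \<and> 0 < \<nu> \<bullet> x}"
  have finF: "finite ?F" using locally_finite[OF K(1,2)] by (rule rev_finite_subset) auto
  have "open (\<Inter>\<nu>\<in>?F. {p. 0 < \<nu> \<bullet> p})"
    by (intro open_INT finF ballI open_Collect_less continuous_intros)
  then obtain e' where e': "0 < e'" "ball x e' \<subseteq> (\<Inter>\<nu>\<in>?F. {p. 0 < \<nu> \<bullet> p})"
    using openE[of _ x] by (metis (no_types, lifting) INT_I mem_Collect_eq)
  show thesis
  proof (rule that[of "min e e'"])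
    show "0 < min e e'" using K(4) e'(1) by simp
    fix \<nu> p assume \<nu>: "\<nu> \<in> R" "0 < \<nu> \<bullet> x" and p: "p \<in> space_form g" "p \<in> ball x (min e e')"
    show "0 < \<nu> \<bullet> p"
    proof (cases "\<exists>p\<in>K. \<nu> \<bullet> p = 0")
      case True
      have "p \<in> ball x e'" using p(2) by simp
      then have "p \<in> (\<Inter>\<nu>\<in>?F. {p. 0 < \<nu> \<bullet> p})" using e'(2) by blast
      then show ?thesis using True \<nu> by blast
    next
      case False
      then show ?thesis
        using sign_change_on_connected[OF K(3), of x p \<nu>] K(4,5) x p \<nu>(2) by (force simp: not_less)
    qed
  qed
qed

end

locale wall_domain = wall_system g R for g and R :: "('a::euclidean_space \<times> real) set" +
  fixes c :: "'a \<times> real"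
  assumes c_space: "c \<in> space_form g" and c_regular: "\<nu> \<in> R \<Longrightarrow> \<nu> \<bullet> c \<noteq> 0"
begin

definition Pos where "Pos = {\<nu>\<in>R. 0 < \<nu> \<bullet> c}"

definition Ch where "Ch = {p\<in>space_form g. \<forall>\<nu>\<in>Pos. 0 \<le> \<nu> \<bullet> p}"

definition Ch_int where "Ch_int = {p\<in>space_form g. \<forall>\<nu>\<in>Pos. 0 < \<nu> \<bullet> p}"

text \<open>
  The mirrors of simple roots are the walls: the point \<open>z\<close> lies in the relative interior of a facet of the chamber.
\<close>

definition simple where
  "simple \<nu> \<longleftrightarrow> \<nu> \<in> Pos \<and> (\<exists>z\<in>space_form g. \<nu> \<bullet> z = 0 \<and> (\<forall>\<mu>\<in>Pos. \<mu> \<noteq> \<nu> \<longrightarrow> 0 < \<mu> \<bullet> z))"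

lemma PosD: "\<nu> \<in> Pos \<Longrightarrow> \<nu> \<in> R" "\<nu> \<in> Pos \<Longrightarrow> 0 < \<nu> \<bullet> c" by (auto simp: Pos_def)

lemma simpleD: "simple \<nu> \<Longrightarrow> \<nu> \<in> Pos" "simple \<nu> \<Longrightarrow> \<nu> \<in> R" by (auto simp: simple_def Pos_def)

lemma ChD: "p \<in> Ch \<Longrightarrow> p \<in> space_form g" "p \<in> Ch \<Longrightarrow> \<nu> \<in> Pos \<Longrightarrow> 0 \<le> \<nu> \<bullet> p" by (auto simp: Ch_def)

lemma Ch_int_subset: "Ch_int \<subseteq> Ch" by (auto simp: Ch_def Ch_int_def intro: less_imp_le)

lemma c_in_Ch_int: "c \<in> Ch_int" by (simp add: Ch_int_def c_space Pos_def)

lemma Ch_int_ball: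
  assumes "p \<in> Ch_int" obtains e where "0 < e" "space_form g \<inter> ball p e \<subseteq> Ch_int"
proof -
  have p: "p \<in> space_form g" using assms by (simp add: Ch_int_def)
  obtain e where e: "0 < e" "\<And>\<nu> q. \<nu> \<in> R \<Longrightarrow> 0 < \<nu> \<bullet> p \<Longrightarrow> q \<in> space_form g \<Longrightarrow> q \<in> ball p e \<Longrightarrow> 0 < \<nu> \<bullet> q"
    using sign_stable[OF p] by blast
  have "space_form g \<inter> ball p e \<subseteq> Ch_int"
    unfolding Ch_int_def using e(2) assms PosD(1) by (simp add: Ch_int_def subset_iff)
  then show thesis using that[OF e(1)] by blast
qed

lemma openin_Ch_int: "openin (top_of_set (space_form g)) Ch_int"
  unfolding openin_contains_ball
proof (intro conjI ballI)
  show "Ch_int \<subseteq> space_form g" by (simp add: Ch_int_def)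
  fix p assume "p \<in> Ch_int"
  then show "\<exists>e>0. ball p e \<inter> space_form g \<subseteq> Ch_int" using Ch_int_ball by (metis Int_commute)
qed

lemma interior_of_Ch: "top_of_set (space_form g) interior_of Ch = Ch_int"
proof
  show "Ch_int \<subseteq> top_of_set (space_form g) interior_of Ch"
    using interior_of_maximal[OF Ch_int_subset openin_Ch_int] .
  show "top_of_set (space_form g) interior_of Ch \<subseteq> Ch_int"
  proof
    fix p assume "p \<in> top_of_set (space_form g) interior_of Ch"
    then obtain U where U: "open U" "p \<in> U" "space_form g \<inter> U \<subseteq> Ch" "p \<in> space_form g"
      by (auto simp: interior_of_def openin_open)
    have "0 < \<nu> \<bullet> p" if "\<nu> \<in> Pos" for \<nu>
      using U that root_nonzero[OF PosD(1)[OF that]] ChD(2)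
      by (intro nonneg_near_imp_pos[OF U(4,1,2)]) blast+
    then show "p \<in> Ch_int" using U by (simp add: Ch_int_def)
  qed
qed

text \<open>
  This makes the simple roots sufficient to define the chamber, although there may be infinitely many of them.
\<close>

lemma simple_separates:
  assumes x: "x \<in> space_form g" "x \<notin> Ch" shows "\<exists>\<nu>. simple \<nu> \<and> \<nu> \<bullet> x < 0"
proof -
  obtain \<nu>0 where \<nu>0: "\<nu>0 \<in> Pos" "\<nu>0 \<bullet> x < 0" using x by (force simp: Ch_def)
  obtain e where e: "0 < e" "space_form g \<inter> ball c e \<subseteq> Ch_int" using Ch_int_ball[OF c_in_Ch_int] by blast
  have fin: "finite {\<nu>\<in>Pos. \<nu> \<bullet> x < 0}"
    using finite_separating_roots[OF c_space x(1)] by (rule rev_finite_subset) (auto simp: Pos_def)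
  have nn: "0 \<le> \<nu> \<bullet> p" if "p \<in> ball c e \<inter> space_form g" "\<nu> \<in> Pos" for p \<nu>
    using e(2) that by (force simp: Ch_int_def)
  have "c \<in> ball c e" using e by simp
  from separating_wall[OF unit[OF PosD(1)] c_space open_ball this nn x(1) \<nu>0 fin]
  obtain \<nu> z where "\<nu> \<in> Pos" "\<nu> \<bullet> x < 0" "z \<in> space_form g" "\<nu> \<bullet> z = 0" "\<And>\<mu>. \<mu> \<in> Pos \<Longrightarrow> \<mu> \<noteq> \<nu> \<Longrightarrow> 0 < \<mu> \<bullet> z"
    by metis
  then show ?thesis unfolding simple_def by blast
qed

lemma Ch_eq_simple: "Ch = {p\<in>space_form g. \<forall>\<nu>. simple \<nu> \<longrightarrow> 0 \<le> \<nu> \<bullet> p}"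
  using simple_separates ChD simpleD(1) by (fastforce simp: not_less[symmetric])

lemma simple_facet_normal:
  assumes "simple \<nu>" shows "facet_normal g Ch \<nu>"
proof -
  obtain z where z: "z \<in> space_form g" "\<nu> \<bullet> z = 0" "\<forall>\<mu>\<in>Pos. \<mu> \<noteq> \<nu> \<longrightarrow> 0 < \<mu> \<bullet> z"
    using assms unfolding simple_def by blast
  obtain e where e: "0 < e" "\<And>\<nu> p. \<nu> \<in> R \<Longrightarrow> 0 < \<nu> \<bullet> z \<Longrightarrow> p \<in> space_form g \<Longrightarrow> p \<in> ball z e \<Longrightarrow> 0 < \<nu> \<bullet> p"
    using sign_stable[OF z(1)] by blast
  have "hyperplane_of g \<nu> \<inter> ball z e \<subseteq> Ch"
  proof
    fix p assume p: "p \<in> hyperplane_of g \<nu> \<inter> ball z e"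
    have "0 \<le> \<mu> \<bullet> p" if "\<mu> \<in> Pos" for \<mu>
      using e(2)[of \<mu> p] z(3) p that PosD(1) by (cases "\<mu> = \<nu>") (auto simp: hyperplane_of_def less_imp_le)
    then show "p \<in> Ch" using p by (auto simp: Ch_def hyperplane_of_def)
  qed
  moreover have "openin (top_of_set (hyperplane_of g \<nu>)) (hyperplane_of g \<nu> \<inter> ball z e)"
    by (simp add: openin_open_Int)
  moreover have "z \<in> hyperplane_of g \<nu> \<inter> ball z e" using z e by (simp add: hyperplane_of_def)
  ultimately have "z \<in> top_of_set (hyperplane_of g \<nu>) interior_of Ch"
    using interior_of_maximal by blast
  moreover have "Ch \<subseteq> half_space g \<nu>" using simpleD(1)[OF assms] by (auto simp: Ch_def half_space_def)
  ultimately show ?thesis using conormal_root simpleD(2)[OF assms] by (auto simp: facet_normal_def)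
qed

lemma facet_interior_point:
  assumes "facet_normal g Ch \<nu>" "z \<in> space_form g" "\<nu> \<bullet> z = 0" "open U" "z \<in> U" "hyperplane_of g \<nu> \<inter> U \<subseteq> Ch"
  defines "\<nu>' \<equiv> (1 / sqrt (conormal_form g \<nu> \<nu>)) *\<^sub>R \<nu>"
  shows "\<nu>' \<in> Pos" "\<forall>\<mu>\<in>Pos. \<mu> \<noteq> \<nu>' \<longrightarrow> 0 < \<mu> \<bullet> z"
proof -
  let ?G = "conormal_form g \<nu> \<nu>"
  have con: "0 < ?G" and half: "Ch \<subseteq> half_space g \<nu>" using assms(1) by (auto simp: facet_normal_def conormal_def)
  have \<nu>0: "\<nu> \<noteq> 0" using con by (auto simp: conormal_form_simps)
  have u: "conormal_form g \<nu>' \<nu>' = 1" using con by (simp add: \<nu>'_def conormal_form_simps)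
  have near: "0 < \<nu> \<bullet> p" if "p \<in> Ch_int" for p
  proof -
    obtain e where e: "0 < e" "space_form g \<inter> ball p e \<subseteq> Ch_int" using Ch_int_ball[OF \<open>p \<in> Ch_int\<close>] by blast
    have "0 \<le> \<nu> \<bullet> q" if "q \<in> ball p e \<inter> space_form g" for q
    proof -
      have "q \<in> half_space g \<nu>" using e(2) half Ch_int_subset that by blast
      then show ?thesis by (simp add: half_space_def)
    qed
    then show ?thesis using that e(1) \<nu>0
      by (intro nonneg_near_imp_pos[of p g "ball p e"]) (simp_all add: Ch_int_def)
  qed
  have mult: "\<mu> = \<nu>'" if \<mu>: "\<mu> \<in> Pos" "\<mu> \<bullet> z = 0" for \<mu>
  proof -
    have "0 \<le> \<mu> \<bullet> p" if "p \<in> U" "p \<in> space_form g" "\<nu> \<bullet> p = 0" for p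
    proof -
      have "p \<in> Ch" using assms(6) that by (auto simp: hyperplane_of_def)
      then show ?thesis using ChD(2) \<mu>(1) by blast
    qed
    then obtain r where r: "\<mu> = r *\<^sub>R \<nu>"
      using nonneg_near_on_hyperplane_imp_multiple[OF assms(2,4,5,3) \<mu>(2)] by blast
    have "\<mu> = (r * sqrt ?G) *\<^sub>R \<nu>'" using con r by (simp add: \<nu>'_def)
    then have "\<mu> = \<nu>' \<or> \<mu> = - \<nu>'" using unit_covector_multiple[OF unit[OF PosD(1)[OF \<mu>(1)]] u] by blast
    moreover have "0 < \<nu>' \<bullet> c" using near[OF c_in_Ch_int] con by (simp add: \<nu>'_def)
    ultimately show ?thesis using PosD(2)[OF \<mu>(1)] by auto
  qed
  have zC: "z \<in> Ch" using assms(2,3,5,6) by (auto simp: hyperplane_of_def)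
  have "z \<notin> Ch_int" using near[of z] assms(3) by auto
  then obtain \<mu> where \<mu>: "\<mu> \<in> Pos" "\<not> 0 < \<mu> \<bullet> z" using ChD(1)[OF zC] unfolding Ch_int_def by blast
  moreover have "\<mu> \<bullet> z = 0" using \<mu> ChD(2)[OF zC \<mu>(1)] by simp
  ultimately show "\<nu>' \<in> Pos" using mult by blast
  show "\<forall>\<mu>\<in>Pos. \<mu> \<noteq> \<nu>' \<longrightarrow> 0 < \<mu> \<bullet> z" using mult ChD(2)[OF zC] by (metis less_eq_real_def)
qed

text \<open>
  Together with \<open>simple_facet_normal\<close>: the facets in the sense of \<open>facet_normal\<close> are those on the mirrors of simple roots, up to scaling
  of the normals.
\<close>

lemma facet_normal_simple:
  assumes "facet_normal g Ch \<nu>"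
  shows "simple ((1 / sqrt (conormal_form g \<nu> \<nu>)) *\<^sub>R \<nu>)"
proof -
  obtain z where "z \<in> top_of_set (hyperplane_of g \<nu>) interior_of Ch" using assms by (auto simp: facet_normal_def)
  then obtain U where U: "open U" "z \<in> U" "hyperplane_of g \<nu> \<inter> U \<subseteq> Ch" "z \<in> hyperplane_of g \<nu>"
    by (auto simp: interior_of_def openin_open)
  then have z: "z \<in> space_form g" "\<nu> \<bullet> z = 0" by (auto simp: hyperplane_of_def)
  show ?thesis unfolding simple_def
    using facet_interior_point[OF assms z U(1-3)] z by auto
qed

end

locale root_system = wall_system +
  assumes closed_reflection: "\<nu> \<in> R \<Longrightarrow> \<mu> \<in> R \<Longrightarrow> root_reflection g \<nu> \<mu> \<in> R"
begin

lemma neg_root: "\<nu> \<in> R \<Longrightarrow> - \<nu> \<in> R"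
  using closed_reflection[of \<nu> \<nu>] root_reflection_self[OF unit[of \<nu>]] by simp

end

locale chamber = wall_domain g R c + root_system g R
  for g and R :: "('a::euclidean_space \<times> real) set" and c
begin

lemma Pos_or_neg: "\<nu> \<in> R \<Longrightarrow> \<nu> \<in> Pos \<or> - \<nu> \<in> Pos"
  using c_regular[of \<nu>] neg_root[of \<nu>] by (auto simp: Pos_def)

primrec word_map where
  "word_map [] = id"
| "word_map (a # ws) = reflection g a \<circ> word_map ws"

definition W where "W = word_map ` {ws. set ws \<subseteq> Collect simple}"

text \<open>
  A simple reflection permutes the positive roots other than the simple root: at a point in the
  relative interior of the facet all of them are positive, and the reflection fixes this point.
\<close>

lemma simple_reflection_positive:
  assumes a: "simple a" and \<mu>: "\<mu> \<in> Pos" "\<mu> \<noteq> a"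
  shows "root_reflection g a \<mu> \<in> Pos" "root_reflection g a \<mu> \<noteq> a"
proof -
  have aR: "a \<in> R" using a simpleD by blast
  obtain z where z: "z \<in> space_form g" "a \<bullet> z = 0" "\<forall>\<mu>\<in>Pos. \<mu> \<noteq> a \<longrightarrow> 0 < \<mu> \<bullet> z"
    using a unfolding simple_def by blast
  let ?\<mu> = "root_reflection g a \<mu>"
  have R: "?\<mu> \<in> R" using closed_reflection[OF aR PosD(1)[OF \<mu>(1)]] .
  have "reflection g a z = z" using z(2) by (simp add: reflection_eq)
  then have pos: "0 < ?\<mu> \<bullet> z" using z(3) \<mu> inner_reflection[OF unit[OF aR], of \<mu> z] by metis
  have "- ?\<mu> \<notin> Pos"
  proof
    assume "- ?\<mu> \<in> Pos"
    then have "0 \<le> - ?\<mu> \<bullet> z" using z(2,3) by (metis less_eq_real_def)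
    then show False using pos by simp
  qed
  then show "?\<mu> \<in> Pos" using Pos_or_neg[OF R] by blast
  show "?\<mu> \<noteq> a" using pos z(2) by auto
qed

subsection \<open>The group generated by the simple reflections\<close>

lemma id_W: "id \<in> W" unfolding W_def by (rule image_eqI[of _ _ "[]"]) auto

lemma simple_W: "simple a \<Longrightarrow> w \<in> W \<Longrightarrow> reflection g a \<circ> w \<in> W"
  unfolding W_def by (auto intro!: image_eqI[of _ _ "a # _"])

lemma W_induct [consumes 1, case_names id refl]:
  assumes "w \<in> W" "P id" "\<And>a w. simple a \<Longrightarrow> w \<in> W \<Longrightarrow> P w \<Longrightarrow> P (reflection g a \<circ> w)"
  shows "P w"
proof -
  have "set ws \<subseteq> Collect simple \<Longrightarrow> P (word_map ws)" for ws
    by (induction ws) (use assms(2,3) in \<open>auto simp: W_def\<close>)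
  then show ?thesis using assms(1) by (auto simp: W_def)
qed

lemma simple_refl_W: "simple a \<Longrightarrow> reflection g a \<in> W"
  using simple_W[OF _ id_W] by simp

lemma comp_W: "w \<in> W \<Longrightarrow> w' \<in> W \<Longrightarrow> w \<circ> w' \<in> W"
  by (induction rule: W_induct) (auto simp: comp_assoc intro: simple_W)

lemma motion_W: "w \<in> W \<Longrightarrow> motion g w"
proof (induction rule: W_induct)
  case (refl a w)
  then show ?case by (intro motion_comp motion_reflection) (simp_all add: conormal_root simpleD)
qed (rule motion_id)

lemma linear_W: "w \<in> W \<Longrightarrow> linear w" using motion_W motion_linear by blast

lemma inverse_W: "w \<in> W \<Longrightarrow> \<exists>w'\<in>W. w' \<circ> w = id \<and> w \<circ> w' = id"
proof (induction rule: W_induct)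
  case (refl a w)
  then obtain w' where w': "w' \<in> W" "w' \<circ> w = id" "w \<circ> w' = id" by blast
  have aa: "reflection g a \<circ> reflection g a = id" using refl(1) simpleD unit by simp
  have "(w' \<circ> reflection g a) \<circ> (reflection g a \<circ> w) = w' \<circ> (reflection g a \<circ> reflection g a) \<circ> w"
       "(reflection g a \<circ> w) \<circ> (w' \<circ> reflection g a) = reflection g a \<circ> (w \<circ> w') \<circ> reflection g a"
    by (simp_all add: comp_assoc)
  then show ?case using w' aa comp_W[OF w'(1) simple_refl_W[OF refl(1)]]
    by (intro bexI[of _ "w' \<circ> reflection g a"]) (simp_all only: comp_id id_comp)
qed (intro bexI[of _ id] conjI id_W; simp only: comp_id)

lemma W_space_form: "w \<in> W \<Longrightarrow> p \<in> space_form g \<Longrightarrow> w p \<in> space_form g"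
  using motion_W motion_space_form by blast

lemma inner_W: "w \<in> W \<Longrightarrow> \<nu> \<bullet> w p = adjoint w \<nu> \<bullet> p"
  using inner_linear linear_W by blast

lemma adjoint_comp_W: "w \<in> W \<Longrightarrow> w' \<in> W \<Longrightarrow> adjoint (w \<circ> w') \<nu> = adjoint w' (adjoint w \<nu>)"
  using adjoint_comp linear_W by blast

lemma adjoint_simple: "simple a \<Longrightarrow> adjoint (reflection g a) = root_reflection g a"
  using adjoint_reflection unit simpleD by blast

lemma adjoint_W_root: "w \<in> W \<Longrightarrow> \<nu> \<in> R \<Longrightarrow> adjoint w \<nu> \<in> R"
  by (induction arbitrary: \<nu> rule: W_induct)
     (auto simp: adjoint_comp_W simple_refl_W adjoint_simple closed_reflection simpleD adjoint_id)

lemma W_c_regular: "w \<in> W \<Longrightarrow> \<nu> \<in> R \<Longrightarrow> \<nu> \<bullet> w c \<noteq> 0"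
  using inner_W adjoint_W_root c_regular by simp

lemma word_W: "set ws \<subseteq> Collect simple \<Longrightarrow> word_map ws \<in> W"
  by (auto simp: W_def)

text \<open>
  The exchange condition. Carry \<open>\<nu>\<close> along the word: it stays positive until it meets the letter equal to it, since a simple
  reflection makes no other positive root negative; this letter is the one deleted.
\<close>

lemma exchange:
  assumes "set ws \<subseteq> Collect simple" "\<nu> \<in> Pos" "\<nu> \<bullet> word_map ws c < 0"
  shows "\<exists>ws'. set ws' \<subseteq> Collect simple \<and> length ws = Suc (length ws') \<and> reflection g \<nu> \<circ> word_map ws = word_map ws'"
  using assms
proof (induction ws arbitrary: \<nu>)
  case Nil
  then show ?case by (simp add: Pos_def)
next
  case (Cons a ws)
  have a: "simple a" "a \<in> R" "conormal_form g a a = 1" using Cons.prems unit by (auto simp: simpleD)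
  have \<nu>: "conormal_form g \<nu> \<nu> = 1" using Cons.prems PosD unit by blast
  show ?case
  proof (cases "\<nu> = a")
    case True
    then have "reflection g \<nu> \<circ> word_map (a # ws) = word_map ws"
      using a(3) by (simp add: comp_assoc[symmetric])
    moreover have "set ws \<subseteq> Collect simple" using Cons.prems(1) by simp
    ultimately show ?thesis by (intro exI[of _ ws] conjI) (simp_all only: list.size add_0_right add_Suc_right)
  next
    case False
    let ?\<nu> = "root_reflection g a \<nu>"
    have "?\<nu> \<in> Pos" using simple_reflection_positive(1)[OF a(1) Cons.prems(2) False] .
    moreover have "?\<nu> \<bullet> word_map ws c < 0" using Cons.prems(3) inner_reflection[OF a(3), of \<nu>] by simp
    ultimately obtain ws' where ws': "set ws' \<subseteq> Collect simple" "length ws = Suc (length ws')"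
       "reflection g ?\<nu> \<circ> word_map ws = word_map ws'"
      using Cons.IH[of ?\<nu>] Cons.prems(1) by (metis insert_subset list.simps(15))
    have "reflection g a \<circ> reflection g ?\<nu> = (reflection g a \<circ> reflection g a) \<circ> reflection g \<nu> \<circ> reflection g a"
      unfolding reflection_conjugate[OF a(3) \<nu>, symmetric] by (simp add: comp_assoc)
    then have "reflection g \<nu> \<circ> reflection g a = reflection g a \<circ> reflection g ?\<nu>" using a(3) by simp
    then have "reflection g \<nu> \<circ> word_map (a # ws) = word_map (a # ws')"
      using ws'(3) by (metis comp_assoc word_map.simps(2))
    moreover have "set (a # ws') \<subseteq> Collect simple" using ws' a(1) by simp
    ultimately show ?thesis using ws'(2)
      by (intro exI[of _ "a # ws'"] conjI) (simp_all only: list.size add_0_right add_Suc_right)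
  qed
qed

text \<open>
  If the first mirror of a word does not separate the base point from its image, the word can be
  shortened without changing the map.
\<close>

lemma shorten_word:
  assumes "set (a # ws) \<subseteq> Collect simple" "0 < a \<bullet> word_map (a # ws) c"
  shows "\<exists>ws'. set ws' \<subseteq> Collect simple \<and> length ws' < length (a # ws) \<and> word_map ws' = word_map (a # ws)"
proof -
  have a: "simple a" "conormal g a" using assms(1) by (auto simp: simpleD conormal_root)
  have "a \<bullet> word_map ws c < 0" using assms(2) inner_reflection_self[OF a(2)] by simp
  then obtain ws' where "set ws' \<subseteq> Collect simple" "length ws = Suc (length ws')"
      "reflection g a \<circ> word_map ws = word_map ws'"
    using exchange[of ws a] assms(1) simpleD(1)[OF a(1)] by auto
  then show ?thesis by (intro exI[of _ ws']) auto
qed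

lemma word_nonpos:
  assumes ws: "set ws \<subseteq> Collect simple" and a: "a \<in> R" "a \<bullet> word_map ws c < 0" and x: "x \<in> Ch"
  shows "a \<bullet> word_map ws x \<le> 0"
proof -
  let ?a = "adjoint (word_map ws) a"
  have "?a \<in> R" "?a \<bullet> c < 0" using adjoint_W_root[OF word_W[OF ws] a(1)] a(2) inner_W[OF word_W[OF ws]] by auto
  then have "- ?a \<in> Pos" using neg_root by (simp add: Pos_def)
  then have "0 \<le> - ?a \<bullet> x" using ChD(2)[OF x] by blast
  then show ?thesis using inner_W[OF word_W[OF ws], of a x] by simp
qed

text \<open>
  Take a shortest word. Its first mirror separates the chamber from its image, so a point common to both lies on
  this mirror, and the first letter may be dropped without changing the image of the point.
\<close>

lemma word_fixes:
  assumes "set ws \<subseteq> Collect simple" "x \<in> Ch" "word_map ws x \<in> Ch"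
  shows "word_map ws x = x"
  using assms
proof (induction "length ws" arbitrary: ws rule: less_induct)
  case less
  show ?case
  proof (cases ws)
    case (Cons a ws1)
    have a: "simple a" "conormal g a" "a \<in> R" using less.prems(1) Cons by (auto simp: simpleD conormal_root)
    show ?thesis
    proof (cases "0 < a \<bullet> word_map ws c")
      case True
      then show ?thesis using shorten_word[of a ws1] less Cons by metis
    next
      case False
      then have "a \<bullet> word_map ws c < 0" using W_c_regular[OF word_W[OF less.prems(1)] a(3)] by linarith
      then have "a \<bullet> word_map ws x \<le> 0" using word_nonpos less.prems a(3) by blast
      moreover have "0 \<le> a \<bullet> word_map ws x" using ChD(2)[OF less.prems(3) simpleD(1)[OF a(1)]] .
      ultimately have 0: "a \<bullet> word_map ws x = 0" by simp
      have "reflection g a (word_map ws x) = word_map ws1 x"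
        using Cons a(2) by (simp add: reflection_involution conormal_def)
      then have eq: "word_map ws1 x = word_map ws x" using 0 by (simp add: reflection_eq)
      then show ?thesis using less.hyps[of ws1] less.prems Cons by simp
    qed
  qed simp
qed

lemma W_fundamental: "w \<in> W \<Longrightarrow> x \<in> Ch \<Longrightarrow> w x \<in> Ch \<Longrightarrow> w x = x"
  using word_fixes unfolding W_def by blast

lemma word_trivial:
  assumes "set ws \<subseteq> Collect simple" "word_map ws c \<in> Ch"
  shows "word_map ws = id"
  using assms
proof (induction "length ws" arbitrary: ws rule: less_induct)
  case less
  show ?case
  proof (cases ws)
    case (Cons a ws1)
    have a: "simple a" "a \<in> R" using less.prems(1) Cons by (auto simp: simpleD)
    have "0 \<le> a \<bullet> word_map ws c" using ChD(2)[OF less.prems(2) simpleD(1)[OF a(1)]] .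
    then have "0 < a \<bullet> word_map ws c" using W_c_regular[OF word_W[OF less.prems(1)] a(2)] by linarith
    then show ?thesis using shorten_word[of a ws1] less Cons by metis
  qed simp
qed

text \<open>
  A positive root stays positive at \<open>w c\<close> because its sign can be read off at the fixed point \<open>x\<close>, where no root vanishes. Hence
  \<open>w c\<close> lies in the chamber and a shortest word for \<open>w\<close> is empty.
\<close>

lemma W_simply_transitive:
  assumes w: "w \<in> W" and x: "x \<in> Ch_int" "w x \<in> Ch" shows "w = id"
proof -
  have wx: "w x = x" using W_fundamental[OF w _ x(2)] x(1) Ch_int_subset by blast
  have "0 \<le> \<nu> \<bullet> w c" if \<nu>: "\<nu> \<in> Pos" for \<nu>
  proof -
    let ?\<nu> = "adjoint w \<nu>"
    have "0 < \<nu> \<bullet> x" using \<nu> x(1) by (simp add: Ch_int_def)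
    then have "0 < ?\<nu> \<bullet> x" using inner_W[OF w, of \<nu> x] wx by metis
    moreover have "0 < - ?\<nu> \<bullet> x" if "- ?\<nu> \<in> Pos" using x(1) that unfolding Ch_int_def by blast
    ultimately have "- ?\<nu> \<notin> Pos" by auto
    then have "?\<nu> \<in> Pos" using Pos_or_neg[OF adjoint_W_root[OF w PosD(1)[OF \<nu>]]] by blast
    then show ?thesis using inner_W[OF w, of \<nu> c] PosD(2) by fastforce
  qed
  then have "w c \<in> Ch" using W_space_form[OF w c_space] by (simp add: Ch_def)
  then show ?thesis using word_trivial w by (auto simp: W_def)
qed

text \<open>
  Every point is brought into the chamber by reflecting in simple mirrors that separate it from the
  chamber; the number of separating positive roots drops. The predicate \<open>H\<close> records a property
  kept along the way, \<open>B\<close> the simple roots actually used.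
\<close>

lemma descend:
  assumes "x \<in> space_form g" "H x"
    and step: "\<And>x a. x \<in> space_form g \<Longrightarrow> H x \<Longrightarrow> simple a \<Longrightarrow> a \<bullet> x < 0 \<Longrightarrow> a \<in> B \<and> H (reflection g a x)"
  shows "\<exists>ws. set ws \<subseteq> B \<inter> Collect simple \<and> word_map ws x \<in> Ch \<and> H (word_map ws x)"
  using assms(1,2)
proof (induction "card {\<nu>\<in>Pos. \<nu> \<bullet> x < 0}" arbitrary: x rule: less_induct)
  case less
  show ?case
  proof (cases "x \<in> Ch")
    case True
    then show ?thesis using less.prems by (intro exI[of _ "[]"]) auto
  next
    case False
    then obtain a where a: "simple a" "a \<bullet> x < 0" using simple_separates less.prems by blast
    have u: "conormal_form g a a = 1" "conormal g a" using a simpleD unit conormal_root by auto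
    let ?x = "reflection g a x"
    have x: "?x \<in> space_form g" using reflection_space_form[OF u(2)] less.prems by blast
    let ?f = "root_reflection g a"
    have fin: "finite {\<nu>\<in>Pos. \<nu> \<bullet> x < 0}"
      using finite_separating_roots[OF c_space less.prems(1)] by (rule rev_finite_subset) (auto simp: Pos_def)
    have "?f ` {\<nu>\<in>Pos. \<nu> \<bullet> ?x < 0} \<subseteq> {\<nu>\<in>Pos. \<nu> \<bullet> x < 0} - {a}"
    proof
      fix \<mu> assume "\<mu> \<in> ?f ` {\<nu>\<in>Pos. \<nu> \<bullet> ?x < 0}"
      then obtain \<nu> where \<nu>: "\<mu> = ?f \<nu>" "\<nu> \<in> Pos" "\<nu> \<bullet> ?x < 0" by blast
      have "\<nu> \<noteq> a" using \<nu>(3) a(2) inner_reflection_self[OF u(2), of x] by auto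
      then show "\<mu> \<in> {\<nu>\<in>Pos. \<nu> \<bullet> x < 0} - {a}"
        using simple_reflection_positive[OF a(1) \<nu>(2)] \<nu> inner_reflection[OF u(1), of \<nu> x] by simp
    qed
    moreover have "inj_on ?f {\<nu>\<in>Pos. \<nu> \<bullet> ?x < 0}"
      by (rule inj_on_inverseI[of _ ?f]) (rule root_reflection_involution[OF u(1)])
    ultimately have "card {\<nu>\<in>Pos. \<nu> \<bullet> ?x < 0} \<le> card ({\<nu>\<in>Pos. \<nu> \<bullet> x < 0} - {a})"
      using fin by (intro card_inj_on_le) auto
    also have "\<dots> < card {\<nu>\<in>Pos. \<nu> \<bullet> x < 0}"
      using a simpleD(1) by (intro card_Diff1_less fin) auto
    finally obtain ws where ws: "set ws \<subseteq> B \<inter> Collect simple" "word_map ws ?x \<in> Ch" "H (word_map ws ?x)"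
      using less.hyps[OF _ x] step[OF less.prems a] by blast
    have "word_map (ws @ [a]) = word_map ws \<circ> reflection g a" for ws
      by (induction ws) (simp_all add: comp_assoc)
    then show ?thesis using ws a(1) step[OF less.prems a] by (intro exI[of _ "ws @ [a]"]) auto
  qed
qed

lemma W_moves_into_Ch: "x \<in> space_form g \<Longrightarrow> \<exists>w\<in>W. w x \<in> Ch"
  using descend[of x "\<lambda>_. True" UNIV] word_W by auto

subsection \<open>Facets and the tiling\<close>

text \<open>
  This identifies the reflected copies of the chamber with its translates under \<open>W\<close>, and the tiling property becomes
  simple transitivity.
\<close>

lemma facet_group_Ch: "facet_group g Ch = W"
proof
  show "facet_group g Ch \<subseteq> W"
  proof
    fix w assume "w \<in> facet_group g Ch"
    then show "w \<in> W"
    proof (induction rule: facet_group.induct)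
      case (step a w)
      then show ?case
        using simple_W[OF facet_normal_simple[OF step(1)] step(3)] unit_multiple(2)[of g a]
        by (simp only: facet_normal_def)
    qed (rule id_W)
  qed
  show "W \<subseteq> facet_group g Ch"
  proof
    fix w assume "w \<in> W"
    then show "w \<in> facet_group g Ch"
      by (induction rule: W_induct) (simp_all only: facet_group.one facet_group.step simple_facet_normal)
  qed
qed

lemma reflected_copies_eq_W: "reflected_copies g Ch = W"
  using reflected_copies_eq_facet_group[of Ch g] facet_group_Ch ChD(1) by blast

lemma interior_of_copy:
  assumes w: "w \<in> W" "w' \<in> W" "w \<circ> w' = id" "w' \<circ> w = id" and p: "p \<in> top_of_set (space_form g) interior_of (w ` Ch)"
  shows "w' p \<in> Ch_int"
  using interior_of_motion[OF motion_W[OF w(1)] motion_W[OF w(2)] w(4,3) p] interior_of_Ch by blast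

theorem coxeter_domain_Ch: "coxeter_domain g Ch"
  unfolding coxeter_domain_def
proof (intro conjI ballI impI)
  show "polyhedral_domain g Ch"
    unfolding polyhedral_domain_def
  proof (intro conjI exI[of _ Pos] ballI)
    show "conormal g \<nu>" if "\<nu> \<in> Pos" for \<nu> using that PosD conormal_root by blast
    show "Ch = space_form g \<inter> (\<Inter>\<nu>\<in>Pos. half_space g \<nu>)" by (auto simp: Ch_def half_space_def)
    show "top_of_set (space_form g) interior_of Ch \<noteq> {}" using interior_of_Ch c_in_Ch_int by blast
    show "locally_finite_in (top_of_set (space_form g)) (hyperplane_of g ` Pos)"
      unfolding locally_finite_in_def
    proof (intro conjI ballI)
      show "\<Union>(hyperplane_of g ` Pos) \<subseteq> topspace (top_of_set (space_form g))" by (auto simp: hyperplane_of_def)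
      fix x :: "'a \<times> real" assume "x \<in> topspace (top_of_set (space_form g))"
      then have x: "x \<in> space_form g" by simp
      obtain K e where K: "K \<subseteq> space_form g" "compact K" "connected K" "0 < e" "space_form g \<inter> ball x e \<subseteq> K"
        using connected_compact_neighbourhood[OF x] by blast
      have "{U \<in> hyperplane_of g ` Pos :: ('a \<times> real) set set. U \<inter> (space_form g \<inter> ball x e) \<noteq> {}} \<subseteq> hyperplane_of g ` {\<nu>\<in>R. \<exists>p\<in>K. \<nu> \<bullet> p = 0}"
      proof
        fix U :: "('a \<times> real) set" assume "U \<in> {U \<in> hyperplane_of g ` Pos. U \<inter> (space_form g \<inter> ball x e) \<noteq> {}}"
        then obtain \<nu> p where \<nu>: "\<nu> \<in> Pos" "U = hyperplane_of g \<nu>" "p \<in> hyperplane_of g \<nu>" "p \<in> space_form g \<inter> ball x e"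
          by blast
        then have "p \<in> K" "\<nu> \<bullet> p = 0" using K(5) by (auto simp: hyperplane_of_def)
        then show "U \<in> hyperplane_of g ` {\<nu>\<in>R. \<exists>p\<in>K. \<nu> \<bullet> p = 0}" using \<nu> PosD(1) by blast
      qed
      then have "finite {U \<in> hyperplane_of g ` Pos :: ('a \<times> real) set set. U \<inter> (space_form g \<inter> ball x e) \<noteq> {}}"
        using locally_finite[OF K(1,2)] finite_subset by blast
      then show "\<exists>V. openin (top_of_set (space_form g)) V \<and> x \<in> V \<and> finite {U \<in> hyperplane_of g ` Pos. U \<inter> V \<noteq> {}}"
        using x K(4) by (intro exI[of _ "space_form g \<inter> ball x e"]) (auto simp: openin_open_Int)
    qed
  qed
  show "(\<Union>w\<in>reflected_copies g Ch. w ` Ch) = space_form g"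
  proof
    show "(\<Union>w\<in>reflected_copies g Ch. w ` Ch) \<subseteq> space_form g"
      unfolding reflected_copies_eq_W using W_space_form ChD by blast
    show "space_form g \<subseteq> (\<Union>w\<in>reflected_copies g Ch. w ` Ch)"
    proof
      fix x :: "'a \<times> real" assume "x \<in> space_form g"
      then obtain w w' where "w \<in> W" "w x \<in> Ch" "w' \<in> W" "w' \<circ> w = id"
        using W_moves_into_Ch inverse_W by meson
      then show "x \<in> (\<Union>w\<in>reflected_copies g Ch. w ` Ch)"
        unfolding reflected_copies_eq_W by (metis UN_I comp_apply id_apply image_eqI)
    qed
  qed
  fix w v p assume wv: "w \<in> reflected_copies g Ch" "v \<in> reflected_copies g Ch"
    and "top_of_set (space_form g) interior_of (w ` Ch) \<inter> top_of_set (space_form g) interior_of (v ` Ch) \<noteq> {}"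
  then obtain q where q: "q \<in> top_of_set (space_form g) interior_of (w ` Ch)" "q \<in> top_of_set (space_form g) interior_of (v ` Ch)"
    by blast
  have W: "w \<in> W" "v \<in> W" using wv reflected_copies_eq_W by auto
  obtain w' where w': "w' \<in> W" "w' \<circ> w = id" "w \<circ> w' = id" using inverse_W[OF W(1)] by blast
  obtain v' where v': "v' \<in> W" "v' \<circ> v = id" "v \<circ> v' = id" using inverse_W[OF W(2)] by blast
  have "w' q \<in> Ch_int" "v' q \<in> Ch_int"
    using interior_of_copy[OF W(1) w'(1,3,2) q(1)] interior_of_copy[OF W(2) v'(1,3,2) q(2)] by auto
  moreover have "(v' \<circ> w) (w' q) = v' q" using w'(3) by (metis comp_apply id_apply)
  ultimately have "v' \<circ> w = id" using W_simply_transitive[OF comp_W[OF v'(1) W(1)]] Ch_int_subset by (metis subsetD)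
  then have "w = v" using v'(3) by (metis comp_assoc comp_id id_comp)
  then show "w p = v p" by simp
qed

end

section \<open>The tiling generated by a Coxeter polyhedron\<close>

lemma continuous_on_sep: "continuous_on A (\<lambda>q. sep g q p)" "continuous_on B (\<lambda>z. sep g (fst z) (snd z))"
  unfolding sep_def conormal_form_def by (auto intro!: continuous_intros)

text \<open>
  Closed balls are compact, uniformly for centres in a compact set. On the hyperboloid the form \<open>t t' - x \<bullet> x'\<close> is bounded below by a
  positive multiple of \<open>t\<close> when \<open>(x', t')\<close> stays in a compact set.
\<close>

lemma bounded_sep_neighbourhood:
  fixes K :: "('a::euclidean_space \<times> real) set"
  assumes K: "K \<subseteq> space_form g" "compact K"
  shows "bounded {q\<in>space_form g. \<exists>y\<in>K. sep g q y \<le> M}"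
proof -
  obtain B where B: "0 < B" "\<And>y. y \<in> K \<Longrightarrow> norm y \<le> B"
    using compact_imp_bounded[OF K(2)] bounded_pos by blast
  consider "g = Spherical" | "g = Euclidean" | "g = Hyperbolic" by (cases g) auto
  then show ?thesis
  proof cases
    case 1
    then show ?thesis by (intro bounded_subset[OF bounded_sphere[of 0 1]]) (auto simp: space_form_spherical)
  next
    case 2
    have "norm q \<le> B + sqrt M" if "q \<in> space_form g" "y \<in> K" "sep g q y \<le> M" for q y
    proof -
      have "(dist q y)\<^sup>2 \<le> M" using sep_formulas(1)[of q g y] that K 2 by auto
      then have "dist q y \<le> sqrt M" by (simp add: real_le_rsqrt)
      then show ?thesis using B(2)[OF that(2)] norm_triangle_sub[of q y] by (simp add: dist_norm)
    qed
    then show ?thesis unfolding bounded_iff by (intro exI[of _ "B + sqrt M"]) blast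
  next
    case 3
    have "norm q \<le> 2 * ((M / 2 + 1) * (2 * B))" if q: "q \<in> space_form g" and y: "y \<in> K" "sep g q y \<le> M" for q y
    proof -
      have yS: "y \<in> space_form g" using y K by auto
      have t: "norm (fst q) < snd q" "norm (fst y) < snd y" "(snd y)\<^sup>2 - (norm (fst y))\<^sup>2 = 1"
        using q yS 3 by (auto simp: space_form_iff mem_cone_over_iff qform_def)
      have "0 < snd q" using order_le_less_trans[OF norm_ge_zero t(1)] .
      have "norm (snd y) \<le> norm y" by (simp add: norm_prod_def real_le_rsqrt)
      then have "snd y \<le> B" using B(2)[OF y(1)] by simp
      then have ub: "snd y + norm (fst y) \<le> 2 * B" using t(2) by simp
      have prod1: "(snd y - norm (fst y)) * (snd y + norm (fst y)) = 1" using t(3) by (simp add: power2_eq_square algebra_simps)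
      have "snd q * (snd y - norm (fst y)) = snd q * snd y - snd q * norm (fst y)" by (simp add: algebra_simps)
      also have "\<dots> \<le> snd q * snd y - norm (fst q) * norm (fst y)" using t(1) by (simp add: mult_right_mono)
      also have "\<dots> \<le> snd q * snd y - fst q \<bullet> fst y" using norm_cauchy_schwarz[of "fst q" "fst y"] by simp
      also have "\<dots> \<le> M / 2 + 1" using sep_formulas(3)[OF q yS] y(2) 3 by simp
      finally have le: "snd q * (snd y - norm (fst y)) \<le> M / 2 + 1" .
      have "snd q = snd q * (snd y - norm (fst y)) * (snd y + norm (fst y))" using prod1 by (simp add: mult.assoc)
      also have "\<dots> \<le> (M / 2 + 1) * (2 * B)"
      proof (rule mult_mono[OF le ub])
        have "0 \<le> snd q * (snd y - norm (fst y))" using \<open>0 < snd q\<close> t(2) by simp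
        then show "0 \<le> M / 2 + 1" using le by simp
        show "0 \<le> snd y + norm (fst y)" using t(2) norm_ge_zero[of "fst y"] by linarith
      qed
      finally have "snd q \<le> (M / 2 + 1) * (2 * B)" .
      moreover have "norm q \<le> norm (fst q) + norm (snd q)" using norm_Pair_le[of "fst q" "snd q"] by simp
      ultimately show ?thesis using t(1) \<open>0 < snd q\<close> by simp
    qed
    then show ?thesis unfolding bounded_iff by (intro exI[of _ "2 * ((M / 2 + 1) * (2 * B))"]) blast
  qed
qed

lemma sep_small_imp_near:
  assumes c: "c \<in> space_form g" and U: "open U" "c \<in> U"
  obtains \<epsilon> where "0 < \<epsilon>" "\<And>q. q \<in> space_form g \<Longrightarrow> sep g q c < \<epsilon> \<Longrightarrow> q \<in> U"
proof -
  let ?A = "{q\<in>space_form g. \<exists>y\<in>{c}. sep g q y \<le> 1} - U"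
  have "closed {q. sep g q c \<le> 1}" by (intro closed_Collect_le continuous_on_sep continuous_intros)
  then have "closed (space_form g \<inter> {q. sep g q c \<le> 1} - U)" using closed_space_form U(1) by (intro closed_Diff closed_Int)
  moreover have "?A = space_form g \<inter> {q. sep g q c \<le> 1} - U" by auto
  ultimately have cl: "closed ?A" by simp
  have "bounded ?A" using bounded_sep_neighbourhood[of "{c}" g 1] c bounded_subset by (metis (no_types, lifting) Diff_subset compact_sing empty_subsetI insert_subset)
  then have A: "compact ?A" using cl compact_eq_bounded_closed by blast
  show thesis
  proof (cases "?A = {}")
    case True
    then show ?thesis using that[of 1] by fastforce
  next
    case False
    then obtain q0 where q0: "q0 \<in> ?A" "\<And>q. q \<in> ?A \<Longrightarrow> sep g q0 c \<le> sep g q c"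
      using continuous_attains_inf[OF A False continuous_on_sep(1)] by blast
    have "sep g q0 c \<noteq> 0" using q0(1) sep_eq_0_iff[of q0 g c] c U by auto
    then have "0 < sep g q0 c" using sep_nonneg[of q0 g c] q0(1) c by auto
    moreover have "q \<in> U" if "q \<in> space_form g" "sep g q c < min 1 (sep g q0 c)" for q
      using q0(2)[of q] that by auto
    ultimately show ?thesis using that[of "min 1 (sep g q0 c)"] by auto
  qed
qed

lemma locally_finite_in_compact:
  assumes lf: "locally_finite_in X \<A>" and K: "compactin X K"
  shows "finite {U\<in>\<A>. U \<inter> K \<noteq> {}}"
proof -
  have "\<exists>V. openin X V \<and> x \<in> V \<and> finite {U\<in>\<A>. U \<inter> V \<noteq> {}}" if "x \<in> K" for x
  proof -
    have "x \<in> topspace X" using compactin_subset_topspace[OF K] that by blast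
    then show ?thesis by (rule lf[unfolded locally_finite_in_def, THEN conjunct2, rule_format])
  qed
  then have "\<exists>V. \<forall>x\<in>K. openin X (V x) \<and> x \<in> V x \<and> finite {U\<in>\<A>. U \<inter> V x \<noteq> {}}" by (intro bchoice) blast
  then obtain V where V: "\<And>x. x \<in> K \<Longrightarrow> openin X (V x) \<and> x \<in> V x \<and> finite {U\<in>\<A>. U \<inter> V x \<noteq> {}}" by blast
  have "K \<subseteq> \<Union>(V ` K)" "\<forall>U\<in>V ` K. openin X U" using V by auto
  then obtain \<F> where \<F>: "finite \<F>" "\<F> \<subseteq> V ` K" "K \<subseteq> \<Union>\<F>" using K unfolding compactin_def by meson
  have "finite (\<Union>W\<in>\<F>. {U\<in>\<A>. U \<inter> W \<noteq> {}})" using \<F> V by blast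
  moreover have "{U\<in>\<A>. U \<inter> K \<noteq> {}} \<subseteq> (\<Union>W\<in>\<F>. {U\<in>\<A>. U \<inter> W \<noteq> {}})"
  proof
    fix U assume "U \<in> {U\<in>\<A>. U \<inter> K \<noteq> {}}"
    then obtain x W where "U \<in> \<A>" "x \<in> U" "x \<in> W" "W \<in> \<F>" using \<F>(3) by blast
    then show "U \<in> (\<Union>W\<in>\<F>. {U\<in>\<A>. U \<inter> W \<noteq> {}})" by blast
  qed
  ultimately show ?thesis by (rule rev_finite_subset)
qed

text \<open>
  A reflection determines its unit covector up to sign.
\<close>

lemma finite_reflections_imp_finite_covectors:
  assumes "finite A" "\<And>\<nu>. \<nu> \<in> N \<Longrightarrow> conormal_form g \<nu> \<nu> = 1 \<and> reflection g \<nu> \<in> A"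
  shows "finite N"
proof -
  have pm: "\<mu> = \<nu> \<or> \<mu> = - \<nu>"
    if u: "conormal_form g \<nu> \<nu> = 1" "conormal_form g \<mu> \<mu> = 1" and eq: "reflection g \<nu> = reflection g \<mu>" for \<nu> \<mu> :: "'a \<times> real"
  proof -
    let ?r = "\<mu> \<bullet> dual_vector g \<nu>"
    have e: "(\<nu> \<bullet> p) *\<^sub>R dual_vector g \<nu> = (\<mu> \<bullet> p) *\<^sub>R dual_vector g \<mu>" for p
    proof -
      have "reflection g \<nu> p = reflection g \<mu> p" using eq by simp
      then have "2 *\<^sub>R ((\<nu> \<bullet> p) *\<^sub>R dual_vector g \<nu>) = 2 *\<^sub>R ((\<mu> \<bullet> p) *\<^sub>R dual_vector g \<mu>)"
        unfolding reflection_eq u by simp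
      then show ?thesis by (metis scaleR_cancel_left zero_neq_numeral)
    qed
    have J\<nu>: "dual_vector g \<nu> = ?r *\<^sub>R dual_vector g \<mu>" using e[of "dual_vector g \<nu>"] u(1) by (simp add: conormal_form_eq_inner)
    have "\<mu> \<bullet> p = (?r *\<^sub>R \<nu>) \<bullet> p" for p
    proof -
      have "\<mu> \<bullet> ((\<nu> \<bullet> p) *\<^sub>R dual_vector g \<nu>) = \<mu> \<bullet> ((\<mu> \<bullet> p) *\<^sub>R dual_vector g \<mu>)" using e by simp
      then show ?thesis using u(2) by (simp add: conormal_form_eq_inner mult.commute)
    qed
    then have "\<mu> = ?r *\<^sub>R \<nu>" using vector_eq_rdot by blast
    then show ?thesis using unit_covector_multiple u by blast
  qed
  have "finite {\<nu>. conormal_form g \<nu> \<nu> = 1 \<and> reflection g \<nu> = h}" for h :: "'a \<times> real \<Rightarrow> 'a \<times> real"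
  proof (cases "\<exists>\<nu>. conormal_form g \<nu> \<nu> = 1 \<and> reflection g \<nu> = h")
    case True
    then obtain \<nu>0 where "conormal_form g \<nu>0 \<nu>0 = 1" "reflection g \<nu>0 = h" by blast
    then have "{\<nu>. conormal_form g \<nu> \<nu> = 1 \<and> reflection g \<nu> = h} \<subseteq> {\<nu>0, - \<nu>0}" using pm by blast
    then show ?thesis by (rule finite_subset) simp
  next
    case False
    then have "{\<nu>. conormal_form g \<nu> \<nu> = 1 \<and> reflection g \<nu> = h} = {}" by blast
    then show ?thesis by (simp only: finite.emptyI)
  qed
  then have "finite (\<Union>h\<in>A. {\<nu>. conormal_form g \<nu> \<nu> = 1 \<and> reflection g \<nu> = h})" using assms(1) by blast
  then show ?thesis by (rule rev_finite_subset) (use assms(2) in blast)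
qed

text \<open>
  Normalising the inner normals merges those with the same hyperplane, so that local finiteness of the hyperplanes
  becomes finiteness of the set of covectors.
\<close>

lemma polyhedral_domain_walls:
  fixes C :: "('a::euclidean_space \<times> real) set"
  assumes pd: "polyhedral_domain g C" and c: "c \<in> top_of_set (space_form g) interior_of C"
  obtains N where "wall_domain g N c" "\<And>\<nu>. \<nu> \<in> N \<Longrightarrow> 0 < \<nu> \<bullet> c" "C = wall_domain.Ch g N c"
proof -
  obtain N0 where N0: "\<forall>\<nu>\<in>N0. conormal g \<nu>" "locally_finite_in (top_of_set (space_form g)) (hyperplane_of g ` N0)"
     "C = space_form g \<inter> (\<Inter>\<nu>\<in>N0. half_space g \<nu>)"
    using pd unfolding polyhedral_domain_def by blast
  define nrm where "nrm \<nu> = (1 / sqrt (conormal_form g \<nu> \<nu>)) *\<^sub>R \<nu>" for \<nu> :: "'a \<times> real"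
  define N where "N = nrm ` N0"
  obtain U where U: "open U" "c \<in> U" "space_form g \<inter> U \<subseteq> C" "c \<in> space_form g"
    using c by (auto simp: interior_of_def openin_open)
  have hyp: "hyperplane_of g (nrm \<nu>) = hyperplane_of g \<nu>" and half: "half_space g (nrm \<nu>) = half_space g \<nu>" if "\<nu> \<in> N0" for \<nu>
  proof -
    have "0 < conormal_form g \<nu> \<nu>" using N0(1) that by (simp add: conormal_def)
    then show "hyperplane_of g (nrm \<nu>) = hyperplane_of g \<nu>" "half_space g (nrm \<nu>) = half_space g \<nu>"
      unfolding hyperplane_of_def half_space_def nrm_def by (simp_all add: zero_le_divide_iff not_le)
  qed
  have unit: "conormal_form g \<nu> \<nu> = 1" if "\<nu> \<in> N" for \<nu>
    using that N0(1) unit_multiple(1) by (auto simp: N_def nrm_def)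
  have pos: "0 < \<nu> \<bullet> c" if \<nu>N: "\<nu> \<in> N" for \<nu>
  proof (rule nonneg_near_imp_pos[OF U(4,1,2)])
    show "\<nu> \<noteq> 0" using unit[OF \<nu>N] by (auto simp: conormal_form_simps)
    obtain \<nu>0 where \<nu>0: "\<nu>0 \<in> N0" "\<nu> = nrm \<nu>0" using \<nu>N unfolding N_def by blast
    fix p assume "p \<in> U \<inter> space_form g"
    then have "p \<in> half_space g \<nu>0" using U(3) N0(3) \<nu>0(1) by blast
    then have "p \<in> half_space g \<nu>" using half[OF \<nu>0(1)] \<nu>0(2) by simp
    then show "0 \<le> \<nu> \<bullet> p" by (simp add: half_space_def)
  qed
  have inj: "\<nu> = \<mu>" if "\<nu> \<in> N" "\<mu> \<in> N" "hyperplane_of g \<nu> = hyperplane_of g \<mu>" "p \<in> hyperplane_of g \<nu>" for \<nu> \<mu> p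
  proof -
    have p: "p \<in> space_form g" "\<nu> \<bullet> p = 0" "\<mu> \<bullet> p = 0" using that(3,4) by (auto simp: hyperplane_of_def)
    have "\<exists>r. \<mu> = r *\<^sub>R \<nu>"
    proof (rule nonneg_near_on_hyperplane_imp_multiple[OF p(1) open_UNIV UNIV_I p(2,3)])
      fix q assume "q \<in> space_form g" "\<nu> \<bullet> q = 0"
      then have "q \<in> hyperplane_of g \<mu>" using that(3) by (auto simp: hyperplane_of_def)
      then show "0 \<le> \<mu> \<bullet> q" by (simp add: hyperplane_of_def)
    qed
    then have "\<mu> = \<nu> \<or> \<mu> = - \<nu>" using unit_covector_multiple unit that(1,2) by blast
    then show ?thesis using pos[OF that(1)] pos[OF that(2)] by auto
  qed
  interpret wd: wall_domain g N c
  proof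
    show "\<And>\<nu>. \<nu> \<in> N \<Longrightarrow> conormal_form g \<nu> \<nu> = 1" by (rule unit)
    show "c \<in> space_form g" by (rule U)
    show "\<And>\<nu>. \<nu> \<in> N \<Longrightarrow> \<nu> \<bullet> c \<noteq> 0" using pos by force
    fix K :: "('a \<times> real) set" assume K: "K \<subseteq> space_form g" "compact K"
    then have "compactin (top_of_set (space_form g)) K" by (simp add: compactin_subtopology)
    then have fin: "finite {U\<in>hyperplane_of g ` N0. U \<inter> K \<noteq> {}}" by (rule locally_finite_in_compact[OF N0(2)])
    have "hyperplane_of g ` {\<nu>\<in>N. \<exists>p\<in>K. \<nu> \<bullet> p = 0} \<subseteq> {U\<in>hyperplane_of g ` N0. U \<inter> K \<noteq> {}}"
    proof (rule image_subsetI)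
      fix \<nu> assume "\<nu> \<in> {\<nu>\<in>N. \<exists>p\<in>K. \<nu> \<bullet> p = 0}"
      then obtain p where p: "\<nu> \<in> N" "p \<in> K" "\<nu> \<bullet> p = 0" by blast
      obtain \<nu>0 where "\<nu>0 \<in> N0" "\<nu> = nrm \<nu>0" using p(1) unfolding N_def by blast
      moreover have "p \<in> hyperplane_of g \<nu>" using p K(1) by (auto simp: hyperplane_of_def)
      ultimately show "hyperplane_of g \<nu> \<in> {U\<in>hyperplane_of g ` N0. U \<inter> K \<noteq> {}}" using hyp p(2) by auto
    qed
    moreover have "inj_on (hyperplane_of g) {\<nu>\<in>N. \<exists>p\<in>K. \<nu> \<bullet> p = 0}"
    proof (rule inj_onI)
      fix \<nu> \<mu> assume *: "\<nu> \<in> {\<nu>\<in>N. \<exists>p\<in>K. \<nu> \<bullet> p = 0}" "\<mu> \<in> {\<nu>\<in>N. \<exists>p\<in>K. \<nu> \<bullet> p = 0}" "hyperplane_of g \<nu> = hyperplane_of g \<mu>"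
      then obtain p where "p \<in> K" "\<nu> \<bullet> p = 0" by blast
      then have "p \<in> hyperplane_of g \<nu>" using K(1) by (auto simp: hyperplane_of_def)
      then show "\<nu> = \<mu>" using inj * by blast
    qed
    ultimately show "finite {\<nu>\<in>N. \<exists>p\<in>K. \<nu> \<bullet> p = 0}" by (rule finite_imageD[OF finite_subset[OF _ fin]])
  qed
  have "C = wd.Ch"
  proof -
    have "wd.Pos = N" using pos by (auto simp: wd.Pos_def)
    moreover have "(\<Inter>\<nu>\<in>N0. half_space g \<nu>) = (\<Inter>\<nu>\<in>N. half_space g \<nu>)" using half by (auto simp: N_def)
    ultimately show ?thesis unfolding N0(3) wd.Ch_def by (auto simp: half_space_def)
  qed
  then show thesis using that[of N] wd.wall_domain_axioms pos by blast
qed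

text \<open>
  If infinitely many members of a group of motions met a compact set, the images of an interior
  point of the domain would accumulate, and two nearby ones would give overlapping copies.
\<close>

lemma facet_group_proper:
  fixes C :: "('a::euclidean_space \<times> real) set"
  assumes c: "c \<in> top_of_set (space_form g) interior_of C"
    and tiling: "\<And>w. w \<in> facet_group g C \<Longrightarrow> w c \<in> top_of_set (space_form g) interior_of C \<Longrightarrow> w = id"
    and K: "K \<subseteq> space_form g" "compact K"
  shows "finite {w\<in>facet_group g C. \<exists>x\<in>K. w x \<in> K}"
proof (rule ccontr)
  let ?F = "{w\<in>facet_group g C. \<exists>x\<in>K. w x \<in> K}"
  assume inf: "infinite ?F"
  obtain U where U: "open U" "c \<in> U" "space_form g \<inter> U \<subseteq> C" "c \<in> space_form g"
    using c by (auto simp: interior_of_def openin_open)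
  have Uint: "q \<in> top_of_set (space_form g) interior_of C" if "q \<in> space_form g" "q \<in> U" for q
    using interior_of_maximal[OF U(3)] U(1) that by (auto simp: openin_open_Int)
  obtain \<epsilon> where \<epsilon>: "0 < \<epsilon>" "\<And>q. q \<in> space_form g \<Longrightarrow> sep g q c < \<epsilon> \<Longrightarrow> q \<in> U"
    using sep_small_imp_near[OF U(4,1,2)] by blast
  have eq: "w = v" if w: "w \<in> facet_group g C" "v \<in> facet_group g C" and s: "sep g (w c) (v c) < \<epsilon>" for w v
  proof -
    obtain v' where v': "v' \<in> facet_group g C" "v' \<circ> v = id" "v \<circ> v' = id" using facet_group_inverse[OF w(2)] by blast
    have m: "motion g w" "motion g v" "motion g v'" using facet_group_motion w v' by auto
    have S: "w c \<in> space_form g" "v c \<in> space_form g" using motion_space_form m U(4) by blast+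
    have "v' (v c) = c" using v'(2) by (metis comp_apply id_apply)
    then have "sep g (v' (w c)) c < \<epsilon>" using motion_sep[OF m(3) S] s by simp
    then have "(v' \<circ> w) c \<in> top_of_set (space_form g) interior_of C"
      using Uint \<epsilon>(2) motion_space_form[OF m(3) S(1)] by simp
    then have "v' \<circ> w = id" using tiling facet_group_comp[OF v'(1) w(1)] by blast
    then show "w = v" using v'(3) by (metis comp_assoc comp_id id_comp)
  qed
  have "inj_on (\<lambda>w. w c) ?F"
    by (rule inj_onI) (use eq \<epsilon>(1) in \<open>auto simp: sep_def conormal_form_simps\<close>)
  then have inf': "infinite ((\<lambda>w. w c) ` ?F)" using inf finite_imageD by blast
  have "compact ((\<lambda>q. sep g q c) ` K)" using K(2) by (intro compact_continuous_image continuous_on_sep(1))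
  then obtain M where M: "\<And>x. x \<in> K \<Longrightarrow> sep g x c \<le> M"
    using compact_imp_bounded bounded_real by (metis abs_le_D1 image_eqI)
  have "(\<lambda>w. w c) ` ?F \<subseteq> {q\<in>space_form g. \<exists>y\<in>K. sep g q y \<le> M}"
  proof (rule image_subsetI)
    fix w assume "w \<in> ?F"
    then obtain x where x: "w \<in> facet_group g C" "x \<in> K" "w x \<in> K" by blast
    have m: "motion g w" using facet_group_motion x(1) .
    have "sep g (w c) (w x) \<le> M" using M[OF x(2)] motion_sep[OF m U(4), of x] x(2) K(1) by (auto simp: sep_commute)
    then show "w c \<in> {q\<in>space_form g. \<exists>y\<in>K. sep g q y \<le> M}" using x(3) motion_space_form[OF m U(4)] by blast
  qed
  then have "bounded ((\<lambda>w. w c) ` ?F)" using bounded_sep_neighbourhood[OF K] bounded_subset by blast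
  then obtain z where z: "z islimpt ((\<lambda>w. w c) ` ?F)" using inf' bounded_infinite_imp_islimpt[OF subset_refl] by blast
  have "open ((\<lambda>z. sep g (fst z) (snd z)) -` {..<\<epsilon>})"
    by (intro open_vimage open_lessThan) (rule continuous_on_sep(2))
  moreover have "(z, z) \<in> (\<lambda>z. sep g (fst z) (snd z)) -` {..<\<epsilon>}" using \<epsilon>(1) by (simp add: sep_def conormal_form_simps)
  ultimately obtain A B where AB: "open A" "open B" "z \<in> A" "z \<in> B" "A \<times> B \<subseteq> (\<lambda>z. sep g (fst z) (snd z)) -` {..<\<epsilon>}"
    by (rule open_prod_elim) auto
  have "z \<in> A \<inter> B" "open (A \<inter> B)" using AB by auto
  then have "infinite ((A \<inter> B) \<inter> (\<lambda>w. w c) ` ?F)" using z unfolding islimpt_eq_acc_point by (metis (no_types))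
  then have infAB: "infinite ((\<lambda>w. w c) ` ?F \<inter> (A \<inter> B))" by (subst Int_commute)
  have two: "\<exists>P\<in>X. \<exists>Q\<in>X. P \<noteq> Q" if inf: "infinite X" for X :: "('a \<times> real) set"
  proof -
    obtain P where "P \<in> X" using infinite_imp_nonempty[OF inf] by blast
    moreover obtain Q where "Q \<in> X - {P}" using infinite_imp_nonempty[OF infinite_remove[OF inf]] by blast
    ultimately show ?thesis by blast
  qed
  define X0 where "X0 = (\<lambda>w. w c) ` ?F \<inter> (A \<inter> B)"
  obtain P Q where "P \<in> X0" "Q \<in> X0" and PQ_ne: "P \<noteq> Q" using two[OF infAB[folded X0_def]] by blast
  note PQ = \<open>P \<in> X0\<close>[unfolded X0_def] \<open>Q \<in> X0\<close>[unfolded X0_def] PQ_ne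
  have "\<exists>w\<in>facet_group g C. P = w c" if "P \<in> (\<lambda>w. w c) ` ?F \<inter> (A \<inter> B)" for P
  proof -
    have "P \<in> (\<lambda>w. w c) ` ?F" using that by (rule IntD1)
    then show ?thesis by blast
  qed
  from this[OF PQ(1)] this[OF PQ(2)] obtain w v where wv: "w \<in> facet_group g C" "v \<in> facet_group g C" "P = w c" "Q = v c"
    by blast
  have "P \<in> A" "Q \<in> B" using IntD1[OF IntD2[OF PQ(1)]] IntD2[OF IntD2[OF PQ(2)]] .
  then have "(P, Q) \<in> (\<lambda>z. sep g (fst z) (snd z)) -` {..<\<epsilon>}" using AB(5) by (meson SigmaI subsetD)
  then have "sep g P Q < \<epsilon>" by simp
  then have "sep g (w c) (v c) < \<epsilon>" using wv(3,4) by simp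
  then have "w = v" by (rule eq[OF wv(1,2)])
  then show False using wv(3,4) PQ(3) by simp
qed

text \<open>
  For the group of a Coxeter polyhedron both properties come directly from the tiling.
\<close>

locale proper_chamber = chamber +
  assumes root_reflection_W: "\<nu> \<in> R \<Longrightarrow> reflection g \<nu> \<in> W"
    and W_proper: "K \<subseteq> space_form g \<Longrightarrow> compact K \<Longrightarrow> finite {w\<in>W. \<exists>x\<in>K. w x \<in> K}"

text \<open>
  The roots are the unit covectors whose reflections belong to the group. They vanish nowhere in the interior of \<open>C\<close>, since a
  reflection fixing an interior point would give a second copy overlapping \<open>C\<close>. They are locally finite: if \<open>p\<close> lies on
  the mirror and in the copy \<open>u ` C\<close>, then \<open>u\<close> and the product of the reflection with \<open>u\<close> both carry a point of \<open>C\<close>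
  to \<open>p\<close>, and by compactness of \<open>C\<close> finitely many elements do so for \<open>p\<close> in a compact set. The walls of \<open>C\<close> are among the mirrors, and no mirror
  enters the interior; so \<open>C\<close> is the chamber.
\<close>

theorem coxeter_polyhedron_chamber:
  fixes C :: "('a::euclidean_space \<times> real) set"
  assumes "coxeter_polyhedron g C"
  obtains R c where "proper_chamber g R c" "C = wall_domain.Ch g R c"
proof -
  have cd: "coxeter_domain g C" and cpt: "compact C" using assms by (auto simp: coxeter_polyhedron_def)
  have pd: "polyhedral_domain g C" using cd by (simp add: coxeter_domain_def)
  let ?I = "top_of_set (space_form g) interior_of C" let ?V = "facet_group g C"
  obtain c where c: "c \<in> ?I" using pd by (auto simp: polyhedral_domain_def)
  have CS: "C \<subseteq> space_form g" using pd by (auto simp: polyhedral_domain_def)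
  have cS: "c \<in> space_form g" using c CS interior_of_subset[of "top_of_set (space_form g)" C] by (meson subsetD)
  have V: "reflected_copies g C = ?V" by (rule reflected_copies_eq_facet_group[OF CS])
  have cover: "\<exists>u\<in>?V. x \<in> u ` C" if "x \<in> space_form g" for x
    using cd that unfolding coxeter_domain_def V by blast
  have tile: "w = id" if w: "w \<in> ?V" and p: "p \<in> ?I" "w p \<in> ?I" for w p
  proof -
    obtain w' where w': "w' \<in> ?V" "w' \<circ> w = id" "w \<circ> w' = id" using facet_group_inverse[OF w] by blast
    have "p \<in> top_of_set (space_form g) interior_of (w' ` w ` C)" unfolding image_comp w'(2) using p(1) by simp
    then have "w p \<in> top_of_set (space_form g) interior_of (w ` C)"
      using interior_of_motion[of g w' w] facet_group_motion w w' by blast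
    then have "top_of_set (space_form g) interior_of (w ` C) \<inter> top_of_set (space_form g) interior_of (id ` C) \<noteq> {}"
      using p(2) by auto
    then have "\<forall>p\<in>space_form g. w p = id p" using cd w facet_group.one unfolding coxeter_domain_def V by blast
    then show ?thesis
      by (intro linear_eq_if_eq_on_space_form[of _ _ g] motion_linear[OF facet_group_motion[OF w]]) (auto simp: linear_id)
  qed
  have proper: "finite {w\<in>?V. \<exists>x\<in>K. w x \<in> K}" if "K \<subseteq> space_form g" "compact K" for K
    using facet_group_proper[OF c tile[OF _ c] that] .
  define R where "R = {\<nu>. conormal_form g \<nu> \<nu> = 1 \<and> reflection g \<nu> \<in> ?V}"
  have regular: "\<nu> \<bullet> p \<noteq> 0" if \<nu>: "\<nu> \<in> R" and p: "p \<in> ?I" for \<nu> p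
  proof
    assume "\<nu> \<bullet> p = 0"
    then have "reflection g \<nu> p = p" by (simp add: reflection_eq)
    then have "reflection g \<nu> = id" using tile[of "reflection g \<nu>" p] \<nu> p by (simp add: R_def)
    then have "reflection g \<nu> (dual_vector g \<nu>) = dual_vector g \<nu>" by simp
    then have "dual_vector g \<nu> = 0" using \<nu> by (simp add: R_def reflection_eq conormal_form_eq_inner)
    then show False using \<nu> by (simp add: R_def conormal_form_eq_inner)
  qed
  interpret ch: chamber g R c
  proof
    show "\<And>\<nu>. \<nu> \<in> R \<Longrightarrow> conormal_form g \<nu> \<nu> = 1" by (simp add: R_def)
    show "c \<in> space_form g" by (rule cS)
    show "\<And>\<nu>. \<nu> \<in> R \<Longrightarrow> \<nu> \<bullet> c \<noteq> 0" using regular c by blast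
    show "root_reflection g \<nu> \<mu> \<in> R" if "\<nu> \<in> R" "\<mu> \<in> R" for \<nu> \<mu>
    proof -
      have u: "conormal_form g \<nu> \<nu> = 1" "conormal_form g \<mu> \<mu> = 1" and v: "reflection g \<nu> \<in> ?V" "reflection g \<mu> \<in> ?V"
        using that by (auto simp: R_def)
      have "reflection g \<nu> \<circ> reflection g \<mu> \<circ> reflection g \<nu> \<in> ?V" by (intro facet_group_comp v)
      then show ?thesis unfolding reflection_conjugate[OF u] by (simp add: R_def root_reflection_form[OF u(1)] u)
    qed
    fix K :: "('a \<times> real) set" assume K: "K \<subseteq> space_form g" "compact K"
    let ?F = "{w\<in>?V. \<exists>x\<in>K \<union> C. w x \<in> K \<union> C}"
    have finF: "finite ?F" using K CS cpt by (intro proper) (auto intro: compact_Un)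
    show "finite {\<nu>\<in>R. \<exists>p\<in>K. \<nu> \<bullet> p = 0}"
    proof (rule finite_reflections_imp_finite_covectors[of "(\<lambda>(a, b). a \<circ> inv b) ` (?F \<times> ?F)"])
      show "finite ((\<lambda>(a, b). a \<circ> inv b) ` (?F \<times> ?F))" using finF by blast
      fix \<nu> assume "\<nu> \<in> {\<nu>\<in>R. \<exists>p\<in>K. \<nu> \<bullet> p = 0}"
      then obtain p where \<nu>: "\<nu> \<in> R" "p \<in> K" "\<nu> \<bullet> p = 0" by blast
      obtain u y where u: "u \<in> ?V" "y \<in> C" "p = u y" using cover[of p] \<nu>(2) K(1) by blast
      obtain u' where u': "u' \<circ> u = id" "u \<circ> u' = id" using facet_group_inverse[OF u(1)] by blast
      have r: "reflection g \<nu> p = p" using \<nu>(3) by (simp add: reflection_eq)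
      have "u \<in> ?F" using u \<nu>(2) by blast
      moreover have "reflection g \<nu> \<circ> u \<in> ?F"
      proof -
        have "reflection g \<nu> \<circ> u \<in> ?V" using \<nu>(1) u(1) facet_group_comp unfolding R_def by blast
        moreover have "(reflection g \<nu> \<circ> u) y \<in> K" using u(3) \<nu>(2) r by simp
        ultimately show ?thesis using u(2) by blast
      qed
      moreover have "reflection g \<nu> = (reflection g \<nu> \<circ> u) \<circ> inv u"
        using u' inv_unique_comp[OF u'(2,1)] by (simp only: comp_assoc comp_id)
      ultimately have "reflection g \<nu> \<in> (\<lambda>(a, b). a \<circ> inv b) ` (?F \<times> ?F)"
        by (intro image_eqI[of _ _ "(reflection g \<nu> \<circ> u, u)"]) simp_all
      then show "conormal_form g \<nu> \<nu> = 1 \<and> reflection g \<nu> \<in> (\<lambda>(a, b). a \<circ> inv b) ` (?F \<times> ?F)"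
        using \<nu>(1) by (simp add: R_def)
    qed
  qed
  obtain N where N: "wall_domain g N c" "\<And>\<nu>. \<nu> \<in> N \<Longrightarrow> 0 < \<nu> \<bullet> c" "C = wall_domain.Ch g N c"
    using polyhedral_domain_walls[OF pd c] by blast
  interpret wd: wall_domain g N c by (rule N(1))
  have PosN: "wd.Pos = N" using N(2) by (auto simp: wd.Pos_def)
  have int: "?I = wd.Ch_int" unfolding N(3) by (rule wd.interior_of_Ch)
  have "C = ch.Ch"
  proof
    show "ch.Ch \<subseteq> C"
    proof
      fix x assume x: "x \<in> ch.Ch"
      show "x \<in> C"
      proof (rule ccontr)
        assume "x \<notin> C"
        then obtain a where a: "wd.simple a" "a \<bullet> x < 0"
          using wd.simple_separates ch.ChD(1)[OF x] N(3) by blast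
        have "facet_normal g C a" unfolding N(3) by (rule wd.simple_facet_normal[OF a(1)])
        then have "a \<in> R" using facet_reflection_in_group[of g C a] wd.unit[OF wd.simpleD(2)[OF a(1)]] by (simp add: R_def)
        then have "a \<in> ch.Pos" using N(2) wd.simpleD(2)[OF a(1)] by (simp add: ch.Pos_def)
        then show False using ch.ChD(2)[OF x] a(2) by fastforce
      qed
    qed
    show "C \<subseteq> ch.Ch"
    proof
      fix p assume p: "p \<in> C"
      have "0 \<le> \<nu> \<bullet> p" if \<nu>: "\<nu> \<in> ch.Pos" for \<nu>
      proof (rule ccontr)
        assume neg: "\<not> 0 \<le> \<nu> \<bullet> p"
        have \<nu>c: "0 < \<nu> \<bullet> c" "\<nu> \<in> R" using ch.PosD \<nu> by auto
        \<comment> \<open>between an interior point and \<open>p\<close> the mirror would cross the interior; antipodal points occur only when \<open>C\<close> is the whole sphere\<close>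
        have "\<exists>m\<in>?I. \<nu> \<bullet> m = 0"
        proof (cases "N = {}")
          case True
          then have all: "?I = space_form g" unfolding int wd.Ch_int_def PosN by simp
          have pS: "p \<in> space_form g" using p CS by blast
          obtain K where K: "K \<subseteq> space_form g" "connected K" "c \<in> K" "p \<in> K"
            by (rule connected_compact_through[OF cS pS])
          have "\<exists>m\<in>K. \<nu> \<bullet> m = 0"
            using \<nu>c(1) neg by (intro ch.sign_change_on_connected[OF K(2-4)]) simp_all
          then show ?thesis using K(1) unfolding all by blast
        next
          case False
          define s where "s = (\<nu> \<bullet> c) / (\<nu> \<bullet> c - \<nu> \<bullet> p)"
          have s: "0 < s" "s < 1" using \<nu>c(1) neg by (auto simp: s_def divide_simps)
          define v where "v = (1 - s) *\<^sub>R c + s *\<^sub>R p"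
          have "\<nu> \<bullet> v = \<nu> \<bullet> c - s * (\<nu> \<bullet> c - \<nu> \<bullet> p)" by (simp add: v_def inner_add_right algebra_simps)
          also have "\<dots> = 0" using \<nu>c(1) neg by (simp add: s_def)
          finally have \<nu>v: "\<nu> \<bullet> v = 0" .
          have posv: "0 < \<mu> \<bullet> v" if "\<mu> \<in> N" for \<mu>
          proof -
            have "0 < (1 - s) * (\<mu> \<bullet> c)" using s N(2)[OF that] by simp
            moreover have "0 \<le> s * (\<mu> \<bullet> p)" using s wd.ChD(2)[of p \<mu>] p N(3) that PosN by simp
            ultimately show ?thesis by (simp add: v_def inner_add_right)
          qed
          have "v \<noteq> 0" using posv False by force
          then have v: "v \<in> cone_over g" unfolding v_def using cS p CS s
            by (intro cone_over_segment) (auto simp: space_form_iff)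
          have "radial g v \<in> ?I" unfolding int wd.Ch_int_def PosN
            using radial_in_space_form[OF v] posv inner_radial_sign(1)[OF v] by blast
          moreover have "\<nu> \<bullet> radial g v = 0" using \<nu>v inner_radial_sign(3)[OF v] by blast
          ultimately show ?thesis by blast
        qed
        then show False using regular[OF \<nu>c(2)] by blast
      qed
      then show "p \<in> ch.Ch" using p CS by (auto simp: ch.Ch_def)
    qed
  qed
  then have VW: "?V = ch.W" using ch.facet_group_Ch by simp
  have "proper_chamber g R c"
  proof
    have "\<forall>\<nu>\<in>R. reflection g \<nu> \<in> ?V" by (simp add: R_def)
    then show "\<And>\<nu>. \<nu> \<in> R \<Longrightarrow> reflection g \<nu> \<in> ch.W" using VW by blast
    show "\<And>K. K \<subseteq> space_form g \<Longrightarrow> compact K \<Longrightarrow> finite {w\<in>ch.W. \<exists>x\<in>K. w x \<in> K}"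
      using proper unfolding VW .
  qed
  then show thesis using \<open>C = ch.Ch\<close> by (rule that)
qed

section \<open>Mirrors through a point of the chamber\<close>

text \<open>
  The covectors vanishing at a point form its cotangent space, on which the form is definite in all three geometries.
\<close>

lemma conormal_form_pos_at_point:
  assumes y: "y \<in> space_form g" and \<nu>: "\<nu> \<bullet> y = 0" "\<nu> \<noteq> 0"
  shows "0 < conormal_form g \<nu> \<nu>"
proof -
  obtain a b where ab: "\<nu> = (a, b)" by (rule prod.exhaust)
  obtain x t where xt: "y = (x, t)" by (rule prod.exhaust)
  have z: "a \<bullet> x + b * t = 0" using \<nu>(1) by (simp add: ab xt)
  show ?thesis
  proof (cases g)
    case Spherical
    have "0 < \<nu> \<bullet> \<nu>" using \<nu>(2) by simp
    then show ?thesis using Spherical by (simp add: conormal_form_def inner_prod_def)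
  next
    case Euclidean
    then have "t = 1" using y by (auto simp: xt space_form_def power2_eq_1_iff)
    then have "a \<noteq> 0" using z \<nu>(2) ab by (auto simp: zero_prod_def)
    then show ?thesis using Euclidean by (simp add: conormal_form_def ab)
  next
    case Hyperbolic
    have t: "norm x < t" using y Hyperbolic by (simp add: xt space_form_iff mem_cone_over_iff)
    have a: "a \<noteq> 0"
    proof
      assume "a = 0"
      then have "b = 0" using z t norm_ge_zero[of x] by simp
      then show False using \<open>a = 0\<close> \<nu>(2) ab by (simp add: zero_prod_def)
    qed
    have "\<bar>b\<bar> * t = \<bar>a \<bullet> x\<bar>" using z t norm_ge_zero[of x] by (metis abs_minus_cancel abs_mult abs_of_nonneg add_eq_0_iff2 less_eq_real_def order_trans)
    also have "\<dots> \<le> norm a * norm x" by (rule Cauchy_Schwarz_ineq2)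
    also have "\<dots> < norm a * t" using a t by simp
    finally have "\<bar>b\<bar> < norm a" using t norm_ge_zero[of x] by (simp add: mult_less_cancel_right)
    then have "b\<^sup>2 < (norm a)\<^sup>2" by (metis abs_ge_zero power2_abs power_strict_mono zero_less_numeral)
    then show ?thesis using Hyperbolic by (simp add: conormal_form_def ab power2_norm_eq_inner[symmetric] power2_eq_square[of b, symmetric])
  qed
qed

lemma unit_form_less_1:
  assumes y: "y \<in> space_form g" "\<nu> \<bullet> y = 0" "\<mu> \<bullet> y = 0"
    and u: "conormal_form g \<nu> \<nu> = 1" "conormal_form g \<mu> \<mu> = 1" and ne: "\<nu> \<noteq> \<mu>" "\<nu> \<noteq> - \<mu>"
  shows "\<bar>conormal_form g \<nu> \<mu>\<bar> < 1"
proof -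
  let ?r = "conormal_form g \<nu> \<mu>"
  have "\<nu> - ?r *\<^sub>R \<mu> \<noteq> 0" using unit_covector_multiple[OF u, of ?r] ne by auto
  then have "0 < conormal_form g (\<nu> - ?r *\<^sub>R \<mu>) (\<nu> - ?r *\<^sub>R \<mu>)"
    using y by (intro conormal_form_pos_at_point[OF y(1)]) (simp_all add: inner_diff_left)
  also have "\<dots> = 1 - ?r\<^sup>2"
    using u by (simp add: conormal_form_simps conormal_form_commute[of g \<mu> \<nu>] power2_eq_square)
  finally show ?thesis by (simp add: abs_square_less_1)
qed

text \<open>
  The unit covector in the plane of \<open>\<nu>\<close> and \<open>\<mu>\<close> at angle \<open>\<phi>\<close> from \<open>\<nu>\<close>, where \<open>\<theta>\<close> is the dihedral angle
  of the two half-spaces; \<open>\<mu>\<close> itself sits at \<open>\<phi> = \<pi> - \<theta>\<close>.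
\<close>

definition plane_root :: "real \<Rightarrow> 'e::real_vector \<Rightarrow> 'e \<Rightarrow> real \<Rightarrow> 'e" where
  "plane_root \<theta> \<nu> \<mu> \<phi> = (sin (\<phi> + \<theta>) / sin \<theta>) *\<^sub>R \<nu> + (sin \<phi> / sin \<theta>) *\<^sub>R \<mu>"

lemma plane_root_form:
  assumes u: "conormal_form g \<nu> \<nu> = 1" "conormal_form g \<mu> \<mu> = 1" "conormal_form g \<nu> \<mu> = - cos \<theta>" and s: "sin \<theta> \<noteq> 0"
  shows "conormal_form g \<nu> (plane_root \<theta> \<nu> \<mu> \<phi>) = cos \<phi>"
    and "conormal_form g \<mu> (plane_root \<theta> \<nu> \<mu> \<phi>) = - cos (\<phi> + \<theta>)"
proof -
  have "conormal_form g \<nu> (plane_root \<theta> \<nu> \<mu> \<phi>) = (sin (\<phi> + \<theta>) - cos \<theta> * sin \<phi>) / sin \<theta>"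
    using u by (simp add: plane_root_def conormal_form_simps diff_divide_distrib)
  then show "conormal_form g \<nu> (plane_root \<theta> \<nu> \<mu> \<phi>) = cos \<phi>" using s by (simp add: sin_add)
  have "conormal_form g \<mu> (plane_root \<theta> \<nu> \<mu> \<phi>) = (sin ((\<phi> + \<theta>) - \<theta>) - cos \<theta> * sin (\<phi> + \<theta>)) / sin \<theta>"
    using u by (simp add: plane_root_def conormal_form_simps conormal_form_commute[of g \<mu> \<nu>] diff_divide_distrib)
  then show "conormal_form g \<mu> (plane_root \<theta> \<nu> \<mu> \<phi>) = - cos (\<phi> + \<theta>)" using s unfolding sin_diff by simp
qed

lemma plane_root_reflection:
  assumes u: "conormal_form g \<nu> \<nu> = 1" "conormal_form g \<mu> \<mu> = 1" "conormal_form g \<nu> \<mu> = - cos \<theta>" and s: "sin \<theta> \<noteq> 0"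
  shows "root_reflection g \<nu> (plane_root \<theta> \<nu> \<mu> \<phi>) = plane_root \<theta> \<nu> \<mu> (pi - \<phi>)"
    and "root_reflection g \<mu> (plane_root \<theta> \<nu> \<mu> \<phi>) = plane_root \<theta> \<nu> \<mu> (pi - 2 * \<theta> - \<phi>)"
proof -
  have 1: "sin (pi - \<phi> + \<theta>) = sin (\<phi> + \<theta>) - 2 * cos \<phi> * sin \<theta>"
    using sin_pi_minus[of "\<phi> - \<theta>"] by (simp add: sin_add sin_diff algebra_simps)
  have "root_reflection g \<nu> (plane_root \<theta> \<nu> \<mu> \<phi>) = (sin (\<phi> + \<theta>) / sin \<theta> - 2 * cos \<phi>) *\<^sub>R \<nu> + (sin \<phi> / sin \<theta>) *\<^sub>R \<mu>"
    unfolding root_reflection_def plane_root_form[OF u s] by (simp add: plane_root_def algebra_simps)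
  also have "sin (\<phi> + \<theta>) / sin \<theta> - 2 * cos \<phi> = sin (pi - \<phi> + \<theta>) / sin \<theta>" using s unfolding 1 by (simp add: field_simps)
  finally show "root_reflection g \<nu> (plane_root \<theta> \<nu> \<mu> \<phi>) = plane_root \<theta> \<nu> \<mu> (pi - \<phi>)" by (simp add: plane_root_def)
  have 2: "sin (pi - 2 * \<theta> - \<phi>) = sin \<phi> + 2 * cos (\<phi> + \<theta>) * sin \<theta>"
  proof -
    have "sin (pi - 2 * \<theta> - \<phi>) = sin ((\<phi> + \<theta>) + \<theta>)" using sin_pi_minus[of "2 * \<theta> + \<phi>"] by (simp add: algebra_simps)
    moreover have "sin \<phi> = sin ((\<phi> + \<theta>) - \<theta>)" by simp
    ultimately show ?thesis unfolding sin_add[of "\<phi> + \<theta>" \<theta>] sin_diff[of "\<phi> + \<theta>" \<theta>] by linarith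
  qed
  have 3: "sin (pi - 2 * \<theta> - \<phi> + \<theta>) = sin (\<phi> + \<theta>)" using sin_pi_minus[of "\<phi> + \<theta>"] by (simp add: algebra_simps)
  have "root_reflection g \<mu> (plane_root \<theta> \<nu> \<mu> \<phi>) = (sin (\<phi> + \<theta>) / sin \<theta>) *\<^sub>R \<nu> + (sin \<phi> / sin \<theta> + 2 * cos (\<phi> + \<theta>)) *\<^sub>R \<mu>"
    unfolding root_reflection_def plane_root_form[OF u s] by (simp add: plane_root_def algebra_simps)
  also have "sin \<phi> / sin \<theta> + 2 * cos (\<phi> + \<theta>) = sin (pi - 2 * \<theta> - \<phi>) / sin \<theta>" using s unfolding 2 by (simp add: field_simps)
  finally show "root_reflection g \<mu> (plane_root \<theta> \<nu> \<mu> \<phi>) = plane_root \<theta> \<nu> \<mu> (pi - 2 * \<theta> - \<phi>)"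
    by (simp only: plane_root_def 3)
qed

lemma plane_root_values:
  assumes "sin \<theta> \<noteq> 0"
  shows "plane_root \<theta> \<nu> \<mu> 0 = \<nu>" "plane_root \<theta> \<nu> \<mu> (pi - \<theta>) = \<mu>"
    "plane_root \<theta> \<nu> \<mu> (\<phi> + pi) = - plane_root \<theta> \<nu> \<mu> \<phi>" "plane_root \<theta> \<nu> \<mu> (\<phi> - pi) = - plane_root \<theta> \<nu> \<mu> \<phi>"
proof -
  have "sin (\<phi> + pi + \<theta>) = - sin (\<phi> + \<theta>)" "sin (\<phi> - pi + \<theta>) = - sin (\<phi> + \<theta>)" "sin (\<phi> - pi) = - sin \<phi>"
    using sin_periodic_pi[of "\<phi> + \<theta>"] sin_diff[of "\<phi> + \<theta>" pi] sin_diff[of \<phi> pi] by (simp_all add: algebra_simps)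
  then show "plane_root \<theta> \<nu> \<mu> 0 = \<nu>" "plane_root \<theta> \<nu> \<mu> (pi - \<theta>) = \<mu>"
    "plane_root \<theta> \<nu> \<mu> (\<phi> + pi) = - plane_root \<theta> \<nu> \<mu> \<phi>" "plane_root \<theta> \<nu> \<mu> (\<phi> - pi) = - plane_root \<theta> \<nu> \<mu> \<phi>"
    using assms by (simp_all add: plane_root_def)
qed

context chamber
begin

definition simple_at where "simple_at y = {\<nu>. simple \<nu> \<and> \<nu> \<bullet> y = 0}"

lemma simple_atD: "\<nu> \<in> simple_at y \<Longrightarrow> simple \<nu>" "\<nu> \<in> simple_at y \<Longrightarrow> \<nu> \<bullet> y = 0" "\<nu> \<in> simple_at y \<Longrightarrow> \<nu> \<in> R"
   "\<nu> \<in> simple_at y \<Longrightarrow> \<nu> \<in> Pos" "\<nu> \<in> simple_at y \<Longrightarrow> conormal_form g \<nu> \<nu> = 1"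
  by (auto simp: simple_at_def simpleD unit)

text \<open>
  Roots are never of mixed sign: test the combination at interior points of the two facets.
\<close>

lemma simple_combination_sign:
  assumes \<nu>: "simple \<nu>" and \<mu>: "simple \<mu>" and ne: "\<nu> \<noteq> \<mu>" and r: "a *\<^sub>R \<nu> + b *\<^sub>R \<mu> \<in> R" and b: "0 < b"
  shows "0 \<le> a"
proof -
  obtain z1 where z1: "\<nu> \<bullet> z1 = 0" "\<forall>\<mu>\<in>Pos. \<mu> \<noteq> \<nu> \<longrightarrow> 0 < \<mu> \<bullet> z1" using \<nu> unfolding simple_def by blast
  obtain z2 where z2: "\<mu> \<bullet> z2 = 0" "\<forall>\<nu>\<in>Pos. \<nu> \<noteq> \<mu> \<longrightarrow> 0 < \<nu> \<bullet> z2" using \<mu> unfolding simple_def by blast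
  let ?\<rho> = "a *\<^sub>R \<nu> + b *\<^sub>R \<mu>"
  have "0 < \<mu> \<bullet> z1" using z1(2) simpleD(1)[OF \<mu>] ne by metis
  then have p1: "0 < ?\<rho> \<bullet> z1" using z1(1) b by (simp add: inner_add_left)
  have "- ?\<rho> \<notin> Pos"
  proof
    assume "- ?\<rho> \<in> Pos"
    then have "- ?\<rho> \<bullet> z1 = 0 \<or> 0 < - ?\<rho> \<bullet> z1" using z1 by auto
    then show False using p1 unfolding inner_minus_left by linarith
  qed
  then have "?\<rho> \<in> Pos" using Pos_or_neg[OF r] by blast
  then have "0 \<le> ?\<rho> \<bullet> z2" using z2 by (metis less_eq_real_def)
  moreover have "0 < \<nu> \<bullet> z2" using z2(2) simpleD(1)[OF \<nu>] ne by blast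
  ultimately show ?thesis using z2(1) by (simp add: inner_add_left zero_le_mult_iff)
qed

text \<open>The product of the two reflections rotates the plane by \<open>2 \<theta>\<close>; the orbits of the two walls give all multiples of \<open>\<theta>\<close>.\<close>

lemma plane_roots:
  assumes \<nu>: "simple \<nu>" and \<mu>: "simple \<mu>" and form: "conormal_form g \<nu> \<mu> = - cos \<theta>" and s: "sin \<theta> \<noteq> 0"
  shows "plane_root \<theta> \<nu> \<mu> \<phi> \<in> R \<Longrightarrow> plane_root \<theta> \<nu> \<mu> (\<phi> + 2 * real k * \<theta>) \<in> R"
    and "plane_root \<theta> \<nu> \<mu> \<phi> \<in> R \<Longrightarrow> plane_root \<theta> \<nu> \<mu> (\<phi> - 2 * real k * \<theta>) \<in> R"
    and "plane_root \<theta> \<nu> \<mu> (real k * \<theta>) \<in> R"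
proof -
  have R: "\<nu> \<in> R" "\<mu> \<in> R" using \<nu> \<mu> simpleD by auto
  note refl = plane_root_reflection[OF unit[OF R(1)] unit[OF R(2)] form s]
  have 1: "plane_root \<theta> \<nu> \<mu> (pi - \<phi>) \<in> R" "plane_root \<theta> \<nu> \<mu> (pi - 2 * \<theta> - \<phi>) \<in> R" if "plane_root \<theta> \<nu> \<mu> \<phi> \<in> R" for \<phi>
    using closed_reflection[OF R(1) that] closed_reflection[OF R(2) that] unfolding refl by auto
  have 2: "plane_root \<theta> \<nu> \<mu> (\<phi> + 2 * \<theta>) \<in> R" "plane_root \<theta> \<nu> \<mu> (\<phi> - 2 * \<theta>) \<in> R" if "plane_root \<theta> \<nu> \<mu> \<phi> \<in> R" for \<phi>
    using 1(1)[OF 1(2)[OF that]] 1(2)[OF 1(1)[OF that]] by (simp_all add: algebra_simps)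
  show up: "plane_root \<theta> \<nu> \<mu> (\<phi> + 2 * real k * \<theta>) \<in> R" if "plane_root \<theta> \<nu> \<mu> \<phi> \<in> R" for k \<phi>
    by (induction k) (use that 2(1) in \<open>fastforce simp: algebra_simps\<close>)+
  show "plane_root \<theta> \<nu> \<mu> (\<phi> - 2 * real k * \<theta>) \<in> R" if "plane_root \<theta> \<nu> \<mu> \<phi> \<in> R" for k \<phi>
    by (induction k) (use that 2(2) in \<open>fastforce simp: algebra_simps\<close>)+
  have "plane_root \<theta> \<nu> \<mu> \<theta> \<in> R" using 1(1)[of "pi - \<theta>"] R(2) plane_root_values(2)[OF s, of \<nu> \<mu>] by simp
  then have odd: "plane_root \<theta> \<nu> \<mu> (\<theta> + 2 * real k * \<theta>) \<in> R" for k using up by blast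
  have even: "plane_root \<theta> \<nu> \<mu> (2 * real k * \<theta>) \<in> R" for k using up[of 0 k] R(1) plane_root_values(1)[OF s, of \<nu> \<mu>] by simp
  show "plane_root \<theta> \<nu> \<mu> (real k * \<theta>) \<in> R"
  proof (cases "even k")
    case True
    then obtain j where "k = 2 * j" by (rule evenE)
    then show ?thesis using even[of j] by simp
  next
    case False
    then obtain j where "k = 2 * j + 1" by (rule oddE)
    then show ?thesis using odd[of j] by (simp add: algebra_simps)
  qed
qed

lemma plane_root_sign:
  assumes \<nu>: "simple \<nu>" and \<mu>: "simple \<mu>" and ne: "\<nu> \<noteq> \<mu>" and s: "0 < sin \<theta>" and r: "plane_root \<theta> \<nu> \<mu> \<phi> \<in> R"
  shows "0 < sin \<phi> \<Longrightarrow> 0 \<le> sin (\<phi> + \<theta>)" "sin \<phi> < 0 \<Longrightarrow> sin (\<phi> + \<theta>) \<le> 0"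
proof -
  show "0 \<le> sin (\<phi> + \<theta>)" if "0 < sin \<phi>"
    using simple_combination_sign[OF \<nu> \<mu> ne r[unfolded plane_root_def]] that s by (simp add: zero_le_divide_iff)
  have "- plane_root \<theta> \<nu> \<mu> \<phi> \<in> R" using neg_root r by blast
  then have "(- sin (\<phi> + \<theta>) / sin \<theta>) *\<^sub>R \<nu> + (- sin \<phi> / sin \<theta>) *\<^sub>R \<mu> \<in> R" by (simp add: plane_root_def)
  from simple_combination_sign[OF \<nu> \<mu> ne this] show "sin (\<phi> + \<theta>) \<le> 0" if "sin \<phi> < 0"
    using that s by (simp add: zero_le_divide_iff divide_less_0_iff divide_le_0_iff)
qed

text \<open>
  The roots of the plane at the angles \<open>k \<theta>\<close> are never of mixed sign, so the multiples of the dihedral angle \<open>\<theta>\<close> cannot jump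
  over \<open>\<pi>\<close>: some multiple is equal to it.
\<close>

lemma simple_pair_angle:
  assumes y: "y \<in> space_form g" and \<nu>: "\<nu> \<in> simple_at y" and \<mu>: "\<mu> \<in> simple_at y" and ne: "\<nu> \<noteq> \<mu>"
  obtains m :: nat where "2 \<le> m" "conormal_form g \<nu> \<mu> = - cos (pi / m)" "0 < sin (pi / m)"
proof -
  let ?\<theta> = "arccos (- conormal_form g \<nu> \<mu>)"
  have "\<nu> \<noteq> - \<mu>" using simple_atD(4)[OF \<nu>] simple_atD(4)[OF \<mu>] by (auto simp: Pos_def)
  then have "\<bar>conormal_form g \<nu> \<mu>\<bar> < 1" using \<nu> \<mu> ne by (intro unit_form_less_1[OF y]) (auto simp: simple_atD)
  then have \<theta>: "0 < ?\<theta>" "?\<theta> < pi" "conormal_form g \<nu> \<mu> = - cos ?\<theta>"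
    using arccos_lt_bounded[of "- conormal_form g \<nu> \<mu>"] by auto
  have s: "0 < sin ?\<theta>" using \<theta> by (intro sin_gt_zero)
  obtain N :: nat where N: "pi / ?\<theta> < real N" using reals_Archimedean2 by blast
  define k where "k = (LEAST k. pi \<le> real k * ?\<theta>)"
  have "pi \<le> real N * ?\<theta>" using N \<theta>(1) by (simp add: field_simps)
  then have k: "pi \<le> real k * ?\<theta>" unfolding k_def by (rule LeastI)
  have less: "real j * ?\<theta> < pi" if "j < k" for j using not_less_Least[OF that[unfolded k_def]] by simp
  have "2 \<le> k"
  proof (rule ccontr)
    assume "\<not> 2 \<le> k"
    then have "real k * ?\<theta> \<le> 1 * ?\<theta>" using \<theta>(1) by (intro mult_right_mono) auto
    then show False using k \<theta>(2) by simp
  qed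
  define j where "j = k - 1"
  have j: "k = Suc j" "1 \<le> j" using \<open>2 \<le> k\<close> by (auto simp: j_def)
  have jl: "real j * ?\<theta> < pi" "0 < real j * ?\<theta>" using less[of j] j \<theta>(1) by auto
  have "0 \<le> sin (real j * ?\<theta> + ?\<theta>)"
    using plane_root_sign(1)[OF simple_atD(1)[OF \<nu>] simple_atD(1)[OF \<mu>] ne s plane_roots(3)[OF simple_atD(1)[OF \<nu>] simple_atD(1)[OF \<mu>] \<theta>(3)]]
      sin_gt_zero[OF jl(2,1)] s by simp
  moreover have "real j * ?\<theta> + ?\<theta> = real k * ?\<theta>" by (simp add: j algebra_simps)
  ultimately have "0 \<le> sin (real k * ?\<theta>)" by simp
  moreover have "real k * ?\<theta> < 2 * pi" using jl(1) \<theta>(2) j by (simp add: algebra_simps)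
  ultimately have "real k * ?\<theta> = pi" using k sin_lt_zero[of "real k * ?\<theta>"] by fastforce
  then have "?\<theta> = pi / real k" using \<open>2 \<le> k\<close> by (simp add: field_simps)
  then show thesis using that[of k] \<open>2 \<le> k\<close> \<theta>(3) s by simp
qed

lemma plane_root_at: "\<nu> \<bullet> y = 0 \<Longrightarrow> \<mu> \<bullet> y = 0 \<Longrightarrow> plane_root \<theta> \<nu> \<mu> \<phi> \<bullet> y = 0"
  by (simp add: plane_root_def inner_add_left)

text \<open>
  For \<open>m = 2 k\<close> the root at the angle \<open>k \<pi> / m\<close> is perpendicular to the first wall.
\<close>

lemma even_angle_perpendicular:
  assumes \<nu>: "\<nu> \<in> simple_at y" and \<mu>: "\<mu> \<in> simple_at y"
    and m: "2 \<le> m" "even m" "conormal_form g \<nu> \<mu> = - cos (pi / real m)" "0 < sin (pi / real m)"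
  shows "\<exists>\<beta>\<in>R. \<beta> \<bullet> y = 0 \<and> conormal_form g \<nu> \<beta> = 0"
proof -
  obtain k where k: "m = 2 * k" using m(2) by (rule evenE)
  let ?\<beta> = "plane_root (pi / real m) \<nu> \<mu> (real k * (pi / real m))"
  have s: "sin (pi / real m) \<noteq> 0" using m(4) by simp
  have "?\<beta> \<in> R" using plane_roots(3)[OF simple_atD(1)[OF \<nu>] simple_atD(1)[OF \<mu>] m(3) s] .
  moreover have right: "real k * (pi / real m) = pi / 2" using m(1) k by simp
  have "conormal_form g \<nu> ?\<beta> = 0"
    unfolding plane_root_form(1)[OF simple_atD(5)[OF \<nu>] simple_atD(5)[OF \<mu>] m(3) s] right by simp
  ultimately show ?thesis using plane_root_at[OF simple_atD(2)[OF \<nu>] simple_atD(2)[OF \<mu>]] by blast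
qed

text \<open>
  For \<open>m = 2 k + 1\<close> the root at the angle \<open>k \<pi> / m\<close> is a multiple of \<open>\<nu> + \<mu>\<close>, because \<open>\<mu>\<close> sits at the
  angle \<open>2 k \<pi> / m\<close>. Its reflection interchanges the two walls.
\<close>

lemma odd_angle_bisector:
  assumes \<nu>: "\<nu> \<in> simple_at y" and \<mu>: "\<mu> \<in> simple_at y"
    and m: "2 \<le> m" "odd m" "conormal_form g \<nu> \<mu> = - cos (pi / real m)" "0 < sin (pi / real m)"
  shows "\<exists>\<sigma>\<in>R. \<sigma> \<bullet> y = 0 \<and> root_reflection g \<sigma> \<nu> = - \<mu> \<and> root_reflection g \<sigma> \<mu> = - \<nu>"
proof -
  obtain k where k: "m = 2 * k + 1" using m(2) by (rule oddE)
  let ?\<theta> = "pi / real m" let ?\<phi> = "real k * ?\<theta>"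
  let ?\<sigma> = "plane_root ?\<theta> \<nu> \<mu> ?\<phi>"
  have s: "sin ?\<theta> \<noteq> 0" using m(4) by simp
  note form = plane_root_form[OF simple_atD(5)[OF \<nu>] simple_atD(5)[OF \<mu>] m(3) s]
  have "real m * ?\<theta> = pi" using m(1) by simp
  moreover have "real m * t = real k * t + t + real k * t" for t by (simp add: k algebra_simps)
  ultimately have "pi = ?\<phi> + ?\<theta> + ?\<phi>" by metis
  moreover have solve: "x + y = p - x" if "p = x + y + x" for x y p :: real using that by simp
  ultimately have mid: "?\<phi> + ?\<theta> = pi - ?\<phi>" by (intro solve)
  have solve2: "x + x = p - y" if "x + y = p - x" for x y p :: real using that by simp
  have "sin (?\<phi> + ?\<phi>) = sin ?\<theta>" unfolding solve2[OF mid] by (rule sin_pi_minus)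
  moreover have "2 * cos x * (sin x / sin t) = 1" if "sin (x + x) = sin t" "sin t \<noteq> 0" for x t :: real
    using that(2) unfolding that(1)[symmetric] sin_add by (simp add: field_simps)
  ultimately have "2 * cos ?\<phi> * (sin ?\<phi> / sin ?\<theta>) = 1" using s by blast
  then have two: "(2 * cos ?\<phi>) *\<^sub>R ?\<sigma> = \<nu> + \<mu>"
  proof -
    have eq: "sin (?\<phi> + ?\<theta>) = sin ?\<phi>" unfolding mid by (rule sin_pi_minus)
    show ?thesis
      unfolding plane_root_def eq scaleR_add_right scaleR_scaleR \<open>2 * cos ?\<phi> * (sin ?\<phi> / sin ?\<theta>) = 1\<close> by simp
  qed
  have "conormal_form g ?\<sigma> \<nu> = cos ?\<phi>" "conormal_form g ?\<sigma> \<mu> = cos ?\<phi>"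
    unfolding conormal_form_commute[of g ?\<sigma>] form mid by simp_all
  then have "root_reflection g ?\<sigma> \<nu> = - \<mu>" "root_reflection g ?\<sigma> \<mu> = - \<nu>"
    unfolding root_reflection_def using two by simp_all
  moreover have "?\<sigma> \<in> R" using plane_roots(3)[OF simple_atD(1)[OF \<nu>] simple_atD(1)[OF \<mu>] m(3) s] .
  ultimately show ?thesis using plane_root_at[OF simple_atD(2)[OF \<nu>] simple_atD(2)[OF \<mu>]] by blast
qed

text \<open>
  If the label is odd, no root of the plane is perpendicular to a wall: rotating it by a suitable
  even multiple of \<open>\<theta>\<close> would produce, up to sign, the root at angle \<open>- \<theta> / 2\<close>, which is of mixed sign.
\<close>

lemma odd_angle_no_perpendicular:
  assumes \<nu>: "\<nu> \<in> simple_at y" and \<mu>: "\<mu> \<in> simple_at y" and ne: "\<nu> \<noteq> \<mu>"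
    and m: "2 \<le> m" "odd m" "conormal_form g \<nu> \<mu> = - cos (pi / real m)" "0 < sin (pi / real m)"
    and \<beta>: "\<beta> \<in> R" "\<beta> = a *\<^sub>R \<nu> + b *\<^sub>R \<mu>" "conormal_form g \<nu> \<beta> = 0"
  shows False
proof -
  let ?\<theta> = "pi / real m" let ?pr = "plane_root ?\<theta> \<nu> \<mu>"
  have u: "conormal_form g \<nu> \<nu> = 1" "conormal_form g \<mu> \<mu> = 1" using \<nu> \<mu> simple_atD by auto
  have s: "sin ?\<theta> \<noteq> 0" using m(4) by simp
  have a: "a = b * cos ?\<theta>" using \<beta>(3) m(3) u unfolding \<beta>(2) by (simp add: conormal_form_simps)
  have "conormal_form g \<mu> \<nu> = - cos ?\<theta>" using m(3) conormal_form_commute by metis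
  then have "1 = a * a - 2 * a * b * cos ?\<theta> + b * b"
    using unit[OF \<beta>(1)] u m(3) unfolding \<beta>(2) by (simp add: conormal_form_simps algebra_simps)
  also have "\<dots> = b\<^sup>2 * (1 - (cos ?\<theta>)\<^sup>2)" unfolding a by (simp add: power2_eq_square algebra_simps)
  also have "\<dots> = (b * sin ?\<theta>)\<^sup>2" by (simp add: sin_squared_eq power_mult_distrib)
  finally have "b * sin ?\<theta> = 1 \<or> b * sin ?\<theta> = -1" by (metis power2_eq_1_iff)
  then have "b = 1 / sin ?\<theta> \<or> b = - 1 / sin ?\<theta>" using s by (auto simp: field_simps)
  moreover have pr90: "?pr (pi / 2) = (cos ?\<theta> / sin ?\<theta>) *\<^sub>R \<nu> + (1 / sin ?\<theta>) *\<^sub>R \<mu>" by (simp add: plane_root_def sin_add)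
  ultimately have "\<beta> = ?pr (pi / 2) \<or> \<beta> = - ?pr (pi / 2)" unfolding \<beta>(2) a by (auto simp: pr90)
  \<comment> \<open>a unit covector of the plane perpendicular to \<open>\<nu>\<close> is at a right angle from it\<close>
  then have pR: "?pr (pi / 2) \<in> R" using \<beta>(1) neg_root by fastforce
  obtain h where h: "m = 2 * h + 1" using m(2) by (rule oddE)
  have m\<theta>: "real m * ?\<theta> = pi" using m(1) by simp
  have half: "0 < ?\<theta> / 2" "?\<theta> / 2 < pi" using m(1) by (auto simp: field_simps intro: less_le_trans[of pi "pi * 2"])
  then have sh: "0 < sin (?\<theta> / 2)" by (intro sin_gt_zero)
  \<comment> \<open>with \<open>m = 2 h + 1\<close> one has \<open>\<pi> / 2 = (h + 1 / 2) \<theta>\<close>, so \<open>\<pi> / 2\<close> and \<open>- \<theta> / 2\<close> differ by \<open>(h + 1) \<theta>\<close>; if \<open>h + 1\<close> is odd, \<open>\<pi> = m \<theta>\<close> is added\<close>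
  have key: "?pr (- (?\<theta> / 2)) \<in> R"
  proof (cases "odd h")
    case True
    then obtain l where l: "h + 1 = 2 * l" by (metis evenE odd_even_add odd_one)
    have "pi / 2 - 2 * real l * ?\<theta> = - (?\<theta> / 2)"
    proof -
      have "real h + 1 = 2 * real l" using l by linarith
      then have "2 * real l * ?\<theta> = (real h + 1) * ?\<theta>" by simp
      moreover have "pi = (2 * real h + 1) * ?\<theta>" using m\<theta> unfolding h by (simp only: of_nat_add of_nat_mult of_nat_numeral of_nat_1)
      moreover have "pi / 2 - x = - (t / 2)" if "x = (real h + 1) * t" "pi = (2 * real h + 1) * t" for x t
        using that by (simp add: algebra_simps)
      ultimately show ?thesis by blast
    qed
    then show ?thesis using plane_roots(2)[OF simple_atD(1)[OF \<nu>] simple_atD(1)[OF \<mu>] m(3) s pR, of l] by simp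
  next
    case False
    then have "even (h + 1 + m)" using m(2) by simp
    then obtain l where l: "h + 1 + m = 2 * l" by (rule evenE)
    have "pi / 2 - 2 * real l * ?\<theta> = - (?\<theta> / 2) - pi"
    proof -
      have "real h + 1 + real m = 2 * real l" using l by linarith
      then have "2 * real l * ?\<theta> = (real h + 1) * ?\<theta> + real m * ?\<theta>" by (metis distrib_right)
      moreover have "pi = (2 * real h + 1) * ?\<theta>" using m\<theta> unfolding h by (simp only: of_nat_add of_nat_mult of_nat_numeral of_nat_1)
      moreover have "pi / 2 - x = - (t / 2) - pi" if "x = (real h + 1) * t + pi" "pi = (2 * real h + 1) * t" for x t
        using that by (simp add: algebra_simps)
      ultimately show ?thesis using m\<theta> by metis
    qed
    then have "?pr (- (?\<theta> / 2) - pi) \<in> R"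
      using plane_roots(2)[OF simple_atD(1)[OF \<nu>] simple_atD(1)[OF \<mu>] m(3) s pR, of l] by simp
    then have "- ?pr (- (?\<theta> / 2)) \<in> R" unfolding plane_root_values(4)[OF s] .
    then show ?thesis using neg_root by fastforce
  qed
  have "sin (- (?\<theta> / 2)) < 0" using sh by simp
  then have "sin (- (?\<theta> / 2) + ?\<theta>) \<le> 0" using plane_root_sign(2)[OF simple_atD(1)[OF \<nu>] simple_atD(1)[OF \<mu>] ne m(4) key] by blast
  moreover have "- (?\<theta> / 2) + ?\<theta> = ?\<theta> / 2" by simp
  ultimately show False using sh by (metis not_le)
qed

subsection \<open>Every mirror through a point is conjugate to a wall through it\<close>

lemma finite_roots_at: "y \<in> space_form g \<Longrightarrow> finite {\<mu>\<in>R. \<mu> \<bullet> y = 0}"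
  using locally_finite[of "{y}"] by simp

lemma finite_simple_at: "y \<in> space_form g \<Longrightarrow> finite (simple_at y)"
  by (rule finite_subset[OF _ finite_roots_at]) (auto simp: simple_atD)

lemma word_at_fixes: "set ws \<subseteq> simple_at y \<Longrightarrow> word_map ws y = y"
  by (induction ws) (auto simp: reflection_eq simple_atD)

lemma word_at_W: "set ws \<subseteq> simple_at y \<Longrightarrow> word_map ws \<in> W"
  by (rule word_W) (auto simp: simple_atD)

text \<open>
  A point near \<open>y\<close> that lies on the given mirror and on no other is moved into the chamber by
  reflections in walls through \<open>y\<close>; there the mirror has become a wall.
\<close>

lemma root_at_conjugate_to_simple:
  assumes y: "y \<in> Ch" and \<alpha>: "\<alpha> \<in> R" "\<alpha> \<bullet> y = 0"
  obtains ws \<nu> where "set ws \<subseteq> simple_at y" "\<nu> \<in> simple_at y"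
    "adjoint (word_map ws) \<nu> = \<alpha> \<or> adjoint (word_map ws) \<nu> = - \<alpha>"
proof -
  have yS: "y \<in> space_form g" using ChD(1) y .
  let ?A = "{\<mu>\<in>R. \<mu> \<bullet> y = 0 \<and> \<mu> \<noteq> \<alpha> \<and> \<mu> \<noteq> - \<alpha>}"
  \<comment> \<open>the generic direction \<open>d\<close> is looked for in the kernel of \<open>\<alpha>\<close>, onto which all covectors are projected\<close>
  let ?p = "\<lambda>\<mu>. \<mu> - (\<mu> \<bullet> \<alpha> / (\<alpha> \<bullet> \<alpha>)) *\<^sub>R \<alpha>"
  have finA: "finite ?A" by (rule finite_subset[OF _ finite_roots_at[OF yS]]) blast
  have "0 \<notin> ?p ` ?A"
  proof
    assume "0 \<in> ?p ` ?A"
    then obtain \<mu> where \<mu>: "\<mu> \<in> ?A" "0 = ?p \<mu>" by (rule imageE)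
    then have "\<mu> = (\<mu> \<bullet> \<alpha> / (\<alpha> \<bullet> \<alpha>)) *\<^sub>R \<alpha>" by simp
    then have "\<mu> = \<alpha> \<or> \<mu> = - \<alpha>" using unit_covector_multiple[OF unit unit] \<mu>(1) \<alpha>(1) by blast
    then show False using \<mu>(1) by blast
  qed
  then obtain d' where d': "\<forall>b\<in>?p ` ?A. b \<bullet> d' \<noteq> 0" using finite_avoid_hyperplanes finA by blast
  define d where "d = d' - (\<alpha> \<bullet> d' / (\<alpha> \<bullet> \<alpha>)) *\<^sub>R \<alpha>"
  have \<alpha>d: "\<alpha> \<bullet> d = 0" using root_nonzero[OF \<alpha>(1)] by (simp add: d_def inner_diff_right)
  have \<mu>d: "\<mu> \<bullet> d \<noteq> 0" if "\<mu> \<in> ?A" for \<mu>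
  proof -
    have "\<mu> \<bullet> d = ?p \<mu> \<bullet> d'" by (simp add: d_def inner_diff_right inner_diff_left)
    moreover have "?p \<mu> \<bullet> d' \<noteq> 0" using d' that by blast
    ultimately show ?thesis by (simp only: not_False_eq_True)
  qed
  obtain e where e: "0 < e" "\<And>\<nu> p. \<nu> \<in> R \<Longrightarrow> 0 < \<nu> \<bullet> y \<Longrightarrow> p \<in> space_form g \<Longrightarrow> p \<in> ball y e \<Longrightarrow> 0 < \<nu> \<bullet> p"
    using sign_stable[OF yS] by blast
  obtain e' where e': "0 < e'" "\<And>\<epsilon>. \<bar>\<epsilon>\<bar> < e' \<Longrightarrow> y + \<epsilon> *\<^sub>R d \<in> cone_over g \<and> radial g (y + \<epsilon> *\<^sub>R d) \<in> ball y e \<inter> space_form g"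
    using radial_perturbation[OF yS open_ball, of y e d] e(1) by (metis centre_in_ball)
  define v where "v = y + (e' / 2) *\<^sub>R d"
  have v: "v \<in> cone_over g" "radial g v \<in> ball y e" "radial g v \<in> space_form g" using e'(2)[of "e' / 2"] e'(1) by (auto simp: v_def)
  define x where "x = radial g v"
  have \<alpha>x: "\<alpha> \<bullet> x = 0" unfolding x_def inner_radial_sign(3)[OF v(1)] using \<alpha>(2) \<alpha>d by (simp add: v_def inner_add_right)
  have only: "\<mu> = \<alpha> \<or> \<mu> = - \<alpha>" if \<mu>: "\<mu> \<in> R" "\<mu> \<bullet> x = 0" for \<mu>
  proof (rule ccontr)
    assume ne: "\<not> ?thesis"
    show False
    proof (cases "\<mu> \<bullet> y = 0")
      case True
      then have "\<mu> \<bullet> v \<noteq> 0" using \<mu>d[of \<mu>] ne \<mu>(1) e'(1) by (simp add: v_def inner_add_right)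
      then show False using \<mu>(2) inner_radial_sign(3)[OF v(1)] unfolding x_def by blast
    next
      case False
      then consider "0 < \<mu> \<bullet> y" | "0 < - \<mu> \<bullet> y" by (metis inner_minus_left linorder_neqE_linordered_idom neg_0_less_iff_less)
      then show False
      proof cases
        case 1
        then show False using e(2)[OF \<mu>(1) 1 v(3,2)] \<mu>(2) by (simp add: x_def)
      next
        case 2
        then show False using e(2)[OF neg_root[OF \<mu>(1)] 2 v(3,2)] \<mu>(2) by (simp add: x_def)
      qed
    qed
  qed
  \<comment> \<open>as long as no mirror off \<open>y\<close> is crossed, only walls through \<open>y\<close> are used\<close>
  define H where "H x' \<longleftrightarrow> (\<forall>\<nu>\<in>Pos. 0 < \<nu> \<bullet> y \<longrightarrow> 0 < \<nu> \<bullet> x')" for x'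
  have Hx: "H x" unfolding H_def x_def using e(2) v(2,3) PosD(1) by blast
  have step: "a \<in> simple_at y \<and> H (reflection g a x')" if *: "x' \<in> space_form g" "H x'" "simple a" "a \<bullet> x' < 0" for x' a
  proof -
    have aP: "a \<in> Pos" using simpleD(1)[OF *(3)] .
    have "\<not> 0 < a \<bullet> y" using *(2,4) aP unfolding H_def by fastforce
    then have ay: "a \<bullet> y = 0" using ChD(2)[OF y aP] by simp
    have "0 < \<nu> \<bullet> reflection g a x'" if \<nu>: "\<nu> \<in> Pos" "0 < \<nu> \<bullet> y" for \<nu>
    proof -
      have u: "conormal_form g a a = 1" using unit[OF PosD(1)[OF aP]] .
      have "\<nu> \<noteq> a" using \<nu>(2) ay by auto
      then have "root_reflection g a \<nu> \<in> Pos" using simple_reflection_positive(1)[OF *(3) \<nu>(1)] by blast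
      moreover have "reflection g a y = y" using ay by (simp add: reflection_eq)
      then have "0 < root_reflection g a \<nu> \<bullet> y" using inner_reflection[OF u, of \<nu> y] \<nu>(2) by simp
      ultimately have "0 < root_reflection g a \<nu> \<bullet> x'" using *(2) unfolding H_def by blast
      then show ?thesis using inner_reflection[OF u, of \<nu> x'] by simp
    qed
    then show ?thesis using *(3) ay unfolding H_def simple_at_def by blast
  qed
  obtain ws where ws: "set ws \<subseteq> simple_at y" "word_map ws x \<in> Ch"
    using descend[of x H "simple_at y"] v(3) Hx step unfolding x_def by (metis le_inf_iff)
  define w where "w = word_map ws"
  have wW: "w \<in> W" unfolding w_def using word_at_W[OF ws(1)] .
  obtain w' where w': "w' \<in> W" "w' \<circ> w = id" "w \<circ> w' = id" using inverse_W[OF wW] by blast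
  have wy: "w y = y" unfolding w_def using word_at_fixes[OF ws(1)] .
  have w'w: "w' (w q) = q" for q using w'(2) by (metis comp_apply id_apply)
  have ad: "adjoint w' (adjoint w \<mu>) = \<mu>" "adjoint w (adjoint w' \<mu>) = \<mu>" for \<mu>
    using adjoint_comp_W[OF wW w'(1), of \<mu>] adjoint_comp_W[OF w'(1) wW, of \<mu>] w' by (simp_all add: adjoint_id)
  have adneg: "adjoint u (- \<mu>) = - adjoint u \<mu>" if "u \<in> W" for u \<mu>
    using adjoint_linear[OF linear_W[OF that]] linear_neg by blast
  define \<alpha>' where "\<alpha>' = adjoint w' \<alpha>"
  have \<alpha>'R: "\<alpha>' \<in> R" unfolding \<alpha>'_def using adjoint_W_root[OF w'(1) \<alpha>(1)] .
  have \<alpha>'z: "\<alpha>' \<bullet> w x = 0" using inner_W[OF w'(1), of \<alpha> "w x"] \<alpha>x w'w by (simp add: \<alpha>'_def)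
  have \<alpha>'y: "\<alpha>' \<bullet> y = 0" using inner_W[OF w'(1), of \<alpha> y] \<alpha>(2) w'w[of y] wy by (simp add: \<alpha>'_def)
  obtain \<nu> where \<nu>: "\<nu> \<in> Pos" "\<nu> = \<alpha>' \<or> \<nu> = - \<alpha>'" using Pos_or_neg[OF \<alpha>'R] by blast
  have "0 < \<mu> \<bullet> w x" if \<mu>: "\<mu> \<in> Pos" "\<mu> \<noteq> \<nu>" for \<mu>
  proof (rule ccontr)
    assume "\<not> ?thesis"
    then have "\<mu> \<bullet> w x = 0" using ChD(2)[OF ws(2) \<mu>(1)] by (simp add: w_def)
    then have "adjoint w \<mu> \<bullet> x = 0" using inner_W[OF wW] by simp
    then have "adjoint w \<mu> = \<alpha> \<or> adjoint w \<mu> = - \<alpha>" using only adjoint_W_root[OF wW PosD(1)[OF \<mu>(1)]] by blast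
    then have "\<mu> = \<alpha>' \<or> \<mu> = - \<alpha>'" using ad(1)[of \<mu>] adneg[OF w'(1)] unfolding \<alpha>'_def by metis
    then have "\<mu> = - \<nu>" using \<nu>(2) \<mu>(2) by auto
    then show False using PosD(2)[OF \<mu>(1)] PosD(2)[OF \<nu>(1)] by simp
  qed
  then have "simple \<nu>" unfolding simple_def
    using \<nu> \<alpha>'z ChD(1)[OF ws(2)] unfolding w_def by (intro conjI bexI[of _ "word_map ws x"]) auto
  then have "\<nu> \<in> simple_at y" using \<nu>(2) \<alpha>'y by (auto simp: simple_at_def)
  moreover have "adjoint w \<nu> = \<alpha> \<or> adjoint w \<nu> = - \<alpha>" using \<nu>(2) ad(2)[of \<alpha>] adneg[OF wW] unfolding \<alpha>'_def by metis
  ultimately show thesis using that[OF ws(1)] unfolding w_def by blast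
qed

lemma simple_at_nonempty: "y \<in> Ch \<Longrightarrow> y \<notin> Ch_int \<Longrightarrow> simple_at y \<noteq> {}"
proof -
  assume y: "y \<in> Ch" "y \<notin> Ch_int"
  then obtain \<alpha> where \<alpha>: "\<alpha> \<in> Pos" "\<not> 0 < \<alpha> \<bullet> y" using ChD(1)[OF y(1)] unfolding Ch_int_def by blast
  then have "\<alpha> \<bullet> y = 0" using ChD(2)[OF y(1) \<alpha>(1)] by simp
  then show ?thesis using root_at_conjugate_to_simple[OF y(1) PosD(1)[OF \<alpha>(1)]] by blast
qed

text \<open>
  The walls through a point are linearly independent, because their pairwise products are not
  positive while all of them are positive on the interior of the chamber.
\<close>

lemma simple_at_independent:
  assumes y: "y \<in> space_form g" shows "independent (simple_at y)"
proof (rule ccontr)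
  let ?A = "simple_at y"
  have fin: "finite ?A" using finite_simple_at[OF y] .
  assume "\<not> independent ?A"
  then obtain k \<nu>0 where k: "\<nu>0 \<in> ?A" "k \<nu>0 \<noteq> 0" "(\<Sum>\<nu>\<in>?A. k \<nu> *\<^sub>R \<nu>) = 0"
    unfolding dependent_finite[OF fin] by blast
  let ?P = "{\<nu>\<in>?A. 0 < k \<nu>}" let ?M = "{\<nu>\<in>?A. k \<nu> \<le> 0}"
  define s where "s = (\<Sum>\<nu>\<in>?P. k \<nu> *\<^sub>R \<nu>)"
  define t where "t = (\<Sum>\<nu>\<in>?M. (- k \<nu>) *\<^sub>R \<nu>)"
  have "(\<Sum>\<nu>\<in>?A. k \<nu> *\<^sub>R \<nu>) = s + (\<Sum>\<nu>\<in>?M. k \<nu> *\<^sub>R \<nu>)" unfolding s_def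
    by (subst sum.union_disjoint[symmetric]) (use fin in \<open>auto intro!: sum.cong\<close>)
  moreover have "t = - (\<Sum>\<nu>\<in>?M. k \<nu> *\<^sub>R \<nu>)" unfolding t_def by (simp add: sum_negf)
  ultimately have "s - t = 0" using k(3) by (simp only: diff_minus_eq_add)
  then have st: "s = t" by simp
  have "conormal_form g s t = (\<Sum>\<nu>\<in>?P. \<Sum>\<mu>\<in>?M. k \<nu> * (- k \<mu> * conormal_form g \<nu> \<mu>))"
  proof -
    have finP: "finite ?P" and finM: "finite ?M" using fin by simp_all
    show ?thesis
      unfolding s_def t_def conormal_form_sum[OF finP] conormal_form_simps(5) conormal_form_sum2[OF finM]
        conormal_form_simps(6) sum_distrib_left
      by (subst sum.swap) (rule sum.cong[OF HOL.refl], rule sum.cong[OF HOL.refl], simp)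
  qed
  also have "\<dots> \<le> 0"
  proof (intro sum_nonpos)
    fix \<nu> \<mu> assume \<nu>: "\<nu> \<in> ?P" and \<mu>: "\<mu> \<in> ?M"
    then have ne: "\<nu> \<noteq> \<mu>" by auto
    obtain m :: nat where m: "2 \<le> m" "conormal_form g \<nu> \<mu> = - cos (pi / m)"
      using simple_pair_angle[OF y _ _ ne] \<nu> \<mu> by blast
    have "pi / m \<le> pi / 2" using m(1) by (intro divide_left_mono) auto
    moreover have "0 \<le> pi / m" by simp
    ultimately have "0 \<le> cos (pi / m)" using pi_ge_zero by (intro cos_ge_zero) linarith+
    then have "conormal_form g \<nu> \<mu> \<le> 0" using m by simp
    then have "0 \<ge> - k \<mu> * conormal_form g \<nu> \<mu>" using \<mu> by (simp add: mult_nonpos_nonpos)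
    then show "k \<nu> * (- k \<mu> * conormal_form g \<nu> \<mu>) \<le> 0" using \<nu> by (simp add: mult_nonneg_nonpos)
  qed
  finally have le: "conormal_form g s s \<le> 0" using st by simp
  have "s \<bullet> y = 0" unfolding s_def by (simp add: inner_sum_left simple_atD)
  then have "s = 0" using le conormal_form_pos_at_point[OF y] by (meson not_le)
  then have 0: "s \<bullet> c = 0" "t \<bullet> c = 0" using st by auto
  have pos: "0 < \<nu> \<bullet> c" if "\<nu> \<in> ?A" for \<nu> using PosD(2)[OF simple_atD(4)[OF that]] .
  have "(\<Sum>\<nu>\<in>?P. k \<nu> * (\<nu> \<bullet> c)) = 0" "(\<Sum>\<nu>\<in>?M. (- k \<nu>) * (\<nu> \<bullet> c)) = 0"
    using 0 unfolding s_def t_def by (simp_all add: inner_sum_left)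
  moreover have "\<forall>\<nu>\<in>?P. 0 \<le> k \<nu> * (\<nu> \<bullet> c)" "\<forall>\<nu>\<in>?M. 0 \<le> (- k \<nu>) * (\<nu> \<bullet> c)"
    using pos by (auto intro!: mult_nonneg_nonneg simp: less_imp_le mult_le_0_iff)
  moreover have "finite ?P" "finite ?M" using fin by simp_all
  ultimately have "\<forall>\<nu>\<in>?P. k \<nu> * (\<nu> \<bullet> c) = 0" "\<forall>\<nu>\<in>?M. (- k \<nu>) * (\<nu> \<bullet> c) = 0"
    using sum_nonneg_eq_0_iff[of ?P "\<lambda>\<nu>. k \<nu> * (\<nu> \<bullet> c)"] sum_nonneg_eq_0_iff[of ?M "\<lambda>\<nu>. (- k \<nu>) * (\<nu> \<bullet> c)"]
    by blast+
  note zero = this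
  have "k \<nu>0 * (\<nu>0 \<bullet> c) = 0"
  proof (cases "0 < k \<nu>0")
    case True
    then have "\<nu>0 \<in> ?P" using k(1) by simp
    then show ?thesis by (rule bspec[OF zero(1)])
  next
    case False
    then have "\<nu>0 \<in> ?M" using k(1) by simp
    then have "(- k \<nu>0) * (\<nu>0 \<bullet> c) = 0" by (rule bspec[OF zero(2)])
    then show ?thesis by simp
  qed
  then show False using k(2) pos[OF k(1)] by simp
qed

text \<open>
  By independence of the walls through \<open>y\<close> a direction can be chosen along the intersection of two of them and into the positive side of the others.
\<close>

lemma simple_pair_direction:
  assumes y: "y \<in> space_form g" and \<nu>: "\<nu> \<in> simple_at y" "\<mu> \<in> simple_at y"
  obtains v where "\<nu> \<bullet> v = 0" "\<mu> \<bullet> v = 0" "\<forall>\<tau>\<in>simple_at y - {\<nu>, \<mu>}. 0 < \<tau> \<bullet> v"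
proof -
  obtain f :: "'a \<times> real \<Rightarrow> real" where f: "linear f" "\<forall>\<tau>\<in>simple_at y. f \<tau> = (if \<tau> = \<nu> \<or> \<tau> = \<mu> then 0 else 1)"
    using linear_independent_extend[OF simple_at_independent[OF y], of "\<lambda>\<tau>. if \<tau> = \<nu> \<or> \<tau> = \<mu> then 0 else 1 :: real"] by blast
  have "\<tau> \<bullet> adjoint f 1 = f \<tau>" for \<tau> using adjoint_works[OF f(1), of \<tau> 1] by simp
  then show thesis using that[of "adjoint f 1"] f(2) \<nu> by auto
qed

subsection \<open>Points away from the even hyperedges\<close>

text \<open>
  Moving from \<open>y\<close> in such a direction leads to a point in the relative interior of the hyperedge, where no other wall passes.
\<close>

lemma simple_pair_neighbouring:
  assumes y: "y \<in> Ch" and \<nu>: "\<nu> \<in> simple_at y" "\<mu> \<in> simple_at y" "\<nu> \<noteq> \<mu>"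
  shows "neighbouring_facets g Ch \<nu> \<mu>"
proof -
  have yS: "y \<in> space_form g" using ChD(1) y .
  obtain d where d: "\<nu> \<bullet> d = 0" "\<mu> \<bullet> d = 0" "\<forall>\<tau>\<in>simple_at y - {\<nu>, \<mu>}. 0 < \<tau> \<bullet> d"
    using simple_pair_direction[OF yS \<nu>(1,2)] by blast
  obtain e where e: "0 < e" "\<And>\<nu> p. \<nu> \<in> R \<Longrightarrow> 0 < \<nu> \<bullet> y \<Longrightarrow> p \<in> space_form g \<Longrightarrow> p \<in> ball y e \<Longrightarrow> 0 < \<nu> \<bullet> p"
    using sign_stable[OF yS] by blast
  obtain e' where e': "0 < e'" "\<And>\<epsilon>. \<bar>\<epsilon>\<bar> < e' \<Longrightarrow> y + \<epsilon> *\<^sub>R d \<in> cone_over g \<and> radial g (y + \<epsilon> *\<^sub>R d) \<in> ball y e \<inter> space_form g"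
    using radial_perturbation[OF yS open_ball, of y e d] e(1) by (metis centre_in_ball)
  define v where "v = y + (e' / 2) *\<^sub>R d"
  have v: "v \<in> cone_over g" "radial g v \<in> ball y e" "radial g v \<in> space_form g" using e'(2)[of "e' / 2"] e'(1) by (auto simp: v_def)
  define x where "x = radial g v"
  have zero: "\<nu> \<bullet> x = 0" "\<mu> \<bullet> x = 0" unfolding x_def inner_radial_sign(3)[OF v(1)]
    using \<nu>(1,2) d by (simp_all add: v_def inner_add_right simple_atD)
  have pos: "0 < \<tau> \<bullet> x" if \<tau>: "simple \<tau>" "\<tau> \<noteq> \<nu>" "\<tau> \<noteq> \<mu>" for \<tau>
  proof (cases "\<tau> \<bullet> y = 0")
    case True
    then have "0 < \<tau> \<bullet> d" using d(3) \<tau> by (simp add: simple_at_def)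
    then show ?thesis unfolding x_def inner_radial_sign(1)[OF v(1)] using True e'(1) by (simp add: v_def inner_add_right)
  next
    case False
    then have "0 < \<tau> \<bullet> y" using ChD(2)[OF y simpleD(1)[OF \<tau>(1)]] by simp
    then show ?thesis using e(2) simpleD(2)[OF \<tau>(1)] v unfolding x_def by blast
  qed
  have xS: "x \<in> space_form g" using v(3) by (simp add: x_def)
  obtain e2 where e2: "0 < e2" "\<And>\<nu> p. \<nu> \<in> R \<Longrightarrow> 0 < \<nu> \<bullet> x \<Longrightarrow> p \<in> space_form g \<Longrightarrow> p \<in> ball x e2 \<Longrightarrow> 0 < \<nu> \<bullet> p"
    using sign_stable[OF xS] by blast
  let ?E = "hyperplane_of g \<nu> \<inter> hyperplane_of g \<mu>"
  have "?E \<inter> ball x e2 \<subseteq> Ch"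
  proof
    fix p assume p: "p \<in> ?E \<inter> ball x e2"
    have pS: "p \<in> space_form g" "\<nu> \<bullet> p = 0" "\<mu> \<bullet> p = 0" using p by (auto simp: hyperplane_of_def)
    have "0 \<le> \<tau> \<bullet> p" if \<tau>: "simple \<tau>" for \<tau>
    proof (cases "\<tau> = \<nu> \<or> \<tau> = \<mu>")
      case False
      then have "0 < \<tau> \<bullet> p" using e2(2)[OF simpleD(2)[OF \<tau>] pos[OF \<tau>] pS(1)] p by blast
      then show ?thesis by simp
    qed (use pS in auto)
    then show "p \<in> Ch" using pS(1) unfolding Ch_eq_simple by blast
  qed
  moreover have "openin (top_of_set ?E) (?E \<inter> ball x e2)" by (simp add: openin_open_Int)
  moreover have "x \<in> ?E \<inter> ball x e2" using xS zero e2(1) by (simp add: hyperplane_of_def)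
  ultimately have "top_of_set ?E interior_of Ch \<noteq> {}" using interior_of_maximal by blast
  moreover have "hyperplane_of g \<nu> \<noteq> hyperplane_of g \<mu>"
  proof
    assume eq: "hyperplane_of g \<nu> = hyperplane_of g \<mu>"
    obtain z where z: "z \<in> space_form g" "\<nu> \<bullet> z = 0" "\<forall>\<mu>\<in>Pos. \<mu> \<noteq> \<nu> \<longrightarrow> 0 < \<mu> \<bullet> z"
      using simple_atD(1)[OF \<nu>(1)] unfolding simple_def by blast
    then have "z \<in> hyperplane_of g \<mu>" using eq by (auto simp: hyperplane_of_def)
    then show False using z(3) simple_atD(4)[OF \<nu>(2)] \<nu>(3) by (auto simp: hyperplane_of_def)
  qed
  ultimately show ?thesis unfolding neighbouring_facets_def
    using simple_facet_normal simple_atD(1) \<nu>(1,2) by blast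
qed

lemma even_hyperedge_iff:
  assumes y: "y \<in> Ch"
  shows "y \<in> \<Union>(even_hyperedges g Ch) \<longleftrightarrow>
    (\<exists>\<nu>\<in>simple_at y. \<exists>\<mu>\<in>simple_at y. \<nu> \<noteq> \<mu> \<and> (\<exists>m::nat. 2 \<le> m \<and> even m \<and> conormal_form g \<nu> \<mu> = - cos (pi / m)))"
    (is "_ \<longleftrightarrow> ?R")
proof
  assume ?R
  then obtain \<nu> \<mu> and m :: nat where *: "\<nu> \<in> simple_at y" "\<mu> \<in> simple_at y" "\<nu> \<noteq> \<mu>" "2 \<le> m" "even m" "conormal_form g \<nu> \<mu> = - cos (pi / m)"
    by blast
  obtain k where k: "m = 2 * k" using *(5) by (rule evenE)
  have "pi / real m \<le> pi" using *(4) by (simp add: field_simps)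
  then have "dihedral_angle g \<nu> \<mu> = pi / (2 * real k)"
    using *(1,2,6) k by (simp add: dihedral_angle_def simple_atD arccos_cos)
  moreover have "0 < k" using *(4) k by simp
  ultimately have "Ch \<inter> hyperplane_of g \<nu> \<inter> hyperplane_of g \<mu> \<in> even_hyperedges g Ch"
    unfolding even_hyperedges_def using simple_pair_neighbouring[OF y *(1-3)] by blast
  moreover have "y \<in> Ch \<inter> hyperplane_of g \<nu> \<inter> hyperplane_of g \<mu>"
    using y ChD(1)[OF y] *(1,2) by (simp add: hyperplane_of_def simple_atD)
  ultimately show "y \<in> \<Union>(even_hyperedges g Ch)" by blast
next
  assume "y \<in> \<Union>(even_hyperedges g Ch)"
  then obtain \<nu>0 \<mu>0 and k :: nat where nb: "neighbouring_facets g Ch \<nu>0 \<mu>0" and k: "0 < k" "dihedral_angle g \<nu>0 \<mu>0 = pi / (2 * real k)"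
    and yH: "y \<in> hyperplane_of g \<nu>0" "y \<in> hyperplane_of g \<mu>0"
    unfolding even_hyperedges_def by blast
  define nrm where "nrm \<nu> = (1 / sqrt (conormal_form g \<nu> \<nu>)) *\<^sub>R \<nu>" for \<nu> :: "'a \<times> real"
  have f: "facet_normal g Ch \<nu>0" "facet_normal g Ch \<mu>0" using nb by (auto simp: neighbouring_facets_def)
  have con: "0 < conormal_form g \<nu>0 \<nu>0" "0 < conormal_form g \<mu>0 \<mu>0" using f by (auto simp: facet_normal_def conormal_def)
  have A: "nrm \<nu>0 \<in> simple_at y" "nrm \<mu>0 \<in> simple_at y"
    using facet_normal_simple[OF f(1)] facet_normal_simple[OF f(2)] yH by (auto simp: simple_at_def nrm_def hyperplane_of_def)
  have "hyperplane_of g (nrm \<nu>0) = hyperplane_of g \<nu>0" "hyperplane_of g (nrm \<mu>0) = hyperplane_of g \<mu>0"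
    using con by (auto simp: hyperplane_of_def nrm_def)
  then have ne: "nrm \<nu>0 \<noteq> nrm \<mu>0" using nb by (auto simp: neighbouring_facets_def)
  have "conormal_form g (nrm \<nu>0) (nrm \<mu>0) = conormal_form g \<nu>0 \<mu>0 / sqrt (conormal_form g \<nu>0 \<nu>0 * conormal_form g \<mu>0 \<mu>0)"
    by (simp add: nrm_def conormal_form_simps real_sqrt_mult)
  then have ang: "arccos (- conormal_form g (nrm \<nu>0) (nrm \<mu>0)) = pi / (2 * real k)"
    using k(2) by (simp add: dihedral_angle_def)
  obtain m :: nat where m: "2 \<le> m" "conormal_form g (nrm \<nu>0) (nrm \<mu>0) = - cos (pi / m)"
    using simple_pair_angle[OF ChD(1)[OF y] A ne] by blast
  have "pi / real m \<le> pi" using m(1) by (simp add: field_simps)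
  then have "pi / real m = pi / (2 * real k)" using ang m by (simp add: arccos_cos)
  then have "real m = 2 * real k" using k(1) m(1) by (simp add: field_simps)
  then have "even m" by (metis dvd_triv_left of_nat_eq_iff of_nat_mult of_nat_numeral)
  then show ?R using A ne m by blast
qed

definition odd_point where "odd_point y \<longleftrightarrow> y \<in> Ch \<and> y \<notin> \<Union>(even_hyperedges g Ch)"

lemma odd_pair_label:
  assumes y: "odd_point y" and \<nu>: "\<nu> \<in> simple_at y" "\<mu> \<in> simple_at y" "\<nu> \<noteq> \<mu>"
  obtains m :: nat where "2 \<le> m" "odd m" "conormal_form g \<nu> \<mu> = - cos (pi / m)" "0 < sin (pi / m)"
proof -
  have yC: "y \<in> Ch" using y by (simp add: odd_point_def)
  obtain m :: nat where m: "2 \<le> m" "conormal_form g \<nu> \<mu> = - cos (pi / m)" "0 < sin (pi / m)"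
    using simple_pair_angle[OF ChD(1)[OF yC] \<nu>] by blast
  have "odd m" using y even_hyperedge_iff[OF yC] \<nu> m unfolding odd_point_def by blast
  then show thesis using that m by blast
qed

text \<open>
  Away from the even hyperedges at most two walls meet: for three walls with labels at least three
  the sum of the unit normals would have non-positive square.
\<close>

lemma odd_point_walls:
  assumes y: "odd_point y" and \<nu>: "\<nu> \<in> simple_at y"
  shows "\<exists>\<mu>\<in>simple_at y. simple_at y = {\<nu>, \<mu>}"
proof (rule ccontr)
  assume no: "\<not> ?thesis"
  have yS: "y \<in> space_form g" using y ChD(1) by (simp add: odd_point_def)
  have "simple_at y \<noteq> {\<nu>}" using no \<nu> by force
  then obtain \<mu> where \<mu>: "\<mu> \<in> simple_at y" "\<mu> \<noteq> \<nu>" using \<nu> by blast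
  then obtain \<tau> where \<tau>: "\<tau> \<in> simple_at y" "\<tau> \<noteq> \<nu>" "\<tau> \<noteq> \<mu>" using no \<nu> by blast
  have half: "conormal_form g a b \<le> - 1 / 2" if ab: "a \<in> simple_at y" "b \<in> simple_at y" "a \<noteq> b" for a b
  proof -
    obtain m :: nat where m: "2 \<le> m" "odd m" "conormal_form g a b = - cos (pi / m)"
      using odd_pair_label[OF y ab] by blast
    have "3 \<le> m" using m(1,2) by (cases "m = 2") auto
    then have "pi / m \<le> pi / 3" by (intro divide_left_mono) auto
    then have "cos (pi / 3) \<le> cos (pi / m)" using m(1) by (intro cos_monotone_0_pi_le) (auto simp: field_simps)
    then show ?thesis using m(3) by (simp add: cos_60)
  qed
  let ?s = "\<nu> + \<mu> + \<tau>"
  have "conormal_form g ?s ?s = 3 + 2 * (conormal_form g \<nu> \<mu> + conormal_form g \<nu> \<tau> + conormal_form g \<mu> \<tau>)"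
    using \<nu> \<mu> \<tau> by (simp add: conormal_form_simps simple_atD conormal_form_commute[of g \<mu> \<nu>] conormal_form_commute[of g \<tau> \<nu>] conormal_form_commute[of g \<tau> \<mu>])
  also have "\<dots> \<le> 0" using half[OF \<nu> \<mu>(1)] half[OF \<nu> \<tau>(1)] half[OF \<mu>(1) \<tau>(1)] \<mu> \<tau> by auto
  finally have le: "conormal_form g ?s ?s \<le> 0" .
  have "?s \<bullet> y = 0" using \<nu> \<mu> \<tau> by (simp add: inner_add_left simple_atD)
  then have "?s = 0" using le conormal_form_pos_at_point[OF yS] by (meson not_le)
  moreover have "0 < ?s \<bullet> c" unfolding inner_add_left
    using PosD(2)[OF simple_atD(4)[OF \<nu>]] PosD(2)[OF simple_atD(4)[OF \<mu>(1)]] PosD(2)[OF simple_atD(4)[OF \<tau>(1)]] by simp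
  ultimately show False by simp
qed

end

section \<open>Folding onto the chamber\<close>

context chamber
begin

lemma W_inverse_obtain:
  assumes "w \<in> W"
  obtains w' where "w' \<in> W" "\<And>p. w' (w p) = p" "\<And>p. w (w' p) = p" "\<And>\<nu>. adjoint w' (adjoint w \<nu>) = \<nu>" "\<And>\<nu>. adjoint w (adjoint w' \<nu>) = \<nu>"
proof -
  obtain w' where w': "w' \<in> W" "w' \<circ> w = id" "w \<circ> w' = id" using inverse_W[OF assms] by blast
  show thesis
  proof (rule that[OF w'(1)])
    show "w' (w p) = p" "w (w' p) = p" for p using w'(2,3) by (metis comp_apply id_apply)+
    show "adjoint w' (adjoint w \<nu>) = \<nu>" "adjoint w (adjoint w' \<nu>) = \<nu>" for \<nu>
      using adjoint_comp_W[OF assms w'(1), of \<nu>] adjoint_comp_W[OF w'(1) assms, of \<nu>] w'(2,3) by (simp_all add: adjoint_id)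
  qed
qed

lemma adjoint_W_neg: "w \<in> W \<Longrightarrow> adjoint w (- \<nu>) = - adjoint w \<nu>"
  using adjoint_linear[OF linear_W] linear_neg by blast

lemma adjoint_word_span:
  assumes "set ws \<subseteq> simple_at y" "\<rho> \<in> span (simple_at y)"
  shows "adjoint (word_map ws) \<rho> \<in> span (simple_at y)"
  using assms
proof (induction ws arbitrary: \<rho>)
  case Nil
  then show ?case by (simp only: word_map.simps adjoint_id)
next
  case (Cons a ws)
  have a: "simple a" "a \<in> simple_at y" and ws: "set ws \<subseteq> simple_at y" using Cons.prems by (auto simp: simple_atD)
  have "adjoint (word_map (a # ws)) \<rho> = adjoint (word_map ws) (root_reflection g a \<rho>)"
    using adjoint_comp_W[OF simple_refl_W[OF a(1)] word_at_W[OF ws], of \<rho>] adjoint_simple[OF a(1)]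
    by (simp only: word_map.simps)
  moreover have "root_reflection g a \<rho> \<in> span (simple_at y)"
    unfolding root_reflection_def by (intro span_diff span_scale span_base a(2) Cons.prems(2))
  ultimately show ?case using Cons.IH[OF ws] by metis
qed

lemma root_at_span:
  assumes y: "y \<in> Ch" and sub: "simple_at y = {\<nu>, \<mu>}" and \<beta>: "\<beta> \<in> R" "\<beta> \<bullet> y = 0"
  shows "\<exists>a b. \<beta> = a *\<^sub>R \<nu> + b *\<^sub>R \<mu>"
proof -
  obtain ws \<rho> where ws: "set ws \<subseteq> simple_at y" "\<rho> \<in> simple_at y"
      "adjoint (word_map ws) \<rho> = \<beta> \<or> adjoint (word_map ws) \<rho> = - \<beta>"
    using root_at_conjugate_to_simple[OF y \<beta>] by blast
  have "adjoint (word_map ws) \<rho> \<in> span (simple_at y)" using adjoint_word_span[OF ws(1) span_base[OF ws(2)]] .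
  then have "\<beta> \<in> span (simple_at y)" using ws(3) span_neg by (metis minus_minus)
  then obtain a b where "\<beta> - a *\<^sub>R \<nu> = b *\<^sub>R \<mu>" unfolding sub span_breakdown_eq span_singleton by blast
  then have "\<beta> = a *\<^sub>R \<nu> + b *\<^sub>R \<mu>" by (simp add: algebra_simps)
  then show ?thesis by blast
qed

lemma odd_point_Ch: "odd_point y \<Longrightarrow> y \<in> Ch" by (simp add: odd_point_def)

text \<open>
  Every root through \<open>y\<close> is conjugate to a wall under reflections in walls through \<open>y\<close>, hence lies in their span, which is at most
  a plane.
\<close>

lemma odd_point_no_perpendicular_simple:
  assumes y: "odd_point y" and \<nu>: "\<nu> \<in> simple_at y" and \<beta>: "\<beta> \<in> R" "\<beta> \<bullet> y = 0" "conormal_form g \<nu> \<beta> = 0"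
  shows False
proof -
  obtain \<mu> where \<mu>: "\<mu> \<in> simple_at y" "simple_at y = {\<nu>, \<mu>}" using odd_point_walls[OF y \<nu>] by blast
  obtain a b where ab: "\<beta> = a *\<^sub>R \<nu> + b *\<^sub>R \<mu>" using root_at_span[OF odd_point_Ch[OF y] \<mu>(2) \<beta>(1,2)] by blast
  show False
  proof (cases "\<nu> = \<mu>")
    case True
    then have "\<beta> = (a + b) *\<^sub>R \<nu>" using ab by (simp add: scaleR_left_distrib)
    then have "\<beta> = 0" using \<beta>(3) simple_atD(5)[OF \<nu>] by (simp add: conormal_form_simps)
    then show False using root_nonzero \<beta>(1) by blast
  next
    case False
    obtain m :: nat where m: "2 \<le> m" "odd m" "conormal_form g \<nu> \<mu> = - cos (pi / m)" "0 < sin (pi / m)"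
      using odd_pair_label[OF y \<nu> \<mu>(1) False] by blast
    show False by (rule odd_angle_no_perpendicular[OF \<nu> \<mu>(1) False m \<beta>(1) ab \<beta>(3)])
  qed
qed

text \<open>Such an element maps an interior point of the chamber near \<open>y\<close> into the chamber.\<close>

lemma stabiliser_positive_trivial:
  assumes y: "y \<in> Ch" and u: "u \<in> W" "u y = y" and pos: "\<And>\<nu>. \<nu> \<in> simple_at y \<Longrightarrow> adjoint u \<nu> \<in> Pos"
  shows "u = id"
proof -
  have yS: "y \<in> space_form g" using ChD(1) y .
  obtain e where e: "0 < e" "\<And>\<nu> p. \<nu> \<in> R \<Longrightarrow> 0 < \<nu> \<bullet> y \<Longrightarrow> p \<in> space_form g \<Longrightarrow> p \<in> ball y e \<Longrightarrow> 0 < \<nu> \<bullet> p"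
    using sign_stable[OF yS] by blast
  have op: "open (u -` ball y e)" "y \<in> u -` ball y e" using open_linear_vimage[OF linear_W[OF u(1)]] e(1) u(2) by auto
  obtain e' where e': "0 < e'" "\<And>\<epsilon>. \<bar>\<epsilon>\<bar> < e' \<Longrightarrow> y + \<epsilon> *\<^sub>R c \<in> cone_over g \<and> radial g (y + \<epsilon> *\<^sub>R c) \<in> (u -` ball y e) \<inter> space_form g"
    using radial_perturbation[OF yS op] by blast
  \<comment> \<open>a point close to \<open>y\<close> on the way to the interior point \<open>c\<close>\<close>
  define v where "v = y + (e' / 2) *\<^sub>R c"
  have v: "v \<in> cone_over g" "u (radial g v) \<in> ball y e" "radial g v \<in> space_form g" using e'(2)[of "e' / 2"] e'(1) by (auto simp: v_def)
  have "0 < \<nu> \<bullet> v" if "\<nu> \<in> Pos" for \<nu>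
    using ChD(2)[OF y that] PosD(2)[OF that] e'(1) by (simp add: v_def inner_add_right add_nonneg_pos)
  then have x: "radial g v \<in> Ch_int" unfolding Ch_int_def using v(3) inner_radial_sign(1)[OF v(1)] by blast
  have ux: "u (radial g v) \<in> space_form g" using W_space_form[OF u(1) v(3)] .
  have "0 \<le> \<nu> \<bullet> u (radial g v)" if \<nu>: "simple \<nu>" for \<nu>
  proof (cases "\<nu> \<bullet> y = 0")
    case True
    then have "adjoint u \<nu> \<in> Pos" using pos \<nu> by (simp add: simple_at_def)
    then have "0 < adjoint u \<nu> \<bullet> radial g v" using x unfolding Ch_int_def by blast
    then show ?thesis using inner_W[OF u(1)] by simp
  next
    case False
    then have "0 < \<nu> \<bullet> y" using ChD(2)[OF y simpleD(1)[OF \<nu>]] by simp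
    then have "0 < \<nu> \<bullet> u (radial g v)" using e(2)[OF simpleD(2)[OF \<nu>]] ux v(2) by blast
    then show ?thesis by simp
  qed
  then have "u (radial g v) \<in> Ch" using ux unfolding Ch_eq_simple by blast
  then show ?thesis by (rule W_simply_transitive[OF u(1) x])
qed

end

context proper_chamber
begin

text \<open>
  Through a point of an even hyperedge every mirror has a perpendicular mirror. If the given wall
  has no even label at the point, it is interchanged by a bisecting reflection with a wall that has.
\<close>

lemma even_point_perpendicular_simple:
  assumes y: "y \<in> Ch" "\<not> odd_point y" and \<nu>: "\<nu> \<in> simple_at y"
  shows "\<exists>\<beta>\<in>R. \<beta> \<bullet> y = 0 \<and> conormal_form g \<nu> \<beta> = 0"
proof -
  have yS: "y \<in> space_form g" using ChD(1) y(1) .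
  obtain i j and m :: nat where ij: "i \<in> simple_at y" "j \<in> simple_at y" "i \<noteq> j" "2 \<le> m" "even m" "conormal_form g i j = - cos (pi / m)"
    using y even_hyperedge_iff[OF y(1)] unfolding odd_point_def by blast
  have sn: "0 < sin (pi / real m)" using ij(4) by (intro sin_gt_zero) (auto simp: field_simps)
  obtain \<beta>' where \<beta>': "\<beta>' \<in> R" "\<beta>' \<bullet> y = 0" "conormal_form g i \<beta>' = 0"
    using even_angle_perpendicular[OF ij(1,2,4-6) sn] by blast
  show ?thesis
  proof (cases "\<nu> = i")
    case False
    obtain m' :: nat where m': "2 \<le> m'" "conormal_form g \<nu> i = - cos (pi / m')" "0 < sin (pi / m')"
      using simple_pair_angle[OF yS \<nu> ij(1) False] by blast
    show ?thesis
    proof (cases "even m'")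
      case True
      then show ?thesis using even_angle_perpendicular[OF \<nu> ij(1) m'(1) _ m'(2,3)] by blast
    next
      case odd: False
      obtain \<sigma> where \<sigma>: "\<sigma> \<in> R" "\<sigma> \<bullet> y = 0" "root_reflection g \<sigma> \<nu> = - i" "root_reflection g \<sigma> i = - \<nu>"
        using odd_angle_bisector[OF \<nu> ij(1) m'(1) odd m'(2,3)] by blast
      have u: "conormal_form g \<sigma> \<sigma> = 1" using unit[OF \<sigma>(1)] .
      have "conormal_form g (root_reflection g \<sigma> i) (root_reflection g \<sigma> \<beta>') = 0" unfolding root_reflection_form[OF u] using \<beta>'(3) .
      then have "conormal_form g \<nu> (root_reflection g \<sigma> \<beta>') = 0" unfolding \<sigma>(4) by (simp add: conormal_form_simps)
      moreover have "root_reflection g \<sigma> \<beta>' \<bullet> y = 0"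
        using \<beta>'(2) \<sigma>(2) by (simp add: root_reflection_def inner_diff_left)
      ultimately show ?thesis using closed_reflection[OF \<sigma>(1) \<beta>'(1)] by blast
    qed
  qed (use \<beta>' in blast)
qed

text \<open>
  By \<open>W_fundamental\<close> the choice is unique.
\<close>

definition fold where "fold x = (SOME y. y \<in> Ch \<and> (\<exists>w\<in>W. w x = y))"

lemma fold_props:
  assumes "x \<in> space_form g" shows "fold x \<in> Ch" "\<exists>w\<in>W. w x = fold x"
proof -
  have "\<exists>y. y \<in> Ch \<and> (\<exists>w\<in>W. w x = y)" using W_moves_into_Ch[OF assms] by blast
  from someI_ex[OF this] show "fold x \<in> Ch" "\<exists>w\<in>W. w x = fold x" unfolding fold_def by blast+
qed

lemma fold_unique:
  assumes x: "x \<in> space_form g" and w: "w \<in> W" "w x \<in> Ch" shows "fold x = w x"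
proof -
  obtain v where v: "v \<in> W" "v x = fold x" using fold_props(2)[OF x] by blast
  obtain w' where w': "w' \<in> W" "\<And>p. w' (w p) = p" using W_inverse_obtain[OF w(1)] by metis
  have "(v \<circ> w') (w x) \<in> Ch" using w'(2) v(2) fold_props(1)[OF x] by simp
  then have "(v \<circ> w') (w x) = w x" using W_fundamental[OF comp_W[OF v(1) w'(1)] w(2)] by blast
  then show ?thesis using w'(2) v(2) by simp
qed

lemma fold_W: assumes x: "x \<in> space_form g" and w: "w \<in> W" shows "fold (w x) = fold x"
proof -
  obtain v where v: "v \<in> W" "v (w x) = fold (w x)" using fold_props(2) W_space_form[OF w x] by blast
  then have "(v \<circ> w) x \<in> Ch" using fold_props(1)[OF W_space_form[OF w x]] by simp
  then show ?thesis using fold_unique[OF x comp_W[OF v(1) w]] v(2) by simp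
qed

lemma fold_Ch: "y \<in> Ch \<Longrightarrow> fold y = y"
  using fold_unique[OF ChD(1) id_W, of y] by simp

lemma fold_eq_iff:
  assumes "x \<in> space_form g" "x' \<in> space_form g" shows "fold x = fold x' \<longleftrightarrow> (\<exists>w\<in>W. w x = x')"
proof
  assume eq: "fold x = fold x'"
  obtain v v' where v: "v \<in> W" "v x = fold x" "v' \<in> W" "v' x' = fold x'" using fold_props(2) assms by metis
  obtain u where u: "u \<in> W" "\<And>p. u (v' p) = p" using W_inverse_obtain[OF v(3)] by metis
  have "(u \<circ> v) x = x'" using u(2)[of x'] v eq by simp
  then show "\<exists>w\<in>W. w x = x'" using comp_W[OF u(1) v(1)] by blast
qed (use fold_W assms in metis)

text \<open>Folding does not increase distances: every reflection in it moves a point to the side where the other one is.\<close>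

lemma fold_sep_Ch:
  assumes x: "x \<in> space_form g" and y: "y \<in> Ch" shows "sep g (fold x) y \<le> sep g x y"
proof -
  have yS: "y \<in> space_form g" using ChD(1)[OF y] .
  have step: "a \<in> UNIV \<and> sep g (reflection g a x') y \<le> sep g x y"
    if *: "x' \<in> space_form g" "sep g x' y \<le> sep g x y" "simple a" "a \<bullet> x' < 0" for x' a
  proof -
    have a: "conormal g a" "conormal_form g a a = 1" using conormal_root unit simpleD(2)[OF *(3)] by auto
    have "sep g (reflection g a x') y = sep g x' y + 4 * (a \<bullet> x') * (a \<bullet> y)"
      using sep_reflection_left[OF a(1) *(1) yS] a(2) by simp
    moreover have "4 * (a \<bullet> x') * (a \<bullet> y) \<le> 0" using *(4) ChD(2)[OF y simpleD(1)[OF *(3)]] by (simp add: mult_nonpos_nonneg)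
    ultimately show ?thesis using *(2) by simp
  qed
  obtain ws where ws: "set ws \<subseteq> Collect simple" "word_map ws x \<in> Ch" "sep g (word_map ws x) y \<le> sep g x y"
    using descend[of x "\<lambda>x'. sep g x' y \<le> sep g x y" UNIV] x step by (metis inf_top_left order_refl)
  then show ?thesis using fold_unique[OF x word_W[OF ws(1)] ws(2)] by simp
qed

text \<open>
  A motion takes \<open>x'\<close> into the chamber and does not change the fold of \<open>x\<close>.
\<close>

lemma fold_sep:
  assumes x: "x \<in> space_form g" "x' \<in> space_form g" shows "sep g (fold x) (fold x') \<le> sep g x x'"
proof -
  obtain w where w: "w \<in> W" "w x' = fold x'" using fold_props(2)[OF x(2)] by blast
  have "sep g (fold (w x)) (w x') \<le> sep g (w x) (w x')"
    using fold_sep_Ch[OF W_space_form[OF w(1) x(1)], of "w x'"] w(2) fold_props(1)[OF x(2)] by simp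
  then show ?thesis using fold_W[OF x(1) w(1)] w(2) motion_sep[OF motion_W[OF w(1)] x] by simp
qed

lemma continuous_on_fold: "continuous_on (space_form g) fold"
  unfolding continuous_on_topological
proof (intro ballI allI impI)
  fix x B assume x: "x \<in> space_form g" and B: "open B" "fold x \<in> B"
  have fS: "fold z \<in> space_form g" if "z \<in> space_form g" for z using fold_props(1)[OF that] ChD(1) by blast
  obtain \<epsilon> where \<epsilon>: "0 < \<epsilon>" "\<And>q. q \<in> space_form g \<Longrightarrow> sep g q (fold x) < \<epsilon> \<Longrightarrow> q \<in> B"
    using sep_small_imp_near[OF fS[OF x] B] by blast
  have "open {z. sep g z x < \<epsilon>}" by (intro open_Collect_less continuous_on_sep continuous_intros)
  moreover have "x \<in> {z. sep g z x < \<epsilon>}" using \<epsilon>(1) by (simp add: sep_def conormal_form_simps)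
  moreover have "fold z \<in> B" if "z \<in> space_form g" "z \<in> {z. sep g z x < \<epsilon>}" for z
    using \<epsilon>(2)[OF fS[OF that(1)]] fold_sep[OF that(1) x] that(2) by simp
  ultimately show "\<exists>A. open A \<and> x \<in> A \<and> (\<forall>y\<in>space_form g. y \<in> A \<longrightarrow> fold y \<in> B)" by blast
qed

subsection \<open>Mirrors through a point of the space\<close>

definition odd_at where "odd_at x \<longleftrightarrow> odd_point (fold x)"

lemma root_moves_to_simple:
  assumes x: "x \<in> space_form g" and \<alpha>: "\<alpha> \<in> R" "\<alpha> \<bullet> x = 0"
  obtains w \<nu> where "w \<in> W" "w x = fold x" "\<nu> \<in> simple_at (fold x)" "adjoint w \<nu> = \<alpha> \<or> adjoint w \<nu> = - \<alpha>"
proof -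
  obtain u where u: "u \<in> W" "u x = fold x" using fold_props(2)[OF x] by blast
  obtain u' where u': "u' \<in> W" "\<And>p. u' (u p) = p" "\<And>\<nu>. adjoint u (adjoint u' \<nu>) = \<nu>" using W_inverse_obtain[OF u(1)] by metis
  have "adjoint u' \<alpha> \<bullet> fold x = 0" using inner_W[OF u'(1), of \<alpha> "fold x"] u(2) u'(2)[of x] \<alpha>(2) by simp
  then obtain ws \<nu> where ws: "set ws \<subseteq> simple_at (fold x)" "\<nu> \<in> simple_at (fold x)"
    "adjoint (word_map ws) \<nu> = adjoint u' \<alpha> \<or> adjoint (word_map ws) \<nu> = - adjoint u' \<alpha>"
    using root_at_conjugate_to_simple[OF fold_props(1)[OF x] adjoint_W_root[OF u'(1) \<alpha>(1)]] by metis
  have wW: "word_map ws \<in> W" using word_at_W[OF ws(1)] .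
  show thesis
  proof (rule that[OF comp_W[OF wW u(1)] _ ws(2)])
    show "(word_map ws \<circ> u) x = fold x" using u(2) word_at_fixes[OF ws(1)] by simp
    have "adjoint (word_map ws \<circ> u) \<nu> = adjoint u (adjoint (word_map ws) \<nu>)" using adjoint_comp_W[OF wW u(1)] .
    then show "adjoint (word_map ws \<circ> u) \<nu> = \<alpha> \<or> adjoint (word_map ws \<circ> u) \<nu> = - \<alpha>"
      using ws(3) u'(3)[of \<alpha>] adjoint_W_neg[OF u(1), of "adjoint u' \<alpha>"] by metis
  qed
qed

text \<open>
  By conjugation it suffices to consider a wall at a point of the chamber.
\<close>

lemma perpendicular_iff_not_odd:
  assumes x: "x \<in> space_form g" and \<alpha>: "\<alpha> \<in> R" "\<alpha> \<bullet> x = 0"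
  shows "(\<exists>\<beta>\<in>R. \<beta> \<bullet> x = 0 \<and> conormal_form g \<alpha> \<beta> = 0) \<longleftrightarrow> \<not> odd_at x"
proof -
  obtain w \<nu> where w: "w \<in> W" "w x = fold x" "\<nu> \<in> simple_at (fold x)" "adjoint w \<nu> = \<alpha> \<or> adjoint w \<nu> = - \<alpha>"
    using root_moves_to_simple[OF assms] by blast
  obtain w' where w': "w' \<in> W" "\<And>p. w' (w p) = p" "\<And>\<nu>. adjoint w (adjoint w' \<nu>) = \<nu>" using W_inverse_obtain[OF w(1)] by metis
  have form: "conormal_form g \<alpha> (adjoint w \<beta>) = 0 \<longleftrightarrow> conormal_form g \<nu> \<beta> = 0" for \<beta>
    using motion_form[OF motion_W[OF w(1)], of \<nu> \<beta>] w(4) by (auto simp: conormal_form_simps minus_equation_iff[of _ \<alpha>])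
  show ?thesis
  proof
    assume "\<exists>\<beta>\<in>R. \<beta> \<bullet> x = 0 \<and> conormal_form g \<alpha> \<beta> = 0"
    then obtain \<beta> where \<beta>: "\<beta> \<in> R" "\<beta> \<bullet> x = 0" "conormal_form g \<alpha> \<beta> = 0" by blast
    have "adjoint w' \<beta> \<bullet> fold x = 0" using inner_W[OF w'(1), of \<beta> "fold x"] w(2) w'(2)[of x] \<beta>(2) by simp
    moreover have "conormal_form g \<nu> (adjoint w' \<beta>) = 0" using form[of "adjoint w' \<beta>"] \<beta>(3) w'(3) by simp
    ultimately show "\<not> odd_at x"
      using odd_point_no_perpendicular_simple[OF _ w(3) adjoint_W_root[OF w'(1) \<beta>(1)]] unfolding odd_at_def by blast
  next
    assume "\<not> odd_at x"
    then obtain \<beta> where \<beta>: "\<beta> \<in> R" "\<beta> \<bullet> fold x = 0" "conormal_form g \<nu> \<beta> = 0"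
      using even_point_perpendicular_simple[OF fold_props(1)[OF x] _ w(3)] unfolding odd_at_def by blast
    have "adjoint w \<beta> \<bullet> x = 0" using inner_W[OF w(1), of \<beta> x] \<beta>(2) w(2) by simp
    then show "\<exists>\<beta>\<in>R. \<beta> \<bullet> x = 0 \<and> conormal_form g \<alpha> \<beta> = 0"
      using adjoint_W_root[OF w(1) \<beta>(1)] form[of \<beta>] \<beta>(3) by blast
  qed
qed

text \<open>
  Both mirrors are conjugate to walls at the folded point, and at most two walls of odd label pass there; the bisector interchanges them.
\<close>

lemma odd_at_mirrors_conjugate:
  assumes x: "x \<in> space_form g" "odd_at x" and \<alpha>: "\<alpha> \<in> R" "\<alpha> \<bullet> x = 0" and \<beta>: "\<beta> \<in> R" "\<beta> \<bullet> x = 0"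
  obtains w where "w \<in> W" "w x = x" "adjoint w \<beta> = \<alpha> \<or> adjoint w \<beta> = - \<alpha>"
proof -
  let ?y = "fold x"
  have y: "odd_point ?y" using x(2) by (simp add: odd_at_def)
  obtain a \<nu> where a: "a \<in> W" "a x = ?y" "\<nu> \<in> simple_at ?y" "adjoint a \<nu> = \<alpha> \<or> adjoint a \<nu> = - \<alpha>"
    using root_moves_to_simple[OF x(1) \<alpha>] by blast
  obtain b \<mu> where b: "b \<in> W" "b x = ?y" "\<mu> \<in> simple_at ?y" "adjoint b \<mu> = \<beta> \<or> adjoint b \<mu> = - \<beta>"
    using root_moves_to_simple[OF x(1) \<beta>] by blast
  obtain b' where b': "b' \<in> W" "\<And>p. b' (b p) = p" "\<And>\<nu>. adjoint b' (adjoint b \<nu>) = \<nu>" using W_inverse_obtain[OF b(1)] by metis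
  obtain s where s: "s \<in> W" "s ?y = ?y" "adjoint s \<mu> = \<nu> \<or> adjoint s \<mu> = - \<nu>"
  proof (cases "\<nu> = \<mu>")
    case True
    then show ?thesis using that[OF id_W] by (simp add: adjoint_id)
  next
    case False
    obtain m :: nat where m: "2 \<le> m" "odd m" "conormal_form g \<nu> \<mu> = - cos (pi / m)" "0 < sin (pi / m)"
      using odd_pair_label[OF y a(3) b(3) False] by blast
    obtain \<sigma> where \<sigma>: "\<sigma> \<in> R" "\<sigma> \<bullet> ?y = 0" "root_reflection g \<sigma> \<mu> = - \<nu>"
      using odd_angle_bisector[OF a(3) b(3) m] by blast
    show ?thesis
    proof (rule that[OF root_reflection_W[OF \<sigma>(1)]])
      show "reflection g \<sigma> ?y = ?y" using \<sigma>(2) by (simp add: reflection_eq)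
      show "adjoint (reflection g \<sigma>) \<mu> = \<nu> \<or> adjoint (reflection g \<sigma>) \<mu> = - \<nu>"
        using \<sigma>(3) adjoint_reflection[OF unit[OF \<sigma>(1)]] by simp
    qed
  qed
  have neg: "adjoint u (- \<tau>) = - adjoint u \<tau>" if "u \<in> W" for u \<tau> using adjoint_W_neg[OF that] .
  have sa: "s \<circ> a \<in> W" using comp_W s(1) a(1) by blast
  show thesis
  proof (rule that[OF comp_W[OF b'(1) sa]])
    show "(b' \<circ> (s \<circ> a)) x = x" using a(2) s(2) b(2) b'(2)[of x] by simp
    have eq: "adjoint (b' \<circ> (s \<circ> a)) \<beta> = adjoint a (adjoint s (adjoint b' \<beta>))"
      by (simp only: adjoint_comp_W[OF b'(1) sa] adjoint_comp_W[OF s(1) a(1)])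
    have "adjoint b' \<beta> = \<mu> \<or> adjoint b' \<beta> = - \<mu>" using b(4) b'(3)[of \<mu>] neg[OF b'(1)] by (metis minus_minus)
    then have "adjoint s (adjoint b' \<beta>) = \<nu> \<or> adjoint s (adjoint b' \<beta>) = - \<nu>" using s(3) neg[OF s(1)] by (metis minus_minus)
    then have "adjoint a (adjoint s (adjoint b' \<beta>)) = \<alpha> \<or> adjoint a (adjoint s (adjoint b' \<beta>)) = - \<alpha>"
      using a(4) neg[OF a(1)] by (metis minus_minus)
    then show "adjoint (b' \<circ> (s \<circ> a)) \<beta> = \<alpha> \<or> adjoint (b' \<circ> (s \<circ> a)) \<beta> = - \<alpha>" unfolding eq .
  qed
qed

text \<open>
  Away from the even hyperedges a group element that fixes a point and a mirror through it acts on
  this mirror trivially. With two walls \<open>\<nu>\<close>, \<open>\<mu>\<close> of odd label at the point, the only other possibility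
  would be the map exchanging the two sides of the hyperedge within the mirror; this is excluded by
  comparison with the product of the reflections in \<open>\<nu>\<close> and in the bisecting mirror.
\<close>

lemma odd_point_stabiliser_simple:
  assumes y: "odd_point y" and \<nu>: "\<nu> \<in> simple_at y" and u: "u \<in> W" "u y = y" "adjoint u \<nu> = \<nu>"
  shows "u = id"
proof -
  have yC: "y \<in> Ch" using odd_point_Ch[OF y] .
  obtain \<mu> where \<mu>: "\<mu> \<in> simple_at y" "simple_at y = {\<nu>, \<mu>}" using odd_point_walls[OF y \<nu>] by blast
  have pos: "adjoint u' \<tau> \<in> Pos" if "adjoint u' \<nu> \<in> simple_at y" "adjoint u' \<mu> \<in> simple_at y" "\<tau> \<in> simple_at y" for u' \<tau>
  proof -
    have "\<tau> = \<nu> \<or> \<tau> = \<mu>" using that(3) unfolding \<mu>(2) by simp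
    then show ?thesis using simple_atD(4)[OF that(1)] simple_atD(4)[OF that(2)] by (elim disjE) simp_all
  qed
  show ?thesis
  proof (cases "\<nu> = \<mu> \<or> adjoint u \<mu> = \<mu>")
    case True
    then have "adjoint u \<nu> \<in> simple_at y" "adjoint u \<mu> \<in> simple_at y" using u(3) \<nu> \<mu>(1) by auto
    then show ?thesis using pos by (intro stabiliser_positive_trivial[OF yC u(1,2)]) blast
  next
    case False
    then have ne: "\<nu> \<noteq> \<mu>" "adjoint u \<mu> \<noteq> \<mu>" by auto
    obtain m :: nat where m: "2 \<le> m" "odd m" "conormal_form g \<nu> \<mu> = - cos (pi / m)" "0 < sin (pi / m)"
      using odd_pair_label[OF y \<nu> \<mu>(1) ne(1)] by blast
    let ?c = "cos (pi / m)"
    have un: "conormal_form g \<nu> \<nu> = 1" "conormal_form g \<mu> \<mu> = 1" using simple_atD(5) \<nu> \<mu>(1) by auto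
    have \<mu>\<nu>: "conormal_form g \<mu> \<nu> = - ?c" using m(3) conormal_form_commute by metis
    have "adjoint u \<mu> \<bullet> y = 0" using inner_W[OF u(1), of \<mu> y] u(2) simple_atD(2)[OF \<mu>(1)] by simp
    then obtain a b where ab: "adjoint u \<mu> = a *\<^sub>R \<nu> + b *\<^sub>R \<mu>"
      using root_at_span[OF yC \<mu>(2) adjoint_W_root[OF u(1) simple_atD(3)[OF \<mu>(1)]]] by blast
    have "conormal_form g (adjoint u \<nu>) (adjoint u \<mu>) = - ?c" unfolding motion_form[OF motion_W[OF u(1)]] using m(3) .
    then have a: "a = (b - 1) * ?c" using un m(3) unfolding u(3) ab by (simp add: conormal_form_simps algebra_simps)
    have "conormal_form g (adjoint u \<mu>) (adjoint u \<mu>) = 1" unfolding motion_form[OF motion_W[OF u(1)]] using un(2) .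
    then have "a * a - 2 * a * b * ?c + b * b = 1" using un m(3) \<mu>\<nu> unfolding ab by (simp add: conormal_form_simps algebra_simps)
    then have "(b * b - 1) * (1 - ?c\<^sup>2) = 0" unfolding a by (simp add: power2_eq_square algebra_simps)
    moreover have "1 - ?c\<^sup>2 \<noteq> 0" using m(4) by (simp add: cos_squared_eq)
    ultimately have "b * b = 1" by simp
    moreover have "b \<noteq> 1" using ne(2) ab a by auto
    ultimately have b: "b = - 1" using square_eq_1_iff by blast
    \<comment> \<open>isometries of the plane that fix \<open>\<nu>\<close>: the identity and the one that fixes \<open>\<nu>\<close> and inverts its orthogonal complement\<close>
    have u\<mu>: "adjoint u \<mu> = - root_reflection g \<nu> \<mu>"
      unfolding ab a b using m(3) by (simp add: root_reflection_def algebra_simps scaleR_2 flip: scaleR_add_left)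
    obtain \<sigma> where \<sigma>: "\<sigma> \<in> R" "\<sigma> \<bullet> y = 0" "root_reflection g \<sigma> \<nu> = - \<mu>" "root_reflection g \<sigma> \<mu> = - \<nu>"
      using odd_angle_bisector[OF \<nu> \<mu>(1) m] by blast
    \<comment> \<open>this product also carries one wall to \<open>- s\<^sub>\<nu> \<mu>\<close>, so that \<open>u v\<^sup>-\<^sup>1\<close> permutes the walls and is trivial, although it interchanges \<open>\<nu>\<close> and \<open>\<mu>\<close>\<close>
    define v where "v = reflection g \<sigma> \<circ> reflection g \<nu>"
    have refl: "reflection g \<sigma> \<in> W" "reflection g \<nu> \<in> W" using root_reflection_W \<sigma>(1) simple_atD(3)[OF \<nu>] by auto
    have vW: "v \<in> W" unfolding v_def by (rule comp_W[OF refl])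
    have vad: "adjoint v \<tau> = root_reflection g \<nu> (root_reflection g \<sigma> \<tau>)" for \<tau>
      unfolding v_def adjoint_comp_W[OF refl] adjoint_reflection[OF un(1)] adjoint_reflection[OF unit[OF \<sigma>(1)]] ..
    have v1: "adjoint v \<nu> = adjoint u \<mu>" unfolding vad \<sigma>(3) u\<mu> by (rule root_reflection_simps)
    have v2: "adjoint v \<mu> = \<nu>" unfolding vad \<sigma>(4) by (simp add: root_reflection_simps root_reflection_self[OF un(1)])
    have vy: "v y = y" using \<sigma>(2) simple_atD(2)[OF \<nu>] by (simp add: v_def reflection_eq)
    obtain v' where v': "v' \<in> W" "\<And>p. v' (v p) = p" "\<And>\<nu>. adjoint v' (adjoint v \<nu>) = \<nu>" using W_inverse_obtain[OF vW] by metis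
    have x1: "adjoint (u \<circ> v') \<nu> = \<mu>" unfolding adjoint_comp_W[OF u(1) v'(1)] u(3) using v'(3)[of \<mu>] v2 by simp
    have x2: "adjoint (u \<circ> v') \<mu> = \<nu>" unfolding adjoint_comp_W[OF u(1) v'(1)] using v'(3)[of \<nu>] v1 by simp
    have "(u \<circ> v') y = y" using v'(2)[of y] vy u(2) by simp
    then have "u \<circ> v' = id"
      using pos[of "u \<circ> v'"] x1 x2 \<nu> \<mu>(1) by (intro stabiliser_positive_trivial[OF yC comp_W[OF u(1) v'(1)]]) auto
    then have "\<nu> = \<mu>" using x1 by (simp add: adjoint_id)
    then show ?thesis using ne(1) by blast
  qed
qed

lemma odd_at_stabiliser_trivial:
  assumes x: "x \<in> space_form g" "odd_at x" and \<alpha>: "\<alpha> \<in> R" "\<alpha> \<bullet> x = 0"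
    and u: "u \<in> W" "u x = x" "adjoint u \<alpha> = \<alpha> \<or> adjoint u \<alpha> = - \<alpha>" and p: "\<alpha> \<bullet> p = 0"
  shows "u p = p"
proof -
  obtain w \<nu> where w: "w \<in> W" "w x = fold x" "\<nu> \<in> simple_at (fold x)" "adjoint w \<nu> = \<alpha> \<or> adjoint w \<nu> = - \<alpha>"
    using root_moves_to_simple[OF x(1) \<alpha>] by blast
  obtain w' where w': "w' \<in> W" "\<And>p. w' (w p) = p" "\<And>p. w (w' p) = p" "\<And>\<nu>. adjoint w' (adjoint w \<nu>) = \<nu>" using W_inverse_obtain[OF w(1)] by metis
  have y: "odd_point (fold x)" using x(2) by (simp add: odd_at_def)
  have u\<alpha>: "conormal_form g \<alpha> \<alpha> = 1" using unit \<alpha>(1) .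
  have fix_pos: "v p = p" if v: "v \<in> W" "v x = x" "adjoint v \<alpha> = \<alpha>" for v
  proof -
    have wv: "w \<circ> v \<in> W" using comp_W w(1) v(1) by blast
    have "adjoint (w \<circ> v \<circ> w') \<nu> = adjoint w' (adjoint v (adjoint w \<nu>))"
      by (simp only: adjoint_comp_W[OF wv w'(1)] adjoint_comp_W[OF w(1) v(1)])
    also have "\<dots> = \<nu>" using w(4) v(3) w'(4)[of \<nu>] adjoint_W_neg[OF v(1), of \<alpha>] by metis
    finally have "adjoint (w \<circ> v \<circ> w') \<nu> = \<nu>" .
    moreover have "(w \<circ> v \<circ> w') (fold x) = fold x" using w(2) w'(2)[of x] v(2) by simp
    ultimately have "w \<circ> v \<circ> w' = id" by (intro odd_point_stabiliser_simple[OF y w(3) comp_W[OF wv w'(1)]])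
    then have "(w \<circ> v \<circ> w') (w p) = w p" by simp
    then have "w (v p) = w p" using w'(2) by simp
    then show ?thesis using w'(2) by metis
  qed
  from u(3) show ?thesis
  proof
    assume "adjoint u \<alpha> = \<alpha>"
    then show ?thesis using fix_pos u by blast
  next
    assume neg: "adjoint u \<alpha> = - \<alpha>"
    have rW: "reflection g \<alpha> \<in> W" using root_reflection_W \<alpha>(1) .
    have "adjoint (reflection g \<alpha> \<circ> u) \<alpha> = \<alpha>"
      unfolding adjoint_comp_W[OF rW u(1)] adjoint_reflection[OF u\<alpha>] root_reflection_self[OF u\<alpha>] adjoint_W_neg[OF u(1)] neg by simp
    moreover have "(reflection g \<alpha> \<circ> u) x = x" using u(2) \<alpha>(2) by (simp add: reflection_eq)
    ultimately have "reflection g \<alpha> (u p) = p" using fix_pos[OF comp_W[OF rW u(1)]] by simp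
    moreover have "\<alpha> \<bullet> u p = 0" using inner_W[OF u(1), of \<alpha> p] neg p by simp
    ultimately show ?thesis by (simp add: reflection_eq)
  qed
qed

text \<open>
  Only finitely many elements keep a compact neighbourhood in contact with itself, and each of them that moves \<open>x\<close> is excluded
  by shrinking the neighbourhood.
\<close>

lemma W_discontinuous:
  assumes x: "x \<in> space_form g"
  obtains U where "open U" "x \<in> U" "\<And>w p. w \<in> W \<Longrightarrow> p \<in> space_form g \<Longrightarrow> p \<in> U \<Longrightarrow> w p \<in> U \<Longrightarrow> w x = x"
proof -
  obtain K e where K: "K \<subseteq> space_form g" "compact K" "0 < e" "space_form g \<inter> ball x e \<subseteq> K"
    by (rule connected_compact_neighbourhood[OF x])
  let ?F = "{w\<in>W. (\<exists>p\<in>K. w p \<in> K) \<and> w x \<noteq> x}"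
  have finF: "finite ?F" by (rule finite_subset[OF _ W_proper[OF K(1,2)]]) blast
  have "\<exists>U. open U \<and> x \<in> U \<and> (\<forall>p\<in>U. w p \<notin> U)" if w: "w \<in> ?F" for w
  proof -
    have "w x \<noteq> x" using w by blast
    from hausdorff[OF this] obtain A B where AB: "open A" "open B" "w x \<in> A" "x \<in> B" "A \<inter> B = {}" by blast
    have lin: "linear w" using w linear_W by blast
    show ?thesis
    proof (intro exI[of _ "B \<inter> w -` A"] conjI ballI)
      show "open (B \<inter> w -` A)" using AB open_linear_vimage[OF lin] by blast
    qed (use AB in auto)
  qed
  then have "\<exists>U. \<forall>w\<in>?F. open (U w) \<and> x \<in> U w \<and> (\<forall>p\<in>U w. w p \<notin> U w)" by (intro bchoice) blast
  then obtain U where U: "\<And>w. w \<in> ?F \<Longrightarrow> open (U w) \<and> x \<in> U w \<and> (\<forall>p\<in>U w. w p \<notin> U w)" by (elim exE) blast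
  show thesis
  proof (rule that[of "ball x e \<inter> (\<Inter>w\<in>?F. U w)"])
    show "open (ball x e \<inter> (\<Inter>w\<in>?F. U w))" using U by (intro open_Int open_ball open_INT finF) blast
    show "x \<in> ball x e \<inter> (\<Inter>w\<in>?F. U w)" using U K(3) by simp
    fix w p assume *: "w \<in> W" "p \<in> space_form g" "p \<in> ball x e \<inter> (\<Inter>w\<in>?F. U w)" "w p \<in> ball x e \<inter> (\<Inter>w\<in>?F. U w)"
    have "p \<in> K" "w p \<in> K" using * K(4) W_space_form[OF *(1,2)] by auto
    show "w x = x"
    proof (rule ccontr)
      assume "w x \<noteq> x"
      then have "w \<in> ?F" using \<open>p \<in> K\<close> \<open>w p \<in> K\<close> *(1) by blast
      then show False using U *(3,4) by blast
    qed
  qed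
qed

subsection \<open>The boundary of the chamber\<close>

lemma closed_Ch: "closed Ch"
proof -
  have "Ch = space_form g \<inter> (\<Inter>\<nu>\<in>Pos. {p. 0 \<le> \<nu> \<bullet> p})" by (auto simp: Ch_def)
  moreover have "closed (\<Inter>\<nu>\<in>Pos. {p. 0 \<le> \<nu> \<bullet> p})" by (intro closed_INT ballI closed_Collect_le continuous_intros)
  ultimately show ?thesis using closed_Int[OF closed_space_form] by (simp only:)
qed

lemma boundary_surface_Ch: "boundary_surface g Ch = Ch - Ch_int"
proof -
  have "closedin (top_of_set (space_form g)) Ch" using closed_Ch ChD(1) by (intro closed_subset) blast
  then show ?thesis unfolding boundary_surface_def frontier_of_def interior_of_Ch by (simp add: closure_of_closedin)
qed

lemma fold_on_mirror_in_boundary: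
  assumes x: "x \<in> space_form g" and \<alpha>: "\<alpha> \<in> R" "\<alpha> \<bullet> x = 0"
  shows "fold x \<in> boundary_surface g Ch"
proof -
  obtain w \<nu> where w: "\<nu> \<in> simple_at (fold x)" using root_moves_to_simple[OF assms] by blast
  have "fold x \<notin> Ch_int" using simple_atD(2,4)[OF w] unfolding Ch_int_def by fastforce
  then show ?thesis unfolding boundary_surface_Ch using fold_props(1)[OF x] by blast
qed

lemma boundary_point_on_wall:
  assumes "y \<in> boundary_surface g Ch" obtains \<nu> where "\<nu> \<in> simple_at y" "y \<in> Ch"
  using assms simple_at_nonempty unfolding boundary_surface_Ch by blast

end

section \<open>A mirror as a space form of one dimension less\<close>

text \<open>
  With \<open>\<alpha> = (s n, t)\<close> for a unit vector \<open>n\<close>, the vector \<open>(- t n, s)\<close> lies in the kernel of \<open>\<alpha>\<close>; it is the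
  image of the base point, and the complement of \<open>n\<close> supplies the remaining directions.
\<close>

locale hyperplane_embedding =
  fixes g :: geometry and \<alpha> :: "'a::euclidean_space \<times> real" and \<iota> :: "'b::euclidean_space \<times> real \<Rightarrow> 'a \<times> real"
    and \<pi> :: "'a \<times> real \<Rightarrow> 'b \<times> real"
  assumes linear_emb: "linear \<iota>" and linear_proj: "linear \<pi>" and proj_emb: "\<pi> (\<iota> v) = v"
    and emb_mirror: "\<alpha> \<bullet> \<iota> v = 0"
    and emb_space: "v \<in> space_form g \<Longrightarrow> \<iota> v \<in> space_form g"
    and proj_space: "x \<in> space_form g \<Longrightarrow> \<alpha> \<bullet> x = 0 \<Longrightarrow> \<pi> x \<in> space_form g \<and> \<iota> (\<pi> x) = x"
    and emb_sep: "v \<in> space_form g \<Longrightarrow> v' \<in> space_form g \<Longrightarrow> sep g (\<iota> v) (\<iota> v') = sep g v v'"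
    and emb_form: "conormal_form g \<nu> \<alpha> = 0 \<Longrightarrow> conormal_form g \<mu> \<alpha> = 0 \<Longrightarrow>
       conormal_form g (adjoint \<iota> \<nu>) (adjoint \<iota> \<mu>) = conormal_form g \<nu> \<mu>"

lemma hyperplane_embedding_exists:
  fixes \<alpha> :: "'a::euclidean_space \<times> real"
  assumes dim: "DIM('a) = DIM('b::euclidean_space) + 1" and \<alpha>: "conormal_form g \<alpha> \<alpha> = 1"
  obtains \<iota> :: "'b::euclidean_space \<times> real \<Rightarrow> 'a \<times> real" and \<pi> where "hyperplane_embedding g \<alpha> \<iota> \<pi>"
proof -
  define s where "s = norm (fst \<alpha>)"
  define t where "t = snd \<alpha>"
  let ?k = "curvature g"
  obtain n :: 'a where n: "norm n = 1" "fst \<alpha> = s *\<^sub>R n"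
  proof (cases "fst \<alpha> = 0")
    case True
    obtain e :: 'a where "norm e = 1" using vector_choose_size[of 1] by auto
    then show ?thesis using that[of e] True by (simp add: s_def)
  next
    case False
    then show ?thesis using that[of "fst \<alpha> /\<^sub>R s"] by (simp add: s_def)
  qed
  have nn: "n \<bullet> n = 1" using n(1) by (simp add: norm_eq_1)
  have st: "s * s + ?k * (t * t) = 1" using \<alpha> n nn by (simp add: conormal_form_def t_def)
  have s0: "0 \<le> s" by (simp add: s_def)
  have \<alpha>_inner: "\<alpha> \<bullet> x = s * (n \<bullet> fst x) + t * snd x" for x by (simp add: inner_prod_def n(2) t_def)
  have "n \<noteq> 0" using n(1) by auto
  then have "dim {x. n \<bullet> x = 0} = dim (UNIV :: 'b set)" using dim_hyperplane[of n] dim by simp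
  then obtain M M' where M: "linear M" "linear M'" "M ` (UNIV :: 'b set) = {x. n \<bullet> x = 0}" "M' ` {x. n \<bullet> x = 0} = UNIV"
      "\<And>y :: 'b. norm (M y) = norm y" "\<And>y. M' (M y) = y"
    using isometries_subspaces[of "UNIV :: 'b set" "{x. n \<bullet> x = 0}"] subspace_hyperplane[of n] subspace_UNIV
    by (metis (no_types, lifting) UNIV_I)
  have nM: "n \<bullet> M y = 0" for y using M(3) by blast
  have MM: "M y \<bullet> M z = y \<bullet> z" for y z
    using M(5)[of "y + z"] M(5)[of y] M(5)[of z] by (simp add: linear_add[OF M(1)] dot_norm)
  let ?A = "adjoint M"
  have A: "?A x \<bullet> y = x \<bullet> M y" for x y using adjoint_works[OF M(1), of y x] by (simp add: inner_commute)
  have AM: "?A (M y) = y" for y by (rule vector_eq_rdot[THEN iffD1]) (simp add: A MM)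
  have An: "?A n = 0" by (rule vector_eq_rdot[THEN iffD1]) (simp add: A nM)
  have linA: "linear ?A" by (rule adjoint_linear[OF M(1)])
  have MA: "M (?A x) = x - (n \<bullet> x) *\<^sub>R n" for x
  proof -
    have "n \<bullet> (x - (n \<bullet> x) *\<^sub>R n) = 0" by (simp add: inner_diff_right nn)
    then obtain y where y: "x - (n \<bullet> x) *\<^sub>R n = M y" using M(3) by blast
    then have "?A (x - (n \<bullet> x) *\<^sub>R n) = y" using AM by simp
    then have "?A x = y" by (simp add: linear_diff[OF linA] linear_scale[OF linA] An)
    then show ?thesis using y by simp
  qed
  define \<iota> :: "'b \<times> real \<Rightarrow> 'a \<times> real" where "\<iota> v = (M (fst v) - (snd v * t) *\<^sub>R n, snd v * s)" for v
  define \<pi> :: "'a \<times> real \<Rightarrow> 'b \<times> real" where "\<pi> x = (?A (fst x), s * snd x - ?k * t * (n \<bullet> fst x))" for x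
  have lin: "linear \<iota>" unfolding \<iota>_def
    by (rule linearI) (simp_all add: linear_add[OF M(1)] linear_scale[OF M(1)] algebra_simps)
  have lin': "linear \<pi>" unfolding \<pi>_def
    by (rule linearI) (simp_all add: linear_add[OF linA] linear_scale[OF linA] inner_add_right algebra_simps)
  have adj: "adjoint \<iota> x = (?A (fst x), s * snd x - t * (n \<bullet> fst x))" for x
  proof -
    have "\<iota> v \<bullet> x = v \<bullet> (?A (fst x), s * snd x - t * (n \<bullet> fst x))" for v x
      by (simp add: \<iota>_def inner_prod_def inner_diff_left A inner_commute[of "fst v"] inner_commute[of n] inner_commute[of "M (fst v)"] algebra_simps)
    then show ?thesis using adjoint_unique[of \<iota> "\<lambda>x. (?A (fst x), s * snd x - t * (n \<bullet> fst x))"] by simp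
  qed
  have norm_iota: "(norm (fst (\<iota> v)))\<^sup>2 = (norm (fst v))\<^sup>2 + (snd v * t)\<^sup>2" for v
    unfolding power2_norm_eq_inner
    by (simp add: \<iota>_def inner_diff_left inner_diff_right MM nM nn inner_commute[of "M (fst v)" n] power2_eq_square)
  have emb_proj: "\<iota> (\<pi> x) = x" if "\<alpha> \<bullet> x = 0" for x
  proof -
    have z: "s * (n \<bullet> fst x) + t * snd x = 0" using that \<alpha>_inner by simp
    have "(s * snd x - ?k * t * (n \<bullet> fst x)) * s = s * s * snd x - ?k * t * (s * (n \<bullet> fst x))" by (simp add: algebra_simps)
    also have "s * (n \<bullet> fst x) = - (t * snd x)" using z by simp
    also have "s * s * snd x - ?k * t * - (t * snd x) = (s * s + ?k * (t * t)) * snd x" by (simp add: algebra_simps)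
    finally have 2: "(s * snd x - ?k * t * (n \<bullet> fst x)) * s = snd x" using st by simp
    have "(s * snd x - ?k * t * (n \<bullet> fst x)) * t = s * (t * snd x) - ?k * (t * t) * (n \<bullet> fst x)" by (simp add: algebra_simps)
    also have "t * snd x = - (s * (n \<bullet> fst x))" using z by simp
    also have "s * - (s * (n \<bullet> fst x)) - ?k * (t * t) * (n \<bullet> fst x) = - ((s * s + ?k * (t * t)) * (n \<bullet> fst x))" by (simp add: algebra_simps)
    finally have 1: "(s * snd x - ?k * t * (n \<bullet> fst x)) * t = - (n \<bullet> fst x)" using st by simp
    show ?thesis unfolding \<iota>_def \<pi>_def fst_conv snd_conv 1 2 MA by (simp add: prod_eq_iff)
  qed
  have qf: "qform g (\<iota> v) = qform g v" for v
  proof -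
    have "qform g (\<iota> v) = ?k * (norm (fst v))\<^sup>2 + (s * s + ?k * (t * t)) * (snd v)\<^sup>2"
      unfolding qform_def norm_iota by (simp add: \<iota>_def power_mult_distrib power2_eq_square algebra_simps)
    then show ?thesis using st by (simp add: qform_def)
  qed
  have spos: "0 < s" if "g \<noteq> Spherical"
  proof -
    have "?k * (t * t) \<le> 0" using that by (cases g) auto
    then have "s \<noteq> 0" using st by force
    then show ?thesis using s0 by simp
  qed
  have "hyperplane_embedding g \<alpha> \<iota> \<pi>"
  proof (rule hyperplane_embedding.intro)
    show "linear \<iota>" "linear \<pi>" by fact+
    fix v :: "'b \<times> real"
    show "\<pi> (\<iota> v) = v"
    proof -
      have "?A (M (fst v) - (snd v * t) *\<^sub>R n) = fst v" by (simp add: linear_diff[OF linA] linear_scale[OF linA] An AM)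
      moreover have "s * (snd v * s) - ?k * t * (n \<bullet> (M (fst v) - (snd v * t) *\<^sub>R n)) = (s * s + ?k * (t * t)) * snd v"
        by (simp add: inner_diff_right nM nn algebra_simps)
      ultimately show ?thesis using st by (simp add: \<iota>_def \<pi>_def prod_eq_iff)
    qed
    show "\<alpha> \<bullet> \<iota> v = 0" unfolding \<alpha>_inner by (simp add: \<iota>_def inner_diff_right nM nn)
    show "\<iota> v \<in> space_form g" if "v \<in> space_form g"
      using that spos qf[of v] by (auto simp: space_form_iff cone_over_def \<iota>_def zero_less_mult_iff)
    show "\<pi> x \<in> space_form g \<and> \<iota> (\<pi> x) = x" if x: "x \<in> space_form g" "\<alpha> \<bullet> x = 0" for x
    proof -
      have eq: "\<iota> (\<pi> x) = x" using emb_proj x(2) .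
      then have "snd (\<pi> x) * s = snd x" by (metis \<iota>_def snd_conv)
      then have "0 < snd (\<pi> x)" if "0 < snd x" using that s0 mult_nonpos_nonneg[of "snd (\<pi> x)" s] by linarith
      moreover have "qform g (\<pi> x) = 1" using qf[of "\<pi> x"] eq x(1) by (simp add: space_form_iff)
      ultimately show ?thesis using eq x(1)
        by (auto simp: space_form_iff cone_over_def)
    qed
    show "sep g (\<iota> v) (\<iota> v') = sep g v v'" if v: "v \<in> space_form g" "v' \<in> space_form g" for v v'
    proof -
      let ?w = "v - v'"
      have k: "?k * (?k * snd ?w) = snd ?w" using curvature_snd_diff[OF v] .
      have "sep g (\<iota> v) (\<iota> v') = conormal_form g (\<iota> ?w) (\<iota> ?w)" unfolding sep_def linear_diff[OF lin] ..
      also have "\<dots> = (norm (fst (\<iota> ?w)))\<^sup>2 + ?k * ((snd ?w * s) * (snd ?w * s))"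
        unfolding conormal_form_def power2_norm_eq_inner by (simp add: \<iota>_def)
      also have "\<dots> = (norm (fst ?w))\<^sup>2 + (snd ?w * t * t * snd ?w + ?k * ((snd ?w * s) * (snd ?w * s)))"
        unfolding norm_iota by (simp add: power2_eq_square algebra_simps)
      also have "snd ?w * t * t * snd ?w = (?k * (?k * snd ?w)) * t * t * snd ?w" unfolding k ..
      also have "(norm (fst ?w))\<^sup>2 + (?k * (?k * snd ?w) * t * t * snd ?w + ?k * ((snd ?w * s) * (snd ?w * s)))
          = (norm (fst ?w))\<^sup>2 + ?k * (snd ?w * snd ?w) * (s * s + ?k * (t * t))" by (simp add: algebra_simps)
      also have "\<dots> = sep g v v'" unfolding st sep_def conormal_form_def power2_norm_eq_inner by simp
      finally show ?thesis .
    qed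
    fix \<nu> \<mu> assume orth: "conormal_form g \<nu> \<alpha> = 0" "conormal_form g \<mu> \<alpha> = 0"
    have o: "s * (n \<bullet> fst x) + ?k * (t * snd x) = 0" if "conormal_form g x \<alpha> = 0" for x
      using that by (simp add: conormal_form_def n(2) t_def inner_commute mult.commute)
    have AA: "?A x \<bullet> ?A y = x \<bullet> y - (n \<bullet> x) * (n \<bullet> y)" for x y by (simp add: A MA inner_diff_right inner_commute)
    let ?p = "n \<bullet> fst \<nu>" let ?q = "n \<bullet> fst \<mu>"
    have "?k * ((s * snd \<nu> - t * ?p) * (s * snd \<mu> - t * ?q)) =
       ?k * (s * s) * (snd \<nu> * snd \<mu>) + ?k * (t * t) * (?p * ?q) - s * ?q * (?k * (t * snd \<nu>)) - s * ?p * (?k * (t * snd \<mu>))"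
      by (simp add: algebra_simps)
    also have "?k * (t * snd \<nu>) = - (s * ?p)" using o[OF orth(1)] by simp
    also have "?k * (t * snd \<mu>) = - (s * ?q)" using o[OF orth(2)] by simp
    also have "?k * (s * s) * (snd \<nu> * snd \<mu>) + ?k * (t * t) * (?p * ?q) - s * ?q * - (s * ?p) - s * ?p * - (s * ?q)
       = ?k * (s * s) * (snd \<nu> * snd \<mu>) + (s * s + ?k * (t * t)) * (?p * ?q) + (s * ?p) * (s * ?q)" by (simp add: algebra_simps)
    also have "(s * ?p) * (s * ?q) = (- (?k * (t * snd \<nu>))) * (- (?k * (t * snd \<mu>)))"
      using o[OF orth(1)] o[OF orth(2)] by (metis add_eq_0_iff2)
    also have "?k * (s * s) * (snd \<nu> * snd \<mu>) + (s * s + ?k * (t * t)) * (?p * ?q) + (- (?k * (t * snd \<nu>))) * (- (?k * (t * snd \<mu>)))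
       = ?k * (s * s + ?k * (t * t)) * (snd \<nu> * snd \<mu>) + (s * s + ?k * (t * t)) * (?p * ?q)" by (simp add: algebra_simps)
    finally have "?k * ((s * snd \<nu> - t * ?p) * (s * snd \<mu> - t * ?q)) = ?k * (snd \<nu> * snd \<mu>) + ?p * ?q" using st by simp
    then show "conormal_form g (adjoint \<iota> \<nu>) (adjoint \<iota> \<mu>) = conormal_form g \<nu> \<mu>"
      unfolding adj conormal_form_def fst_conv snd_conv AA by simp
  qed
  then show thesis by (rule that)
qed

section \<open>The chamber cut out on a mirror by the perpendicular mirrors\<close>

text \<open>
  The mirror of the root \<open>\<alpha>\<close> is parametrised by the space form of one dimension less; the base point \<open>v0\<close> is a point whose fold
  lies on no even hyperedge.
\<close>

locale mirror_chamber = proper_chamber g R c + hyperplane_embedding g \<alpha> \<iota> \<pi>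
  for g and R :: "('a::euclidean_space \<times> real) set" and c \<alpha> and \<iota> :: "'b::euclidean_space \<times> real \<Rightarrow> 'a \<times> real" and \<pi> +
  fixes v0 :: "'b \<times> real"
  assumes \<alpha>_root: "\<alpha> \<in> R" and v0_space: "v0 \<in> space_form g" and v0_odd: "odd_at (\<iota> v0)"
begin

text \<open>
  A root perpendicular to \<open>\<alpha>\<close> restricts to the mirror with its length unchanged, and its reflection restricts to the
  reflection in the restricted root.
\<close>

definition mirror_roots where "mirror_roots = adjoint \<iota> ` {\<nu>\<in>R. conormal_form g \<nu> \<alpha> = 0}"

lemma inner_emb: "\<nu> \<bullet> \<iota> v = adjoint \<iota> \<nu> \<bullet> v"
  using adjoint_works[OF linear_emb, of v \<nu>] by (simp add: inner_commute)

lemma mirror_rootsI: "\<nu> \<in> R \<Longrightarrow> conormal_form g \<nu> \<alpha> = 0 \<Longrightarrow> adjoint \<iota> \<nu> \<in> mirror_roots"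
  unfolding mirror_roots_def by blast

lemma mirror_roots_regular_iff:
  assumes v: "v \<in> space_form g" shows "(\<forall>\<beta>\<in>mirror_roots. \<beta> \<bullet> v \<noteq> 0) \<longleftrightarrow> odd_at (\<iota> v)"
proof -
  have "(\<exists>\<beta>\<in>mirror_roots. \<beta> \<bullet> v = 0) \<longleftrightarrow> (\<exists>\<nu>\<in>R. \<nu> \<bullet> \<iota> v = 0 \<and> conormal_form g \<alpha> \<nu> = 0)"
    unfolding mirror_roots_def using inner_emb conormal_form_commute[of g \<alpha>] by auto
  then show ?thesis using perpendicular_iff_not_odd[OF emb_space[OF v] \<alpha>_root emb_mirror] by blast
qed

lemma chamber_mirror: "chamber g mirror_roots v0"
proof
  have lin: "linear (adjoint \<iota>)" by (rule adjoint_linear[OF linear_emb])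
  show unit': "conormal_form g \<beta> \<beta> = 1" if \<beta>: "\<beta> \<in> mirror_roots" for \<beta>
  proof -
    obtain \<nu> where "\<nu> \<in> R" "conormal_form g \<nu> \<alpha> = 0" "\<beta> = adjoint \<iota> \<nu>" using \<beta> unfolding mirror_roots_def by blast
    then show ?thesis using emb_form[of \<nu> \<nu>] unit by simp
  qed
  show "root_reflection g \<beta> \<gamma> \<in> mirror_roots" if \<beta>\<gamma>: "\<beta> \<in> mirror_roots" "\<gamma> \<in> mirror_roots" for \<beta> \<gamma>
  proof -
    obtain \<nu> where \<nu>: "\<nu> \<in> R" "conormal_form g \<nu> \<alpha> = 0" "\<beta> = adjoint \<iota> \<nu>" using \<beta>\<gamma>(1) unfolding mirror_roots_def by blast
    obtain \<mu> where \<mu>: "\<mu> \<in> R" "conormal_form g \<mu> \<alpha> = 0" "\<gamma> = adjoint \<iota> \<mu>" using \<beta>\<gamma>(2) unfolding mirror_roots_def by blast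
    have "adjoint \<iota> (root_reflection g \<nu> \<mu>) = root_reflection g \<beta> \<gamma>"
      using emb_form[OF \<nu>(2) \<mu>(2)] by (simp add: root_reflection_def linear_diff[OF lin] linear_scale[OF lin] \<nu>(3) \<mu>(3))
    moreover have "conormal_form g (root_reflection g \<nu> \<mu>) \<alpha> = 0"
      using \<nu>(2) \<mu>(2) by (simp add: root_reflection_def conormal_form_simps)
    ultimately show ?thesis using mirror_rootsI[OF closed_reflection[OF \<nu>(1) \<mu>(1)]] by metis
  qed
  show "v0 \<in> space_form g" by (rule v0_space)
  show "\<beta> \<bullet> v0 \<noteq> 0" if "\<beta> \<in> mirror_roots" for \<beta> using mirror_roots_regular_iff[OF v0_space] v0_odd that by blast
  fix K :: "('b \<times> real) set" assume K: "K \<subseteq> space_form g" "compact K"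
  have "compact (\<iota> ` K)"
    using K(2) linear_continuous_on[of \<iota>] linear_emb by (intro compact_continuous_image) (simp_all add: linear_conv_bounded_linear)
  moreover have "\<iota> ` K \<subseteq> space_form g" using K(1) emb_space by blast
  ultimately have "finite {\<nu>\<in>R. \<exists>p\<in>\<iota> ` K. \<nu> \<bullet> p = 0}" by (intro locally_finite)
  moreover have "{\<beta>\<in>mirror_roots. \<exists>p\<in>K. \<beta> \<bullet> p = 0} \<subseteq> adjoint \<iota> ` {\<nu>\<in>R. \<exists>p\<in>\<iota> ` K. \<nu> \<bullet> p = 0}"
  proof
    fix \<beta> assume "\<beta> \<in> {\<beta>\<in>mirror_roots. \<exists>p\<in>K. \<beta> \<bullet> p = 0}"
    then obtain p \<nu> where "p \<in> K" "\<beta> \<bullet> p = 0" "\<nu> \<in> R" "\<beta> = adjoint \<iota> \<nu>" unfolding mirror_roots_def by blast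
    then show "\<beta> \<in> adjoint \<iota> ` {\<nu>\<in>R. \<exists>p\<in>\<iota> ` K. \<nu> \<bullet> p = 0}" using inner_emb by (intro image_eqI[of _ _ \<nu>]) auto
  qed
  ultimately show "finite {\<beta>\<in>mirror_roots. \<exists>p\<in>K. \<beta> \<bullet> p = 0}" using finite_surj by blast
qed

sublocale D: chamber g mirror_roots v0 by (rule chamber_mirror)

definition U where "U = D.Ch_int"

definition \<phi> where "\<phi> v = fold (\<iota> v)"

lemma U_space: "v \<in> U \<Longrightarrow> v \<in> space_form g" by (simp add: U_def D.Ch_int_def)

lemma U_emb: "v \<in> U \<Longrightarrow> \<iota> v \<in> space_form g" using U_space emb_space by blast

lemma U_odd: assumes "v \<in> U" shows "odd_at (\<iota> v)"
proof -
  have "\<beta> \<bullet> v \<noteq> 0" if "\<beta> \<in> mirror_roots" for \<beta>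
  proof -
    have "0 < \<beta> \<bullet> v \<or> 0 < - \<beta> \<bullet> v" using assms D.Pos_or_neg[OF that] unfolding U_def D.Ch_int_def by blast
    then show ?thesis by auto
  qed
  then show ?thesis using mirror_roots_regular_iff[OF U_space[OF assms]] by blast
qed

lemma v0_U: "v0 \<in> U" unfolding U_def by (rule D.c_in_Ch_int)

lemma open_subset_U: "openin (top_of_set U) A \<Longrightarrow> \<exists>O'. open O' \<and> A = space_form g \<inter> O'"
  using openin_trans[OF _ D.openin_Ch_int, folded U_def] unfolding openin_open by blast

lemma continuous_emb: "continuous_on A \<iota>"
  using linear_emb linear_continuous_on linear_conv_bounded_linear by blast

lemma continuous_proj: "continuous_on A \<pi>"
  using linear_proj linear_continuous_on linear_conv_bounded_linear by blast

lemma continuous_\<phi>: "A \<subseteq> space_form g \<Longrightarrow> continuous_on A \<phi>"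
  unfolding \<phi>_def using emb_space by (intro continuous_on_compose2[OF continuous_on_fold continuous_emb]) blast

abbreviation Bd where "Bd \<equiv> boundary_surface g Ch - \<Union>(even_hyperedges g Ch)"

lemma \<phi>_Bd: assumes "v \<in> U" shows "\<phi> v \<in> Bd"
  using fold_on_mirror_in_boundary[OF U_emb[OF assms] \<alpha>_root emb_mirror] U_odd[OF assms]
  unfolding odd_at_def odd_point_def \<phi>_def by blast

lemma Bd_odd: assumes "y \<in> Bd" shows "odd_at y" "fold y = y" "y \<in> space_form g" "y \<in> Ch"
proof -
  show C: "y \<in> Ch" using assms unfolding boundary_surface_Ch by blast
  then show f: "fold y = y" "y \<in> space_form g" using fold_Ch ChD(1) by auto
  show "odd_at y" using assms C unfolding odd_at_def odd_point_def f(1) by blast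
qed

text \<open>Deck transformations of the covering by folding arise from the elements that preserve the mirror.\<close>

definition \<Gamma> where "\<Gamma> = {u\<in>W. adjoint u \<alpha> = \<alpha> \<or> adjoint u \<alpha> = - \<alpha>}"

lemma \<Gamma>_mirror: "u \<in> \<Gamma> \<Longrightarrow> \<alpha> \<bullet> u (\<iota> v) = 0"
  using inner_W[of u \<alpha> "\<iota> v"] emb_mirror[of v] unfolding \<Gamma>_def by auto

lemma \<Gamma>_act:
  assumes "u \<in> \<Gamma>" "v \<in> space_form g"
  shows "\<pi> (u (\<iota> v)) \<in> space_form g" "\<iota> (\<pi> (u (\<iota> v))) = u (\<iota> v)"
proof -
  have "u (\<iota> v) \<in> space_form g" using W_space_form emb_space assms unfolding \<Gamma>_def by blast
  then show "\<pi> (u (\<iota> v)) \<in> space_form g" "\<iota> (\<pi> (u (\<iota> v))) = u (\<iota> v)"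
    using proj_space \<Gamma>_mirror[OF assms(1)] by blast+
qed

lemma \<Gamma>_comp: "u \<in> \<Gamma> \<Longrightarrow> w \<in> \<Gamma> \<Longrightarrow> u \<circ> w \<in> \<Gamma>"
proof -
  assume u: "u \<in> \<Gamma>" and w: "w \<in> \<Gamma>"
  then have W: "u \<in> W" "w \<in> W" unfolding \<Gamma>_def by auto
  have "adjoint (u \<circ> w) \<alpha> = adjoint w (adjoint u \<alpha>)" using adjoint_comp_W[OF W] .
  then have "adjoint (u \<circ> w) \<alpha> = \<alpha> \<or> adjoint (u \<circ> w) \<alpha> = - \<alpha>"
    using u w adjoint_W_neg[OF W(2), of \<alpha>] unfolding \<Gamma>_def mem_Collect_eq by (metis minus_minus)
  then show ?thesis unfolding \<Gamma>_def using comp_W[OF W] by blast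
qed

lemma \<Gamma>_inverse: assumes "u \<in> \<Gamma>" obtains u' where "u' \<in> \<Gamma>" "\<And>p. u' (u p) = p" "\<And>p. u (u' p) = p"
proof -
  have uW: "u \<in> W" using assms unfolding \<Gamma>_def by blast
  obtain u' where u': "u' \<in> W" "\<And>p. u' (u p) = p" "\<And>p. u (u' p) = p" "\<And>\<nu>. adjoint u' (adjoint u \<nu>) = \<nu>"
    by (rule W_inverse_obtain[OF uW]) blast
  have "adjoint u \<alpha> = \<alpha> \<or> adjoint u \<alpha> = - \<alpha>" using assms unfolding \<Gamma>_def by blast
  then have "adjoint u' \<alpha> = \<alpha> \<or> adjoint u' \<alpha> = - \<alpha>"
    using u'(4)[of \<alpha>] adjoint_W_neg[OF u'(1), of \<alpha>] by (metis minus_minus)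
  then show thesis using that[of u'] u' unfolding \<Gamma>_def by blast
qed

text \<open>
  An element that preserves the mirror permutes the perpendicular mirrors, hence the chambers that they cut out.
\<close>

lemma U_\<Gamma>_invariant:
  assumes u: "u \<in> \<Gamma>" and v: "v \<in> U" "\<pi> (u (\<iota> v)) \<in> U" and z: "z \<in> U"
  shows "\<pi> (u (\<iota> z)) \<in> U"
proof -
  have uW: "u \<in> W" using u unfolding \<Gamma>_def by blast
  have "0 < \<beta> \<bullet> \<pi> (u (\<iota> z))" if \<beta>: "\<beta> \<in> D.Pos" for \<beta>
  proof -
    obtain \<nu> where \<nu>: "\<nu> \<in> R" "conormal_form g \<nu> \<alpha> = 0" "\<beta> = adjoint \<iota> \<nu>" using D.PosD(1)[OF \<beta>] unfolding mirror_roots_def by blast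
    define \<gamma> where "\<gamma> = adjoint \<iota> (adjoint u \<nu>)"
    have act: "\<beta> \<bullet> \<pi> (u (\<iota> x)) = \<gamma> \<bullet> x" if "x \<in> space_form g" for x
      using inner_emb[of \<nu> "\<pi> (u (\<iota> x))"] \<Gamma>_act(2)[OF u that] inner_W[OF uW, of \<nu> "\<iota> x"] inner_emb[of "adjoint u \<nu>" x]
      by (simp add: \<nu>(3) \<gamma>_def)
    have "conormal_form g (adjoint u \<nu>) (adjoint u \<alpha>) = 0" unfolding motion_form[OF motion_W[OF uW]] by (rule \<nu>(2))
    then have "conormal_form g (adjoint u \<nu>) \<alpha> = 0" using u unfolding \<Gamma>_def by (auto simp: conormal_form_simps)
    then have \<gamma>: "\<gamma> \<in> mirror_roots" unfolding \<gamma>_def by (rule mirror_rootsI[OF adjoint_W_root[OF uW \<nu>(1)]])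
    have "0 < \<gamma> \<bullet> v" using act[OF U_space[OF v(1)]] v(2) \<beta> unfolding U_def D.Ch_int_def by auto
    moreover have "0 < - \<gamma> \<bullet> v" if "- \<gamma> \<in> D.Pos" using v(1) that unfolding U_def D.Ch_int_def by blast
    ultimately have "\<gamma> \<in> D.Pos" using D.Pos_or_neg[OF \<gamma>] by auto
    then have "0 < \<gamma> \<bullet> z" using z unfolding U_def D.Ch_int_def by blast
    then show ?thesis using act[OF U_space[OF z]] by simp
  qed
  then show ?thesis using \<Gamma>_act(1)[OF u U_space[OF z]] unfolding U_def D.Ch_int_def by blast
qed

text \<open>
  An element that carries \<open>p\<close> to a point \<open>x\<close> of the mirror can be corrected by the stabiliser of \<open>x\<close> so that a given mirror through \<open>p\<close> goes to the
  mirror of \<open>\<alpha>\<close>.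
\<close>

lemma mirror_conjugation:
  assumes x: "x \<in> space_form g" "odd_at x" "\<alpha> \<bullet> x = 0" and w: "w \<in> W" "w p = x" and \<nu>: "\<nu> \<in> R" "\<nu> \<bullet> p = 0"
  obtains u where "u \<in> W" "u p = x" "adjoint u \<alpha> = \<nu> \<or> adjoint u \<alpha> = - \<nu>"
proof -
  obtain w' where w': "w' \<in> W" "\<And>p. w' (w p) = p" "\<And>\<nu>. adjoint w (adjoint w' \<nu>) = \<nu>" using W_inverse_obtain[OF w(1)] by metis
  have "adjoint w' \<nu> \<bullet> x = 0" using inner_W[OF w'(1), of \<nu> x] w'(2)[of p] w(2) \<nu>(2) by simp
  then obtain z where z: "z \<in> W" "z x = x" "adjoint z \<alpha> = adjoint w' \<nu> \<or> adjoint z \<alpha> = - adjoint w' \<nu>"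
    using odd_at_mirrors_conjugate[OF x(1,2) adjoint_W_root[OF w'(1) \<nu>(1)] _ \<alpha>_root x(3)] by blast
  show thesis
  proof (rule that[OF comp_W[OF z(1) w(1)]])
    show "(z \<circ> w) p = x" using w(2) z(2) by simp
    show "adjoint (z \<circ> w) \<alpha> = \<nu> \<or> adjoint (z \<circ> w) \<alpha> = - \<nu>"
      unfolding adjoint_comp_W[OF z(1) w(1)] using z(3) w'(3)[of \<nu>] adjoint_W_neg[OF w(1), of "adjoint w' \<nu>"] by metis
  qed
qed

lemma \<phi>_eq_imp_\<Gamma>:
  assumes v: "v \<in> U" "v' \<in> U" and eq: "\<phi> v = \<phi> v'"
  obtains u where "u \<in> \<Gamma>" "u (\<iota> v) = \<iota> v'"
proof -
  obtain w where w: "w \<in> W" "w (\<iota> v) = \<iota> v'" using fold_eq_iff[OF U_emb[OF v(1)] U_emb[OF v(2)]] eq unfolding \<phi>_def by blast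
  obtain u where "u \<in> W" "u (\<iota> v) = \<iota> v'" "adjoint u \<alpha> = \<alpha> \<or> adjoint u \<alpha> = - \<alpha>"
    using mirror_conjugation[OF U_emb[OF v(2)] U_odd[OF v(2)] emb_mirror w \<alpha>_root emb_mirror] by blast
  then show thesis using that unfolding \<Gamma>_def by blast
qed

lemma \<Gamma>_free:
  assumes "u \<in> \<Gamma>" "v \<in> U" "u (\<iota> v) = \<iota> v" shows "u (\<iota> z) = \<iota> z"
proof -
  have u: "u \<in> W" "adjoint u \<alpha> = \<alpha> \<or> adjoint u \<alpha> = - \<alpha>" using assms(1) unfolding \<Gamma>_def by auto
  show ?thesis by (rule odd_at_stabiliser_trivial[OF U_emb[OF assms(2)] U_odd[OF assms(2)] \<alpha>_root emb_mirror u(1) assms(3) u(2) emb_mirror])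
qed

text \<open>
  The map is open: near \<open>\<phi> v\<close> the boundary consists of the walls through \<open>\<phi> v\<close>, and for each of them an
  element of the group carries it into the mirror and \<open>\<phi> v\<close> to the point of the mirror given by \<open>v\<close>.
\<close>

lemma \<phi>_open:
  assumes A: "openin (top_of_set U) A" and v: "v \<in> A"
  obtains Q where "open Q" "\<phi> v \<in> Q" "Q \<inter> boundary_surface g Ch \<subseteq> \<phi> ` A"
proof -
  obtain O' where O': "open O'" "A = space_form g \<inter> O'" using open_subset_U[OF A] by blast
  have vU: "v \<in> U" using openin_imp_subset[OF A] v by blast
  let ?x = "\<iota> v" let ?y = "fold ?x"
  have x: "?x \<in> space_form g" using U_emb[OF vU] .
  have yC: "?y \<in> Ch" using fold_props(1)[OF x] .
  have yS: "?y \<in> space_form g" using ChD(1)[OF yC] .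
  obtain w0 where w0: "w0 \<in> W" "w0 ?x = ?y" using fold_props(2)[OF x] by blast
  obtain w where w: "w \<in> W" "w ?y = ?x" using W_inverse_obtain[OF w0(1)] w0(2) by metis
  have "\<exists>u. u \<in> W \<and> u ?y = ?x \<and> (adjoint u \<alpha> = \<nu> \<or> adjoint u \<alpha> = - \<nu>)" if "\<nu> \<in> simple_at ?y" for \<nu>
    using mirror_conjugation[OF x U_odd[OF vU] emb_mirror w simple_atD(3)[OF that] simple_atD(2)[OF that]] by blast
  then have "\<exists>G. \<forall>\<nu>\<in>simple_at ?y. G \<nu> \<in> W \<and> G \<nu> ?y = ?x \<and> (adjoint (G \<nu>) \<alpha> = \<nu> \<or> adjoint (G \<nu>) \<alpha> = - \<nu>)"
    by (intro bchoice) blast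
  then obtain G where G: "\<And>\<nu>. \<nu> \<in> simple_at ?y \<Longrightarrow> G \<nu> \<in> W \<and> G \<nu> ?y = ?x \<and> (adjoint (G \<nu>) \<alpha> = \<nu> \<or> adjoint (G \<nu>) \<alpha> = - \<nu>)"
    by blast
  obtain e where e: "0 < e" "\<And>\<nu> p. \<nu> \<in> R \<Longrightarrow> 0 < \<nu> \<bullet> ?y \<Longrightarrow> p \<in> space_form g \<Longrightarrow> p \<in> ball ?y e \<Longrightarrow> 0 < \<nu> \<bullet> p"
    using sign_stable[OF yS] by blast
  define Q where "Q = ball ?y e \<inter> (\<Inter>\<nu>\<in>simple_at ?y. (\<lambda>p. \<pi> (G \<nu> p)) -` O')"
  have "open ((\<lambda>p. \<pi> (G \<nu> p)) -` O')" if "\<nu> \<in> simple_at ?y" for \<nu>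
    using G[OF that] linear_W continuous_on_linear
    by (intro open_vimage[OF O'(1)] continuous_on_compose2[OF continuous_proj[of UNIV]]) auto
  then have "open Q" unfolding Q_def by (intro open_Int open_ball open_INT finite_simple_at[OF yS]) blast
  moreover have "\<phi> v \<in> Q"
  proof -
    have "?y \<in> (\<lambda>p. \<pi> (G \<nu> p)) -` O'" if "\<nu> \<in> simple_at ?y" for \<nu>
      using G[OF that] proj_emb[of v] O'(2) v by simp
    then show ?thesis unfolding Q_def \<phi>_def using e(1) by simp
  qed
  moreover have "Q \<inter> boundary_surface g Ch \<subseteq> \<phi> ` A"
  proof
    fix p assume p: "p \<in> Q \<inter> boundary_surface g Ch"
    obtain \<nu> where \<nu>: "\<nu> \<in> simple_at p" "p \<in> Ch" using boundary_point_on_wall p by blast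
    have pS: "p \<in> space_form g" using ChD(1)[OF \<nu>(2)] .
    have "\<not> 0 < \<nu> \<bullet> ?y" using e(2)[OF simple_atD(3)[OF \<nu>(1)] _ pS] p simple_atD(2)[OF \<nu>(1)] unfolding Q_def by fastforce
    then have "\<nu> \<bullet> ?y = 0" using ChD(2)[OF yC simple_atD(4)[OF \<nu>(1)]] by simp
    then have \<nu>y: "\<nu> \<in> simple_at ?y" using simple_atD(1)[OF \<nu>(1)] by (simp add: simple_at_def)
    have GW: "G \<nu> \<in> W" and Gad: "adjoint (G \<nu>) \<alpha> = \<nu> \<or> adjoint (G \<nu>) \<alpha> = - \<nu>" using G[OF \<nu>y] by auto
    have "\<alpha> \<bullet> G \<nu> p = 0" using inner_W[OF GW, of \<alpha> p] Gad simple_atD(2)[OF \<nu>(1)] by auto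
    then have pr: "\<pi> (G \<nu> p) \<in> space_form g" "\<iota> (\<pi> (G \<nu> p)) = G \<nu> p" using proj_space W_space_form[OF GW pS] by auto
    moreover have "\<pi> (G \<nu> p) \<in> O'" using p \<nu>y unfolding Q_def by blast
    ultimately have "\<pi> (G \<nu> p) \<in> A" using O'(2) by blast
    moreover have "\<phi> (\<pi> (G \<nu> p)) = p" unfolding \<phi>_def pr(2) using fold_W[OF pS GW] fold_Ch[OF \<nu>(2)] by simp
    ultimately show "p \<in> \<phi> ` A" by (metis image_eqI)
  qed
  ultimately show thesis using that by blast
qed

text \<open>
  The image is closed in the complement of the even hyperedges: if a point \<open>\<phi> v\<close> lies near \<open>y\<close>, it lies on
  a wall through \<open>y\<close>, and the group element that carries this wall into the mirror carries \<open>y\<close> to a point of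
  the same component, because no perpendicular mirror passes through \<open>y\<close>.
\<close>

lemma \<phi>_closed:
  assumes y: "y \<in> Bd"
  obtains Q where "open Q" "y \<in> Q" "Q \<inter> \<phi> ` U \<noteq> {} \<Longrightarrow> y \<in> \<phi> ` U"
proof -
  have yS: "y \<in> space_form g" and yC: "y \<in> Ch" using Bd_odd[OF y] by auto
  obtain e where e: "0 < e" "\<And>\<nu> p. \<nu> \<in> R \<Longrightarrow> 0 < \<nu> \<bullet> y \<Longrightarrow> p \<in> space_form g \<Longrightarrow> p \<in> ball y e \<Longrightarrow> 0 < \<nu> \<bullet> p"
    using sign_stable[OF yS] by blast
  have "y \<in> \<phi> ` U" if ne: "ball y e \<inter> \<phi> ` U \<noteq> {}"
  proof -
    obtain v where v: "v \<in> U" "\<phi> v \<in> ball y e" using ne by blast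
    let ?x = "\<iota> v" let ?p = "\<phi> v"
    have x: "?x \<in> space_form g" using U_emb[OF v(1)] .
    obtain \<nu> where \<nu>: "\<nu> \<in> simple_at ?p" "?p \<in> Ch" using boundary_point_on_wall \<phi>_Bd[OF v(1)] by blast
    have pS: "?p \<in> space_form g" using ChD(1)[OF \<nu>(2)] .
    have "\<not> 0 < \<nu> \<bullet> y" using e(2)[OF simple_atD(3)[OF \<nu>(1)] _ pS v(2)] simple_atD(2)[OF \<nu>(1)] by fastforce
    then have \<nu>y: "\<nu> \<bullet> y = 0" using ChD(2)[OF yC simple_atD(4)[OF \<nu>(1)]] by simp
    obtain w0 where w0: "w0 \<in> W" "w0 ?x = ?p" using fold_props(2)[OF x] unfolding \<phi>_def by blast
    obtain w where w: "w \<in> W" "w ?p = ?x" using W_inverse_obtain[OF w0(1)] w0(2) by metis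
    obtain u where u: "u \<in> W" "u ?p = ?x" "adjoint u \<alpha> = \<nu> \<or> adjoint u \<alpha> = - \<nu>"
      using mirror_conjugation[OF x U_odd[OF v(1)] emb_mirror w simple_atD(3)[OF \<nu>(1)] simple_atD(2)[OF \<nu>(1)]] by blast
    have "\<alpha> \<bullet> u y = 0" using inner_W[OF u(1), of \<alpha> y] u(3) \<nu>y by auto
    then have pr: "\<pi> (u y) \<in> space_form g" "\<iota> (\<pi> (u y)) = u y" using proj_space W_space_form[OF u(1) yS] by auto
    have "0 < \<beta> \<bullet> \<pi> (u y)" if \<beta>: "\<beta> \<in> D.Pos" for \<beta>
    proof -
      obtain \<tau> where \<tau>: "\<tau> \<in> R" "conormal_form g \<tau> \<alpha> = 0" "\<beta> = adjoint \<iota> \<tau>" using D.PosD(1)[OF \<beta>] unfolding mirror_roots_def by blast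
      let ?\<tau> = "adjoint u \<tau>"
      have \<tau>R: "?\<tau> \<in> R" using adjoint_W_root[OF u(1) \<tau>(1)] .
      have "0 < \<beta> \<bullet> v" using v(1) \<beta> unfolding U_def D.Ch_int_def by blast
      then have p: "0 < ?\<tau> \<bullet> ?p" using inner_W[OF u(1), of \<tau> ?p] u(2) inner_emb[of \<tau> v] \<tau>(3) by simp
      have "conormal_form g (adjoint u \<alpha>) ?\<tau> = 0" unfolding motion_form[OF motion_W[OF u(1)]] using \<tau>(2) conormal_form_commute by metis
      then have "conormal_form g \<nu> ?\<tau> = 0" using u(3) by (auto simp: conormal_form_simps)
      then have ne0: "?\<tau> \<bullet> y \<noteq> 0"
        using perpendicular_iff_not_odd[OF yS simple_atD(3)[OF \<nu>(1)] \<nu>y] Bd_odd(1)[OF y] \<tau>R by blast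
      have "\<not> 0 < - ?\<tau> \<bullet> y" using e(2)[OF neg_root[OF \<tau>R] _ pS v(2)] p by auto
      then have "0 < ?\<tau> \<bullet> y" using ne0 by auto
      then show ?thesis using inner_W[OF u(1), of \<tau> y] inner_emb[of \<tau> "\<pi> (u y)"] pr(2) \<tau>(3) by simp
    qed
    then have "\<pi> (u y) \<in> U" using pr(1) unfolding U_def D.Ch_int_def by blast
    moreover have "\<phi> (\<pi> (u y)) = y" unfolding \<phi>_def pr(2) using fold_W[OF yS u(1)] Bd_odd(2)[OF y] by simp
    ultimately show ?thesis by (metis image_eqI)
  qed
  then show thesis using that[OF open_ball, of y e] e(1) by auto
qed

text \<open>
  The image is connected, and it is open and closed in the complement of the even hyperedges.
\<close>

lemma \<phi>_image_component:
  assumes conn: "connected U" and \<Omega>: "\<Omega> \<in> components Bd" "\<phi> v0 \<in> \<Omega>"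
  shows "\<phi> ` U = \<Omega>"
proof
  have US: "U \<subseteq> space_form g" using U_space by blast
  have "connected (\<phi> ` U)" using conn continuous_\<phi>[OF US] by (rule connected_continuous_image[rotated])
  then show sub: "\<phi> ` U \<subseteq> \<Omega>"
    using components_maximal[OF \<Omega>(1)] \<phi>_Bd v0_U \<Omega>(2) by blast
  have \<Omega>Bd: "\<Omega> \<subseteq> Bd" using in_components_subset[OF \<Omega>(1)] .
  have "openin (top_of_set \<Omega>) (\<phi> ` U)"
  proof (subst openin_subopen, intro ballI)
    fix y assume "y \<in> \<phi> ` U"
    then obtain v where v: "v \<in> U" "y = \<phi> v" by blast
    obtain Q where Q: "open Q" "\<phi> v \<in> Q" "Q \<inter> boundary_surface g Ch \<subseteq> \<phi> ` U" using \<phi>_open[OF openin_subtopology_self v(1)] by blast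
    then have "openin (top_of_set \<Omega>) (\<Omega> \<inter> Q)" "y \<in> \<Omega> \<inter> Q" "\<Omega> \<inter> Q \<subseteq> \<phi> ` U"
      using v sub \<Omega>Bd by (auto simp: openin_open_Int)
    then show "\<exists>T. openin (top_of_set \<Omega>) T \<and> y \<in> T \<and> T \<subseteq> \<phi> ` U" by blast
  qed
  moreover have "openin (top_of_set \<Omega>) (\<Omega> - \<phi> ` U)"
  proof (subst openin_subopen, intro ballI)
    fix y assume y: "y \<in> \<Omega> - \<phi> ` U"
    then have "y \<in> Bd" using \<Omega>Bd by blast
    then obtain Q where Q: "open Q" "y \<in> Q" "Q \<inter> \<phi> ` U \<noteq> {} \<Longrightarrow> y \<in> \<phi> ` U" using \<phi>_closed by metis
    then have "openin (top_of_set \<Omega>) (\<Omega> \<inter> Q)" "y \<in> \<Omega> \<inter> Q" "\<Omega> \<inter> Q \<subseteq> \<Omega> - \<phi> ` U" using y by (auto simp: openin_open_Int)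
    then show "\<exists>T. openin (top_of_set \<Omega>) T \<and> y \<in> T \<and> T \<subseteq> \<Omega> - \<phi> ` U" by blast
  qed
  then have "closedin (top_of_set \<Omega>) (\<phi> ` U)" using sub by (simp add: closedin_def)
  ultimately have "\<phi> ` U = {} \<or> \<phi> ` U = \<Omega>" using in_components_connected[OF \<Omega>(1)] unfolding connected_clopen by blast
  then show "\<Omega> \<subseteq> \<phi> ` U" using v0_U by blast
qed

text \<open>
  Over a small neighbourhood the sheets are the translates of one sheet under the elements of the group that
  preserve the mirror; two translates that meet are equal because this group acts freely and discontinuously.
\<close>

lemma \<phi>_covering:
  assumes im: "\<phi> ` U = \<Omega>" and \<Omega>: "\<Omega> \<subseteq> Bd"
  shows "covering_space U \<phi> \<Omega>"
proof
  have US: "U \<subseteq> space_form g" using U_space by blast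
  show cont: "continuous_on U \<phi>" using continuous_\<phi>[OF US] .
  show "\<phi> ` U = \<Omega>" by (rule im)
  fix y assume "y \<in> \<Omega>"
  then obtain v where v: "v \<in> U" "\<phi> v = y" using im by blast
  obtain N where N: "open N" "\<iota> v \<in> N" "\<And>w p. w \<in> W \<Longrightarrow> p \<in> space_form g \<Longrightarrow> p \<in> N \<Longrightarrow> w p \<in> N \<Longrightarrow> w (\<iota> v) = \<iota> v"
    using W_discontinuous[OF U_emb[OF v(1)]] by blast
  define B where "B = U \<inter> \<iota> -` N"
  have oN: "open (\<iota> -` N)" using N(1) continuous_emb by (intro open_vimage) auto
  have oB: "openin (top_of_set U) B" unfolding B_def using oN by (simp add: openin_open_Int)
  have BU: "B \<subseteq> U" and vB: "v \<in> B" using v(1) N(2) by (auto simp: B_def)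
  have triv: "u (\<iota> z) = \<iota> z" if "u \<in> \<Gamma>" "b \<in> B" "b' \<in> B" "u (\<iota> b) = \<iota> b'" for u b b' z
  proof -
    have "u \<in> W" using that(1) unfolding \<Gamma>_def by blast
    then have "u (\<iota> v) = \<iota> v" using N(3)[of u "\<iota> b"] that U_emb by (auto simp: B_def)
    then show ?thesis using \<Gamma>_free[OF that(1) v(1)] by blast
  qed
  define k where "k u z = \<pi> (u (\<iota> z))" for u z
  \<comment> \<open>different elements may give the same sheet, so the sheets are collected as a set; empty ones are left out\<close>
  define sheet where "sheet u = {z\<in>U. k u z \<in> B}" for u
  have k\<phi>: "\<phi> (k u z) = \<phi> z" if "u \<in> \<Gamma>" "z \<in> U" for u z
    using \<Gamma>_act(2)[OF that(1) U_space[OF that(2)]] fold_W[OF U_emb[OF that(2)]] that(1)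
    unfolding k_def \<phi>_def \<Gamma>_def by simp
  have contk: "continuous_on A (k u)" if "u \<in> \<Gamma>" for u A
  proof -
    have "continuous_on UNIV u" using that linear_W continuous_on_linear unfolding \<Gamma>_def by blast
    then have "continuous_on A (\<lambda>z. u (\<iota> z))" by (rule continuous_on_compose2[OF _ continuous_emb]) simp
    then show ?thesis unfolding k_def by (rule continuous_on_compose2[OF continuous_proj[of UNIV]]) simp
  qed
  have openB: "openin (top_of_set \<Omega>) (\<phi> ` A)" if A: "openin (top_of_set B) A" for A
  proof (subst openin_subopen, intro ballI)
    have AU: "openin (top_of_set U) A" using openin_trans[OF A oB] .
    fix p assume "p \<in> \<phi> ` A"
    then obtain a where a: "a \<in> A" "p = \<phi> a" by blast
    obtain Q where Q: "open Q" "\<phi> a \<in> Q" "Q \<inter> boundary_surface g Ch \<subseteq> \<phi> ` A" using \<phi>_open[OF AU a(1)] by blast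
    have "\<phi> a \<in> \<Omega>" using im openin_imp_subset[OF AU] a(1) by blast
    then have "openin (top_of_set \<Omega>) (\<Omega> \<inter> Q)" "p \<in> \<Omega> \<inter> Q" "\<Omega> \<inter> Q \<subseteq> \<phi> ` A"
      using Q a \<Omega> by (auto simp: openin_open_Int)
    then show "\<exists>T. openin (top_of_set \<Omega>) T \<and> p \<in> T \<and> T \<subseteq> \<phi> ` A" by blast
  qed
  have TB: "openin (top_of_set \<Omega>) (\<phi> ` B)" using openB by simp
  have injB: "inj_on \<phi> B"
  proof (rule inj_onI)
    fix b b' assume b: "b \<in> B" "b' \<in> B" "\<phi> b = \<phi> b'"
    obtain u where u: "u \<in> \<Gamma>" "u (\<iota> b) = \<iota> b'" using \<phi>_eq_imp_\<Gamma>[OF _ _ b(3)] b(1,2) BU by blast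
    have "\<iota> b' = \<iota> b" using triv[OF u(1) b(1,2) u(2), of b] u(2) by simp
    then show "b = b'" using proj_emb by metis
  qed
  have "\<exists>q. homeomorphism B (\<phi> ` B) \<phi> q"
  proof (rule homeomorphism_injective_open_map[of B \<phi> "\<phi> ` B"])
    show "continuous_on B \<phi>" using cont BU continuous_on_subset by blast
    show "openin (top_of_set (\<phi> ` B)) (\<phi> ` A)" if "openin (top_of_set B) A" for A
      using openin_subset_trans[OF openB[OF that], of "\<phi> ` B"] openin_imp_subset[OF that] openin_imp_subset[OF TB] by blast
  qed (use injB in auto)
  then obtain q where q: "homeomorphism B (\<phi> ` B) \<phi> q" by blast
  have sheet_homeo: "\<exists>q. homeomorphism (sheet u) (\<phi> ` B) \<phi> q" if u: "u \<in> \<Gamma>" and ne: "sheet u \<noteq> {}" for u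
  proof -
    obtain z where z: "z \<in> U" "k u z \<in> B" using ne by (auto simp: sheet_def)
    obtain u' where u': "u' \<in> \<Gamma>" "\<And>p. u' (u p) = p" "\<And>p. u (u' p) = p" using \<Gamma>_inverse[OF u] by blast
    have inv1: "k u' (k u x) = x" if "x \<in> space_form g" for x
      using \<Gamma>_act(2)[OF u that] u'(2) proj_emb by (simp add: k_def)
    have inv2: "k u (k u' x) = x" if "x \<in> space_form g" for x
      using \<Gamma>_act(2)[OF u'(1) that] u'(3) proj_emb by (simp add: k_def)
    have kz: "k u z \<in> U" using z(2) BU by blast
    have ku'U: "k u' b \<in> U" if "b \<in> U" for b
      using U_\<Gamma>_invariant[OF u'(1) kz _ that] inv1[OF U_space[OF z(1)]] z(1) unfolding k_def by simp
    have pull_back: "k u' b \<in> sheet u" if "b \<in> B" for b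
      using ku'U[of b] inv2[OF U_space, of b] that BU by (auto simp: sheet_def)
    have h: "homeomorphism (sheet u) B (k u) (k u')"
      unfolding homeomorphism_def
    proof (intro conjI ballI contk u u'(1))
      show "k u' (k u x) = x" if "x \<in> sheet u" for x using that inv1 U_space by (auto simp: sheet_def)
      show bi: "k u (k u' b) = b" if "b \<in> B" for b using that inv2 U_space BU by blast
      show "k u ` sheet u = B"
      proof
        show "B \<subseteq> k u ` sheet u" using pull_back bi by (metis image_eqI subsetI)
      qed (auto simp: sheet_def)
      show "k u' ` B = sheet u"
      proof
        show "sheet u \<subseteq> k u' ` B" 
        proof
          fix x assume "x \<in> sheet u"
          then have "k u x \<in> B" "k u' (k u x) = x" using inv1 U_space by (auto simp: sheet_def)
          then show "x \<in> k u' ` B" by (metis image_eqI)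
        qed
      qed (use pull_back in auto)
    qed
    have "homeomorphism (sheet u) (\<phi> ` B) (\<phi> \<circ> k u) (k u' \<circ> q)" using homeomorphism_compose[OF h q] .
    moreover have "(\<phi> \<circ> k u) x = \<phi> x" if "x \<in> sheet u" for x using k\<phi>[OF u] that by (simp add: sheet_def)
    ultimately have "homeomorphism (sheet u) (\<phi> ` B) \<phi> (k u' \<circ> q)" by (auto intro: homeomorphism_cong)
    then show ?thesis by blast
  qed
  show "\<exists>T. y \<in> T \<and> openin (top_of_set \<Omega>) T \<and> (\<exists>\<V>. \<Union>\<V> = U \<inter> \<phi> -` T \<and> (\<forall>u\<in>\<V>. openin (top_of_set U) u) \<and>
      pairwise disjnt \<V> \<and> (\<forall>u\<in>\<V>. \<exists>q. homeomorphism u T \<phi> q))"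
  proof (intro exI[of _ "\<phi> ` B"] conjI exI[of _ "sheet ` \<Gamma> - {{}}"] ballI)
    show "y \<in> \<phi> ` B" using v vB by blast
    show "openin (top_of_set \<Omega>) (\<phi> ` B)" by (rule TB)
    show "\<Union>(sheet ` \<Gamma> - {{}}) = U \<inter> \<phi> -` (\<phi> ` B)"
    proof
      show "\<Union>(sheet ` \<Gamma> - {{}}) \<subseteq> U \<inter> \<phi> -` (\<phi> ` B)"
      proof
        fix z assume "z \<in> \<Union>(sheet ` \<Gamma> - {{}})"
        then obtain u where u: "u \<in> \<Gamma>" "z \<in> U" "k u z \<in> B" by (auto simp: sheet_def)
        then show "z \<in> U \<inter> \<phi> -` (\<phi> ` B)" using k\<phi>[OF u(1,2)] by (metis IntI image_eqI vimageI)
      qed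
      show "U \<inter> \<phi> -` (\<phi> ` B) \<subseteq> \<Union>(sheet ` \<Gamma> - {{}})"
      proof
        fix z assume "z \<in> U \<inter> \<phi> -` (\<phi> ` B)"
        then obtain b where b: "z \<in> U" "b \<in> B" "\<phi> z = \<phi> b" by auto
        obtain u where u: "u \<in> \<Gamma>" "u (\<iota> z) = \<iota> b" using \<phi>_eq_imp_\<Gamma>[OF b(1) _ b(3)] b(2) BU by blast
        have "k u z = b" unfolding k_def u(2) by (rule proj_emb)
        then have "z \<in> sheet u" using b by (simp add: sheet_def)
        then show "z \<in> \<Union>(sheet ` \<Gamma> - {{}})" using u(1) by blast
      qed
    qed
    show "openin (top_of_set U) s" if s: "s \<in> sheet ` \<Gamma> - {{}}" for s
    proof -
      obtain u where u: "u \<in> \<Gamma>" "s = sheet u" using s by blast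
      obtain O' where O': "open O'" "B = space_form g \<inter> O'" using open_subset_U[OF oB] by blast
      have "sheet u = U \<inter> k u -` O'" using \<Gamma>_act(1)[OF u(1) U_space] unfolding sheet_def O'(2) k_def by auto
      moreover have "openin (top_of_set U) (U \<inter> k u -` O')" using contk[OF u(1)] O'(1) by (rule continuous_openin_preimage_gen)
      ultimately show ?thesis using u(2) by simp
    qed
    show "\<exists>q. homeomorphism s (\<phi> ` B) \<phi> q" if "s \<in> sheet ` \<Gamma> - {{}}" for s using sheet_homeo that by blast
    show "pairwise disjnt (sheet ` \<Gamma> - {{}})"
    proof (rule pairwiseI)
      fix s s' assume s: "s \<in> sheet ` \<Gamma> - {{}}" "s' \<in> sheet ` \<Gamma> - {{}}" "s \<noteq> s'"
      obtain u u' where u: "u \<in> \<Gamma>" "s = sheet u" "u' \<in> \<Gamma>" "s' = sheet u'" using s by blast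
      show "disjnt s s'"
      proof (rule ccontr)
        assume "\<not> disjnt s s'"
        then obtain z where z: "z \<in> U" "k u z \<in> B" "k u' z \<in> B" unfolding disjnt_def u sheet_def by blast
        obtain u1 where u1: "u1 \<in> \<Gamma>" "\<And>p. u1 (u p) = p" "\<And>p. u (u1 p) = p" using \<Gamma>_inverse[OF u(1)] by blast
        have "\<iota> (k u z) = u (\<iota> z)" "\<iota> (k u' z) = u' (\<iota> z)" using \<Gamma>_act(2) u(1,3) U_space[OF z(1)] unfolding k_def by auto
        then have "(u' \<circ> u1) (\<iota> (k u z)) = \<iota> (k u' z)" using u1(2) by simp
        then have tr: "(u' \<circ> u1) (\<iota> x) = \<iota> x" for x using triv[OF \<Gamma>_comp[OF u(3) u1(1)] z(2,3)] by blast
        have "k u' x = k u x" if "x \<in> U" for x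
          using tr[of "k u x"] \<Gamma>_act(2)[OF u(1) U_space[OF that]] u1(2) proj_emb[of "k u x"] unfolding k_def by simp
        then have "sheet u = sheet u'" unfolding sheet_def by auto
        then show False using s(3) u by simp
      qed
    qed
  qed
qed

end

section \<open>Triangle inequality and geodesics\<close>

text \<open>
  Split \<open>p\<close> and \<open>r\<close> into components along \<open>q\<close> and orthogonal to it; the orthogonal components have lengths \<open>sin a\<close> and \<open>sin b\<close>, and
  the Cauchy-Schwarz inequality bounds their product.
\<close>

lemma spherical_triangle:
  fixes p q r :: "'a::euclidean_space"
  assumes "norm p = 1" "norm q = 1" "norm r = 1"
  shows "arccos (p \<bullet> r) \<le> arccos (p \<bullet> q) + arccos (q \<bullet> r)"
proof -
  have b: "\<bar>x \<bullet> y\<bar> \<le> 1" if "norm x = 1" "norm y = 1" for x y :: 'a using Cauchy_Schwarz_ineq2[of x y] that by simp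
  have unit: "x \<bullet> x = 1" if "norm x = 1" for x :: 'a using that by (simp add: norm_eq_1)
  define a where "a = arccos (p \<bullet> q)"
  define b' where "b' = arccos (q \<bullet> r)"
  have ca: "cos a = p \<bullet> q" "cos b' = q \<bullet> r" unfolding a_def b'_def using b assms by (simp_all add: cos_arccos_abs)
  have rng: "0 \<le> a" "a \<le> pi" "0 \<le> b'" "b' \<le> pi" unfolding a_def b'_def using b[OF assms(1,2)] b[OF assms(2,3)] by (auto intro!: arccos_lbound arccos_ubound)
  show ?thesis
  proof (cases "a + b' \<le> pi")
    case True
    have perp: "norm (x - (q \<bullet> x) *\<^sub>R q) = sin t" if "norm x = 1" "cos t = q \<bullet> x" "0 \<le> t" "t \<le> pi" for x t
    proof -
      have "(norm (x - (q \<bullet> x) *\<^sub>R q))\<^sup>2 = 1 - (cos t)\<^sup>2" unfolding power2_norm_eq_inner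
        using unit[OF that(1)] unit[OF assms(2)] that(2)
        by (simp add: inner_diff_left inner_diff_right inner_commute[of x q] power2_eq_square)
      also have "\<dots> = (sin t)\<^sup>2" by (simp add: sin_squared_eq)
      finally show ?thesis using sin_ge_zero[OF that(3,4)] by (simp add: power2_eq_iff_nonneg)
    qed
    have "p \<bullet> r - cos a * cos b' = (p - (q \<bullet> p) *\<^sub>R q) \<bullet> (r - (q \<bullet> r) *\<^sub>R q)"
      using ca unit[OF assms(2)] by (simp add: inner_diff_left inner_diff_right inner_commute[of p q])
    also have "\<dots> \<ge> - (norm (p - (q \<bullet> p) *\<^sub>R q) * norm (r - (q \<bullet> r) *\<^sub>R q))"
      using Cauchy_Schwarz_ineq2[of "p - (q \<bullet> p) *\<^sub>R q" "r - (q \<bullet> r) *\<^sub>R q"] by linarith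
    also have "norm (p - (q \<bullet> p) *\<^sub>R q) * norm (r - (q \<bullet> r) *\<^sub>R q) = sin a * sin b'"
      using perp[OF assms(1) _ rng(1,2)] perp[OF assms(3) _ rng(3,4)] ca by (simp add: inner_commute)
    finally have "cos (a + b') \<le> p \<bullet> r" by (simp add: cos_add)
    then have "arccos (p \<bullet> r) \<le> arccos (cos (a + b'))" using b[OF assms(1,3)] by (intro arccos_le_mono[THEN iffD2]) auto
    then show ?thesis using arccos_cos[of "a + b'"] rng True by (simp add: a_def b'_def)
  next
    case False
    then show ?thesis using arccos_ubound[of "p \<bullet> r"] b[OF assms(1,3)] unfolding a_def b'_def by linarith
  qed
qed

text \<open>
  The condition says that \<open>u\<close> is tangent to the hyperboloid at \<open>q\<close>; since \<open>q\<close> is timelike, its orthogonal complement is spacelike.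
\<close>

lemma tangent_form_definite:
  assumes q: "q \<in> space_form Hyperbolic" and u: "snd u * snd q = fst u \<bullet> fst q"
  shows "0 \<le> conormal_form Hyperbolic u u" "conormal_form Hyperbolic u u = 0 \<Longrightarrow> u = 0"
proof -
  have q1: "(snd q)\<^sup>2 = 1 + (norm (fst q))\<^sup>2" using q by (auto simp: space_form_def)
  have "(snd u * snd q)\<^sup>2 \<le> (norm (fst u) * norm (fst q))\<^sup>2"
    unfolding u using Cauchy_Schwarz_ineq2[of "fst u" "fst q"] by (intro power2_le_iff_abs_le[THEN iffD2]) auto
  then have le: "(snd u)\<^sup>2 + (snd u)\<^sup>2 * (norm (fst q))\<^sup>2 \<le> (norm (fst u))\<^sup>2 * (norm (fst q))\<^sup>2"
    unfolding power_mult_distrib q1 by (simp add: algebra_simps)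
  have N: "conormal_form Hyperbolic u u = (norm (fst u))\<^sup>2 - (snd u)\<^sup>2"
    unfolding power2_norm_eq_inner by (simp add: conormal_form_def power2_eq_square)
  have le': "(snd u)\<^sup>2 \<le> ((norm (fst u))\<^sup>2 - (snd u)\<^sup>2) * (norm (fst q))\<^sup>2" using le by (simp add: algebra_simps)
  show "0 \<le> conormal_form Hyperbolic u u"
  proof (rule ccontr)
    assume "\<not> ?thesis"
    then have neg: "(norm (fst u))\<^sup>2 - (snd u)\<^sup>2 < 0" using N by simp
    then have "((norm (fst u))\<^sup>2 - (snd u)\<^sup>2) * (norm (fst q))\<^sup>2 \<le> 0" by (intro mult_nonpos_nonneg) auto
    then have "(snd u)\<^sup>2 \<le> 0" using le' by linarith
    then show False using neg zero_le_power2[of "norm (fst u)"] by linarith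
  qed
  assume z: "conormal_form Hyperbolic u u = 0"
  then have "snd u = 0" using le' N by simp
  then show "u = 0" using z N by (simp add: prod_eq_iff)
qed

lemma tangent_Cauchy_Schwarz:
  assumes q: "q \<in> space_form Hyperbolic" and u: "snd u * snd q = fst u \<bullet> fst q" and v: "snd v * snd q = fst v \<bullet> fst q"
  shows "(conormal_form Hyperbolic u v)\<^sup>2 \<le> conormal_form Hyperbolic u u * conormal_form Hyperbolic v v"
proof (cases "v = 0")
  case True
  then show ?thesis by (simp add: conormal_form_def)
next
  case False
  let ?B = "conormal_form Hyperbolic"
  have pos: "0 < ?B v v" using tangent_form_definite[OF q v] False by fastforce
  define w where "w = ?B v v *\<^sub>R u - ?B u v *\<^sub>R v"
  have "snd w * snd q = fst w \<bullet> fst q" using u v by (simp add: w_def inner_diff_left left_diff_distrib mult.assoc)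
  then have "0 \<le> ?B w w" by (rule tangent_form_definite(1)[OF q])
  also have "?B w w = ?B v v * (?B u u * ?B v v - (?B u v)\<^sup>2)"
    by (simp add: w_def conormal_form_simps conormal_form_commute[of _ v u] power2_eq_square algebra_simps)
  finally show ?thesis using pos by (simp add: zero_le_mult_iff)
qed

text \<open>
  The argument of the spherical case, with the components orthogonal to \<open>q\<close> in the tangent space at \<open>q\<close>.
\<close>

lemma hyperbolic_triangle:
  assumes p: "p \<in> space_form Hyperbolic" "q \<in> space_form Hyperbolic" "r \<in> space_form Hyperbolic"
  shows "arcosh (snd p * snd r - fst p \<bullet> fst r) \<le>
    arcosh (snd p * snd q - fst p \<bullet> fst q) + arcosh (snd q * snd r - fst q \<bullet> fst r)"
proof -
  let ?B = "conormal_form Hyperbolic"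
  have B: "snd x * snd y - fst x \<bullet> fst y = - ?B x y" for x y :: "'a \<times> real" by (simp add: conormal_form_def)
  have B1: "?B x x = - 1" if "x \<in> space_form Hyperbolic" for x :: "'a \<times> real"
    using that by (auto simp: space_form_def conormal_form_def dot_square_norm power2_eq_square)
  define a where "a = - ?B p q"
  define b where "b = - ?B q r"
  have ge: "1 \<le> a" "1 \<le> b" "1 \<le> - ?B p r" unfolding a_def b_def using hyperbolic_product_ge_1(2) p B by metis+
  define u where "u = p - a *\<^sub>R q"
  define v where "v = r - b *\<^sub>R q"
  have tang: "?B x q = 0 \<Longrightarrow> snd x * snd q = fst x \<bullet> fst q" for x by (simp add: conormal_form_def)
  have uq: "?B u q = 0" unfolding u_def conormal_form_simps B1[OF p(2)] by (simp add: a_def)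
  have vq: "?B v q = 0" unfolding v_def conormal_form_simps B1[OF p(2)] conormal_form_commute[of _ r q] by (simp add: b_def)
  have uv: "?B u v = ?B p r + a * b"
    unfolding u_def v_def conormal_form_simps B1[OF p(2)] by (simp add: a_def b_def algebra_simps)
  have uu: "?B u u = a\<^sup>2 - 1"
    unfolding u_def conormal_form_simps B1[OF p(2)] B1[OF p(1)] conormal_form_commute[of _ q p] by (simp add: a_def power2_eq_square)
  have vv: "?B v v = b\<^sup>2 - 1"
    unfolding v_def conormal_form_simps B1[OF p(2)] B1[OF p(3)] conormal_form_commute[of _ r q] by (simp add: b_def power2_eq_square)
  have "(?B u v)\<^sup>2 \<le> (sinh (arcosh a) * sinh (arcosh b))\<^sup>2"
    using tangent_Cauchy_Schwarz[OF p(2) tang[OF uq] tang[OF vq]] ge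
    by (simp add: uu vv sinh_arcosh_real power_mult_distrib real_sqrt_pow2 one_le_power)
  then have "\<bar>?B u v\<bar> \<le> sinh (arcosh a) * sinh (arcosh b)"
    using ge by (intro power2_le_imp_le[of "\<bar>?B u v\<bar>"]) (auto simp: arcosh_nonneg_real)
  then have "- ?B p r \<le> cosh (arcosh a + arcosh b)"
    using uv ge unfolding cosh_add by (simp add: cosh_arcosh_real)
  then have "arcosh (- ?B p r) \<le> arcosh (cosh (arcosh a + arcosh b))"
    using ge arcosh_less_iff_real[of "cosh (arcosh a + arcosh b)" "- ?B p r"] cosh_real_ge_1[of "arcosh a + arcosh b"] by linarith
  also have "\<dots> = arcosh a + arcosh b" using ge by (simp add: arcosh_cosh_real arcosh_nonneg_real)
  finally show ?thesis unfolding B a_def b_def .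
qed

lemma space_dist_triangle:
  assumes "p \<in> space_form g" "q \<in> space_form g" "r \<in> space_form g"
  shows "space_dist g p r \<le> space_dist g p q + space_dist g q r"
proof (cases g)
  case Euclidean
  then show ?thesis by (simp add: dist_triangle)
next
  case Spherical
  then show ?thesis using spherical_triangle[of p q r] assms by (simp add: space_form_spherical)
next
  case Hyperbolic
  then show ?thesis using hyperbolic_triangle[of p q r] assms by simp
qed

lemma space_dist_polygon:
  assumes "\<And>i. i \<le> n \<Longrightarrow> x i \<in> space_form g"
  shows "space_dist g (x 0) (x n) \<le> (\<Sum>i<n. space_dist g (x i) (x (Suc i)))"
  using assms
proof (induction n)
  case 0
  then have "space_dist g (x 0) (x 0) = 0"
    using sep_eq_0_iff[of "x 0" g "x 0"] space_dist_sep[of "x 0" g "x 0"] by (cases g) (simp_all add: dist_of_sep_def)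
  then show ?case by simp
next
  case (Suc n)
  then show ?case using space_dist_triangle[of "x 0" g "x n" "x (Suc n)"] by fastforce
qed

text \<open>
  The last property says that a half-space containing both ends contains the segment. Between antipodal points of
  the sphere every great semicircle serves, and no half-space contains both ends in its interior.
\<close>

definition geodesic where
  "geodesic g p q \<gamma> \<longleftrightarrow> path \<gamma> \<and> pathstart \<gamma> = p \<and> pathfinish \<gamma> = q \<and> path_image \<gamma> \<subseteq> space_form g \<and>
     (\<forall>s t. 0 \<le> s \<longrightarrow> s \<le> t \<longrightarrow> t \<le> 1 \<longrightarrow> space_dist g (\<gamma> s) (\<gamma> t) = (t - s) * space_dist g p q) \<and>
     (\<forall>\<beta>. 0 < \<beta> \<bullet> p \<longrightarrow> 0 < \<beta> \<bullet> q \<longrightarrow> (\<forall>t\<in>{0..1}. 0 < \<beta> \<bullet> \<gamma> t))"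

lemma geodesic_euclidean:
  assumes "p \<in> space_form Euclidean" "q \<in> space_form Euclidean"
  shows "geodesic Euclidean p q (linepath p q)"
  unfolding geodesic_def
proof (intro conjI allI impI ballI)
  have lin: "\<beta> \<bullet> linepath p q t = (1 - t) * (\<beta> \<bullet> p) + t * (\<beta> \<bullet> q)" for \<beta> t
    by (simp add: linepath_def inner_add_right)
  show "path_image (linepath p q) \<subseteq> space_form Euclidean"
    using assms by (auto simp: path_image_def space_form_def linepath_def power2_eq_1_iff algebra_simps)
  show "space_dist Euclidean (linepath p q s) (linepath p q t) = (t - s) * space_dist Euclidean p q"
    if "0 \<le> s" "s \<le> t" "t \<le> 1" for s t
  proof -
    have "linepath p q s - linepath p q t = (t - s) *\<^sub>R (p - q)" by (simp add: linepath_def algebra_simps)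
    then show ?thesis using that by (simp add: dist_norm)
  qed
  show "0 < \<beta> \<bullet> linepath p q t" if "0 < \<beta> \<bullet> p" "0 < \<beta> \<bullet> q" "t \<in> {0..1}" for \<beta> t
  proof (cases "t = 0")
    case True then show ?thesis using that unfolding lin by simp
  next
    case False
    then show ?thesis using that unfolding lin by (intro add_nonneg_pos mult_nonneg_nonneg mult_pos_pos) auto
  qed
qed auto

lemma geodesic_spherical:
  fixes p q :: "'a::euclidean_space \<times> real"
  assumes p: "p \<in> space_form Spherical" and q: "q \<in> space_form Spherical"
  shows "\<exists>\<gamma>. geodesic Spherical p q \<gamma>"
proof -
  have n: "norm p = 1" "norm q = 1" using p q by (auto simp: space_form_spherical)
  have pp: "p \<bullet> p = 1" "q \<bullet> q = 1" using n by (simp_all add: norm_eq_1)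
  have ab: "\<bar>p \<bullet> q\<bar> \<le> 1" using Cauchy_Schwarz_ineq2[of p q] n by simp
  define \<theta> where "\<theta> = arccos (p \<bullet> q)"
  have \<theta>: "0 \<le> \<theta>" "\<theta> \<le> pi" "cos \<theta> = p \<bullet> q" unfolding \<theta>_def using ab by (auto intro: arccos_lbound arccos_ubound simp: cos_arccos_abs)
  have "\<exists>e. norm e = 1 \<and> p \<bullet> e = 0 \<and> q = cos \<theta> *\<^sub>R p + sin \<theta> *\<^sub>R e"
  proof (cases "sin \<theta> = 0")
    case True
    obtain x :: "'a \<times> real" where x: "x \<noteq> 0" "orthogonal p x"
      using orthogonal_to_vector_exists[of p] by (auto simp: DIM_positive Suc_le_eq)
    have "cos \<theta> * cos \<theta> = 1" using sin_cos_squared_add[of \<theta>] True by (simp add: power2_eq_square)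
    then have "(q - cos \<theta> *\<^sub>R p) \<bullet> (q - cos \<theta> *\<^sub>R p) = 0"
      using pp \<theta>(3) by (simp add: inner_diff_left inner_diff_right inner_commute[of q p])
    then have "q = cos \<theta> *\<^sub>R p" by simp
    then show ?thesis using x True by (intro exI[of _ "x /\<^sub>R norm x"]) (simp add: orthogonal_def)
  next
    case False
    define e where "e = (q - cos \<theta> *\<^sub>R p) /\<^sub>R sin \<theta>"
    have s2: "sin \<theta> * sin \<theta> = 1 - cos \<theta> * cos \<theta>" using sin_squared_eq[of \<theta>] by (simp add: power2_eq_square)
    have "(q - cos \<theta> *\<^sub>R p) \<bullet> (q - cos \<theta> *\<^sub>R p) = sin \<theta> * sin \<theta>"
      using pp \<theta>(3) s2 by (simp add: inner_diff_left inner_diff_right inner_commute[of q p])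
    then have "norm e = 1" unfolding norm_eq_1 e_def inner_scaleR_left inner_scaleR_right using False by (simp add: field_simps)
    moreover have "p \<bullet> e = 0" using pp \<theta>(3) by (simp add: e_def inner_diff_right)
    moreover have "q = cos \<theta> *\<^sub>R p + sin \<theta> *\<^sub>R e" using False by (simp add: e_def)
    ultimately show ?thesis by blast
  qed
  then obtain e where e: "norm e = 1" "p \<bullet> e = 0" "q = cos \<theta> *\<^sub>R p + sin \<theta> *\<^sub>R e" by blast
  have ee: "e \<bullet> e = 1" using e(1) by (simp add: norm_eq_1)
  define \<gamma> where "\<gamma> t = cos (t * \<theta>) *\<^sub>R p + sin (t * \<theta>) *\<^sub>R e" for t
  have prod: "\<gamma> s \<bullet> \<gamma> t = cos ((t - s) * \<theta>)" for s t
    unfolding left_diff_distrib cos_diff using pp ee e(2)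
    by (simp add: \<gamma>_def inner_add_left inner_add_right inner_commute[of e p] mult.commute)
  have "geodesic Spherical p q \<gamma>"
    unfolding geodesic_def
  proof (intro conjI allI impI ballI)
    show "path \<gamma>" unfolding path_def \<gamma>_def by (intro continuous_intros)
    show "pathstart \<gamma> = p" "pathfinish \<gamma> = q" using e(3) by (simp_all add: pathstart_def pathfinish_def \<gamma>_def)
    have "norm (\<gamma> t) = 1" for t unfolding norm_eq_1 prod by simp
    then show "path_image \<gamma> \<subseteq> space_form Spherical" by (auto simp: space_form_spherical path_image_def)
    show "space_dist Spherical (\<gamma> s) (\<gamma> t) = (t - s) * space_dist Spherical p q" if "0 \<le> s" "s \<le> t" "t \<le> 1" for s t
    proof -
      have "(t - s) * \<theta> \<le> 1 * pi" using that \<theta> by (intro mult_mono) auto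
      then show ?thesis using that \<theta> prod[of s t] arccos_cos[of "(t - s) * \<theta>"] by (simp add: \<theta>_def)
    qed
    fix \<beta> :: "'a \<times> real" and t :: real assume \<beta>: "0 < \<beta> \<bullet> p" "0 < \<beta> \<bullet> q" and t: "t \<in> {0..1}"
    show "0 < \<beta> \<bullet> \<gamma> t"
    proof (cases "sin \<theta> = 0")
      case True
      have "\<theta> = 0 \<or> \<theta> = pi" using True \<theta> sin_gt_zero[of \<theta>] by force
      moreover have "\<theta> \<noteq> pi" using \<beta> e(3) by auto
      ultimately show ?thesis using \<beta> by (simp add: \<gamma>_def)
    next
      case False
      then have "\<theta> \<noteq> 0" "\<theta> \<noteq> pi" by auto
      then have \<theta>': "0 < \<theta>" "\<theta> < pi" using \<theta> by auto
      have pos: "0 < sin \<theta>" using sin_gt_zero[OF \<theta>'] .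
      have "sin \<theta> *\<^sub>R \<gamma> t = sin ((1 - t) * \<theta>) *\<^sub>R p + sin (t * \<theta>) *\<^sub>R q"
      proof -
        have s: "sin ((1 - t) * \<theta>) = sin \<theta> * cos (t * \<theta>) - cos \<theta> * sin (t * \<theta>)"
          using sin_diff[of \<theta> "t * \<theta>"] by (simp add: left_diff_distrib)
        show ?thesis unfolding s by (simp add: \<gamma>_def e(3) algebra_simps)
      qed
      then have eq: "sin \<theta> * (\<beta> \<bullet> \<gamma> t) = sin ((1 - t) * \<theta>) * (\<beta> \<bullet> p) + sin (t * \<theta>) * (\<beta> \<bullet> q)"
        by (metis inner_add_right inner_scaleR_right)
      have shrink: "r * \<theta> \<le> \<theta>" if "r \<le> 1" for r using that \<theta>' mult_right_mono[of r 1 \<theta>] by simp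
      have nn: "0 \<le> sin (r * \<theta>)" if "0 \<le> r" "r \<le> 1" for r
        using that \<theta>' shrink[OF that(2)] by (intro sin_ge_zero mult_nonneg_nonneg) linarith+
      have ps: "0 < sin (r * \<theta>)" if "0 < r" "r \<le> 1" for r
        using that \<theta>' shrink[OF that(2)] by (intro sin_gt_zero mult_pos_pos) linarith+
      have "0 < sin ((1 - t) * \<theta>) * (\<beta> \<bullet> p) + sin (t * \<theta>) * (\<beta> \<bullet> q)"
      proof (cases "t = 0")
        case True then show ?thesis using pos \<beta> by simp
      next
        case False
        then show ?thesis using t \<beta> nn[of "1 - t"] ps[of t] by (intro add_nonneg_pos mult_nonneg_nonneg mult_pos_pos) auto
      qed
      then show ?thesis using eq pos zero_less_mult_pos by metis
    qed
  qed
  then show ?thesis by blast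
qed

lemma geodesic_hyperbolic:
  fixes p q :: "'a::euclidean_space \<times> real"
  assumes p: "p \<in> space_form Hyperbolic" and q: "q \<in> space_form Hyperbolic"
  shows "\<exists>\<gamma>. geodesic Hyperbolic p q \<gamma>"
proof -
  let ?B = "conormal_form Hyperbolic"
  have d: "space_dist Hyperbolic x y = arcosh (- ?B x y)" for x y :: "'a \<times> real" by (simp add: conormal_form_def)
  have B1: "x \<in> space_form Hyperbolic \<longleftrightarrow> ?B x x = - 1 \<and> 0 < snd x" for x :: "'a \<times> real"
    by (auto simp: space_form_def conormal_form_def dot_square_norm power2_eq_square)
  define \<theta> where "\<theta> = arcosh (- ?B p q)"
  have ge: "1 \<le> - ?B p q" using hyperbolic_product_ge_1(2)[OF p q] by (simp add: conormal_form_def)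
  have \<theta>: "0 \<le> \<theta>" "cosh \<theta> = - ?B p q" using ge by (simp_all add: \<theta>_def arcosh_nonneg_real cosh_arcosh_real)
  show ?thesis
  proof (cases "\<theta> = 0")
    case True
    then have "?B p q = - 1" using \<theta>(2) by simp
    then have "sep Hyperbolic p q = 0" using p q
      by (simp add: sep_def conormal_form_simps B1 conormal_form_commute[of _ q p])
    then have "q = p" using sep_eq_0_iff[OF p q] by simp
    then have "geodesic Hyperbolic p q (\<lambda>_. p)"
      using p \<theta> True by (auto simp: geodesic_def path_def pathstart_def pathfinish_def path_image_def d \<theta>_def simp del: space_dist.simps)
    then show ?thesis by blast
  next
    case False
    then have \<theta>0: "0 < \<theta>" using \<theta>(1) by simp
    then have pos: "0 < sinh \<theta>" by simp
    define e where "e = (q - cosh \<theta> *\<^sub>R p) /\<^sub>R sinh \<theta>"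
    have Bpp: "?B p p = - 1" "?B q q = - 1" using p q B1 by auto
    have qe: "q = cosh \<theta> *\<^sub>R p + sinh \<theta> *\<^sub>R e" using pos by (simp add: e_def)
    have pe: "?B p e = 0" unfolding e_def conormal_form_simps Bpp using \<theta>(2) by simp
    have "?B (q - cosh \<theta> *\<^sub>R p) (q - cosh \<theta> *\<^sub>R p) = (cosh \<theta>)\<^sup>2 - 1"
      unfolding conormal_form_simps Bpp conormal_form_commute[of _ q p] using \<theta>(2) by (simp add: power2_eq_square)
    also have "\<dots> = (sinh \<theta>)\<^sup>2" by (simp add: cosh_square_eq)
    finally have ee: "?B e e = 1" unfolding e_def conormal_form_simps(5-) using pos by (simp add: power2_eq_square field_simps)
    define \<gamma> where "\<gamma> t = cosh (t * \<theta>) *\<^sub>R p + sinh (t * \<theta>) *\<^sub>R e" for t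
    have prod: "- ?B (\<gamma> s) (\<gamma> t) = cosh ((t - s) * \<theta>)" for s t
      unfolding \<gamma>_def conormal_form_simps Bpp pe ee conormal_form_commute[of _ e p] left_diff_distrib cosh_diff
      by (simp add: mult.commute)
    have half: "0 < \<beta> \<bullet> \<gamma> t" if \<beta>: "0 < \<beta> \<bullet> p" "0 < \<beta> \<bullet> q" and t: "0 \<le> t" "t \<le> 1" for \<beta> t
    proof -
      have "sinh \<theta> *\<^sub>R \<gamma> t = sinh ((1 - t) * \<theta>) *\<^sub>R p + sinh (t * \<theta>) *\<^sub>R q"
      proof -
        have s: "sinh ((1 - t) * \<theta>) = sinh \<theta> * cosh (t * \<theta>) - cosh \<theta> * sinh (t * \<theta>)"
          using sinh_diff[of \<theta> "t * \<theta>"] by (simp add: left_diff_distrib)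
        show ?thesis unfolding s by (simp add: \<gamma>_def qe algebra_simps)
      qed
      then have eq: "sinh \<theta> * (\<beta> \<bullet> \<gamma> t) = sinh ((1 - t) * \<theta>) * (\<beta> \<bullet> p) + sinh (t * \<theta>) * (\<beta> \<bullet> q)"
        by (metis inner_add_right inner_scaleR_right)
      have "0 < sinh ((1 - t) * \<theta>) * (\<beta> \<bullet> p) + sinh (t * \<theta>) * (\<beta> \<bullet> q)"
      proof (cases "t = 0")
        case True then show ?thesis using pos \<beta> by simp
      next
        case False
        then show ?thesis using t \<beta> \<theta>0 by (intro add_nonneg_pos mult_nonneg_nonneg mult_pos_pos) auto
      qed
      then show ?thesis using eq pos zero_less_mult_pos by metis
    qed
    have "geodesic Hyperbolic p q \<gamma>"
      unfolding geodesic_def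
    proof (intro conjI allI impI ballI)
      show "path \<gamma>" unfolding path_def \<gamma>_def by (intro continuous_intros)
      show "pathstart \<gamma> = p" "pathfinish \<gamma> = q" using qe by (simp_all add: pathstart_def pathfinish_def \<gamma>_def)
      have "0 < snd (\<gamma> t)" if "0 \<le> t" "t \<le> 1" for t
        using half[of "(0, 1)" t] that p q B1 by (simp add: inner_prod_def)
      moreover have "?B (\<gamma> t) (\<gamma> t) = - 1" for t using prod[of t t] by simp
      ultimately show "path_image \<gamma> \<subseteq> space_form Hyperbolic" by (auto simp: B1 path_image_def)
      show "space_dist Hyperbolic (\<gamma> s) (\<gamma> t) = (t - s) * space_dist Hyperbolic p q" if "0 \<le> s" "s \<le> t" "t \<le> 1" for s t
        unfolding d prod using that \<theta> by (simp add: arcosh_cosh_real \<theta>_def)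
    qed (use half in auto)
    then show ?thesis by blast
  qed
qed

lemma geodesic_exists:
  assumes "p \<in> space_form g" "q \<in> space_form g" obtains \<gamma> where "geodesic g p q \<gamma>"
  using assms geodesic_euclidean geodesic_spherical geodesic_hyperbolic by (cases g) blast+

section \<open>Lengths of curves\<close>

lemma path_length_cong:
  assumes "\<And>t. t \<in> {0..1} \<Longrightarrow> c t = c' t" shows "path_length g c = path_length g c'"
  unfolding path_length_def
proof (intro SUP_cong refl sum.cong)
  fix ts i assume ts: "ts \<in> {ts. sorted ts \<and> set ts \<subseteq> {0..1::real}}" and i: "i \<in> {..<length ts - 1}"
  then have "ts ! i \<in> {0..1}" "ts ! Suc i \<in> {0..1}" by (auto simp: subset_iff)
  then show "ennreal (space_dist g (c (ts ! i)) (c (ts ! Suc i))) = ennreal (space_dist g (c' (ts ! i)) (c' (ts ! Suc i)))"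
    using assms by simp
qed

lemma path_length_le:
  assumes "0 \<le> L" and le: "\<And>s t. 0 \<le> s \<Longrightarrow> s \<le> t \<Longrightarrow> t \<le> 1 \<Longrightarrow> space_dist g (c s) (c t) \<le> (t - s) * L"
  shows "path_length g c \<le> ennreal L"
  unfolding path_length_def
proof (rule SUP_least)
  fix ts assume "ts \<in> {ts. sorted ts \<and> set ts \<subseteq> {0..1::real}}"
  then have ts: "sorted ts" "set ts \<subseteq> {0..1}" by auto
  have r: "0 \<le> ts ! i" "ts ! i \<le> 1" if "i < length ts" for i using subsetD[OF ts(2) nth_mem[OF that]] by auto
  have m: "ts ! i \<le> ts ! Suc i" if "i < length ts - 1" for i using sorted_nth_mono[OF ts(1), of i "Suc i"] that by auto
  have "(\<Sum>i<length ts - 1. ennreal (space_dist g (c (ts ! i)) (c (ts ! Suc i)))) \<le> (\<Sum>i<length ts - 1. ennreal ((ts ! Suc i - ts ! i) * L))"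
    using r m by (intro sum_mono ennreal_leI le) auto
  also have "\<dots> = ennreal (\<Sum>i<length ts - 1. (ts ! Suc i - ts ! i) * L)"
    using m assms(1) by (intro sum_ennreal) (auto intro!: mult_nonneg_nonneg)
  also have "(\<Sum>i<length ts - 1. (ts ! Suc i - ts ! i) * L) = (ts ! (length ts - 1) - ts ! 0) * L"
    unfolding sum_distrib_right[symmetric] sum_lessThan_telescope ..
  also have "ennreal \<dots> \<le> ennreal L"
  proof (cases "ts = []")
    case False
    then have "ts ! (length ts - 1) - ts ! 0 \<le> 1" using r[of "length ts - 1"] r[of 0] by auto
    then have "(ts ! (length ts - 1) - ts ! 0) * L \<le> 1 * L" using assms(1) by (intro mult_right_mono) auto
    then show ?thesis by (intro ennreal_leI) simp
  qed simp
  finally show "(\<Sum>i<length ts - 1. ennreal (space_dist g (c (ts ! i)) (c (ts ! Suc i)))) \<le> ennreal L" .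
qed

text \<open>Follow one of the sets up to the last point of the interval that lies in it; then that set may be discarded.\<close>

lemma finite_closed_cover_chain:
  fixes A :: "'f \<Rightarrow> real set"
  assumes "finite F" "\<And>f. f \<in> F \<Longrightarrow> closed (A f)" "{a..b} \<subseteq> (\<Union>f\<in>F. A f)" "a \<le> b"
  shows "\<exists>ts. ts \<noteq> [] \<and> sorted ts \<and> hd ts = a \<and> last ts = b \<and> set ts \<subseteq> {a..b} \<and>
    (\<forall>i<length ts - 1. \<exists>f\<in>F. ts ! i \<in> A f \<and> ts ! Suc i \<in> A f)"
  using assms
proof (induction "card F" arbitrary: F a)
  case 0
  then show ?case by auto
next
  case (Suc n)
  obtain f where f: "f \<in> F" "a \<in> A f" using Suc.prems(3,4) by fastforce
  let ?X = "A f \<inter> {a..b}"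
  have "compact ?X" using Suc.prems(2)[OF f(1)] by (intro closed_Int_compact) auto
  moreover have "?X \<noteq> {}" using f Suc.prems(4) by auto
  ultimately obtain s where s: "s \<in> ?X" "\<And>t. t \<in> ?X \<Longrightarrow> t \<le> s" using compact_attains_sup[of ?X] by blast
  show ?case
  proof (cases "s = b")
    case True
    have "\<forall>i<length [a, b] - 1. \<exists>f\<in>F. [a, b] ! i \<in> A f \<and> [a, b] ! Suc i \<in> A f" using f s(1) True by auto
    then show ?thesis using Suc.prems(4) by (intro exI[of _ "[a, b]"]) auto
  next
    case False
    then have sb: "s < b" using s(1) by auto
    let ?G = "F - {f}"
    have "closed (\<Union>f\<in>?G. A f)" using Suc.prems(1,2) by (intro closed_UN) auto
    moreover have "{s<..b} \<subseteq> (\<Union>f\<in>?G. A f)"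
    proof
      fix t assume t: "t \<in> {s<..b}"
      then have "t \<notin> A f" using s by force
      moreover have "t \<in> (\<Union>f\<in>F. A f)" using t s(1) Suc.prems(3) by (intro subsetD[OF Suc.prems(3)]) auto
      ultimately show "t \<in> (\<Union>f\<in>?G. A f)" by blast
    qed
    ultimately have "closure {s<..b} \<subseteq> (\<Union>f\<in>?G. A f)" by (intro closure_minimal)
    then have cov: "{s..b} \<subseteq> (\<Union>f\<in>?G. A f)" using sb by simp
    have "n = card ?G" using Suc.hyps(2) f(1) Suc.prems(1) by simp
    from Suc.hyps(1)[OF this _ _ cov] obtain ts where ts: "ts \<noteq> []" "sorted ts" "hd ts = s" "last ts = b" "set ts \<subseteq> {s..b}"
      "\<forall>i<length ts - 1. \<exists>f\<in>?G. ts ! i \<in> A f \<and> ts ! Suc i \<in> A f" using Suc.prems(1,2) sb by auto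
    have "\<exists>f\<in>F. (a # ts) ! i \<in> A f \<and> (a # ts) ! Suc i \<in> A f" if "i < length (a # ts) - 1" for i
    proof (cases i)
      case 0
      then show ?thesis using f s(1) ts(1,3) by (auto simp: hd_conv_nth)
    next
      case (Suc j)
      then have "j < length ts - 1" using that by simp
      then show ?thesis using ts(6) Suc by auto
    qed
    then show ?thesis using ts(1-5) s(1) by (intro exI[of _ "a # ts"]) fastforce
  qed
qed

text \<open>
  On a subdivision with neighbouring points in a common set of the cover the two polygons have the same length.
\<close>

lemma path_length_ge:
  assumes "finite F" "\<And>f. f \<in> F \<Longrightarrow> closed (A f)" "{0..1} \<subseteq> (\<Union>f\<in>F. A f)"
    and d: "\<And>t. t \<in> {0..1} \<Longrightarrow> \<delta> t \<in> space_form g"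
    and iso: "\<And>f s t. f \<in> F \<Longrightarrow> s \<in> A f \<Longrightarrow> t \<in> A f \<Longrightarrow> s \<in> {0..1} \<Longrightarrow> t \<in> {0..1} \<Longrightarrow> space_dist g (c s) (c t) = space_dist g (\<delta> s) (\<delta> t)"
  shows "ennreal (space_dist g (\<delta> 0) (\<delta> 1)) \<le> path_length g c"
proof -
  obtain ts where ts: "ts \<noteq> []" "sorted ts" "hd ts = 0" "last ts = 1" "set ts \<subseteq> {0..1}"
    "\<forall>i<length ts - 1. \<exists>f\<in>F. ts ! i \<in> A f \<and> ts ! Suc i \<in> A f"
    using finite_closed_cover_chain[OF assms(1-3)] by auto
  have mem: "ts ! i \<in> {0..1}" if "i < length ts" for i using nth_mem[OF that] ts(5) by blast
  have S: "\<delta> (ts ! i) \<in> space_form g" if "i < length ts" for i using d[OF mem[OF that]] .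
  have "space_dist g (\<delta> (ts ! 0)) (\<delta> (ts ! (length ts - 1))) \<le> (\<Sum>i<length ts - 1. space_dist g (\<delta> (ts ! i)) (\<delta> (ts ! Suc i)))"
    using S ts(1) by (intro space_dist_polygon[of "length ts - 1" "\<lambda>i. \<delta> (ts ! i)"]) (simp add: less_Suc_eq_le[symmetric])
  also have "\<dots> = (\<Sum>i<length ts - 1. space_dist g (c (ts ! i)) (c (ts ! Suc i)))"
  proof (intro sum.cong refl)
    fix i assume "i \<in> {..<length ts - 1}"
    then have i: "i < length ts - 1" by simp
    then obtain f where "f \<in> F" "ts ! i \<in> A f" "ts ! Suc i \<in> A f" using ts(6) by blast
    then show "space_dist g (\<delta> (ts ! i)) (\<delta> (ts ! Suc i)) = space_dist g (c (ts ! i)) (c (ts ! Suc i))"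
      using iso mem i by (metis add.commute less_diff_conv less_imp_diff_less linorder_not_less not_less_eq plus_1_eq_Suc order_less_imp_le)
  qed
  finally have le: "space_dist g (\<delta> 0) (\<delta> 1) \<le> (\<Sum>i<length ts - 1. space_dist g (c (ts ! i)) (c (ts ! Suc i)))"
    using ts(1,3,4) by (simp add: hd_conv_nth last_conv_nth)
  have nn: "0 \<le> space_dist g (c (ts ! i)) (c (ts ! Suc i))" if i: "i < length ts - 1" for i
  proof -
    obtain f where "f \<in> F" "ts ! i \<in> A f" "ts ! Suc i \<in> A f" using ts(6) i by blast
    then have "space_dist g (c (ts ! i)) (c (ts ! Suc i)) = space_dist g (\<delta> (ts ! i)) (\<delta> (ts ! Suc i))"
      using iso mem[of i] mem[of "Suc i"] i by simp
    then show ?thesis using space_dist_nonneg[OF S S] i by simp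
  qed
  have "ennreal (space_dist g (\<delta> 0) (\<delta> 1)) \<le> (\<Sum>i<length ts - 1. ennreal (space_dist g (c (ts ! i)) (c (ts ! Suc i))))"
    using le nn by (subst sum_ennreal) (auto intro: ennreal_leI)
  also have "\<dots> \<le> path_length g c" unfolding path_length_def using ts by (intro SUP_upper) simp
  finally show ?thesis .
qed

section \<open>The topology of the chamber on the mirror\<close>

context mirror_chamber
begin

text \<open>
  This cone is convex except when it is the whole linear space without \<open>0\<close>, and \<open>U\<close> is a retract of it.
\<close>

definition U_cone where "U_cone = {x\<in>cone_over g. \<forall>\<beta>\<in>D.Pos. 0 < \<beta> \<bullet> x}"

lemma U_retract_of_cone: "U retract_of U_cone"
  unfolding retract_of_def retraction_def
proof (intro exI[of _ "radial g"] conjI ballI)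
  show "U \<subseteq> U_cone" by (auto simp: U_def U_cone_def D.Ch_int_def space_form_iff)
  show "continuous_on U_cone (radial g)" by (rule continuous_on_subset[OF continuous_on_radial]) (auto simp: U_cone_def)
  show "radial g \<in> U_cone \<rightarrow> U"
    using radial_in_space_form inner_radial_sign(1) unfolding U_def U_cone_def D.Ch_int_def by blast
  show "radial g x = x" if "x \<in> U" for x using radial_id U_space[OF that] .
qed

lemma contractible_U:
  assumes "g = Spherical \<Longrightarrow> mirror_roots \<noteq> {}" shows "contractible U"
proof -
  have "convex U_cone" unfolding convex_alt
  proof (intro ballI allI impI)
    fix x y and s :: real assume x: "x \<in> U_cone" and y: "y \<in> U_cone" and s: "0 \<le> s \<and> s \<le> 1"
    let ?z = "(1 - s) *\<^sub>R x + s *\<^sub>R y"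
    have pos: "0 < \<beta> \<bullet> ?z" if "\<beta> \<in> D.Pos" for \<beta>
    proof -
      have "0 < \<beta> \<bullet> x" "0 < \<beta> \<bullet> y" using x y that unfolding U_cone_def by auto
      then show ?thesis using s by (cases "s = 0") (auto simp: inner_add_right intro!: add_nonneg_pos)
    qed
    have "?z \<noteq> 0" if sph: "g = Spherical"
    proof -
      obtain \<beta> where "\<beta> \<in> D.Pos" using D.Pos_or_neg assms[OF sph] by blast
      then show ?thesis using pos[of \<beta>] by auto
    qed
    then show "?z \<in> U_cone" using cone_over_segment[of x g y s] x y s pos unfolding U_cone_def by blast
  qed
  then show ?thesis using convex_imp_contractible U_retract_of_cone retract_of_contractible by blast
qed

lemma U_whole: "mirror_roots = {} \<Longrightarrow> U = space_form g"
  unfolding U_def D.Ch_int_def D.Pos_def by simp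

lemma connected_U: "connected U"
proof (cases "g = Spherical \<and> mirror_roots = {}")
  case True
  then have "U = sphere 0 1" using U_whole space_form_spherical by metis
  then show ?thesis using connected_sphere[of "0 :: 'b \<times> real" 1] by (simp add: Suc_le_eq)
next
  case False
  then show ?thesis using contractible_imp_connected[OF contractible_U] by blast
qed

lemma simply_connected_U:
  assumes "g = Spherical \<Longrightarrow> mirror_roots = {} \<Longrightarrow> 2 \<le> DIM('b)" shows "simply_connected U"
proof (cases "g = Spherical \<and> mirror_roots = {}")
  case True
  then have "U = sphere 0 1" using U_whole space_form_spherical by metis
  moreover have "2 \<le> DIM('b)" using assms True by blast
  ultimately show ?thesis using simply_connected_sphere[of "0 :: 'b \<times> real" 1] by simp
next
  case False
  then show ?thesis using contractible_imp_simply_connected[OF contractible_U] by blast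
qed

lemma locally_path_connected_U: "locally path_connected U"
proof -
  have "space_form g retract_of (cone_over g :: ('b \<times> real) set)"
    unfolding retract_of_def retraction_def
    using continuous_on_radial radial_in_space_form radial_id by (intro exI[of _ "radial g"]) (use space_form_iff in blast)
  then have "locally path_connected (space_form g :: ('b \<times> real) set)"
    using open_imp_locally_path_connected[OF open_cone_over] retract_of_locally_path_connected by blast
  then show ?thesis using locally_open_subset D.openin_Ch_int unfolding U_def by blast
qed

text \<open>
  A great sphere without perpendicular mirrors covers the whole boundary: it meets every other mirror \<open>\<nu>\<close>, and
  at a common point the two mirrors are conjugate under the stabiliser.
\<close>

lemma boundary_subset_image:
  assumes sph: "g = Spherical" and no: "mirror_roots = {}" and dim: "2 \<le> DIM('a)"
  shows "boundary_surface g Ch \<subseteq> \<phi> ` U"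
proof
  fix y assume "y \<in> boundary_surface g Ch"
  then obtain \<nu> where \<nu>: "\<nu> \<in> simple_at y" "y \<in> Ch" using boundary_point_on_wall by blast
  have yS: "y \<in> space_form g" using ChD(1)[OF \<nu>(2)] .
  have "dim (span {\<alpha>, \<nu>}) \<le> card {\<alpha>, \<nu>}" by (simp only: dim_span) (rule dim_le_card', simp)
  also have "\<dots> < DIM('a \<times> real)" using dim card_insert_le_m1[of 2 "{\<nu>}" \<alpha>] by simp
  finally obtain x where x: "x \<noteq> 0" "\<And>z. z \<in> span {\<alpha>, \<nu>} \<Longrightarrow> orthogonal x z"
    using orthogonal_to_subspace_exists[of "{\<alpha>, \<nu>}"] by auto
  have cone: "x \<in> cone_over g" using x(1) sph by (simp add: mem_cone_over_iff)
  let ?x = "radial g x"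
  have "\<alpha> \<bullet> x = 0" "\<nu> \<bullet> x = 0" using x(2)[of \<alpha>] x(2)[of \<nu>] span_base[of _ "{\<alpha>, \<nu>}"] by (auto simp: orthogonal_def inner_commute)
  then have on: "\<alpha> \<bullet> ?x = 0" "\<nu> \<bullet> ?x = 0" using inner_radial_sign(3)[OF cone] by auto
  have xS: "?x \<in> space_form g" using radial_in_space_form[OF cone] .
  have "odd_at (\<iota> (\<pi> ?x))" using mirror_roots_regular_iff proj_space[OF xS on(1)] no by blast
  then have odd: "odd_at ?x" using proj_space[OF xS on(1)] by simp
  obtain w where w: "w \<in> W" "w ?x = ?x" "adjoint w \<alpha> = \<nu> \<or> adjoint w \<alpha> = - \<nu>"
    using odd_at_mirrors_conjugate[OF xS odd simple_atD(3)[OF \<nu>(1)] on(2) \<alpha>_root on(1)] by blast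
  have "\<alpha> \<bullet> w y = 0" using inner_W[OF w(1), of \<alpha> y] w(3) simple_atD(2)[OF \<nu>(1)] by auto
  then have pr: "\<pi> (w y) \<in> space_form g" "\<iota> (\<pi> (w y)) = w y" using proj_space W_space_form[OF w(1) yS] by auto
  have "\<phi> (\<pi> (w y)) = y" unfolding \<phi>_def pr(2) using fold_W[OF yS w(1)] fold_Ch[OF \<nu>(2)] by simp
  then show "y \<in> \<phi> ` U" using pr(1) U_whole[OF no] by (metis image_eqI)
qed

section \<open>The intrinsic metric\<close>

lemma \<phi>_space: "v \<in> space_form g \<Longrightarrow> \<phi> v \<in> space_form g"
  unfolding \<phi>_def using fold_props(1) emb_space ChD(1) by blast

lemma \<phi>_dist_le:
  assumes v: "v \<in> space_form g" "v' \<in> space_form g"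
  shows "space_dist g (\<phi> v) (\<phi> v') \<le> space_dist g v v'"
proof (rule space_dist_mono[OF \<phi>_space[OF v(1)] \<phi>_space[OF v(2)] v])
  show "sep g (\<phi> v) (\<phi> v') \<le> sep g v v'"
    unfolding \<phi>_def emb_sep[OF v, symmetric] by (rule fold_sep[OF emb_space[OF v(1)] emb_space[OF v(2)]])
qed

lemma \<phi>_dist_in_tile:
  assumes v: "v \<in> space_form g" "v' \<in> space_form g" and w: "w \<in> W" "w (\<iota> v) \<in> Ch" "w (\<iota> v') \<in> Ch"
  shows "space_dist g (\<phi> v) (\<phi> v') = space_dist g v v'"
proof -
  have S: "\<iota> v \<in> space_form g" "\<iota> v' \<in> space_form g" using v emb_space by auto
  have "sep g (\<phi> v) (\<phi> v') = sep g v v'"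
    unfolding \<phi>_def fold_unique[OF S(1) w(1,2)] fold_unique[OF S(2) w(1,3)]
    using motion_sep[OF motion_W[OF w(1)] S] emb_sep[OF v] by simp
  then show ?thesis using space_dist_sep[OF \<phi>_space[OF v(1)] \<phi>_space[OF v(2)]] space_dist_sep[OF v] by simp
qed

text \<open>
  A curve on the mirror meets finitely many copies of the chamber, and folding is an isometry on each of them;
  hence folding preserves the lengths of curves.
\<close>

lemma folded_curve_length_ge:
  assumes \<delta>: "path \<delta>" "path_image \<delta> \<subseteq> U"
  shows "ennreal (space_dist g (\<delta> 0) (\<delta> 1)) \<le> path_length g (\<phi> \<circ> \<delta>)"
proof -
  have U: "\<delta> t \<in> U" if "t \<in> {0..1}" for t using \<delta>(2) that by (auto simp: path_image_def)
  have S: "\<iota> (\<delta> t) \<in> space_form g" if "t \<in> {0..1}" for t using U_emb[OF U[OF that]] .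
  define K0 where "K0 = \<iota> ` path_image \<delta>"
  have K0S: "K0 \<subseteq> space_form g" using S by (auto simp: K0_def path_image_def)
  have K0: "compact K0" unfolding K0_def using compact_path_image[OF \<delta>(1)] continuous_emb by (intro compact_continuous_image)
  define K where "K = K0 \<union> fold ` K0"
  have "compact (fold ` K0)" using K0 continuous_on_subset[OF continuous_on_fold K0S] by (intro compact_continuous_image)
  then have "compact K" unfolding K_def using K0 by (rule compact_Un[rotated])
  moreover have "K \<subseteq> space_form g" unfolding K_def using K0S fold_props(1) ChD(1) by blast
  ultimately have fin: "finite {w\<in>W. \<exists>x\<in>K. w x \<in> K}" using W_proper by blast
  let ?F = "{w\<in>W. \<exists>x\<in>K. w x \<in> K}"
  define A where "A w = {0..1} \<inter> (\<lambda>t. w (\<iota> (\<delta> t))) -` Ch" for w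
  have "{0..1} \<subseteq> (\<Union>w\<in>?F. A w)"
  proof
    fix t :: real assume t: "t \<in> {0..1}"
    have tK: "\<iota> (\<delta> t) \<in> K0" using t by (auto simp: K0_def path_image_def)
    obtain w where w: "w \<in> W" "w (\<iota> (\<delta> t)) = fold (\<iota> (\<delta> t))" using fold_props(2)[OF S[OF t]] by blast
    have "w \<in> ?F" using w tK unfolding K_def by (metis (mono_tags, lifting) UnI1 UnI2 image_eqI mem_Collect_eq)
    moreover have "t \<in> A w" unfolding A_def using t w(2) fold_props(1)[OF S[OF t]] by simp
    ultimately show "t \<in> (\<Union>w\<in>?F. A w)" by blast
  qed
  moreover have "closed (A w)" if "w \<in> ?F" for w
  proof -
    have lin: "linear w" using that linear_W by blast
    have "continuous_on {0..1} (\<lambda>t. \<iota> (\<delta> t))"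
      using \<delta>(1) unfolding path_def by (intro continuous_on_compose2[OF continuous_emb[of UNIV]]) auto
    then have "continuous_on {0..1} (\<lambda>t. w (\<iota> (\<delta> t)))"
      by (intro continuous_on_compose2[OF linear_continuous_on[OF lin[unfolded linear_conv_bounded_linear], of UNIV]]) auto
    then show ?thesis unfolding A_def by (intro continuous_closed_preimage closed_Ch) auto
  qed
  ultimately show ?thesis
  proof (intro path_length_ge[OF fin])
    show "\<delta> t \<in> space_form g" if "t \<in> {0..1}" for t using U_space[OF U[OF that]] .
    show "space_dist g ((\<phi> \<circ> \<delta>) s) ((\<phi> \<circ> \<delta>) t) = space_dist g (\<delta> s) (\<delta> t)"
      if "w \<in> ?F" "s \<in> A w" "t \<in> A w" "s \<in> {0..1}" "t \<in> {0..1}" for w s t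
      unfolding comp_apply
      using that U U_space by (intro \<phi>_dist_in_tile[of _ _ w]) (auto simp: A_def)
  qed
qed

text \<open>
  The geodesic stays in \<open>U\<close>, and folding does not increase distances.
\<close>

lemma folded_curve_length_le:
  assumes v: "v \<in> U" "v' \<in> U"
  obtains \<gamma> where "path \<gamma>" "path_image \<gamma> \<subseteq> U" "pathstart \<gamma> = v" "pathfinish \<gamma> = v'"
    "path_length g (\<phi> \<circ> \<gamma>) \<le> ennreal (space_dist g v v')"
proof -
  have vS: "v \<in> space_form g" "v' \<in> space_form g" using v U_space by auto
  obtain \<gamma> where \<gamma>: "geodesic g v v' \<gamma>" using geodesic_exists[OF vS] .
  have S: "\<gamma> t \<in> space_form g" if "t \<in> {0..1}" for t using \<gamma> that unfolding geodesic_def path_image_def by blast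
  have "\<gamma> t \<in> U" if t: "t \<in> {0..1}" for t
  proof -
    have "0 < \<beta> \<bullet> \<gamma> t" if "\<beta> \<in> D.Pos" for \<beta>
    proof -
      have "0 < \<beta> \<bullet> v" "0 < \<beta> \<bullet> v'" using v that unfolding U_def D.Ch_int_def by auto
      then show ?thesis using \<gamma> t unfolding geodesic_def by blast
    qed
    then show ?thesis using S[OF t] unfolding U_def D.Ch_int_def by blast
  qed
  then have im: "path_image \<gamma> \<subseteq> U" by (auto simp: path_image_def)
  have "path_length g (\<phi> \<circ> \<gamma>) \<le> ennreal (space_dist g v v')"
  proof (rule path_length_le[OF space_dist_nonneg[OF vS]])
    fix s t :: real assume st: "0 \<le> s" "s \<le> t" "t \<le> 1"
    have "space_dist g (\<gamma> s) (\<gamma> t) = (t - s) * space_dist g v v'" using \<gamma> st unfolding geodesic_def by blast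
    moreover have "space_dist g (\<phi> (\<gamma> s)) (\<phi> (\<gamma> t)) \<le> space_dist g (\<gamma> s) (\<gamma> t)" using st by (intro \<phi>_dist_le S) auto
    ultimately show "space_dist g ((\<phi> \<circ> \<gamma>) s) ((\<phi> \<circ> \<gamma>) t) \<le> (t - s) * space_dist g v v'" by simp
  qed
  then show thesis using that[of \<gamma>] im \<gamma> unfolding geodesic_def by blast
qed

text \<open>
  Curves in \<open>T\<close> correspond to curves in \<open>U\<close>, with the same images in the boundary of the polyhedron.
\<close>

lemma isometric_to_mirror_chamber:
  fixes T :: "'c::topological_space set"
  assumes h: "homeomorphism T U h h'" and lift: "\<And>x. x \<in> T \<Longrightarrow> \<phi> (h x) = p x"
  shows "isometric_to_interior g T p D.Ch"
proof -
  have hU: "h x \<in> U" if "x \<in> T" for x using h that by (auto simp: homeomorphism_def)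
  have h'T: "h' v \<in> T" "h (h' v) = v" if "v \<in> U" for v using h that by (auto simp: homeomorphism_def)
  have "pullback_dist g T p x y = ennreal (space_dist g (h x) (h y))" if x: "x \<in> T" and y: "y \<in> T" for x y
  proof (rule antisym)
    obtain \<gamma> where \<gamma>: "path \<gamma>" "path_image \<gamma> \<subseteq> U" "pathstart \<gamma> = h x" "pathfinish \<gamma> = h y"
      "path_length g (\<phi> \<circ> \<gamma>) \<le> ennreal (space_dist g (h x) (h y))" using folded_curve_length_le[OF hU[OF x] hU[OF y]] .
    have \<gamma>U: "\<gamma> t \<in> U" if "t \<in> {0..1}" for t using \<gamma>(2) that by (auto simp: path_image_def)
    have "path (h' \<circ> \<gamma>)"
      using h \<gamma>(1,2) by (intro path_continuous_image) (auto simp: homeomorphism_def intro: continuous_on_subset)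
    moreover have "path_image (h' \<circ> \<gamma>) \<subseteq> T" using h'T(1) \<gamma>(2) by (auto simp: path_image_compose)
    moreover have "pathstart (h' \<circ> \<gamma>) = x" "pathfinish (h' \<circ> \<gamma>) = y"
      using \<gamma>(3,4) h x y by (auto simp: pathstart_compose pathfinish_compose homeomorphism_def)
    ultimately have "pullback_dist g T p x y \<le> path_length g (p \<circ> (h' \<circ> \<gamma>))"
      unfolding pullback_dist_def by (intro INF_lower) simp
    also have "\<dots> = path_length g (\<phi> \<circ> \<gamma>)"
      using lift[OF h'T(1)[OF \<gamma>U]] h'T(2)[OF \<gamma>U] by (intro path_length_cong) simp
    also note \<gamma>(5)
    finally show "pullback_dist g T p x y \<le> ennreal (space_dist g (h x) (h y))" .
  next
    show "ennreal (space_dist g (h x) (h y)) \<le> pullback_dist g T p x y"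
      unfolding pullback_dist_def
    proof (rule INF_greatest)
      fix c assume "c \<in> {c. path c \<and> path_image c \<subseteq> T \<and> pathstart c = x \<and> pathfinish c = y}"
      then have c: "path c" "path_image c \<subseteq> T" "c 0 = x" "c 1 = y" by (auto simp: pathstart_def pathfinish_def)
      have cT: "c t \<in> T" if "t \<in> {0..1}" for t using c(2) that by (auto simp: path_image_def)
      have "path (h \<circ> c)"
        using h c(1,2) by (intro path_continuous_image) (auto simp: homeomorphism_def intro: continuous_on_subset)
      moreover have "path_image (h \<circ> c) \<subseteq> U" using hU c(2) by (auto simp: path_image_compose)
      ultimately have "ennreal (space_dist g ((h \<circ> c) 0) ((h \<circ> c) 1)) \<le> path_length g (\<phi> \<circ> (h \<circ> c))"
        by (rule folded_curve_length_ge)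
      also have "\<dots> = path_length g (p \<circ> c)" using lift[OF cT] by (intro path_length_cong) simp
      finally show "ennreal (space_dist g (h x) (h y)) \<le> path_length g (p \<circ> c)" using c(3,4) by simp
    qed
  qed
  moreover have "bij_betw h T U" using h unfolding homeomorphism_def by (intro bij_betw_byWitness[of _ h']) auto
  ultimately show ?thesis unfolding isometric_to_interior_def D.interior_of_Ch U_def by blast
qed

end

section \<open>The universal coverings of the pieces\<close>

theorem theorem1p1:
  fixes g :: geometry
    and C \<Omega> :: "('a::euclidean_space \<times> real) set"
    and T :: "'c::topological_space set"
    and p :: "'c \<Rightarrow> 'a \<times> real"
  assumes dim: "DIM('a) = DIM('b::euclidean_space) + 1"
    and C: "coxeter_polyhedron g C"
    and piece: "\<Omega> \<in> pieces g C"
    and not_closed_curve_in_S2: "\<not> (g = Spherical \<and> DIM('a) = 2 \<and> \<Omega> = boundary_surface g C)"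
    and covering: "universal_covering T p \<Omega>"
  shows "\<exists>D :: ('b \<times> real) set. coxeter_domain g D \<and> isometric_to_interior g T p D"
proof -
  obtain R c where ch: "proper_chamber g R c" and CR: "C = wall_domain.Ch g R c"
    using coxeter_polyhedron_chamber[OF C] .
  interpret P: proper_chamber g R c by (rule ch)
  have \<Omega>: "\<Omega> \<in> components (boundary_surface g P.Ch - \<Union>(even_hyperedges g P.Ch))"
    using piece unfolding pieces_def CR .
  then obtain y0 where y0: "y0 \<in> \<Omega>" using in_components_nonempty by blast
  have y0B: "y0 \<in> boundary_surface g P.Ch - \<Union>(even_hyperedges g P.Ch)" using in_components_subset[OF \<Omega>] y0 by blast
  obtain \<alpha> where \<alpha>: "\<alpha> \<in> P.simple_at y0" "y0 \<in> P.Ch" using P.boundary_point_on_wall y0B by blast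
  have y0S: "y0 \<in> space_form g" using P.ChD(1)[OF \<alpha>(2)] .
  obtain \<iota> :: "'b \<times> real \<Rightarrow> 'a \<times> real" and \<pi> where emb: "hyperplane_embedding g \<alpha> \<iota> \<pi>"
    using hyperplane_embedding_exists[OF dim P.unit[OF P.simple_atD(3)[OF \<alpha>(1)]]] .
  have v0: "\<pi> y0 \<in> space_form g" "\<iota> (\<pi> y0) = y0"
    using hyperplane_embedding.proj_space[OF emb y0S P.simple_atD(2)[OF \<alpha>(1)]] by auto
  have odd: "P.odd_at y0" unfolding P.odd_at_def P.odd_point_def P.fold_Ch[OF \<alpha>(2)] using \<alpha>(2) y0B by blast
  interpret M: mirror_chamber g R c \<alpha> \<iota> \<pi> "\<pi> y0"
    using ch emb P.simple_atD(3)[OF \<alpha>(1)] v0 odd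
    by (intro mirror_chamber.intro mirror_chamber_axioms.intro) simp_all
  have "M.\<phi> (\<pi> y0) = y0" unfolding M.\<phi>_def v0(2) by (rule P.fold_Ch[OF \<alpha>(2)])
  then have im: "M.\<phi> ` M.U = \<Omega>" using M.\<phi>_image_component[OF M.connected_U \<Omega>] y0 by simp
  have cov: "covering_space M.U M.\<phi> \<Omega>" using M.\<phi>_covering[OF im in_components_subset[OF \<Omega>]] .
  have "simply_connected M.U"
  proof (rule M.simply_connected_U, rule ccontr)
    assume *: "g = Spherical" "M.mirror_roots = {}" "\<not> 2 \<le> DIM('b)"
    then have d: "DIM('a) = 2" using dim DIM_positive[where 'a='b] by linarith
    have "boundary_surface g P.Ch \<subseteq> \<Omega>" using M.boundary_subset_image[OF *(1,2)] d im by simp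
    then have "\<Omega> = boundary_surface g C" using in_components_subset[OF \<Omega>] CR by blast
    then show False using not_closed_curve_in_S2 *(1) d by blast
  qed
  moreover have "locally path_connected \<Omega>" using covering_space_locally_path_connected[OF M.locally_path_connected_U cov] .
  ultimately obtain h h' where "homeomorphism T M.U h h'" "\<And>x. x \<in> T \<Longrightarrow> M.\<phi> (h x) = p x"
    using simply_connected_covering_unique[OF _ _ _ cov, of T p] covering y0 unfolding universal_covering_def by blast
  then have "isometric_to_interior g T p M.D.Ch" by (rule M.isometric_to_mirror_chamber)
  then show ?thesis using M.D.coxeter_domain_Ch by blast
qed

end
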